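(* Let $A$ be a finite-dimensional basic algebra over an algebraically closed field, let $T$ be a $\tau$-tilting right $A$-module and $B=\operatorname{End}_A(T)$. If $$d=2\text{-}\operatorname{ddell}_B(DT)<\infty$$ and $$\operatorname{Ext}_A^j(T,T)=0\qquad(2\le j\le d+3),$$ then $T$ is a $1$-tilting $A$-module. In particular, if $T$ is self-orthogonal and $2\text{-}\operatorname{ddell}_B(DT)<\infty$, then $T$ is $1$-tilting.
   Context: Conventions. $A$ is a finite-dimensional basic algebra over an algebraically closed field $K$; modules are finitely generated right modules; $D=\operatorname{Hom}_K(-,K)$, and $DT$ is a right $B$-module via the left $B$-action on $T$. $|T|$ is the number of isomorphism classes of indecomposable direct summands of $T$ and $\tau$ is the Auslander–Reiten translation. $T$ is $\tau$-tilting if $\operatorname{Hom}_A(T,\tau T)=0$ and $|T|=|A|$. $T$ is self-orthogonal if $\operatorname{Ext}_A^i(T,T)=0$ for all $i\ge1$. $T$ is $1$-tilting if $\operatorname{pd}_AT\le1$, $\operatorname{Ext}^1_A(T,T)=0$ and $|T|=|A|$. Delooping levels over $B$ (with $\mathcal E=\operatorname{mod}B$). The stable category $\underline{\operatorname{mod}}B$ has morphisms modulo those factoring through projectives, and $\Omega_B$ is the syzygy endofunctor. $X$ is a stable retract of $Y$ if there are $u:X\to Y$, $v:Y\to X$ in the stable category with $vu=1_X$. For $k\ge1$, $k\text{-}\operatorname{dell}_BX$ is the infimum of all $n\ge0$ such that $\Omega_B^nX$ is a stable retract of $\Omega_B^{n+k}Y$ for some $Y\in\operatorname{mod}B$. $k\text{-}\operatorname{ddell}_BX$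 is the infimum of the integers $m\ge0$ for which there are $0\le t\le m$ and an exact sequence $0\to C_t\to\cdots\to C_0\to X\to0$ in $\operatorname{mod}B$ with $(i+k)\text{-}\operatorname{dell}_BC_i\le m-i$ for $0\le i\le t$. ($\inf\emptyset=\infty$.) *)

theory Defs
  imports "HOL-Algebra.Algebra" "HOL-Library.Extended_Nat"
begin

section \<open>Right modules over a ring\<close>

text \<open>
  A right module over a ring \<open>R\<close> is stored in the record type of HOL-Algebra modules;
  \<open>a \<odot>\<^bsub>M\<^esub> m\<close> stands for the product usually written \<open>m a\<close>, whence the order of the
  factors in \<open>smult_assoc\<close>. The multiplicative fields of the record are irrelevant.
  Left modules use the same record, with \<open>a \<odot>\<^bsub>M\<^esub> m\<close> read as \<open>a m\<close>; equivalently, they are right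
  modules over the opposite ring.
\<close>

locale right_module = R?: ring R + M?: abelian_group M
  for R :: "('a, 'r) ring_scheme" (structure) and M :: "('a, 'm) module" (structure) +
  assumes smult_closed: "\<lbrakk>a \<in> carrier R; x \<in> carrier M\<rbrakk> \<Longrightarrow> a \<odot>\<^bsub>M\<^esub> x \<in> carrier M"
    and smult_l_distr: "\<lbrakk>a \<in> carrier R; b \<in> carrier R; x \<in> carrier M\<rbrakk> \<Longrightarrow>
      (a \<oplus>\<^bsub>R\<^esub> b) \<odot>\<^bsub>M\<^esub> x = a \<odot>\<^bsub>M\<^esub> x \<oplus>\<^bsub>M\<^esub> b \<odot>\<^bsub>M\<^esub> x"
    and smult_r_distr: "\<lbrakk>a \<in> carrier R; x \<in> carrier M; y \<in> carrier M\<rbrakk> \<Longrightarrow>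
      a \<odot>\<^bsub>M\<^esub> (x \<oplus>\<^bsub>M\<^esub> y) = a \<odot>\<^bsub>M\<^esub> x \<oplus>\<^bsub>M\<^esub> a \<odot>\<^bsub>M\<^esub> y"
    and smult_assoc: "\<lbrakk>a \<in> carrier R; b \<in> carrier R; x \<in> carrier M\<rbrakk> \<Longrightarrow>
      (a \<otimes>\<^bsub>R\<^esub> b) \<odot>\<^bsub>M\<^esub> x = b \<odot>\<^bsub>M\<^esub> (a \<odot>\<^bsub>M\<^esub> x)"
    and smult_one: "x \<in> carrier M \<Longrightarrow> \<one>\<^bsub>R\<^esub> \<odot>\<^bsub>M\<^esub> x = x"

text \<open>Equip the additive group of \<open>M\<close> with the scalar multiplication \<open>s\<close>.\<close>

definition with_smult :: "('m, 'r) ring_scheme \<Rightarrow> ('a \<Rightarrow> 'm \<Rightarrow> 'm) \<Rightarrow> ('a, 'm) module" where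
  "with_smult M s = ring.extend (ring.truncate M) (module.fields s)"

definition regular :: "('a, 'r) ring_scheme \<Rightarrow> ('a, 'a) module" where
  "regular R = with_smult R (\<lambda>a x. x \<otimes>\<^bsub>R\<^esub> a)"

definition fin_gen :: "('a, 'r) ring_scheme \<Rightarrow> ('a, 'm) module \<Rightarrow> bool" where
  "fin_gen R M \<longleftrightarrow> (\<exists>S. finite S \<and> S \<subseteq> carrier M \<and>
     (\<forall>N. submodule N R M \<and> S \<subseteq> N \<longrightarrow> N = carrier M))"

definition fg_mod :: "('a, 'r) ring_scheme \<Rightarrow> ('a, 'm) module \<Rightarrow> bool" where
  "fg_mod R M \<longleftrightarrow> right_module R M \<and> fin_gen R M"

text \<open>
  Quantification over all finitely generated modules is quantification over the following
  type, in which every finitely generated \<open>R\<close>-module \<open>M\<close> has an isomorphic copy: if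
  \<open>x\<^sub>0, \<dots>, x\<^sub>n\<^sub>-\<^sub>1\<close> generate \<open>M\<close>, replace \<open>x\<close> by the set of those families \<open>r\<close> in \<open>R\<close> that
  vanish from index \<open>n\<close> on and satisfy \<open>x = \<Sum> x\<^sub>i r\<^sub>i\<close>.
\<close>

type_synonym 'a std_module = "('a, (nat \<Rightarrow> 'a) set) module"

text \<open>Homomorphisms are extensional, so that equality of morphisms is equality of functions.\<close>

definition rhom :: "('a, 'r) ring_scheme \<Rightarrow> ('a, 'm) module \<Rightarrow> ('a, 'n) module \<Rightarrow> ('m \<Rightarrow> 'n) set"
  where "rhom R M N = {f \<in> carrier M \<rightarrow>\<^sub>E carrier N.
     (\<forall>x\<in>carrier M. \<forall>y\<in>carrier M. f (x \<oplus>\<^bsub>M\<^esub> y) = f x \<oplus>\<^bsub>N\<^esub> f y) \<and>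
     (\<forall>a\<in>carrier R. \<forall>x\<in>carrier M. f (a \<odot>\<^bsub>M\<^esub> x) = a \<odot>\<^bsub>N\<^esub> f x)}"

definition module_iso :: "('a, 'r) ring_scheme \<Rightarrow> ('a, 'm) module \<Rightarrow> ('a, 'n) module \<Rightarrow> bool" where
  "module_iso R M N \<longleftrightarrow> (\<exists>f\<in>rhom R M N. bij_betw f (carrier M) (carrier N))"

definition hom_group ::
  "('a, 'r) ring_scheme \<Rightarrow> ('a, 'm) module \<Rightarrow> ('a, 'n) module \<Rightarrow> ('m \<Rightarrow> 'n) ring" where
  "hom_group R M N = \<lparr>carrier = rhom R M N, monoid.mult = undefined, one = undefined,
     ring.zero = (\<lambda>x\<in>carrier M. \<zero>\<^bsub>N\<^esub>), ring.add = (\<lambda>f g. \<lambda>x\<in>carrier M. f x \<oplus>\<^bsub>N\<^esub> g x)\<rparr>"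

definition quot_module :: "('a, 'm) module \<Rightarrow> 'm set \<Rightarrow> ('a, 'm set) module" where
  "quot_module M N = \<lparr>carrier = a_rcosets\<^bsub>M\<^esub> N, monoid.mult = undefined, one = undefined,
     ring.zero = N, ring.add = set_add M, smult = (\<lambda>a C. \<Union>x\<in>C. N +>\<^bsub>M\<^esub> (a \<odot>\<^bsub>M\<^esub> x))\<rparr>"

section \<open>Direct summands\<close>

definition complementary :: "('a, 'r) ring_scheme \<Rightarrow> ('a, 'm) module \<Rightarrow> 'm set \<Rightarrow> 'm set \<Rightarrow> bool" where
  "complementary R M N N' \<longleftrightarrow> submodule N R M \<and> submodule N' R M \<and>
     N \<inter> N' = {\<zero>\<^bsub>M\<^esub>} \<and> N <+>\<^bsub>M\<^esub> N' = carrier M"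

definition indecomposable :: "('a, 'r) ring_scheme \<Rightarrow> ('a, 'm) module \<Rightarrow> bool" where
  "indecomposable R M \<longleftrightarrow> carrier M \<noteq> {\<zero>\<^bsub>M\<^esub>} \<and>
     (\<forall>N N'. complementary R M N N' \<longrightarrow> N = {\<zero>\<^bsub>M\<^esub>} \<or> N' = {\<zero>\<^bsub>M\<^esub>})"

definition ind_summands :: "('a, 'r) ring_scheme \<Rightarrow> ('a, 'm) module \<Rightarrow> 'm set set" where
  "ind_summands R M =
     {N. (\<exists>N'. complementary R M N N') \<and> indecomposable R (M\<lparr>carrier := N\<rparr>)}"

definition num_summands :: "('a, 'r) ring_scheme \<Rightarrow> ('a, 'm) module \<Rightarrow> nat" where
  "num_summands R M = card (ind_summands R M //
     {(N, N'). N \<in> ind_summands R M \<and> N' \<in> ind_summands R M \<and>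
        module_iso R (M\<lparr>carrier := N\<rparr>) (M\<lparr>carrier := N'\<rparr>)})"

section \<open>Finite-dimensional basic algebras\<close>

locale fd_algebra = K?: field K + A?: ring A + module K A
  for K :: "'k ring" (structure) and A :: "('k, 'a) module" (structure) +
  assumes smult_mult_left: "\<lbrakk>c \<in> carrier K; x \<in> carrier A; y \<in> carrier A\<rbrakk> \<Longrightarrow>
      (c \<odot>\<^bsub>A\<^esub> x) \<otimes>\<^bsub>A\<^esub> y = c \<odot>\<^bsub>A\<^esub> (x \<otimes>\<^bsub>A\<^esub> y)"
    and smult_mult_right: "\<lbrakk>c \<in> carrier K; x \<in> carrier A; y \<in> carrier A\<rbrakk> \<Longrightarrow>
      x \<otimes>\<^bsub>A\<^esub> (c \<odot>\<^bsub>A\<^esub> y) = c \<odot>\<^bsub>A\<^esub> (x \<otimes>\<^bsub>A\<^esub> y)"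
    and finite_dim: "fin_gen K A"

definition idempotent :: "('a, 'r) ring_scheme \<Rightarrow> 'a \<Rightarrow> bool" where
  "idempotent R e \<longleftrightarrow> e \<in> carrier R \<and> e \<otimes>\<^bsub>R\<^esub> e = e"

definition orthogonal_in :: "('a, 'r) ring_scheme \<Rightarrow> 'a \<Rightarrow> 'a \<Rightarrow> bool" where
  "orthogonal_in R e f \<longleftrightarrow> e \<otimes>\<^bsub>R\<^esub> f = \<zero>\<^bsub>R\<^esub> \<and> f \<otimes>\<^bsub>R\<^esub> e = \<zero>\<^bsub>R\<^esub>"

definition primitive_idem :: "('a, 'r) ring_scheme \<Rightarrow> 'a \<Rightarrow> bool" where
  "primitive_idem R e \<longleftrightarrow> idempotent R e \<and> e \<noteq> \<zero>\<^bsub>R\<^esub> \<and>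
     (\<forall>f g. idempotent R f \<and> idempotent R g \<and> orthogonal_in R f g \<and> e = f \<oplus>\<^bsub>R\<^esub> g \<longrightarrow>
        f = \<zero>\<^bsub>R\<^esub> \<or> g = \<zero>\<^bsub>R\<^esub>)"

definition principal_right :: "('a, 'r) ring_scheme \<Rightarrow> 'a \<Rightarrow> ('a, 'a) module" where
  "principal_right R e = (regular R)\<lparr>carrier := {e \<otimes>\<^bsub>R\<^esub> x |x. x \<in> carrier R}\<rparr>"

definition basic :: "('a, 'r) ring_scheme \<Rightarrow> bool" where
  "basic R \<longleftrightarrow> (\<exists>E. finite E \<and> (\<forall>e\<in>E. primitive_idem R e) \<and>
     (\<forall>e\<in>E. \<forall>f\<in>E. e \<noteq> f \<longrightarrow> orthogonal_in R e f) \<and> (\<Oplus>\<^bsub>R\<^esub>e\<in>E. e) = \<one>\<^bsub>R\<^esub> \<and>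
     (\<forall>e\<in>E. \<forall>f\<in>E. e \<noteq> f \<longrightarrow> \<not> module_iso R (principal_right R e) (principal_right R f)))"

section \<open>Projective modules, resolutions and extension groups\<close>

definition projective :: "('a, 'r) ring_scheme \<Rightarrow> 'a std_module \<Rightarrow> bool" where
  "projective R P \<longleftrightarrow> fg_mod R P \<and>
     (\<forall>(M :: 'a std_module) (N :: 'a std_module). fg_mod R M \<and> fg_mod R N \<longrightarrow>
       (\<forall>g\<in>rhom R M N. \<forall>f\<in>rhom R P N. g ` carrier M = carrier N \<longrightarrow>
         (\<exists>h\<in>rhom R P M. f = compose (carrier P) g h)))"

definition projective_cover ::
  "('a, 'r) ring_scheme \<Rightarrow> ('a, 'm) module \<Rightarrow> 'a std_module \<Rightarrow> ((nat \<Rightarrow> 'a) set \<Rightarrow> 'm) \<Rightarrow> bool" where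
  "projective_cover R M P p \<longleftrightarrow> projective R P \<and> p \<in> rhom R P M \<and> p ` carrier P = carrier M \<and>
     (\<forall>N. submodule N R P \<and> N <+>\<^bsub>P\<^esub> a_kernel P M p = carrier P \<longrightarrow> N = carrier P)"

text \<open>
  The constants below that select a projective cover or a projective resolution by Hilbert
  choice are meaningful over finite-dimensional algebras, where these exist; the results do
  not depend on the choice up to isomorphism.
\<close>

definition proj_cover ::
  "('a, 'r) ring_scheme \<Rightarrow> ('a, 'm) module \<Rightarrow> 'a std_module \<times> ((nat \<Rightarrow> 'a) set \<Rightarrow> 'm)" where
  "proj_cover R M = (SOME (P, p). projective_cover R M P p)"

definition syzygy :: "('a, 'r) ring_scheme \<Rightarrow> ('a, 'm) module \<Rightarrow> 'a std_module" where
  "syzygy R M = (let (P, p) = proj_cover R M in P\<lparr>carrier := a_kernel P M p\<rparr>)"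

text \<open>
  An exact complex \<open>\<dots> \<rightarrow> C 1 \<rightarrow> C 0 \<rightarrow> M \<rightarrow> 0\<close> of finitely generated modules with maps \<open>\<epsilon>\<close> and
  \<open>\<delta> i : C (i + 1) \<rightarrow> C i\<close>. A finite one is padded with zero modules.
\<close>

definition resolution ::
  "('a, 'r) ring_scheme \<Rightarrow> ('a, 'm) module \<Rightarrow> (nat \<Rightarrow> 'a std_module) \<Rightarrow>
   ((nat \<Rightarrow> 'a) set \<Rightarrow> 'm) \<Rightarrow> (nat \<Rightarrow> (nat \<Rightarrow> 'a) set \<Rightarrow> (nat \<Rightarrow> 'a) set) \<Rightarrow> bool" where
  "resolution R M C \<epsilon> \<delta> \<longleftrightarrow> (\<forall>i. fg_mod R (C i)) \<and>
     \<epsilon> \<in> rhom R (C 0) M \<and> (\<forall>i. \<delta> i \<in> rhom R (C (Suc i)) (C i)) \<and>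
     \<epsilon> ` carrier (C 0) = carrier M \<and>
     a_kernel (C 0) M \<epsilon> = \<delta> 0 ` carrier (C 1) \<and>
     (\<forall>i. a_kernel (C (Suc i)) (C i) (\<delta> i) = \<delta> (Suc i) ` carrier (C (Suc (Suc i))))"

definition vanishes_above :: "nat \<Rightarrow> (nat \<Rightarrow> ('a, 'm) module) \<Rightarrow> bool" where
  "vanishes_above n C \<longleftrightarrow> (\<forall>i>n. carrier (C i) = {\<zero>\<^bsub>C i\<^esub>})"

definition proj_resolution ::
  "('a, 'r) ring_scheme \<Rightarrow> ('a, 'm) module \<Rightarrow> (nat \<Rightarrow> 'a std_module) \<Rightarrow>
   ((nat \<Rightarrow> 'a) set \<Rightarrow> 'm) \<Rightarrow> (nat \<Rightarrow> (nat \<Rightarrow> 'a) set \<Rightarrow> (nat \<Rightarrow> 'a) set) \<Rightarrow> bool" where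
  "proj_resolution R M P \<epsilon> \<delta> \<longleftrightarrow> resolution R M P \<epsilon> \<delta> \<and> (\<forall>i. projective R (P i))"

definition proj_dim :: "('a, 'r) ring_scheme \<Rightarrow> ('a, 'm) module \<Rightarrow> enat" where
  "proj_dim R M = Inf {enat n |n. \<exists>P \<epsilon> \<delta>. proj_resolution R M P \<epsilon> \<delta> \<and> vanishes_above n P}"

text \<open>\<open>Ext R i M N\<close> is the \<open>i\<close>-th cohomology group of \<open>Hom\<^sub>R(P, N)\<close>, \<open>P\<close> a projective
  resolution of \<open>M\<close>.\<close>

definition Ext ::
  "('a, 'r) ring_scheme \<Rightarrow> nat \<Rightarrow> ('a, 'm) module \<Rightarrow> ('a, 'n) module \<Rightarrow>
   ((nat \<Rightarrow> 'a) set \<Rightarrow> 'n) set monoid" where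
  "Ext R i M N =
     (let (P, \<epsilon>, \<delta>) = (SOME (P, \<epsilon>, \<delta>). proj_resolution R M P \<epsilon> \<delta>);
          H = (\<lambda>j. hom_group R (P j) N);
          pull = (\<lambda>j f. compose (carrier (P (Suc j))) f (\<delta> j));
          Z = a_kernel (H i) (H (Suc i)) (pull i);
          B = (case i of 0 \<Rightarrow> {\<zero>\<^bsub>H 0\<^esub>} | Suc j \<Rightarrow> pull j ` carrier (H j))
      in ((H i)\<lparr>carrier := Z\<rparr>) A_Mod B)"

section \<open>Duality and the Auslander--Reiten translation\<close>

definition restrict_scalars :: "('k, 'a) module \<Rightarrow> ('a, 'm) module \<Rightarrow> ('k, 'm) module" where
  "restrict_scalars A M = with_smult M (\<lambda>c x. (c \<odot>\<^bsub>A\<^esub> \<one>\<^bsub>A\<^esub>) \<odot>\<^bsub>M\<^esub> x)"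

text \<open>
  \<open>Hom\<^sub>K(M, K)\<close>, with \<open>A\<close> acting through its action on \<open>M\<close>. It exchanges the sides: for a
  left \<open>A\<close>-module \<open>M\<close> it is a right \<open>A\<close>-module.
\<close>

definition dual :: "'k ring \<Rightarrow> ('k, 'a) module \<Rightarrow> ('a, 'm) module \<Rightarrow> ('a, 'm \<Rightarrow> 'k) module" where
  "dual K A M = with_smult (hom_group K (restrict_scalars A M) (regular K))
     (\<lambda>a \<phi>. \<lambda>x\<in>carrier M. \<phi> (a \<odot>\<^bsub>M\<^esub> x))"

text \<open>The left \<open>R\<close>-module \<open>Hom\<^sub>R(P, R)\<close>.\<close>

definition ring_dual :: "('a, 'r) ring_scheme \<Rightarrow> ('a, 'm) module \<Rightarrow> ('a, 'm \<Rightarrow> 'a) module" where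
  "ring_dual R P = with_smult (hom_group R P (regular R)) (\<lambda>a f. \<lambda>x\<in>carrier P. a \<otimes>\<^bsub>R\<^esub> f x)"

text \<open>
  The transpose, a left module: the cokernel of \<open>Hom\<^sub>R(P0, R) \<rightarrow> Hom\<^sub>R(P1, R)\<close> for the minimal
  projective presentation \<open>P1 \<rightarrow> P0 \<rightarrow> M \<rightarrow> 0\<close>. Note that \<open>syzygy R M\<close> is a submodule of \<open>P0\<close>.
\<close>

definition transpose_module ::
  "('a, 'r) ring_scheme \<Rightarrow> ('a, 'm) module \<Rightarrow> ('a, ((nat \<Rightarrow> 'a) set \<Rightarrow> 'a) set) module" where
  "transpose_module R M =
     (let (P0, p0) = proj_cover R M;
          (P1, p1) = proj_cover R (syzygy R M)
      in quot_module (ring_dual R P1)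
           ((\<lambda>f. compose (carrier P1) f p1) ` carrier (ring_dual R P0)))"

definition tau ::
  "'k ring \<Rightarrow> ('k, 'a) module \<Rightarrow> ('a, 'm) module \<Rightarrow>
   ('a, ((nat \<Rightarrow> 'a) set \<Rightarrow> 'a) set \<Rightarrow> 'k) module" where
  "tau K A M = dual K A (transpose_module A M)"

section \<open>Tilting modules and endomorphism algebras\<close>

definition tau_tilting :: "'k ring \<Rightarrow> ('k, 'a) module \<Rightarrow> ('a, 't) module \<Rightarrow> bool" where
  "tau_tilting K A T \<longleftrightarrow> fg_mod A T \<and>
     rhom A T (tau K A T) = {\<lambda>x\<in>carrier T. \<zero>\<^bsub>tau K A T\<^esub>} \<and>
     num_summands A T = num_summands A (regular A)"

definition self_orthogonal :: "('a, 'r) ring_scheme \<Rightarrow> ('a, 't) module \<Rightarrow> bool" where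
  "self_orthogonal A T \<longleftrightarrow> (\<forall>i\<ge>1. trivial_group (Ext A i T T))"

definition one_tilting :: "('a, 'r) ring_scheme \<Rightarrow> ('a, 't) module \<Rightarrow> bool" where
  "one_tilting A T \<longleftrightarrow> fg_mod A T \<and> proj_dim A T \<le> 1 \<and> trivial_group (Ext A 1 T T) \<and>
     num_summands A T = num_summands A (regular A)"

definition End_algebra ::
  "('k, 'a) module \<Rightarrow> ('a, 't) module \<Rightarrow> ('k, 't \<Rightarrow> 't) module" where
  "End_algebra A T = with_smult
     ((hom_group A T T)\<lparr>mult := compose (carrier T), one := (\<lambda>x\<in>carrier T. x)\<rparr>)
     (\<lambda>c f. \<lambda>x\<in>carrier T. (c \<odot>\<^bsub>A\<^esub> \<one>\<^bsub>A\<^esub>) \<odot>\<^bsub>T\<^esub> f x)"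

text \<open>\<open>T\<close> as a left module over its endomorphism algebra.\<close>

definition End_module :: "('a, 't) module \<Rightarrow> ('t \<Rightarrow> 't, 't) module" where
  "End_module T = with_smult T (\<lambda>f x. f x)"

section \<open>Delooping levels\<close>

text \<open>Equality in the stable category: the difference factors through a projective.\<close>

definition stably_equal ::
  "('a, 'r) ring_scheme \<Rightarrow> ('a, 'm) module \<Rightarrow> ('a, 'n) module \<Rightarrow> ('m \<Rightarrow> 'n) \<Rightarrow> ('m \<Rightarrow> 'n) \<Rightarrow> bool" where
  "stably_equal R M N f g \<longleftrightarrow> (\<exists>P. projective R P \<and> (\<exists>s\<in>rhom R M P. \<exists>t\<in>rhom R P N.
     \<forall>x\<in>carrier M. f x \<ominus>\<^bsub>N\<^esub> g x = t (s x)))"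

definition stable_retract ::
  "('a, 'r) ring_scheme \<Rightarrow> ('a, 'm) module \<Rightarrow> ('a, 'n) module \<Rightarrow> bool" where
  "stable_retract R M N \<longleftrightarrow> (\<exists>u\<in>rhom R M N. \<exists>v\<in>rhom R N M.
     stably_equal R M M (compose (carrier M) v u) (\<lambda>x\<in>carrier M. x))"

definition dell :: "('a, 'r) ring_scheme \<Rightarrow> nat \<Rightarrow> 'a std_module \<Rightarrow> enat" where
  "dell R k M = Inf {enat n |n. \<exists>Y :: 'a std_module. fg_mod R Y \<and>
     stable_retract R ((syzygy R ^^ n) M) ((syzygy R ^^ (n + k)) Y)}"

definition ddell :: "('a, 'r) ring_scheme \<Rightarrow> nat \<Rightarrow> ('a, 'm) module \<Rightarrow> enat" where
  "ddell R k M = Inf {enat m |m. \<exists>t\<le>m. \<exists>C \<epsilon> \<delta>. resolution R M C \<epsilon> \<delta> \<and> vanishes_above t C \<and>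
     (\<forall>i\<le>t. dell R (i + k) (C i) \<le> enat (m - i))}"

end

theory Submission
  imports Defs
begin

text \<open>
  Let \<open>P1 \<rightarrow> P0 \<rightarrow> T\<close> be the minimal projective presentation, with first map \<open>d\<close>, and \<open>F = Hom\<^sub>A(T, -)\<close>.
  By \<open>\<tau>\<close>-rigidity, every map from \<open>P1\<close> to a module generated by \<open>T\<close> factors through \<open>d\<close>; hence \<open>F\<close>
  preserves surjections between such modules, provided that their kernels are generated by \<open>T\<close> as well.
  For \<open>|T| = |A|\<close> indecomposable summands \<open>T\<^sub>i\<close> the dimensions of \<open>Hom(T\<^sub>i, X)\<close> determine the dimension
  vector of \<open>X\<close>: the linear system has as many unknowns as equations, and it is independent because the
  non-split maps \<open>T \<rightarrow> T\<^sub>i\<close> form a module \<open>F(Y)\<close> whose dimensions differ from those of \<open>F(T\<^sub>i)\<close> in one place.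
  Consequently \<open>F\<close> is fully faithful on modules generated by \<open>T\<close>, and exact sequences of \<open>B\<close>-modules
  \<open>F(X)\<close> come from exact sequences of \<open>A\<close>-modules.

  All syzygies over \<open>B\<close> are of the form \<open>F(X)\<close>, and \<open>Ext(T, X)\<close> can be followed along exact sequences.
  A \<open>k\<close>-th syzygy gives \<open>Ext\<^sup>j(T, X) = 0\<close> for \<open>1 \<le> j \<le> k\<close>; the delooping levels turn this into the same
  vanishing for the first syzygies of the modules \<open>C\<^sub>i\<close> in the resolution of \<open>DT\<close>, and so into
  \<open>Ext\<^sup>2(T, X) = 0\<close> where \<open>DT = F(X)\<close>. Here \<open>X\<close> is the dual of \<open>A / I\<close>, \<open>I\<close> the annihilator of \<open>T\<close>.
  Therefore every map from \<open>L = ker d\<close> to \<open>X\<close> extends to \<open>P1\<close>; it then factors through \<open>d\<close>, so it vanishes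
  on \<open>L\<close>. This means \<open>L = L I\<close>, and \<open>L = 0\<close> because \<open>T\<close> is sincere.
\<close>

text \<open>The modules \<open>C_i\<close> need not be of the form F(X); only submodules of such
  modules are, and every first syzygy is one. So the degrees are carried along first syzygies and
  return to the module itself only for \<open>DT\<close>, which is F(X) by adjunction. If the r-th
  syzygy of \<open>C_i\<close> is a stable retract of a syzygy of order r + i + 2, then j <= r + i +
  2 on it, and going back to the first syzygy leaves j <= i + 3. Each map of the resolution costs
  one degree: the first syzygy of \<open>DT\<close> keeps j = 3 and X keeps j = 2. For r = 0 the
  first syzygy is reached upwards, which uses Ext^(i+3)(T, T) = 0 with i possibly equal to d; this
  accounts for the bound d + 3. That X is generated by \<open>T\<close> is again a dimension count:
  X and the trace of \<open>T\<close> in X have the same maps from \<open>T\<close>, and maps from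
  \<open>P1\<close> to either of them factor through the presentation. Sincerity suffices to pass
  from L = L I to L = 0, because e is then not in I for any primitive e in the chosen decomposition
  of 1, and the elements of e I e are nilpotent in the local ring e A e.\<close>

abbreviation submodule_of :: "('a, 'm) module \<Rightarrow> 'm set \<Rightarrow> ('a, 'm) module" (infixl "\<down>" 85) where
  "M \<down> N \<equiv> M\<lparr>carrier := N\<rparr>"

\<comment> \<open>Reads a subscripted token as a structure index, which saves the brackets around
  short indices as in \<open>x \<oplus>\<^sub>M y\<close>.\<close>
syntax "_subscript_index" :: "logic \<Rightarrow> index" ("\<^sub>_" [1000])
translations "_subscript_index M" \<rightharpoonup> "_index M"

section \<open>Modules, submodules and linear maps\<close>

lemma eq_singletonI: "\<lbrakk>\<And>x. x \<in> S \<Longrightarrow> x = z; z \<in> S\<rbrakk> \<Longrightarrow> S = {z}"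
  by blast

lemma (in abelian_group) diff_eq_zero_iff:
  "\<lbrakk>x \<in> carrier G; y \<in> carrier G\<rbrakk> \<Longrightarrow> x \<ominus> y = \<zero> \<longleftrightarrow> x = y"
  by (metis a_minus_def add.inv_closed add.inv_solve_right' l_zero r_neg zero_closed)

lemma (in abelian_group) diff_add_cancel [simp]:
  "\<lbrakk>x \<in> carrier G; y \<in> carrier G\<rbrakk> \<Longrightarrow> x \<ominus> y \<oplus> y = x"
  by (simp add: a_minus_def a_assoc l_neg)

lemma (in abelian_group) add_diff_cancel [simp]:
  "\<lbrakk>x \<in> carrier G; y \<in> carrier G\<rbrakk> \<Longrightarrow> x \<oplus> y \<ominus> y = x"
  by (simp add: a_minus_def a_assoc r_neg)

lemma (in abelian_group) add_diff_cancel' [simp]: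
  "\<lbrakk>x \<in> carrier G; y \<in> carrier G\<rbrakk> \<Longrightarrow> y \<oplus> (x \<ominus> y) = x"
  by (metis a_comm diff_add_cancel minus_closed)

lemma (in abelian_group) diff_self [simp]: "x \<in> carrier G \<Longrightarrow> x \<ominus> x = \<zero>"
  by (simp add: a_minus_def r_neg)

lemma (in abelian_group) add_diff_add:
  "\<lbrakk>a \<in> carrier G; b \<in> carrier G; c \<in> carrier G; d \<in> carrier G\<rbrakk> \<Longrightarrow>
    (a \<oplus> b) \<ominus> (c \<oplus> d) = (a \<ominus> c) \<oplus> (b \<ominus> d)"
  by (simp add: a_minus_def minus_add a_ac)

lemma (in abelian_group) a_four:
  "\<lbrakk>a \<in> carrier G; b \<in> carrier G; c \<in> carrier G; d \<in> carrier G\<rbrakk> \<Longrightarrow>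
    (a \<oplus> b) \<oplus> (c \<oplus> d) = (a \<oplus> c) \<oplus> (b \<oplus> d)"
  by (simp add: a_ac)

context right_module
begin

lemma M_abelian_group: "abelian_group M" ..

lemma R_ring: "ring R" ..

lemma smult_closed' [simp]:
  "\<lbrakk>a \<in> carrier R; x \<in> carrier M\<rbrakk> \<Longrightarrow> a \<odot>\<^sub>M x \<in> carrier M"
  by (rule smult_closed)

declare smult_one [simp]

lemma smult_l_null [simp]: "x \<in> carrier M \<Longrightarrow> \<zero>\<^sub>R \<odot>\<^sub>M x = \<zero>\<^sub>M"
  by (metis M.add.r_cancel_one' R.l_zero R.zero_closed smult_closed smult_l_distr)

lemma smult_r_null [simp]: "a \<in> carrier R \<Longrightarrow> a \<odot>\<^sub>M \<zero>\<^sub>M = \<zero>\<^sub>M"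
  by (metis M.add.r_cancel_one' M.l_zero M.zero_closed smult_closed smult_r_distr)

lemma smult_l_minus: "\<lbrakk>a \<in> carrier R; x \<in> carrier M\<rbrakk> \<Longrightarrow> (\<ominus>\<^sub>R a) \<odot>\<^sub>M x = \<ominus>\<^sub>M (a \<odot>\<^sub>M x)"
  by (metis M.minus_equality R.a_inv_closed R.l_neg smult_closed smult_l_distr smult_l_null)

lemma smult_r_minus: "\<lbrakk>a \<in> carrier R; x \<in> carrier M\<rbrakk> \<Longrightarrow> a \<odot>\<^sub>M (\<ominus>\<^sub>M x) = \<ominus>\<^sub>M (a \<odot>\<^sub>M x)"
  by (metis M.minus_equality M.a_inv_closed M.l_neg smult_closed smult_r_distr smult_r_null)

lemma smult_r_diff:
  "\<lbrakk>a \<in> carrier R; x \<in> carrier M; y \<in> carrier M\<rbrakk> \<Longrightarrow>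
    a \<odot>\<^sub>M (x \<ominus>\<^sub>M y) = a \<odot>\<^sub>M x \<ominus>\<^sub>M a \<odot>\<^sub>M y"
  by (simp add: a_minus_def smult_r_distr smult_r_minus)

lemma minus_via_smult: "x \<in> carrier M \<Longrightarrow> \<ominus>\<^sub>M x = (\<ominus>\<^sub>R \<one>\<^sub>R) \<odot>\<^sub>M x"
  by (simp add: smult_l_minus)

lemma submoduleI:
  assumes "H \<subseteq> carrier M" "\<zero>\<^sub>M \<in> H"
    and "\<And>x y. \<lbrakk>x \<in> H; y \<in> H\<rbrakk> \<Longrightarrow> x \<oplus>\<^sub>M y \<in> H"
    and "\<And>a x. \<lbrakk>a \<in> carrier R; x \<in> H\<rbrakk> \<Longrightarrow> a \<odot>\<^sub>M x \<in> H"
  shows "submodule H R M"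
proof (intro submodule.intro subgroup.intro submodule_axioms.intro)
  fix x assume "x \<in> H"
  then have "\<ominus>\<^sub>M x \<in> H" using assms minus_via_smult by (metis R.a_inv_closed R.one_closed subsetD)
  then show "inv\<^bsub>add_monoid M\<^esub> x \<in> H" by (simp add: a_inv_def)
qed (use assms in auto)

end

lemma submoduleD:
  assumes "submodule H R M"
  shows "H \<subseteq> carrier M" "\<zero>\<^sub>M \<in> H" "\<And>x. x \<in> H \<Longrightarrow> x \<in> carrier M"
    "\<And>x y. \<lbrakk>x \<in> H; y \<in> H\<rbrakk> \<Longrightarrow> x \<oplus>\<^sub>M y \<in> H"
    "\<And>a x. \<lbrakk>a \<in> carrier R; x \<in> H\<rbrakk> \<Longrightarrow> a \<odot>\<^sub>M x \<in> H"
proof -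
  interpret subgroup H "add_monoid M" using assms by (rule submodule.axioms)
  show "H \<subseteq> carrier M" "\<zero>\<^sub>M \<in> H" using subset one_closed by auto
  show "x \<in> carrier M" if "x \<in> H" for x using that subset by auto
  show add: "x \<oplus>\<^sub>M y \<in> H" if "x \<in> H" "y \<in> H" for x y using m_closed that by auto
  show "a \<odot>\<^sub>M x \<in> H" if "a \<in> carrier R" "x \<in> H" for a x
    using assms that by (rule submodule.smult_closed)
qed

lemma submodule_minus: "\<lbrakk>submodule H R M; x \<in> H\<rbrakk> \<Longrightarrow> \<ominus>\<^sub>M x \<in> H"
  using subgroup.m_inv_closed[OF submodule.axioms(1), of H R M x] by (auto simp: a_inv_def)

lemma submodule_diff: "\<lbrakk>submodule H R M; x \<in> H; y \<in> H\<rbrakk> \<Longrightarrow> x \<ominus>\<^sub>M y \<in> H"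
  by (simp add: a_minus_def submodule_minus submoduleD(4))

context right_module
begin

lemma right_module_sub:
  assumes "submodule H R M"
  shows "right_module R (M \<down> H)"
proof -
  note H = submoduleD[OF assms]
  have "abelian_group (M \<down> H)"
  proof (rule abelian_groupI)
    fix x assume "x \<in> carrier (M \<down> H)"
    then show "\<exists>y\<in>carrier (M \<down> H). y \<oplus>\<^bsub>M \<down> H\<^esub> x = \<zero>\<^bsub>M \<down> H\<^esub>"
      using H submodule_minus[OF assms] by (auto intro!: bexI[of _ "\<ominus>\<^sub>M x"] simp: M.l_neg)
  qed (use H in \<open>auto simp: M.a_ac\<close>)
  then show ?thesis
    using R_ring H by (auto intro!: right_module.intro right_module_axioms.intro
        simp: smult_l_distr smult_r_distr smult_assoc)
qed

lemma a_inv_sub: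
  assumes "submodule H R M" "x \<in> H"
  shows "\<ominus>\<^bsub>M \<down> H\<^esub> x = \<ominus>\<^sub>M x"
proof -
  interpret H: right_module R "M \<down> H" using assms(1) by (rule right_module_sub)
  show ?thesis using submoduleD[OF assms(1)] assms(2)
    by (intro H.M.minus_equality) (auto simp: M.l_neg submodule_minus[OF assms(1)])
qed

lemma a_minus_sub:
  assumes "submodule H R M" "y \<in> H"
  shows "x \<ominus>\<^bsub>M \<down> H\<^esub> y = x \<ominus>\<^sub>M y"
  using assms by (simp add: a_minus_def a_inv_sub)

lemma submodule_carrier: "submodule (carrier M) R M"
  by (rule submoduleI) auto

lemma submodule_zero: "submodule {\<zero>\<^sub>M} R M"
  by (rule submoduleI) auto

lemma submodule_Int:
  assumes "submodule H R M" "submodule H' R M"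
  shows "submodule (H \<inter> H') R M"
proof -
  note H = submoduleD[OF assms(1)] and H' = submoduleD[OF assms(2)]
  show ?thesis by (rule submoduleI) (use H H' in auto)
qed

lemma submodule_sub_iff:
  assumes "submodule N R M"
  shows "submodule H R (M \<down> N) \<longleftrightarrow> submodule H R M \<and> H \<subseteq> N"
proof -
  interpret N: right_module R "M \<down> N" using assms(1) by (rule right_module_sub)
  note N = submoduleD[OF assms]
  show ?thesis
  proof
    assume "submodule H R (M \<down> N)"
    note H = submoduleD[OF this]
    show "submodule H R M \<and> H \<subseteq> N" using H N by (auto intro!: submoduleI)
  next
    assume "submodule H R M \<and> H \<subseteq> N"
    then have "H \<subseteq> N" and H: "submodule H R M" by auto
    show "submodule H R (M \<down> N)" using submoduleD[OF H] \<open>H \<subseteq> N\<close> by (auto intro!: N.submoduleI)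
  qed
qed

lemma set_add_iff: "x \<in> H <+>\<^sub>M H' \<longleftrightarrow> (\<exists>h\<in>H. \<exists>h'\<in>H'. x = h \<oplus>\<^sub>M h')"
  by (auto simp: set_add_def')

lemma set_addI: "\<lbrakk>h \<in> H; h' \<in> H'; x = h \<oplus>\<^sub>M h'\<rbrakk> \<Longrightarrow> x \<in> H <+>\<^sub>M H'"
  by (auto simp: set_add_iff)

lemma submodule_set_add:
  assumes "submodule H R M" "submodule H' R M"
  shows "submodule (H <+>\<^sub>M H') R M"
proof -
  note H = submoduleD[OF assms(1)] and H' = submoduleD[OF assms(2)]
  show ?thesis
  proof (rule submoduleI)
    show "\<zero>\<^sub>M \<in> H <+>\<^sub>M H'" by (rule set_addI[OF H(2) H'(2)]) simp
  next
    fix x y assume "x \<in> H <+>\<^sub>M H'" "y \<in> H <+>\<^sub>M H'"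
    then obtain h h' k k' where *: "h \<in> H" "h' \<in> H'" "k \<in> H" "k' \<in> H'"
      "x = h \<oplus>\<^sub>M h'" "y = k \<oplus>\<^sub>M k'" by (auto simp: set_add_iff)
    then have "x \<oplus>\<^sub>M y = (h \<oplus>\<^sub>M k) \<oplus>\<^sub>M (h' \<oplus>\<^sub>M k')" using H H' by (simp add: M.a_four)
    then show "x \<oplus>\<^sub>M y \<in> H <+>\<^sub>M H'" by (rule set_addI[OF H(4)[OF *(1,3)] H'(4)[OF *(2,4)]])
  next
    fix a x assume a: "a \<in> carrier R" and "x \<in> H <+>\<^sub>M H'"
    then obtain h h' where *: "h \<in> H" "h' \<in> H'" "x = h \<oplus>\<^sub>M h'" by (auto simp: set_add_iff)
    then have "a \<odot>\<^sub>M x = a \<odot>\<^sub>M h \<oplus>\<^sub>M a \<odot>\<^sub>M h'" using H H' a by (simp add: smult_r_distr)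
    then show "a \<odot>\<^sub>M x \<in> H <+>\<^sub>M H'" by (rule set_addI[OF H(5)[OF a *(1)] H'(5)[OF a *(2)]])
  next
    show "H <+>\<^sub>M H' \<subseteq> carrier M" using H(3) H'(3) by (auto simp: set_add_iff)
  qed
qed

lemma set_add_upper:
  assumes "submodule H R M" "submodule H' R M"
  shows "H \<subseteq> H <+>\<^sub>M H'" "H' \<subseteq> H <+>\<^sub>M H'"
proof -
  note H = submoduleD[OF assms(1)] and H' = submoduleD[OF assms(2)]
  show "H \<subseteq> H <+>\<^sub>M H'"
  proof
    fix x assume "x \<in> H"
    then show "x \<in> H <+>\<^sub>M H'" using H(3) by (intro set_addI[OF _ H'(2)]) auto
  qed
  show "H' \<subseteq> H <+>\<^sub>M H'"
  proof
    fix x assume "x \<in> H'"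
    then show "x \<in> H <+>\<^sub>M H'" using H'(3) by (intro set_addI[OF H(2)]) auto
  qed
qed

lemma set_add_least:
  assumes "submodule N R M" "H \<subseteq> N" "H' \<subseteq> N"
  shows "H <+>\<^sub>M H' \<subseteq> N"
  using submoduleD(4)[OF assms(1)] assms(2,3) by (auto simp: set_add_iff subset_iff)

end

text \<open>Maps in \<open>rhom\<close> are extensional, which composites and sums written as plain
  lambda terms are not. \<open>lin\<close> constrains a function on the carrier only;
  \<open>in_rhom\<close> and \<open>rhom_lin\<close> translate between the two.\<close>

locale lin = M: right_module R M + N: right_module R N
  for R :: "('a, 'r) ring_scheme" and M :: "('a, 'm) module" and N :: "('a, 'n) module" +
  fixes f :: "'m \<Rightarrow> 'n"
  assumes closed [simp]: "x \<in> carrier M \<Longrightarrow> f x \<in> carrier N"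
    and add: "\<lbrakk>x \<in> carrier M; y \<in> carrier M\<rbrakk> \<Longrightarrow> f (x \<oplus>\<^sub>M y) = f x \<oplus>\<^sub>N f y"
    and smult: "\<lbrakk>a \<in> carrier R; x \<in> carrier M\<rbrakk> \<Longrightarrow> f (a \<odot>\<^sub>M x) = a \<odot>\<^sub>N f x"

definition ker :: "('a, 'm) module \<Rightarrow> ('a, 'n) module \<Rightarrow> ('m \<Rightarrow> 'n) \<Rightarrow> 'm set" where
  "ker M N f = {x \<in> carrier M. f x = \<zero>\<^sub>N}"

lemma ker_iff: "x \<in> ker M N f \<longleftrightarrow> x \<in> carrier M \<and> f x = \<zero>\<^sub>N"
  by (auto simp: ker_def)

lemma a_kernel_eq_ker: "a_kernel M N f = ker M N f"
  by (auto simp: a_kernel_def kernel_def ker_def)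

abbreviation lifts_along :: "('a, 'r) ring_scheme \<Rightarrow> ('a, 'p) module \<Rightarrow> ('a, 'm) module \<Rightarrow> ('m \<Rightarrow> 'n) \<Rightarrow> ('p \<Rightarrow> 'n) \<Rightarrow> bool" where
  "lifts_along R P M g f \<equiv> \<exists>h. lin R P M h \<and> (\<forall>x\<in>carrier P. g (h x) = f x)"

abbreviation extends_along :: "('a, 'r) ring_scheme \<Rightarrow> ('a, 'l) module \<Rightarrow> ('a, 'p) module \<Rightarrow> ('a, 'm) module \<Rightarrow>
    ('l \<Rightarrow> 'p) \<Rightarrow> ('l \<Rightarrow> 'm) \<Rightarrow> bool" where
  "extends_along R L P M d f \<equiv> \<exists>g. lin R P M g \<and> (\<forall>x\<in>carrier L. g (d x) = f x)"

lemma linI: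
  assumes "right_module R M" "right_module R N"
    and "\<And>x. x \<in> carrier M \<Longrightarrow> f x \<in> carrier N"
    and "\<And>x y. \<lbrakk>x \<in> carrier M; y \<in> carrier M\<rbrakk> \<Longrightarrow> f (x \<oplus>\<^sub>M y) = f x \<oplus>\<^sub>N f y"
    and "\<And>a x. \<lbrakk>a \<in> carrier R; x \<in> carrier M\<rbrakk> \<Longrightarrow> f (a \<odot>\<^sub>M x) = a \<odot>\<^sub>N f x"
  shows "lin R M N f"
  using assms by (auto simp: lin_def lin_axioms_def)

context lin
begin

lemma dom_mod: "right_module R M" ..
lemma cod_mod: "right_module R N" ..

lemma zero [simp]: "f \<zero>\<^sub>M = \<zero>\<^sub>N"
  using smult[of "\<zero>\<^sub>R" "\<zero>\<^sub>M"] by simp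

lemma minus: "x \<in> carrier M \<Longrightarrow> f (\<ominus>\<^sub>M x) = \<ominus>\<^sub>N f x"
  by (simp add: M.minus_via_smult N.minus_via_smult smult)

lemma diff: "\<lbrakk>x \<in> carrier M; y \<in> carrier M\<rbrakk> \<Longrightarrow> f (x \<ominus>\<^sub>M y) = f x \<ominus>\<^sub>N f y"
  by (simp add: a_minus_def add minus)

lemma submodule_ker: "submodule (ker M N f) R M"
  by (rule M.submoduleI) (auto simp: ker_iff add smult)

lemma submodule_vimage:
  assumes "submodule H R N"
  shows "submodule {x \<in> carrier M. f x \<in> H} R M"
  by (rule M.submoduleI) (simp_all add: add smult submoduleD(2,4,5)[OF assms])

lemma submodule_image:
  assumes "submodule H R M"
  shows "submodule (f ` H) R N"
proof -
  note H = submoduleD[OF assms]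
  show ?thesis
  proof (rule N.submoduleI)
    show "f ` H \<subseteq> carrier N" using H(3) by (simp add: image_subset_iff)
    show "\<zero>\<^sub>N \<in> f ` H" using H(2) by (intro image_eqI[of _ _ "\<zero>\<^sub>M"]) simp_all
  next
    fix x y assume "x \<in> f ` H" "y \<in> f ` H"
    then obtain u v where "u \<in> H" "v \<in> H" "x = f u" "y = f v" by (elim imageE)
    then show "x \<oplus>\<^sub>N y \<in> f ` H"
      by (intro image_eqI[of _ _ "u \<oplus>\<^sub>M v"]) (simp_all add: add H)
  next
    fix a x assume "a \<in> carrier R" "x \<in> f ` H"
    then obtain u where "a \<in> carrier R" "u \<in> H" "x = f u" by (elim imageE)
    then show "a \<odot>\<^sub>N x \<in> f ` H"
      by (intro image_eqI[of _ _ "a \<odot>\<^sub>M u"]) (simp_all add: smult H)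
  qed
qed

lemma submodule_range: "submodule (f ` carrier M) R N"
  by (rule submodule_image[OF M.submodule_carrier])

lemma inj_iff: "inj_on f (carrier M) \<longleftrightarrow> (\<forall>x\<in>carrier M. f x = \<zero>\<^sub>N \<longrightarrow> x = \<zero>\<^sub>M)"
proof
  assume *: "\<forall>x\<in>carrier M. f x = \<zero>\<^sub>N \<longrightarrow> x = \<zero>\<^sub>M"
  show "inj_on f (carrier M)"
  proof (rule inj_onI)
    fix x y assume xy: "x \<in> carrier M" "y \<in> carrier M" "f x = f y"
    then have "f (x \<ominus>\<^sub>M y) = \<zero>\<^sub>N" by (simp add: diff)
    then have "x \<ominus>\<^sub>M y = \<zero>\<^sub>M" using *[rule_format, of "x \<ominus>\<^sub>M y"] xy by simp
    then show "x = y" using xy by (simp add: M.M.diff_eq_zero_iff)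
  qed
next
  assume "inj_on f (carrier M)"
  then show "\<forall>x\<in>carrier M. f x = \<zero>\<^sub>N \<longrightarrow> x = \<zero>\<^sub>M"
    using inj_onD[of f "carrier M" _ "\<zero>\<^sub>M"] by simp
qed

lemma inj_iff_ker: "inj_on f (carrier M) \<longleftrightarrow> ker M N f = {\<zero>\<^sub>M}"
  using zero M.M.zero_closed unfolding inj_iff set_eq_iff ker_iff singleton_iff by blast

lemma eq_iff_diff_ker:
  "\<lbrakk>x \<in> carrier M; y \<in> carrier M\<rbrakk> \<Longrightarrow> f x = f y \<longleftrightarrow> x \<ominus>\<^sub>M y \<in> ker M N f"
  by (simp add: ker_iff diff N.M.diff_eq_zero_iff)

lemma restrict_codomain:
  assumes "submodule H R N" "f ` carrier M \<subseteq> H"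
  shows "lin R M (N \<down> H) f"
  using assms N.right_module_sub by (intro linI) (auto simp: add smult M.right_module_axioms)

lemma restrict_domain:
  assumes "submodule H R M"
  shows "lin R (M \<down> H) N f"
  using submoduleD[OF assms] M.right_module_sub[OF assms]
  by (intro linI) (auto simp: add smult N.right_module_axioms)

lemma inv_into_lin:
  assumes "bij_betw f (carrier M) (carrier N)"
  shows "lin R N M (inv_into (carrier M) f)"
proof -
  let ?g = "inv_into (carrier M) f"
  have g: "?g y \<in> carrier M" "f (?g y) = y" if "y \<in> carrier N" for y
    using that assms by (auto simp: bij_betw_def inv_into_into f_inv_into_f)
  have u: "?g (f x) = x" if "x \<in> carrier M" for x
    using that assms by (auto simp: bij_betw_def inv_into_f_f)
  show ?thesis
  proof (rule linI)
    fix x y assume "x \<in> carrier N" "y \<in> carrier N"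
    then show "?g (x \<oplus>\<^sub>N y) = ?g x \<oplus>\<^sub>M ?g y"
      using u[of "?g x \<oplus>\<^sub>M ?g y"] g by (simp add: add)
  next
    fix a x assume "a \<in> carrier R" "x \<in> carrier N"
    then show "?g (a \<odot>\<^sub>N x) = a \<odot>\<^sub>M ?g x"
      using u[of "a \<odot>\<^sub>M ?g x"] g by (simp add: smult)
  qed (use g in \<open>auto intro: M.right_module_axioms N.right_module_axioms\<close>)
qed

lemma in_rhom: "restrict f (carrier M) \<in> rhom R M N"
  by (auto simp: rhom_def add smult)

text \<open>Any choice of preimages under \<open>f\<close> works, because two preimages of one
  element differ by an element of the kernel, where \<open>g\<close> vanishes.\<close>

lemma factor_surj:
  assumes g: "lin R M L g" and s: "f ` carrier M = carrier N"
    and k: "\<And>x. \<lbrakk>x \<in> carrier M; f x = \<zero>\<^sub>N\<rbrakk> \<Longrightarrow> g x = \<zero>\<^sub>L"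
  shows "extends_along R M N L f g"
proof -
  interpret g: lin R M L g by fact
  define h where "h y = g (inv_into (carrier M) f y)" for y
  have h: "h (f x) = g x" if x: "x \<in> carrier M" for x
  proof -
    let ?x = "inv_into (carrier M) f (f x)"
    have x': "?x \<in> carrier M" "f ?x = f x"
      using x by (simp_all add: inv_into_into f_inv_into_f)
    then have "f (?x \<ominus>\<^sub>M x) = \<zero>\<^sub>N" using x by (simp add: diff)
    then have "g (?x \<ominus>\<^sub>M x) = \<zero>\<^sub>L" using k[of "?x \<ominus>\<^sub>M x"] x x'(1) by simp
    then have "g ?x \<ominus>\<^sub>L g x = \<zero>\<^sub>L" using x x'(1) by (simp only: g.diff)
    then show ?thesis unfolding h_def using x x'(1) by (simp add: g.N.M.diff_eq_zero_iff)
  qed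
  have ex: "\<exists>u\<in>carrier M. y = f u" if "y \<in> carrier N" for y
    using that unfolding s[symmetric] by blast
  have "lin R N L h"
  proof (rule linI)
    fix y assume "y \<in> carrier N"
    then obtain u where "u \<in> carrier M" "y = f u" using ex by blast
    then show "h y \<in> carrier L" by (simp add: h)
  next
    fix y z assume "y \<in> carrier N" "z \<in> carrier N"
    with ex[of y] ex[of z] obtain u v where "u \<in> carrier M" "v \<in> carrier M" "y = f u" "z = f v" by metis
    then show "h (y \<oplus>\<^sub>N z) = h y \<oplus>\<^sub>L h z"
      using h[of "u \<oplus>\<^sub>M v"] by (simp add: h add g.add)
  next
    fix a y assume "a \<in> carrier R" "y \<in> carrier N"
    then obtain u where "a \<in> carrier R" "u \<in> carrier M" "y = f u" using ex by blast
    then show "h (a \<odot>\<^sub>N y) = a \<odot>\<^sub>L h y"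
      using h[of "a \<odot>\<^sub>M u"] by (simp add: h smult g.smult)
  qed (rule N.right_module_axioms g.N.right_module_axioms)+
  then show ?thesis using h by auto
qed

end

lemma lin_comp:
  assumes "lin R M N f" "lin R N L g"
  shows "lin R M L (\<lambda>x. g (f x))"
proof -
  interpret f: lin R M N f by fact
  interpret g: lin R N L g by fact
  show ?thesis
    by (intro linI) (simp_all add: f.add g.add f.smult g.smult f.dom_mod g.cod_mod)
qed

lemma lin_id: "right_module R M \<Longrightarrow> lin R M M (\<lambda>x. x)"
  by (auto intro!: linI)

lemma lin_zero:
  assumes "right_module R M" "right_module R N"
  shows "lin R M N (\<lambda>x. \<zero>\<^sub>N)"
proof -
  interpret N: right_module R N by fact
  show ?thesis using assms by (intro linI) auto
qed

lemma lin_incl: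
  assumes "right_module R M" "submodule H R M"
  shows "lin R (M \<down> H) M (\<lambda>x. x)"
  by (rule lin.restrict_domain[OF lin_id]) fact+

lemma lin_add_map:
  assumes "lin R M N f" "lin R M N g"
  shows "lin R M N (\<lambda>x. f x \<oplus>\<^sub>N g x)"
proof -
  interpret f: lin R M N f by fact
  interpret g: lin R M N g by fact
  show ?thesis
    by (intro linI) (simp_all add: f.add g.add f.smult g.smult f.N.M.a_four f.N.smult_r_distr
        f.dom_mod f.cod_mod)
qed

lemma lin_minus_map:
  assumes "lin R M N f"
  shows "lin R M N (\<lambda>x. \<ominus>\<^sub>N f x)"
proof -
  interpret f: lin R M N f by fact
  show ?thesis
    by (intro linI) (simp_all add: f.add f.smult f.N.M.minus_add f.N.smult_r_minus
        f.dom_mod f.cod_mod)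
qed

lemma lin_diff_map: "\<lbrakk>lin R M N f; lin R M N g\<rbrakk> \<Longrightarrow> lin R M N (\<lambda>x. f x \<ominus>\<^sub>N g x)"
  unfolding a_minus_def by (intro lin_add_map lin_minus_map)

lemma rhom_lin: "\<lbrakk>right_module R M; right_module R N; f \<in> rhom R M N\<rbrakk> \<Longrightarrow> lin R M N f"
  by (auto simp: rhom_def intro!: linI)

lemma rhom_ext: "\<lbrakk>f \<in> rhom R M N; g \<in> rhom R M N; \<And>x. x \<in> carrier M \<Longrightarrow> f x = g x\<rbrakk> \<Longrightarrow> f = g"
  unfolding rhom_def by (auto intro: PiE_ext)

lemma rhom_closed: "\<lbrakk>f \<in> rhom R M N; x \<in> carrier M\<rbrakk> \<Longrightarrow> f x \<in> carrier N"
  by (auto simp: rhom_def)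

lemma module_isoI:
  assumes "lin R M N f" "bij_betw f (carrier M) (carrier N)"
  shows "module_iso R M N"
proof -
  have "bij_betw (restrict f (carrier M)) (carrier M) (carrier N)"
    using assms(2) by (simp cong: bij_betw_cong)
  then show ?thesis unfolding module_iso_def using lin.in_rhom[OF assms(1)] by blast
qed

lemma module_isoE:
  assumes "module_iso R M N" "right_module R M" "right_module R N"
  obtains f where "lin R M N f" "bij_betw f (carrier M) (carrier N)"
  using assms rhom_lin unfolding module_iso_def by blast

lemma module_iso_refl: "right_module R M \<Longrightarrow> module_iso R M M"
  by (rule module_isoI[OF lin_id]) (auto simp: bij_betw_def)

lemma module_iso_sym:
  assumes "module_iso R M N" "right_module R M" "right_module R N"
  shows "module_iso R N M"
  using assms by (metis module_isoE lin.inv_into_lin module_isoI bij_betw_inv_into)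

lemma module_iso_trans:
  assumes "module_iso R M N" "module_iso R N L" "right_module R M" "right_module R N" "right_module R L"
  shows "module_iso R M L"
proof -
  obtain f where f: "lin R M N f" "bij_betw f (carrier M) (carrier N)" using assms module_isoE by blast
  obtain g where g: "lin R N L g" "bij_betw g (carrier N) (carrier L)" using assms module_isoE by blast
  show ?thesis using lin_comp[OF f(1) g(1)] bij_betw_trans[OF f(2) g(2)]
    by (auto intro: module_isoI simp: comp_def)
qed

section \<open>Length\<close>

text \<open>Only the number of strict inclusions and the top term of a chain are kept, so that a
  chain can be moved along a map and its top enlarged. Bounded chains give composition length over
  \<open>A\<close> and \<open>B\<close> and dimension over \<open>K\<close> by one notion.\<close>

inductive mchain :: "('a, 'r) ring_scheme \<Rightarrow> ('a, 'm) module \<Rightarrow> nat \<Rightarrow> 'm set \<Rightarrow> bool" for R M where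
  base: "submodule U R M \<Longrightarrow> mchain R M 0 U"
| step: "\<lbrakk>mchain R M n U; submodule V R M; U \<subset> V\<rbrakk> \<Longrightarrow> mchain R M (Suc n) V"

definition flen :: "('a, 'r) ring_scheme \<Rightarrow> ('a, 'm) module \<Rightarrow> bool" where
  "flen R M \<longleftrightarrow> (\<exists>b. \<forall>n U. mchain R M n U \<longrightarrow> n \<le> b)"

definition len :: "('a, 'r) ring_scheme \<Rightarrow> ('a, 'm) module \<Rightarrow> nat" where
  "len R M = Max {n. \<exists>U. mchain R M n U}"

lemma mchain_submodule: "mchain R M n U \<Longrightarrow> submodule U R M"
  by (cases rule: mchain.cases) auto

lemma mchain_mono:
  assumes "mchain R M n U" "U \<subseteq> V" "submodule V R M"
  shows "mchain R M n V"
  using assms(1)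
proof cases
  case base
  then show ?thesis using assms(3) by (auto intro: mchain.base)
next
  case (step m W)
  then show ?thesis using assms(2,3) by (auto intro!: mchain.step[of R M m W])
qed

lemma flen_finite: "flen R M \<Longrightarrow> finite {n. \<exists>U. mchain R M n U}"
  unfolding flen_def finite_nat_set_iff_bounded_le by blast

lemma mchain_le_len: "\<lbrakk>flen R M; mchain R M n U\<rbrakk> \<Longrightarrow> n \<le> len R M"
  unfolding len_def using flen_finite by (intro Max_ge) auto

lemma (in right_module) mchain_zero: "mchain R M 0 {\<zero>\<^sub>M}"
  by (intro mchain.base submodule_zero)

lemma (in right_module) mchain_len:
  assumes "flen R M"
  shows "mchain R M (len R M) (carrier M)"
proof -
  have "len R M \<in> {n. \<exists>U. mchain R M n U}"
    unfolding len_def using flen_finite[OF assms] mchain_zero by (intro Max_in) auto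
  then obtain U where "mchain R M (len R M) U" by auto
  then show ?thesis
    using mchain_mono submodule_carrier submoduleD(1)[OF mchain_submodule] by metis
qed

lemma (in right_module) len_eqI:
  assumes "flen R M" "mchain R M n U" "\<And>m V. mchain R M m V \<Longrightarrow> m \<le> n"
  shows "len R M = n"
  using mchain_len[OF assms(1)] assms mchain_le_len[OF assms(1)] by (meson le_antisym)

text \<open>By the modular law a strict inclusion of submodules stays strict after intersection with
  the kernel or after taking images. Every step of the chain is therefore counted at least once on
  one of the two sides.\<close>

lemma (in lin) mchain_image_ker:
  assumes "mchain R M n U"
  shows "\<exists>a b. n \<le> a + b \<and> mchain R (M \<down> ker M N f) a (U \<inter> ker M N f) \<and> mchain R N b (f ` U)"
  using assms
proof induction
  case (base U)
  have "submodule (U \<inter> ker M N f) R (M \<down> ker M N f)"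
    using M.submodule_sub_iff[OF submodule_ker] M.submodule_Int[OF base submodule_ker] by auto
  then show ?case
    using mchain.base[OF submodule_image[OF base]] mchain.base[of "U \<inter> ker M N f"] by fastforce
next
  case (step n U V)
  then obtain a b where ab: "n \<le> a + b" "mchain R (M \<down> ker M N f) a (U \<inter> ker M N f)"
    "mchain R N b (f ` U)" by blast
  have sV: "submodule (V \<inter> ker M N f) R (M \<down> ker M N f)"
    using M.submodule_sub_iff[OF submodule_ker] M.submodule_Int[OF step(2) submodule_ker] by auto
  note sfV = submodule_image[OF step(2)]
  note U = mchain_submodule[OF step(1)]
  have UV: "U \<subseteq> V" using step(3) by auto
  have a: "mchain R (M \<down> ker M N f) a (V \<inter> ker M N f)"
    by (rule mchain_mono[OF ab(2) _ sV]) (use UV in auto)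
  have b: "mchain R N b (f ` V)" by (rule mchain_mono[OF ab(3) image_mono[OF UV] sfV])
  show ?case
  proof (cases "U \<inter> ker M N f = V \<inter> ker M N f")
    case True
    have "f ` U \<noteq> f ` V"
    proof
      assume eq: "f ` U = f ` V"
      have "V \<subseteq> U"
      proof
        fix v assume v: "v \<in> V"
        then obtain u where u: "u \<in> U" "f v = f u" using eq by (metis imageE imageI)
        then have uV: "u \<in> V" using step(3) by auto
        note c = submoduleD(3)[OF step(2) v] submoduleD(3)[OF U u(1)]
        have "v \<ominus>\<^sub>M u \<in> V \<inter> ker M N f"
          using submodule_diff[OF step(2) v uV] eq_iff_diff_ker[OF c] u by simp
        then have "v \<ominus>\<^sub>M u \<in> U" using True by auto
        then have "v \<ominus>\<^sub>M u \<oplus>\<^sub>M u \<in> U" using submoduleD(4)[OF U] u by auto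
        then show "v \<in> U" using c by simp
      qed
      then show False using step(3) by auto
    qed
    then have "mchain R N (Suc b) (f ` V)" using mchain.step[OF ab(3) sfV] image_mono[OF UV, of f] by auto
    then show ?thesis using a ab(1) by (metis Suc_le_mono add_Suc_right)
  next
    case False
    then have "mchain R (M \<down> ker M N f) (Suc a) (V \<inter> ker M N f)"
      using mchain.step[OF ab(2) sV] UV by auto
    then show ?thesis using b ab(1) by (metis Suc_le_mono add_Suc)
  qed
qed

lemma (in right_module) mchain_sub:
  assumes "submodule N R M" "mchain R (M \<down> N) n U"
  shows "mchain R M n U"
  using assms(2) by induction (auto intro: mchain.intros simp: submodule_sub_iff[OF assms(1)])

text \<open>Preimages of submodules of \<open>N\<close> contain the kernel, so their chain can be
  placed on top of a chain inside it. Together with \<open>mchain_image_ker\<close> this makes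
  length additive.\<close>

lemma (in lin) mchain_vimage:
  assumes s: "f ` carrier M = carrier N"
    and "mchain R N b V" and a: "mchain R (M \<down> ker M N f) a U"
  shows "mchain R M (a + b) {x \<in> carrier M. f x \<in> V}"
  using assms(2)
proof induction
  case (base V)
  have "U \<subseteq> ker M N f" using submoduleD(1)[OF mchain_submodule[OF a]] by simp
  then have "U \<subseteq> {x \<in> carrier M. f x \<in> V}" using submoduleD(2)[OF base] by (auto simp: ker_def)
  then show ?case
    using mchain_mono[OF M.mchain_sub[OF submodule_ker a] _ submodule_vimage[OF base]] by simp
next
  case (step n V W)
  obtain w where "w \<in> W" "w \<notin> V" using step(3) by auto
  moreover then have "w \<in> f ` carrier M" using s submoduleD(3)[OF step(2)] by auto
  ultimately have "{x \<in> carrier M. f x \<in> V} \<subset> {x \<in> carrier M. f x \<in> W}" using step(3) by auto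
  then show ?case using mchain.step[OF step(4) submodule_vimage[OF step(2)]] by simp
qed

lemma (in right_module) flen_sub: "\<lbrakk>submodule N R M; flen R M\<rbrakk> \<Longrightarrow> flen R (M \<down> N)"
  unfolding flen_def using mchain_sub by metis

lemma (in lin) flen_ker_image:
  assumes "f ` carrier M = carrier N"
  shows "flen R M \<longleftrightarrow> flen R (M \<down> ker M N f) \<and> flen R N"
proof
  assume M: "flen R M"
  have "n \<le> len R M" if n: "mchain R N n V" for n V
    using mchain_le_len[OF M mchain_vimage[OF assms n mchain.base]]
    using M.submodule_sub_iff[OF submodule_ker] submodule_ker by auto
  then have "flen R N" unfolding flen_def by blast
  then show "flen R (M \<down> ker M N f) \<and> flen R N" using M.flen_sub[OF submodule_ker M] by auto
next
  assume f: "flen R (M \<down> ker M N f) \<and> flen R N"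
  have "n \<le> len R (M \<down> ker M N f) + len R N" if n: "mchain R M n V" for n V
  proof -
    obtain a b where "n \<le> a + b" "mchain R (M \<down> ker M N f) a (V \<inter> ker M N f)"
      "mchain R N b (f ` V)" using mchain_image_ker[OF n] by blast
    then show ?thesis using mchain_le_len f by (metis add_mono order_trans)
  qed
  then show "flen R M" unfolding flen_def by blast
qed

lemma (in lin) len_ker_image:
  assumes s: "f ` carrier M = carrier N" and M: "flen R M"
  shows "len R M = len R (M \<down> ker M N f) + len R N"
proof (rule M.len_eqI[OF M])
  note f = conjunct1[OF flen_ker_image[OF s, THEN iffD1, OF M]]
    conjunct2[OF flen_ker_image[OF s, THEN iffD1, OF M]]
  interpret k: right_module R "M \<down> ker M N f" by (rule M.right_module_sub[OF submodule_ker])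
  show "mchain R M (len R (M \<down> ker M N f) + len R N) {x \<in> carrier M. f x \<in> carrier N}"
    using mchain_vimage[OF s N.mchain_len[OF f(2)] k.mchain_len[OF f(1)]] by simp
next
  fix n V assume n: "mchain R M n V"
  note f = conjunct1[OF flen_ker_image[OF s, THEN iffD1, OF M]]
    conjunct2[OF flen_ker_image[OF s, THEN iffD1, OF M]]
  obtain a b where ab: "n \<le> a + b" "mchain R (M \<down> ker M N f) a (V \<inter> ker M N f)"
    "mchain R N b (f ` V)" using mchain_image_ker[OF n] by blast
  show "n \<le> len R (M \<down> ker M N f) + len R N"
    using ab(1) mchain_le_len[OF f(1) ab(2)] mchain_le_len[OF f(2) ab(3)] by linarith
qed

lemma mchain_of_zero:
  assumes "mchain R M n U" "carrier M = {\<zero>\<^sub>M}"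
  shows "n = 0"
  using assms(1)
proof cases
  case (step m V)
  note submoduleD(1,2)[OF mchain_submodule[OF step(2)]] submoduleD(1)[OF step(3)]
  then show ?thesis using step(4) assms(2) by auto
qed simp

lemma (in right_module) len_zero:
  assumes "carrier M = {\<zero>\<^sub>M}"
  shows "flen R M" "len R M = 0"
proof -
  show f: "flen R M" unfolding flen_def using mchain_of_zero[OF _ assms] by auto
  show "len R M = 0" using mchain_of_zero[OF mchain_len[OF f] assms] .
qed

lemma (in right_module) len_sub_le: "\<lbrakk>submodule N R M; flen R M\<rbrakk> \<Longrightarrow> len R (M \<down> N) \<le> len R M"
  using mchain_le_len mchain_sub right_module.mchain_len[OF right_module_sub flen_sub] by metis

lemma (in right_module) len_sub_less:
  assumes "submodule N R M" "flen R M" "N \<noteq> carrier M"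
  shows "len R (M \<down> N) < len R M"
proof -
  have "mchain R M (len R (M \<down> N)) N"
    using mchain_sub[OF assms(1) right_module.mchain_len[OF right_module_sub flen_sub]] assms by simp
  then have "mchain R M (Suc (len R (M \<down> N))) (carrier M)"
    using assms submoduleD(1)[OF assms(1)] by (intro mchain.step[OF _ submodule_carrier]) auto
  then show ?thesis using mchain_le_len[OF assms(2)] by fastforce
qed

lemma (in right_module) submodule_eq_of_len:
  "\<lbrakk>submodule N R M; flen R M; len R (M \<down> N) = len R M\<rbrakk> \<Longrightarrow> N = carrier M"
  using len_sub_less by fastforce

lemma (in right_module) len_0_iff:
  assumes "flen R M"
  shows "len R M = 0 \<longleftrightarrow> carrier M = {\<zero>\<^sub>M}"
  using len_sub_less[OF submodule_zero assms] len_zero(2) by fastforce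

lemma (in lin) len_inj:
  assumes "inj_on f (carrier M)" and N: "flen R N"
  shows "flen R M" "len R M = len R (N \<down> f ` carrier M)"
proof -
  interpret g: lin R M "N \<down> f ` carrier M" f
    by (rule restrict_codomain[OF submodule_range]) simp
  have k: "ker M (N \<down> f ` carrier M) f = {\<zero>\<^sub>M}" using assms(1) g.inj_iff_ker by simp
  interpret z: right_module R "M \<down> {\<zero>\<^sub>M}" by (rule M.right_module_sub[OF M.submodule_zero])
  have z: "flen R (M \<down> {\<zero>\<^sub>M})" "len R (M \<down> {\<zero>\<^sub>M}) = 0"
    using z.len_zero by simp_all
  show M: "flen R M" using g.flen_ker_image z N.flen_sub[OF submodule_range N] k by simp
  show "len R M = len R (N \<down> f ` carrier M)" using g.len_ker_image[OF _ M] k z by simp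
qed

lemma (in lin) len_bij:
  assumes "bij_betw f (carrier M) (carrier N)" and "flen R M"
  shows "flen R N" "len R N = len R M"
proof -
  interpret g: lin R N M "inv_into (carrier M) f" by (rule inv_into_lin[OF assms(1)])
  have b: "bij_betw (inv_into (carrier M) f) (carrier N) (carrier M)" using assms(1) by (rule bij_betw_inv_into)
  show "flen R N" "len R N = len R M" using g.len_inj[OF _ assms(2)] b by (simp_all add: bij_betw_def)
qed

lemma (in lin) surj_imp_inj:
  assumes "flen R M" "f ` carrier M = carrier N" "len R N \<ge> len R M"
  shows "inj_on f (carrier M)"
proof -
  interpret k: right_module R "M \<down> ker M N f" by (rule M.right_module_sub[OF submodule_ker])
  have "len R (M \<down> ker M N f) = 0" using len_ker_image[OF assms(2,1)] assms(3) by simp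
  then have "ker M N f = {\<zero>\<^sub>M}"
    using k.len_0_iff M.flen_sub[OF submodule_ker assms(1)] by simp
  then show ?thesis by (simp add: inj_iff_ker)
qed

lemma (in lin) inj_imp_surj:
  assumes "flen R N" "inj_on f (carrier M)" "len R N \<le> len R M"
  shows "f ` carrier M = carrier N"
  using len_inj(2)[OF assms(2,1)] assms N.len_sub_le[OF submodule_range]
  by (intro N.submodule_eq_of_len[OF submodule_range]) auto

text \<open>Finite length does the work of Zorn's lemma: a member of \<open>F\<close> of greatest
  length is maximal, since a proper inclusion raises the length.\<close>

lemma (in right_module) ex_maximal_submodule:
  assumes "flen R M" "U \<in> F" "\<And>U. U \<in> F \<Longrightarrow> submodule U R M"
  shows "\<exists>U\<in>F. \<forall>V\<in>F. U \<subseteq> V \<longrightarrow> U = V"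
proof -
  have "\<exists>U. U \<in> F \<and> (\<forall>V. V \<in> F \<longrightarrow> len R (M \<down> V) \<le> len R (M \<down> U))"
    using len_sub_le[OF _ assms(1)] assms(2,3)
    \<comment> \<open>The bound has to be strict, whence \<open>Suc\<close>.\<close>
    by (intro ex_has_greatest_nat[of _ _ _ "Suc (len R M)"]) (auto simp: less_Suc_eq_le)
  then obtain U where U: "U \<in> F" "\<And>V. V \<in> F \<Longrightarrow> len R (M \<down> V) \<le> len R (M \<down> U)"
    by blast
  have "U = V" if V: "V \<in> F" "U \<subseteq> V" for V
  proof (rule ccontr)
    assume ne: "U \<noteq> V"
    interpret V: right_module R "M \<down> V" by (rule right_module_sub[OF assms(3)[OF V(1)]])
    have "len R (M \<down> V \<down> U) < len R (M \<down> V)"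
      using V ne U(1) assms(3) flen_sub[OF assms(3)[OF V(1)] assms(1)]
      by (intro V.len_sub_less) (auto simp: submodule_sub_iff)
    then show False using U(2)[OF V(1)] by simp
  qed
  then show ?thesis using U(1) by blast
qed

lemma (in right_module) submodule_cyclic:
  assumes "x \<in> carrier M"
  shows "submodule ((\<lambda>a. a \<odot>\<^sub>M x) ` carrier R) R M"
proof (rule submoduleI)
  show "\<zero>\<^sub>M \<in> (\<lambda>a. a \<odot>\<^sub>M x) ` carrier R"
    using assms by (intro image_eqI[of _ _ "\<zero>\<^sub>R"]) auto
next
  fix u v assume "u \<in> (\<lambda>a. a \<odot>\<^sub>M x) ` carrier R" "v \<in> (\<lambda>a. a \<odot>\<^sub>M x) ` carrier R"
  then obtain a b where "a \<in> carrier R" "b \<in> carrier R" "u = a \<odot>\<^sub>M x" "v = b \<odot>\<^sub>M x" by (elim imageE)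
  then show "u \<oplus>\<^sub>M v \<in> (\<lambda>a. a \<odot>\<^sub>M x) ` carrier R"
    using assms by (intro image_eqI[of _ _ "a \<oplus>\<^sub>R b"]) (simp_all add: smult_l_distr)
next
  fix c u assume c: "c \<in> carrier R" and "u \<in> (\<lambda>a. a \<odot>\<^sub>M x) ` carrier R"
  then obtain a where "a \<in> carrier R" "u = a \<odot>\<^sub>M x" by (elim imageE)
  then show "c \<odot>\<^sub>M u \<in> (\<lambda>a. a \<odot>\<^sub>M x) ` carrier R"
    using assms c by (intro image_eqI[of _ _ "a \<otimes>\<^sub>R c"]) (simp_all add: smult_assoc)
qed (use assms in \<open>simp add: image_subset_iff\<close>)

lemma (in right_module) cyclic_self: "x \<in> carrier M \<Longrightarrow> x \<in> (\<lambda>a. a \<odot>\<^sub>M x) ` carrier R"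
  by (intro image_eqI[of _ _ "\<one>\<^sub>R"]) auto

text \<open>A maximal finitely generated submodule absorbs every cyclic submodule, so it is the
  whole module.\<close>

lemma (in right_module) fin_gen_of_flen:
  assumes "flen R M"
  shows "fin_gen R M"
proof -
  define F where "F = {U. submodule U R M \<and>
    (\<exists>S. finite S \<and> S \<subseteq> U \<and> (\<forall>N. submodule N R M \<and> S \<subseteq> N \<longrightarrow> U \<subseteq> N))}"
  have F0: "{\<zero>\<^sub>M} \<in> F" unfolding F_def using submodule_zero submoduleD(2) by (auto intro!: exI[of _ "{}"])
  have "\<exists>U\<in>F. \<forall>V\<in>F. U \<subseteq> V \<longrightarrow> U = V"
    by (rule ex_maximal_submodule[OF assms F0]) (simp add: F_def)
  then obtain U where U: "U \<in> F" and max: "\<And>V. V \<in> F \<Longrightarrow> U \<subseteq> V \<Longrightarrow> U = V" by auto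
  from U obtain S where sU: "submodule U R M" and S: "finite S" "S \<subseteq> U"
    "\<And>N. submodule N R M \<Longrightarrow> S \<subseteq> N \<Longrightarrow> U \<subseteq> N" unfolding F_def by auto
  have "x \<in> U" if x: "x \<in> carrier M" for x
  proof -
    let ?C = "(\<lambda>a. a \<odot>\<^sub>M x) ` carrier R"
    note C = submodule_cyclic[OF x] cyclic_self[OF x]
    have "U <+>\<^sub>M ?C \<in> F" unfolding F_def
    proof (intro CollectI conjI exI[of _ "insert x S"] allI impI)
      fix N assume N: "submodule N R M \<and> insert x S \<subseteq> N"
      then have "?C \<subseteq> N" using submoduleD(5)[of N R M] by (simp add: image_subset_iff)
      then show "U <+>\<^sub>M ?C \<subseteq> N" using S(3) N by (intro set_add_least) auto
    next
      show "insert x S \<subseteq> U <+>\<^sub>M ?C" using S(2) set_add_upper[OF sU C(1)] C(2) by blast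
    qed (use S(1) sU C in \<open>auto intro: submodule_set_add\<close>)
    then have "U = U <+>\<^sub>M ?C" by (rule max[OF _ set_add_upper(1)[OF sU C(1)]])
    then show ?thesis using set_add_upper(2)[OF sU C(1)] C(2) by blast
  qed
  then have "U = carrier M" using submoduleD(1)[OF sU] by auto
  then show ?thesis unfolding fin_gen_def using S submoduleD(1) by (metis subset_antisym)
qed

section \<open>Free modules\<close>

lemma with_smult_simps [simp]:
  "carrier (with_smult M s) = carrier M" "ring.zero (with_smult M s) = ring.zero M"
  "ring.add (with_smult M s) = ring.add M" "smult (with_smult M s) = s"
  by (simp_all add: with_smult_def ring.defs module.defs)

lemma a_inv_with_smult [simp]: "a_inv (with_smult M s) = a_inv M"
  by (simp add: a_inv_def m_inv_def fun_eq_iff)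

lemma regular_simps [simp]:
  "carrier (regular R) = carrier R" "\<zero>\<^bsub>regular R\<^esub> = \<zero>\<^sub>R"
  "x \<oplus>\<^bsub>regular R\<^esub> y = x \<oplus>\<^sub>R y" "a \<odot>\<^bsub>regular R\<^esub> x = x \<otimes>\<^sub>R a"
  by (simp_all add: regular_def)

lemma abelian_group_with_smult:
  assumes "abelian_group M"
  shows "abelian_group (with_smult M s)"
proof -
  interpret abelian_group M by fact
  show ?thesis
  proof (rule abelian_groupI)
    fix x assume "x \<in> carrier (with_smult M s)"
    then show "\<exists>y\<in>carrier (with_smult M s). y \<oplus>\<^bsub>with_smult M s\<^esub> x = \<zero>\<^bsub>with_smult M s\<^esub>"
      by (intro bexI[of _ "\<ominus>\<^sub>M x"]) (simp_all add: l_neg)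
  qed (simp_all add: a_ac)
qed

lemma (in ring) right_module_regular: "right_module R (regular R)"
proof (intro right_module.intro right_module_axioms.intro)
  show "abelian_group (regular R)" unfolding regular_def by (rule abelian_group_with_smult) (rule is_abelian_group)
qed (simp_all add: ring_axioms l_distr r_distr m_assoc)

text \<open>Sequences with finite support put all free modules into one type, with the one of rank
  \<open>n\<close> a submodule of the one of rank \<open>Suc n\<close>; inductions on the rank split
  off the last coordinate.\<close>

definition free_module :: "('a, 'r) ring_scheme \<Rightarrow> nat \<Rightarrow> ('a, nat \<Rightarrow> 'a) module" where
  "free_module R n = \<lparr>carrier = {r. (\<forall>i. r i \<in> carrier R) \<and> (\<forall>i\<ge>n. r i = \<zero>\<^sub>R)},
     monoid.mult = undefined, one = undefined, ring.zero = (\<lambda>_. \<zero>\<^sub>R),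
     ring.add = (\<lambda>r s i. r i \<oplus>\<^sub>R s i), smult = (\<lambda>a r i. r i \<otimes>\<^sub>R a)\<rparr>"

lemma free_module_simps [simp]:
  "r \<in> carrier (free_module R n) \<longleftrightarrow> (\<forall>i. r i \<in> carrier R) \<and> (\<forall>i\<ge>n. r i = \<zero>\<^sub>R)"
  "\<zero>\<^bsub>free_module R n\<^esub> = (\<lambda>_. \<zero>\<^sub>R)"
  "r \<oplus>\<^bsub>free_module R n\<^esub> s = (\<lambda>i. r i \<oplus>\<^sub>R s i)"
  "a \<odot>\<^bsub>free_module R n\<^esub> r = (\<lambda>i. r i \<otimes>\<^sub>R a)"
  by (auto simp: free_module_def)

lemma free_module_sub: "(free_module R n) \<down> carrier (free_module R m) = free_module R m"
  by (simp add: free_module_def)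

context ring
begin

lemma right_module_free: "right_module R (free_module R n)"
proof (intro right_module.intro right_module_axioms.intro)
  show "abelian_group (free_module R n)"
  proof (rule abelian_groupI)
    fix r assume "r \<in> carrier (free_module R n)"
    then show "\<exists>s\<in>carrier (free_module R n). s \<oplus>\<^bsub>free_module R n\<^esub> r = \<zero>\<^bsub>free_module R n\<^esub>"
      by (intro bexI[of _ "\<lambda>i. \<ominus> r i"]) (simp_all add: l_neg)
  qed (simp_all add: a_ac)
qed (simp_all add: ring_axioms l_distr r_distr m_assoc)

lemma lin_coord: "lin R (free_module R n) (regular R) (\<lambda>r. r i)"
  by (rule linI[OF right_module_free right_module_regular]) simp_all

lemma ker_coord: "ker (free_module R (Suc n)) (regular R) (\<lambda>r. r n) = carrier (free_module R n)"
  by (auto simp: ker_def le_Suc_eq) (metis not_less_eq_eq le_antisym)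

lemma lin_drop: "lin R (free_module R (Suc n)) (free_module R n) (\<lambda>r. r(n := \<zero>))"
  by (rule linI[OF right_module_free right_module_free]) (auto simp: fun_eq_iff le_Suc_eq)

lemma lin_free_incl: "lin R (free_module R n) (free_module R (Suc n)) (\<lambda>r. r)"
  by (rule linI[OF right_module_free right_module_free]) simp_all

lemma lin_unit: "lin R (regular R) (free_module R (Suc n)) (\<lambda>a. (\<lambda>_. \<zero>)(n := a))"
  by (rule linI[OF right_module_regular right_module_free]) (auto simp: fun_eq_iff)

lemma flen_free:
  assumes "flen R (regular R)"
  shows "flen R (free_module R n)"
proof (induction n)
  case 0
  have "carrier (free_module R 0) = {\<zero>\<^bsub>free_module R 0\<^esub>}" by auto
  then show ?case by (rule right_module.len_zero[OF right_module_free])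
next
  case (Suc n)
  interpret c: lin R "free_module R (Suc n)" "regular R" "\<lambda>r. r n" by (rule lin_coord)
  have "(\<lambda>r. r n) ` carrier (free_module R (Suc n)) = carrier (regular R)"
  proof
    show "carrier (regular R) \<subseteq> (\<lambda>r. r n) ` carrier (free_module R (Suc n))"
      by (auto intro!: image_eqI[of _ "\<lambda>r. r n" "(\<lambda>_. \<zero>)(n := x)" for x])
  qed auto
  from c.flen_ker_image[OF this] show ?case using Suc assms by (simp add: ker_coord free_module_sub)
qed

end

lemma (in right_module) lin_cyclic:
  assumes "x \<in> carrier M"
  shows "lin R (regular R) M (\<lambda>a. a \<odot>\<^sub>M x)"
  using assms by (intro linI R.right_module_regular) (simp_all add: smult_l_distr smult_assoc right_module_axioms)

lemma (in right_module) free_cover_finite: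
  assumes "finite S" "S \<subseteq> carrier M"
  shows "\<exists>n \<phi>. lin R (free_module R n) M \<phi> \<and> S \<subseteq> \<phi> ` carrier (free_module R n)"
  using assms
proof induction
  case empty
  show ?case using lin_zero[OF R.right_module_free right_module_axioms] by blast
next
  case (insert x S)
  then obtain n \<phi> where \<phi>: "lin R (free_module R n) M \<phi>" "S \<subseteq> \<phi> ` carrier (free_module R n)" by auto
  interpret \<phi>: lin R "free_module R n" M \<phi> by fact
  have x: "x \<in> carrier M" using insert by simp
  let ?\<psi> = "\<lambda>r. \<phi> (r(n := \<zero>\<^sub>R)) \<oplus>\<^sub>M r n \<odot>\<^sub>M x"
  have l: "lin R (free_module R (Suc n)) M ?\<psi>"
    by (intro lin_add_map lin_comp[OF R.lin_drop \<phi>(1)] lin_comp[OF R.lin_coord lin_cyclic[OF x]])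
  have 1: "\<phi> ` carrier (free_module R n) \<subseteq> ?\<psi> ` carrier (free_module R (Suc n))"
  proof
    fix y assume "y \<in> \<phi> ` carrier (free_module R n)"
    then obtain r where r: "r \<in> carrier (free_module R n)" "y = \<phi> r" by blast
    then have "r(n := \<zero>\<^sub>R) = r" "r n = \<zero>\<^sub>R" by auto
    then have "?\<psi> r = y" using r \<phi>.closed[OF r(1)] x by simp
    then show "y \<in> ?\<psi> ` carrier (free_module R (Suc n))" using r by (intro image_eqI[of _ _ r]) auto
  qed
  have "?\<psi> ((\<lambda>_. \<zero>\<^sub>R)(n := \<one>\<^sub>R)) = x" using \<phi>.zero x by (simp add: fun_upd_idem)
  then have "x \<in> ?\<psi> ` carrier (free_module R (Suc n))"
    by (intro image_eqI[of _ _ "(\<lambda>_. \<zero>\<^sub>R)(n := \<one>\<^sub>R)"]) auto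
  then show ?case using l 1 \<phi>(2) by (intro exI[of _ "Suc n"] exI[of _ ?\<psi>]) auto
qed

lemma fg_modD: "fg_mod R M \<Longrightarrow> right_module R M" by (simp add: fg_mod_def)

lemma fg_free_cover:
  assumes "fg_mod R M"
  shows "\<exists>n \<phi>. lin R (free_module R n) M \<phi> \<and> \<phi> ` carrier (free_module R n) = carrier M"
proof -
  interpret M: right_module R M using fg_modD[OF assms] .
  obtain S where S: "finite S" "S \<subseteq> carrier M" "\<And>N. submodule N R M \<Longrightarrow> S \<subseteq> N \<Longrightarrow> N = carrier M"
    using assms unfolding fg_mod_def fin_gen_def by blast
  obtain n \<phi> where \<phi>: "lin R (free_module R n) M \<phi>" "S \<subseteq> \<phi> ` carrier (free_module R n)"
    using M.free_cover_finite[OF S(1,2)] by blast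
  then show ?thesis using S(3)[OF lin.submodule_range[OF \<phi>(1)]] by blast
qed

lemma fg_image:
  assumes "lin R M N f" "f ` carrier M = carrier N" "fg_mod R M"
  shows "fg_mod R N"
proof -
  interpret f: lin R M N f by fact
  obtain S where S: "finite S" "S \<subseteq> carrier M" "\<And>N. submodule N R M \<Longrightarrow> S \<subseteq> N \<Longrightarrow> N = carrier M"
    using assms(3) unfolding fg_mod_def fin_gen_def by blast
  have "H = carrier N" if H: "submodule H R N" "f ` S \<subseteq> H" for H
  proof -
    have "{x \<in> carrier M. f x \<in> H} = carrier M" using S(2) H by (intro S(3) f.submodule_vimage) auto
    then show ?thesis using submoduleD(1)[OF H(1)] by (auto simp: assms(2)[symmetric])
  qed
  then have "fin_gen R N" unfolding fin_gen_def using S(1,2)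
    by (intro exI[of _ "f ` S"]) (auto simp: image_subset_iff)
  then show ?thesis by (simp add: fg_mod_def f.cod_mod)
qed

text \<open>The working form of a right Artinian ring. Finitely generated and of finite length then
  mean the same, so submodules of finitely generated modules are finitely generated. It is
  instantiated by \<open>K\<close>, \<open>A\<close> and the endomorphism algebra.\<close>

locale finlen_ring = ring R for R :: "('a, 'r) ring_scheme" (structure) +
  assumes flen_regular: "flen R (regular R)"
begin

lemma fg_iff_flen: "fg_mod R M \<longleftrightarrow> right_module R M \<and> flen R M"
proof
  assume M: "fg_mod R M"
  obtain n \<phi> where \<phi>: "lin R (free_module R n) M \<phi>" "\<phi> ` carrier (free_module R n) = carrier M"
    using fg_free_cover[OF M] by blast
  then show "right_module R M \<and> flen R M"
    using lin.flen_ker_image[OF \<phi>] flen_free[OF flen_regular] fg_modD[OF M] by blast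
qed (simp add: fg_mod_def right_module.fin_gen_of_flen)

lemma fg_flen: "fg_mod R M \<Longrightarrow> flen R M" by (simp add: fg_iff_flen)

lemma fg_sub: "\<lbrakk>fg_mod R M; submodule N R M\<rbrakk> \<Longrightarrow> fg_mod R (M \<down> N)"
  by (simp add: fg_iff_flen right_module.right_module_sub right_module.flen_sub)

lemma fg_regular: "fg_mod R (regular R)" by (simp add: fg_iff_flen right_module_regular flen_regular)

lemma fg_free: "fg_mod R (free_module R n)"
  by (simp add: fg_iff_flen right_module_free flen_free flen_regular)

end

text \<open>A quotient by \<open>N\<close>, realised on the image of any map \<open>\<phi>\<close> whose fibres are the cosets of \<open>N\<close>.\<close>

lemma (in right_module) quotient_along:
  fixes \<phi> :: "_ \<Rightarrow> 'c"
  assumes N: "submodule N R M"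
    and \<phi>: "\<And>x y. \<lbrakk>x \<in> carrier M; y \<in> carrier M\<rbrakk> \<Longrightarrow> \<phi> x = \<phi> y \<longleftrightarrow> x \<ominus>\<^sub>M y \<in> N"
  shows "\<exists>Q :: ('a, 'c) module. lin R M Q \<phi> \<and> \<phi> ` carrier M = carrier Q \<and> ker M Q \<phi> = N"
proof -
  note N' = submoduleD[OF N]
  define r where "r = inv_into (carrier M) \<phi>"
  \<comment> \<open>All operations are computed on representatives \<open>r u\<close>; they are well
    defined because the fibres of \<open>\<phi>\<close> are exactly the cosets of
    \<open>N\<close>.\<close>
  define Q :: "('a, 'c) module" where "Q = \<lparr>carrier = \<phi> ` carrier M, monoid.mult = undefined,
    one = undefined, ring.zero = \<phi> \<zero>\<^sub>M, ring.add = (\<lambda>u v. \<phi> (r u \<oplus>\<^sub>M r v)),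
    smult = (\<lambda>a u. \<phi> (a \<odot>\<^sub>M r u))\<rparr>"
  have r: "r (\<phi> x) \<in> carrier M" "r (\<phi> x) \<ominus>\<^sub>M x \<in> N" if x: "x \<in> carrier M" for x
  proof -
    show "r (\<phi> x) \<in> carrier M" unfolding r_def using x by (simp add: inv_into_into)
    moreover have "\<phi> (r (\<phi> x)) = \<phi> x" unfolding r_def using x by (simp add: f_inv_into_f)
    ultimately show "r (\<phi> x) \<ominus>\<^sub>M x \<in> N" using \<phi> x by simp
  qed
  have add: "\<phi> x \<oplus>\<^sub>Q \<phi> y = \<phi> (x \<oplus>\<^sub>M y)" if xy: "x \<in> carrier M" "y \<in> carrier M" for x y
  proof -
    have "(r (\<phi> x) \<ominus>\<^sub>M x) \<oplus>\<^sub>M (r (\<phi> y) \<ominus>\<^sub>M y) \<in> N" using r xy N'(4) by simp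
    then have "(r (\<phi> x) \<oplus>\<^sub>M r (\<phi> y)) \<ominus>\<^sub>M (x \<oplus>\<^sub>M y) \<in> N" using r xy by (simp add: M.add_diff_add)
    then show ?thesis using \<phi> r xy by (simp add: Q_def)
  qed
  have sm: "a \<odot>\<^sub>Q \<phi> x = \<phi> (a \<odot>\<^sub>M x)" if ax: "a \<in> carrier R" "x \<in> carrier M" for a x
  proof -
    have "a \<odot>\<^sub>M (r (\<phi> x) \<ominus>\<^sub>M x) \<in> N" using r ax N'(5) by simp
    then show ?thesis using \<phi> r ax by (simp add: Q_def smult_r_diff)
  qed
  have z: "\<zero>\<^sub>Q = \<phi> \<zero>\<^sub>M" and c: "carrier Q = \<phi> ` carrier M" by (simp_all add: Q_def)
  have "right_module R Q"
  proof (intro right_module.intro right_module_axioms.intro R_ring abelian_groupI; unfold c z; (elim imageE)?)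
    fix u x assume "u = \<phi> x" "x \<in> carrier M"
    then show "\<exists>y\<in>\<phi> ` carrier M. y \<oplus>\<^sub>Q u = \<phi> \<zero>\<^sub>M"
      by (intro bexI[of _ "\<phi> (\<ominus>\<^sub>M x)"]) (simp_all add: add M.l_neg)
  qed (simp_all add: add sm smult_l_distr smult_r_distr smult_assoc M.a_assoc, simp_all add: M.a_comm)
  then have "lin R M Q \<phi>" by (intro linI right_module_axioms) (simp_all add: add sm c)
  moreover have "ker M Q \<phi> = N"
  proof -
    have "x \<ominus>\<^sub>M \<zero>\<^sub>M = x" if "x \<in> carrier M" for x
      using that M.add.inv_one M.r_zero by (simp add: a_minus_def)
    then have "\<phi> x = \<phi> \<zero>\<^sub>M \<longleftrightarrow> x \<in> N" if "x \<in> carrier M" for x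
      using that \<phi>[OF that M.zero_closed] by simp
    then show ?thesis using N'(3) by (auto simp: ker_def z)
  qed
  ultimately show ?thesis using c by blast
qed

text \<open>The quotient has to live in the type of \<open>std_module\<close>. Its elements are
  coded as singletons \<open>{v}\<close>, where a free cover of \<open>M\<close> sends the
  coefficient vector \<open>v\<close> to a chosen representative of the coset.\<close>

lemma std_quotient:
  fixes M :: "('a, 'm) module"
  assumes M: "fg_mod R M" and N: "submodule N R M"
  shows "\<exists>(Q :: 'a std_module) q. fg_mod R Q \<and> lin R M Q q \<and> q ` carrier M = carrier Q \<and> ker M Q q = N"
proof -
  interpret M: right_module R M using fg_modD[OF M] .
  obtain n \<pi> where \<pi>: "lin R (free_module R n) M \<pi>" "\<pi> ` carrier (free_module R n) = carrier M"
    using fg_free_cover[OF M] by blast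
  define \<rho> where "\<rho> x = (SOME y. y \<in> carrier M \<and> x \<ominus>\<^sub>M y \<in> N)" for x
  have eqv: "x \<ominus>\<^sub>M y \<in> N \<Longrightarrow> y \<ominus>\<^sub>M z \<in> N \<Longrightarrow> x \<ominus>\<^sub>M z \<in> N"
    if "x \<in> carrier M" "y \<in> carrier M" "z \<in> carrier M" for x y z
  proof -
    assume a: "x \<ominus>\<^sub>M y \<in> N" "y \<ominus>\<^sub>M z \<in> N"
    have "(x \<ominus>\<^sub>M y) \<oplus>\<^sub>M (y \<ominus>\<^sub>M z) = x \<ominus>\<^sub>M z"
      using that by (simp add: a_minus_def M.M.a_assoc M.M.r_neg1)
    then show ?thesis using submoduleD(4)[OF N a] by simp
  qed
  have eqv_sym: "y \<ominus>\<^sub>M x \<in> N" if "x \<in> carrier M" "y \<in> carrier M" "x \<ominus>\<^sub>M y \<in> N" for x y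
  proof -
    have "\<ominus>\<^sub>M (x \<ominus>\<^sub>M y) = y \<ominus>\<^sub>M x" using that by (simp add: a_minus_def M.M.minus_add M.M.a_comm)
    then show ?thesis using submodule_minus[OF N that(3)] by simp
  qed
  have \<rho>: "\<rho> x \<in> carrier M \<and> x \<ominus>\<^sub>M \<rho> x \<in> N" if "x \<in> carrier M" for x
  proof -
    have "\<exists>y. y \<in> carrier M \<and> x \<ominus>\<^sub>M y \<in> N"
      using that submoduleD(2)[OF N] by (intro exI[of _ x]) simp
    then show ?thesis unfolding \<rho>_def by (rule someI_ex)
  qed
  have \<rho>_eq: "\<rho> x = \<rho> y \<longleftrightarrow> x \<ominus>\<^sub>M y \<in> N" if xy: "x \<in> carrier M" "y \<in> carrier M" for x y
  proof
    assume "\<rho> x = \<rho> y"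
    then show "x \<ominus>\<^sub>M y \<in> N" using \<rho> xy eqv eqv_sym by metis
  next
    assume xyN: "x \<ominus>\<^sub>M y \<in> N"
    \<comment> \<open>Elements of one coset give the same predicate, hence the same choice of
      representative.\<close>
    have "(\<lambda>z. z \<in> carrier M \<and> x \<ominus>\<^sub>M z \<in> N) = (\<lambda>z. z \<in> carrier M \<and> y \<ominus>\<^sub>M z \<in> N)"
      using eqv eqv_sym xy xyN by (intro ext) metis
    then show "\<rho> x = \<rho> y" unfolding \<rho>_def by simp
  qed
  define \<phi> :: "'m \<Rightarrow> (nat \<Rightarrow> 'a) set" where
    "\<phi> x = {inv_into (carrier (free_module R n)) \<pi> (\<rho> x)}" for x
  have "inv_into (carrier (free_module R n)) \<pi> x = inv_into (carrier (free_module R n)) \<pi> y \<longleftrightarrow> x = y"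
    if "x \<in> carrier M" "y \<in> carrier M" for x y
    using that \<pi>(2) by (metis f_inv_into_f)
  then have "\<phi> x = \<phi> y \<longleftrightarrow> x \<ominus>\<^sub>M y \<in> N" if "x \<in> carrier M" "y \<in> carrier M" for x y
    unfolding \<phi>_def using \<rho>_eq \<rho> that by simp
  from M.quotient_along[OF N this] obtain Q :: "'a std_module"
    where Q: "lin R M Q \<phi>" "\<phi> ` carrier M = carrier Q" "ker M Q \<phi> = N" by blast
  then show ?thesis using fg_image[OF Q(1,2) M] by blast
qed

lemma std_copy:
  fixes M :: "('a, 'm) module"
  assumes M: "fg_mod R M"
  shows "\<exists>(Q :: 'a std_module) i p. fg_mod R Q \<and> lin R Q M i \<and> lin R M Q p \<and>
    (\<forall>x\<in>carrier M. i (p x) = x) \<and> (\<forall>y\<in>carrier Q. p (i y) = y)"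
proof -
  interpret M: right_module R M using fg_modD[OF M] .
  obtain Q :: "'a std_module" and q where Q: "fg_mod R Q" "lin R M Q q" "q ` carrier M = carrier Q"
    "ker M Q q = {\<zero>\<^sub>M}" using std_quotient[OF M M.submodule_zero] by blast
  interpret q: lin R M Q q by fact
  have b: "bij_betw q (carrier M) (carrier Q)" using Q q.inj_iff_ker by (simp add: bij_betw_def)
  show ?thesis
    using Q(1,2) q.inv_into_lin[OF b] b
    by (intro exI[of _ Q] exI[of _ "inv_into (carrier M) q"] exI[of _ q])
      (simp add: bij_betw_def inv_into_f_f f_inv_into_f)
qed

section \<open>Biproducts and projective modules\<close>

text \<open>A direct sum is recorded by its four maps, because it occurs on several carriers: as a
  product, as an isomorphic \<open>std_module\<close>, as a free module of one rank more, and as a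
  module with two complementary submodules.\<close>

definition biprod ::
  "('a, 'r) ring_scheme \<Rightarrow> ('a, 'm) module \<Rightarrow> ('a, 'n) module \<Rightarrow> ('a, 's) module \<Rightarrow>
   ('m \<Rightarrow> 's) \<Rightarrow> ('n \<Rightarrow> 's) \<Rightarrow> ('s \<Rightarrow> 'm) \<Rightarrow> ('s \<Rightarrow> 'n) \<Rightarrow> bool" where
  "biprod R M N S i j p q \<longleftrightarrow> lin R M S i \<and> lin R N S j \<and> lin R S M p \<and> lin R S N q \<and>
     (\<forall>x\<in>carrier M. p (i x) = x \<and> q (i x) = \<zero>\<^sub>N) \<and>
     (\<forall>y\<in>carrier N. q (j y) = y \<and> p (j y) = \<zero>\<^sub>M) \<and>
     (\<forall>s\<in>carrier S. i (p s) \<oplus>\<^sub>S j (q s) = s)"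

lemma biprodD:
  assumes "biprod R M N S i j p q"
  shows "lin R M S i" "lin R N S j" "lin R S M p" "lin R S N q"
    "\<And>x. x \<in> carrier M \<Longrightarrow> p (i x) = x" "\<And>x. x \<in> carrier M \<Longrightarrow> q (i x) = \<zero>\<^sub>N"
    "\<And>y. y \<in> carrier N \<Longrightarrow> q (j y) = y" "\<And>y. y \<in> carrier N \<Longrightarrow> p (j y) = \<zero>\<^sub>M"
    "\<And>s. s \<in> carrier S \<Longrightarrow> i (p s) \<oplus>\<^sub>S j (q s) = s"
  using assms by (auto simp: biprod_def)

lemma biprod_copy:
  assumes "biprod R M N S i j p q" "lin R S Q k" "lin R Q S l"
    "\<And>s. s \<in> carrier S \<Longrightarrow> l (k s) = s" "\<And>x. x \<in> carrier Q \<Longrightarrow> k (l x) = x"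
  shows "biprod R M N Q (\<lambda>x. k (i x)) (\<lambda>y. k (j y)) (\<lambda>x. p (l x)) (\<lambda>x. q (l x))"
proof -
  note b = biprodD[OF assms(1)]
  interpret k: lin R S Q k by fact
  interpret l: lin R Q S l by fact
  have "k (i (p (l x))) \<oplus>\<^sub>Q k (j (q (l x))) = x" if "x \<in> carrier Q" for x
    using k.add[of "i (p (l x))" "j (q (l x))"] that b(9)[of "l x"] assms(5)
      lin.closed[OF b(1)] lin.closed[OF b(2)] lin.closed[OF b(3)] lin.closed[OF b(4)] by simp
  then show ?thesis
    unfolding biprod_def using assms(2,3,4) b lin.closed[OF b(1)] lin.closed[OF b(2)]
    by (simp add: lin_comp[OF b(1) assms(2)] lin_comp[OF b(2) assms(2)]
        lin_comp[OF assms(3) b(3)] lin_comp[OF assms(3) b(4)])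
qed

definition product_module :: "('a, 'm) module \<Rightarrow> ('a, 'n) module \<Rightarrow> ('a, 'm \<times> 'n) module" where
  "product_module M N = \<lparr>carrier = carrier M \<times> carrier N, monoid.mult = undefined, one = undefined,
     ring.zero = (\<zero>\<^sub>M, \<zero>\<^sub>N), ring.add = (\<lambda>(x, y) (x', y'). (x \<oplus>\<^sub>M x', y \<oplus>\<^sub>N y')),
     smult = (\<lambda>a (x, y). (a \<odot>\<^sub>M x, a \<odot>\<^sub>N y))\<rparr>"

lemma product_module_simps [simp]:
  "carrier (product_module M N) = carrier M \<times> carrier N"
  "\<zero>\<^bsub>product_module M N\<^esub> = (\<zero>\<^sub>M, \<zero>\<^sub>N)"
  "(x, y) \<oplus>\<^bsub>product_module M N\<^esub> (x', y') = (x \<oplus>\<^sub>M x', y \<oplus>\<^sub>N y')"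
  "a \<odot>\<^bsub>product_module M N\<^esub> (x, y) = (a \<odot>\<^sub>M x, a \<odot>\<^sub>N y)"
  by (simp_all add: product_module_def)

lemma biprod_product:
  assumes "right_module R M" "right_module R N"
  shows "biprod R M N (product_module M N) (\<lambda>x. (x, \<zero>\<^sub>N)) (\<lambda>y. (\<zero>\<^sub>M, y)) fst snd"
proof -
  interpret M: right_module R M by fact
  interpret N: right_module R N by fact
  have P: "right_module R (product_module M N)"
  proof (intro right_module.intro right_module_axioms.intro M.R_ring abelian_groupI)
    fix x assume "x \<in> carrier (product_module M N)"
    then show "\<exists>y\<in>carrier (product_module M N). y \<oplus>\<^bsub>product_module M N\<^esub> x = \<zero>\<^bsub>product_module M N\<^esub>"
      by (intro bexI[of _ "(\<ominus>\<^sub>M fst x, \<ominus>\<^sub>N snd x)"]) (auto simp: M.M.l_neg N.M.l_neg)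
  qed (auto simp: M.smult_l_distr M.smult_r_distr M.smult_assoc
      N.smult_l_distr N.smult_r_distr N.smult_assoc M.M.a_ac N.M.a_ac)
  show ?thesis
    unfolding biprod_def using assms P by (intro conjI linI) auto
qed

lemma (in ring) biprod_free:
  "biprod R (free_module R n) (regular R) (free_module R (Suc n)) (\<lambda>r. r) (\<lambda>a. (\<lambda>_. \<zero>)(n := a))
     (\<lambda>r. r(n := \<zero>)) (\<lambda>r. r n)"
proof -
  have "(\<lambda>_. \<zero>)(n := a) \<in> carrier (free_module R (Suc n))" if "a \<in> carrier R" for a using that by auto
  then show ?thesis
    unfolding biprod_def using lin_free_incl lin_unit lin_drop lin_coord by (auto simp: fun_eq_iff)
qed

context finlen_ring
begin

lemma fg_biprod:
  assumes b: "biprod R M N S i j p q" and fg: "fg_mod R M" "fg_mod R N"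
  shows "fg_mod R S"
proof -
  note b' = biprodD[OF b]
  interpret i: lin R M S i by fact
  interpret q: lin R S N q by fact
  have s: "q ` carrier S = carrier N"
  proof
    show "carrier N \<subseteq> q ` carrier S"
      using b'(7) lin.closed[OF b'(2)] by (intro subsetI, metis imageI)
  qed auto
  have k: "ker S N q = i ` carrier M"
  proof
    show "ker S N q \<subseteq> i ` carrier M"
    proof
      fix x assume "x \<in> ker S N q"
      then have x: "x \<in> carrier S" "q x = \<zero>\<^sub>N" by (auto simp: ker_def)
      then have "i (p x) = x" using b'(9)[of x] lin.zero[OF b'(2)] lin.closed[OF b'(3)] by simp
      then show "x \<in> i ` carrier M" using lin.closed[OF b'(3) x(1)] by (metis imageI)
    qed
  qed (use b'(6) in \<open>auto simp: ker_def\<close>)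
  interpret k: lin R M "S \<down> ker S N q" i
    by (rule i.restrict_codomain[OF q.submodule_ker]) (simp add: k)
  have "bij_betw i (carrier M) (carrier (S \<down> ker S N q))"
    using inj_on_inverseI[of "carrier M" p i] b'(5) k by (simp add: bij_betw_def)
  then have "flen R (S \<down> ker S N q)" using k.len_bij(1) fg_flen[OF fg(1)] by blast
  then show ?thesis using q.flen_ker_image[OF s] fg_flen[OF fg(2)] q.dom_mod by (simp add: fg_iff_flen)
qed

lemma ex_biprod:
  fixes M :: "('a, 'm) module" and N :: "('a, 'n) module"
  assumes fg: "fg_mod R M" "fg_mod R N"
  shows "\<exists>(S :: 'a std_module) i j p q. fg_mod R S \<and> biprod R M N S i j p q"
proof -
  note b = biprod_product[OF fg_modD[OF fg(1)] fg_modD[OF fg(2)]]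
  obtain Q :: "'a std_module" and k l where Q: "fg_mod R Q" "lin R Q (product_module M N) k"
    "lin R (product_module M N) Q l" "\<forall>x\<in>carrier (product_module M N). k (l x) = x"
    "\<forall>y\<in>carrier Q. l (k y) = y"
    using std_copy[OF fg_biprod[OF b fg]] by blast
  have "biprod R M N Q (\<lambda>x. l (x, \<zero>\<^sub>N)) (\<lambda>y. l (\<zero>\<^sub>M, y)) (\<lambda>x. fst (k x)) (\<lambda>x. snd (k x))"
    using Q by (intro biprod_copy[OF b]) auto
  then show ?thesis using Q(1) by blast
qed

end

abbreviation lifting_problem :: "('a, 'r) ring_scheme \<Rightarrow> ('a, 'p) module \<Rightarrow> ('a, 'm) module \<Rightarrow> ('a, 'n) module \<Rightarrow>
    ('m \<Rightarrow> 'n) \<Rightarrow> ('p \<Rightarrow> 'n) \<Rightarrow> bool" where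
  "lifting_problem R P M N g f \<equiv> fg_mod R M \<and> fg_mod R N \<and> lin R M N g \<and> g ` carrier M = carrier N \<and> lin R P N f"

text \<open>\<open>projective\<close> is confined to \<open>std_module\<close>. The bare lifting
  property makes sense for a \<open>P\<close> of any type, in particular for free modules and
  principal right ideals.\<close>

definition lifts :: "('a, 'r) ring_scheme \<Rightarrow> ('a, 'm) module \<Rightarrow> bool" where
  "lifts R P \<longleftrightarrow> (\<forall>(M :: 'a std_module) (N :: 'a std_module) g f.
     lifting_problem R P M N g f \<longrightarrow> lifts_along R P M g f)"

lemma projective_iff: "projective R P \<longleftrightarrow> fg_mod R P \<and> lifts R P"
proof
  assume P: "projective R P"
  then have fg: "fg_mod R P" by (simp add: projective_def)
  have "lifts_along R P M g f"
    if MN: "fg_mod R M" "fg_mod R N" "lin R M N g" "g ` carrier M = carrier N" "lin R P N f"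
    for M N :: "'a std_module" and g f
  proof -
    have "restrict g (carrier M) ` carrier M = carrier N" using MN(4) by auto
    then obtain h where h: "h \<in> rhom R P M"
      "restrict f (carrier P) = compose (carrier P) (restrict g (carrier M)) h"
      using P MN(1,2) lin.in_rhom[OF MN(3)] lin.in_rhom[OF MN(5)] unfolding projective_def by meson
    have "g (h x) = f x" if x: "x \<in> carrier P" for x
      using fun_cong[OF h(2), of x] x rhom_closed[OF h(1) x] by (simp add: compose_def)
    then show ?thesis using rhom_lin[OF fg_modD[OF fg] fg_modD[OF MN(1)] h(1)] by blast
  qed
  then show "fg_mod R P \<and> lifts R P" using fg unfolding lifts_def by meson
next
  assume P: "fg_mod R P \<and> lifts R P"
  have "\<exists>h\<in>rhom R P M. f = compose (carrier P) g h"
    if MN: "fg_mod R M \<and> fg_mod R N" and g: "g \<in> rhom R M N" and f: "f \<in> rhom R P N"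
      and s: "g ` carrier M = carrier N" for M N :: "'a std_module" and g f
  proof -
    have m: "right_module R M" "right_module R N" "right_module R P" using MN P fg_modD by blast+
    obtain h where h: "lin R P M h" "\<forall>x\<in>carrier P. g (h x) = f x"
      using P MN rhom_lin[OF m(1,2) g] rhom_lin[OF m(3,2) f] s unfolding lifts_def by meson
    have "f = compose (carrier P) g (restrict h (carrier P))"
    proof
      fix x show "f x = compose (carrier P) g (restrict h (carrier P)) x"
        using h(2) f by (cases "x \<in> carrier P") (auto simp: compose_def rhom_def PiE_def extensional_def)
    qed
    then show ?thesis using lin.in_rhom[OF h(1)] by blast
  qed
  then show "projective R P" unfolding projective_def using P by meson
qed

lemma projective_fg: "projective R P \<Longrightarrow> fg_mod R P" by (simp add: projective_iff)

text \<open>The definition tests surjections between standard modules only; other surjections are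
  conjugated with the isomorphisms of \<open>std_copy\<close>.\<close>

lemma lifts_gen:
  fixes M :: "('a, 'm) module" and N :: "('a, 'n) module"
  assumes P: "lifts R P" and M: "fg_mod R M" and g: "lin R M N g" "g ` carrier M = carrier N"
    and f: "lin R P N f"
  shows "lifts_along R P M g f"
proof -
  note N = fg_image[OF g M]
  obtain M' :: "'a std_module" and i p where M': "fg_mod R M'" "lin R M' M i" "lin R M M' p"
    "\<forall>x\<in>carrier M. i (p x) = x" "\<forall>y\<in>carrier M'. p (i y) = y" using std_copy[OF M] by blast
  obtain N' :: "'a std_module" and j q where N': "fg_mod R N'" "lin R N' N j" "lin R N N' q"
    "\<forall>x\<in>carrier N. j (q x) = x" "\<forall>y\<in>carrier N'. q (j y) = y" using std_copy[OF N] by blast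
  have l: "lin R M' N' (\<lambda>x. q (g (i x)))" by (intro lin_comp[OF M'(2)] lin_comp[OF g(1)] N'(3))
  have "(\<lambda>x. q (g (i x))) ` carrier M' = carrier N'"
  proof
    show "(\<lambda>x. q (g (i x))) ` carrier M' \<subseteq> carrier N'" using lin.closed[OF l] by auto
    show "carrier N' \<subseteq> (\<lambda>x. q (g (i x))) ` carrier M'"
    proof
      fix y assume y: "y \<in> carrier N'"
      then have "j y \<in> g ` carrier M" using lin.closed[OF N'(2)] g(2) by simp
      then obtain x where x: "x \<in> carrier M" "j y = g x" by auto
      then have "q (g (i (p x))) = y" using M'(4) N'(5) y by (metis)
      then show "y \<in> (\<lambda>x. q (g (i x))) ` carrier M'" using lin.closed[OF M'(3) x(1)] by (intro image_eqI) auto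
    qed
  qed
  then obtain h where h: "lin R P M' h" "\<forall>x\<in>carrier P. q (g (i (h x))) = q (f x)"
    using P M'(1) N'(1) l lin_comp[OF f N'(3)] unfolding lifts_def by meson
  have "g (i (h x)) = f x" if x: "x \<in> carrier P" for x
    using h(2) N'(4) x lin.closed[OF f x] lin.closed[OF g(1) lin.closed[OF M'(2) lin.closed[OF h(1) x]]]
    by metis
  then show ?thesis using lin_comp[OF h(1) M'(2)] by (intro exI[of _ "\<lambda>x. i (h x)"]) auto
qed

lemmas projective_lift = lifts_gen[OF projective_iff[THEN iffD1, THEN conjunct2]]

lemma lifts_retract:
  assumes "lifts R S" "lin R P S i" "lin R S P p" "\<And>x. x \<in> carrier P \<Longrightarrow> p (i x) = x"
  shows "lifts R P"
  unfolding lifts_def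
proof (intro allI impI)
  fix M N :: "'a std_module" and g f
  assume a: "lifting_problem R P M N g f"
  then obtain h where h: "lin R S M h" "\<forall>x\<in>carrier S. g (h x) = f (p x)"
    using assms(1) lin_comp[OF assms(3), of N f] unfolding lifts_def by meson
  then show "lifts_along R P M g f"
    using lin_comp[OF assms(2) h(1)] assms(4) lin.closed[OF assms(2)]
    by (intro exI[of _ "\<lambda>x. h (i x)"]) auto
qed

lemma biprod_map:
  assumes b: "biprod R M N S i j p q" and f: "lin R M L f" and g: "lin R N L g"
  shows "lin R S L (\<lambda>s. f (p s) \<oplus>\<^sub>L g (q s))"
    "\<And>x. x \<in> carrier M \<Longrightarrow> f (p (i x)) \<oplus>\<^sub>L g (q (i x)) = f x"
    "\<And>y. y \<in> carrier N \<Longrightarrow> f (p (j y)) \<oplus>\<^sub>L g (q (j y)) = g y"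
proof -
  note b' = biprodD[OF b]
  interpret f: lin R M L f by fact
  interpret g: lin R N L g by fact
  show "lin R S L (\<lambda>s. f (p s) \<oplus>\<^sub>L g (q s))"
    by (intro lin_add_map lin_comp[OF b'(3) f] lin_comp[OF b'(4) g])
  show "\<And>x. x \<in> carrier M \<Longrightarrow> f (p (i x)) \<oplus>\<^sub>L g (q (i x)) = f x" by (simp add: b')
  show "\<And>y. y \<in> carrier N \<Longrightarrow> f (p (j y)) \<oplus>\<^sub>L g (q (j y)) = g y" by (simp add: b')
qed

lemma biprod_ext:
  assumes b: "biprod R M N S i j p q" and f: "lin R S L f" and g: "lin R S L g"
    and "\<And>x. x \<in> carrier M \<Longrightarrow> f (i x) = g (i x)" "\<And>y. y \<in> carrier N \<Longrightarrow> f (j y) = g (j y)"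
    and s: "s \<in> carrier S"
  shows "f s = g s"
proof -
  note b' = biprodD[OF b]
  have c: "p s \<in> carrier M" "q s \<in> carrier N" using lin.closed b' s by fast+
  then have c': "i (p s) \<in> carrier S" "j (q s) \<in> carrier S" using lin.closed b' by fast+
  have "f (i (p s) \<oplus>\<^sub>S j (q s)) = g (i (p s) \<oplus>\<^sub>S j (q s))"
    using lin.add[OF f c'] lin.add[OF g c'] assms(4)[OF c(1)] assms(5)[OF c(2)] by simp
  then show ?thesis using b'(9)[OF s] by simp
qed

lemma lifts_biprod:
  assumes b: "biprod R M' N' S i j p q" and l: "lifts R M'" "lifts R N'"
  shows "lifts R S"
  unfolding lifts_def
proof (intro allI impI)
  fix M N :: "'a std_module" and g f
  assume a: "lifting_problem R S M N g f"
  note b' = biprodD[OF b]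
  obtain h where h: "lin R M' M h" "\<forall>x\<in>carrier M'. g (h x) = f (i x)"
    using l(1) a lin_comp[OF b'(1), of N f] unfolding lifts_def by meson
  obtain k where k: "lin R N' M k" "\<forall>x\<in>carrier N'. g (k x) = f (j x)"
    using l(2) a lin_comp[OF b'(2), of N f] unfolding lifts_def by meson
  note m = biprod_map[OF b h(1) k(1)]
  have "g (h (p s) \<oplus>\<^sub>M k (q s)) = f s" if "s \<in> carrier S" for s
    by (rule biprod_ext[OF b lin_comp[OF m(1)] _ _ _ that]) (use a h(2) k(2) m(2,3) in auto)
  then show "lifts_along R S M g f"
    using m(1) by (intro exI[of _ "\<lambda>s. h (p s) \<oplus>\<^sub>M k (q s)"]) auto
qed

lemma (in ring) lifts_regular: "lifts R (regular R)"
  unfolding lifts_def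
proof (intro allI impI)
  fix M N :: "'a std_module" and g f
  assume a: "lifting_problem R (regular R) M N g f"
  interpret g: lin R M N g using a by simp
  interpret f: lin R "regular R" N f using a by simp
  have "f \<one> \<in> g ` carrier M" using a f.closed[of \<one>] by simp
  then obtain x where x: "x \<in> carrier M" "f \<one> = g x" by auto
  have "g (c \<odot>\<^sub>M x) = f c" if c: "c \<in> carrier R" for c
    using f.smult[of c \<one>] c x g.smult[OF c x(1)] by simp
  then show "lifts_along R (regular R) M g f"
    using g.M.lin_cyclic[OF x(1)] by (intro exI[of _ "\<lambda>c. c \<odot>\<^sub>M x"]) simp
qed

lemma lifts_zero:
  fixes R :: "('a, 'r) ring_scheme" and P :: "('a, 'm) module"
  assumes P: "carrier P = {\<zero>\<^sub>P}" and "right_module R P"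
  shows "lifts R P"
  unfolding lifts_def
proof (intro allI impI)
  fix M N :: "'a std_module" and g f
  assume a: "lifting_problem R P M N g f"
  then have "g \<zero>\<^sub>M = \<zero>\<^sub>N" "f \<zero>\<^sub>P = \<zero>\<^sub>N"
    using lin.zero[of R M N g] lin.zero[of R P N f] by simp_all
  then show "lifts_along R P M g f"
    using lin_zero[OF assms(2), of M] a lin.dom_mod[of R M N g] P by (intro exI[of _ "\<lambda>x. \<zero>\<^sub>M"]) simp
qed

lemma (in ring) lifts_free: "lifts R (free_module R n)"
proof (induction n)
  case 0
  show ?case by (rule lifts_zero[OF _ right_module_free]) auto
next
  case (Suc n)
  show ?case by (rule lifts_biprod[OF biprod_free Suc lifts_regular])
qed

lemma projective_retract:
  assumes "projective R S" "lin R P S i" "lin R S P p" "\<And>x. x \<in> carrier P \<Longrightarrow> p (i x) = x"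
  shows "projective R P"
proof -
  have "p ` carrier S = carrier P"
  proof
    show "carrier P \<subseteq> p ` carrier S" using assms(4) lin.closed[OF assms(2)] by (metis imageI subsetI)
  qed (use lin.closed[OF assms(3)] in auto)
  then show ?thesis
    using fg_image[OF assms(3) _ projective_fg[OF assms(1)]] lifts_retract[OF _ assms(2-4)] assms(1)
    by (simp add: projective_iff)
qed

lemma (in finlen_ring) projective_retract_free:
  assumes P: "projective R P"
  shows "\<exists>n i p. lin R P (free_module R n) i \<and> lin R (free_module R n) P p \<and> (\<forall>x\<in>carrier P. p (i x) = x)"
proof -
  obtain n \<phi> where \<phi>: "lin R (free_module R n) P \<phi>" "\<phi> ` carrier (free_module R n) = carrier P"
    using fg_free_cover[OF projective_fg[OF P]] by blast
  then show ?thesis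
    using projective_lift[OF P fg_free \<phi> lin_id[OF fg_modD[OF projective_fg[OF P]]]] by metis
qed

lemma (in finlen_ring) ex_projective_onto:
  fixes M :: "('a, 'm) module"
  assumes M: "fg_mod R M"
  shows "\<exists>(P :: 'a std_module) p. projective R P \<and> lin R P M p \<and> p ` carrier P = carrier M"
proof -
  obtain n \<phi> where \<phi>: "lin R (free_module R n) M \<phi>" "\<phi> ` carrier (free_module R n) = carrier M"
    using fg_free_cover[OF M] by blast
  obtain P :: "'a std_module" and i p where P: "fg_mod R P" "lin R P (free_module R n) i"
    "lin R (free_module R n) P p" "\<forall>x\<in>carrier (free_module R n). i (p x) = x" "\<forall>y\<in>carrier P. p (i y) = y"
    using std_copy[OF fg_free[of n]] by metis
  have "projective R P"
    using lifts_retract[OF lifts_free P(2,3)] P(1,5) by (simp add: projective_iff)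
  moreover have "(\<lambda>x. \<phi> (i x)) ` carrier P = carrier M"
  proof -
    have "i ` carrier P = carrier (free_module R n)"
    proof
      show "carrier (free_module R n) \<subseteq> i ` carrier P"
        using P(4) lin.closed[OF P(3)] by (metis imageI subsetI)
    qed (use lin.closed[OF P(2)] in auto)
    then show ?thesis using \<phi>(2) by (metis image_image)
  qed
  ultimately show ?thesis using lin_comp[OF P(2) \<phi>(1)] by blast
qed

section \<open>Fitting's lemma\<close>

lemma lin_funpow:
  assumes "lin R M M h"
  shows "lin R M M (h ^^ k)"
proof (induction k)
  case 0
  show ?case using lin_id[OF lin.dom_mod[OF assms]] by (simp add: id_def)
next
  case (Suc k)
  show ?case using lin_comp[OF Suc assms] by (simp add: comp_def)
qed

text \<open>For an exponent that minimises the length of the image, applying the power once more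
  cannot shrink the image; and a surjective endomorphism of a module of finite length is
  injective.\<close>

lemma fitting:
  assumes h: "lin R M M h" and f: "flen R M"
  shows "\<exists>k\<ge>1. (h ^^ k) ` (h ^^ k) ` carrier M = (h ^^ k) ` carrier M \<and> inj_on (h ^^ k) ((h ^^ k) ` carrier M)"
proof -
  interpret h: lin R M M h by fact
  define L where "L k = len R (M \<down> (h ^^ k) ` carrier M)" for k
  obtain k where k: "k \<ge> 1" "\<And>j. j \<ge> 1 \<Longrightarrow> L k \<le> L j"
    using ex_has_least_nat[of "\<lambda>k. k \<ge> 1" 1 L] by auto
  let ?H = "h ^^ k"
  interpret H: lin R M M ?H by (rule lin_funpow[OF h])
  let ?I = "?H ` carrier M"
  note I = H.submodule_range
  interpret I: right_module R "M \<down> ?I" by (rule h.M.right_module_sub[OF I])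
  have sub: "?I \<subseteq> carrier M" using submoduleD(1)[OF I] .
  have fI: "flen R (M \<down> ?I)" by (rule h.M.flen_sub[OF I f])
  have e: "?H ` ?I = (h ^^ (k + k)) ` carrier M" by (simp add: funpow_add image_comp)
  have s: "submodule (?H ` ?I) R (M \<down> ?I)"
    using h.M.submodule_sub_iff[OF I] H.submodule_image[OF I] image_mono[OF sub] by simp
  have "L k \<le> L (k + k)" using k by simp
  then have "\<not> len R (M \<down> ?H ` ?I) < len R (M \<down> ?I)" unfolding L_def e by simp
  then have eq: "?H ` ?I = ?I" using I.len_sub_less[OF s fI] by auto
  interpret r: lin R "M \<down> ?I" "M \<down> ?I" ?H
    using lin.restrict_codomain[OF H.restrict_domain[OF I] I] eq by simp
  have "inj_on ?H ?I" using r.surj_imp_inj[OF fI] eq by simp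
  then show ?thesis using eq k(1) by blast
qed

text \<open>\<open>H\<close> is bijective on its stable image; \<open>r\<close> is \<open>H\<close>
  followed by the inverse of that bijection.\<close>

lemma stable_image_retract:
  assumes H: "lin R M M H" and k: "H ` H ` carrier M = H ` carrier M" "inj_on H (H ` carrier M)"
  shows "\<exists>r. lin R M (M \<down> H ` carrier M) r \<and> (\<forall>x\<in>H ` carrier M. r x = x) \<and>
    (\<forall>x\<in>carrier M. H (r x) = H x) \<and> (\<forall>x\<in>carrier M. H x = \<zero>\<^sub>M \<longrightarrow> r x = \<zero>\<^sub>M)"
proof -
  interpret H: lin R M M H by fact
  let ?I = "H ` carrier M"
  note I = H.submodule_range
  interpret r: lin R "M \<down> ?I" "M \<down> ?I" H
    using lin.restrict_codomain[OF H.restrict_domain[OF I] I] k(1) by simp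
  have b: "bij_betw H (carrier (M \<down> ?I)) (carrier (M \<down> ?I))"
    using k by (simp add: bij_betw_def)
  have l: "lin R M (M \<down> ?I) (\<lambda>x. inv_into ?I H (H x))"
    using lin_comp[OF H.restrict_codomain[OF I] r.inv_into_lin[OF b]] by simp
  have 1: "inv_into ?I H (H x) = x" if "x \<in> ?I" for x
    using that k(2) by (simp add: inv_into_f_f)
  have 2: "H (inv_into ?I H (H x)) = H x" if "x \<in> carrier M" for x
    using that k(1) by (intro f_inv_into_f) simp
  have 3: "inv_into ?I H (H x) = \<zero>\<^sub>M" if "H x = \<zero>\<^sub>M" for x
    using that 1[OF submoduleD(2)[OF I]] by simp
  show ?thesis using l 1 2 3 by (intro exI[of _ "\<lambda>x. inv_into ?I H (H x)"]) simp
qed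

lemma fitting_retract:
  assumes h: "lin R M M h" and f: "flen R M"
  shows "\<exists>k\<ge>1. \<exists>r. lin R M (M \<down> (h ^^ k) ` carrier M) r \<and> (\<forall>x\<in>(h ^^ k) ` carrier M. r x = x) \<and>
    (\<forall>x\<in>carrier M. (h ^^ k) x = \<zero>\<^sub>M \<longrightarrow> r x = \<zero>\<^sub>M)"
proof -
  obtain k where k: "k \<ge> 1" "(h ^^ k) ` (h ^^ k) ` carrier M = (h ^^ k) ` carrier M"
    "inj_on (h ^^ k) ((h ^^ k) ` carrier M)" using fitting[OF h f] by blast
  show ?thesis using stable_image_retract[OF lin_funpow[OF h] k(2,3)] k(1) by metis
qed

text \<open>Powers keep the stable image, so two endomorphisms can be given one common Fitting
  exponent.\<close>

lemma stable_image_power: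
  assumes k: "H ` H ` M = H ` M" "inj_on H (H ` M)"
  shows "(H ^^ Suc m) ` M = H ` M" "(H ^^ Suc m) ` (H ^^ Suc m) ` M = (H ^^ Suc m) ` M"
    "inj_on (H ^^ Suc m) ((H ^^ Suc m) ` M)"
proof -
  have 1: "(H ^^ j) ` H ` M = H ` M \<and> inj_on (H ^^ j) (H ` M)" for j
  proof (induction j)
    case (Suc j)
    have "(H ^^ Suc j) ` H ` M = H ` (H ^^ j) ` H ` M" by (auto simp: image_image)
    then show ?case using Suc k comp_inj_on[of "H ^^ j" "H ` M" H] by (simp add: comp_def)
  qed simp
  have "(H ^^ Suc m) ` M = (H ^^ m) ` H ` M" by (simp add: funpow_swap1 image_image)
  then show e: "(H ^^ Suc m) ` M = H ` M" using 1[of m] by simp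
  show "(H ^^ Suc m) ` (H ^^ Suc m) ` M = (H ^^ Suc m) ` M" "inj_on (H ^^ Suc m) ((H ^^ Suc m) ` M)"
    unfolding e using 1[of "Suc m"] by blast+
qed

text \<open>A projective module of least length among those mapping onto \<open>M\<close> is a
  cover. If a proper submodule \<open>N\<close> already maps onto \<open>M\<close>, then
  \<open>p\<close> lifts to an endomorphism \<open>h\<close> with values in \<open>N\<close>; its
  stable image is a projective summand that still maps onto \<open>M\<close> and is shorter.\<close>

lemma projective_cover_exists:
  fixes M :: "('a, 'm) module"
  assumes R: "finlen_ring R" and M: "fg_mod R M"
  shows "\<exists>P p. projective_cover R M P p"
proof -
  interpret finlen_ring R by fact
  obtain P0 :: "'a std_module" and p0 where P0: "projective R P0" "lin R P0 M p0" "p0 ` carrier P0 = carrier M"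
    using ex_projective_onto[OF M] by blast
  define good where "good l \<longleftrightarrow> (\<exists>(P :: 'a std_module) p. projective R P \<and> lin R P M p \<and> p ` carrier P = carrier M \<and> len R P = l)" for l
  have "good (len R P0)" unfolding good_def using P0 by blast
  then obtain l where l: "good l" "\<And>l'. good l' \<Longrightarrow> l \<le> l'" using LeastI Least_le by metis
  then obtain P :: "'a std_module" and p where P: "projective R P" "lin R P M p" "p ` carrier P = carrier M" "len R P = l"
    unfolding good_def by blast
  interpret p: lin R P M p by fact
  note fgP = projective_fg[OF P(1)] and fP = fg_flen[OF projective_fg[OF P(1)]]
  have "N = carrier P" if N: "submodule N R P" and c: "N <+>\<^sub>P a_kernel P M p = carrier P" for N
  proof (rule ccontr)
    assume ne: "N \<noteq> carrier P"
    note N' = submoduleD[OF N]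
    have "p ` N = carrier M"
    proof
      show "carrier M \<subseteq> p ` N"
      proof
        fix y assume "y \<in> carrier M"
        then have "y \<in> p ` carrier P" using P(3) by simp
        then obtain x where x: "x \<in> carrier P" "y = p x" by auto
        then obtain n k where nk: "n \<in> N" "k \<in> ker P M p" "x = n \<oplus>\<^sub>P k"
          using c p.M.set_add_iff[of x N "ker P M p"] unfolding a_kernel_eq_ker by auto
        then have "p n = y" using x N'(3) by (simp add: ker_iff p.add)
        then show "y \<in> p ` N" using nk(1) by auto
      qed
    qed (use N'(3) in auto)
    then have "lifts_along R P (P \<down> N) p p"
      using projective_lift[OF P(1) fg_sub[OF fgP N] p.restrict_domain[OF N]] P(2) by simp
    then obtain h where h: "lin R P (P \<down> N) h" "\<And>x. x \<in> carrier P \<Longrightarrow> p (h x) = p x" by blast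
    have hN: "h x \<in> N" if "x \<in> carrier P" for x using lin.closed[OF h(1) that] by simp
    have hP: "lin R P P h" using lin_comp[OF h(1) lin_incl[OF p.dom_mod N]] by simp
    obtain k r where k: "k \<ge> 1" and r: "lin R P (P \<down> (h ^^ k) ` carrier P) r"
      "\<And>x. x \<in> (h ^^ k) ` carrier P \<Longrightarrow> r x = x" using fitting_retract[OF hP fP] by metis
    interpret H: lin R P P "h ^^ k" by (rule lin_funpow[OF hP])
    let ?I = "(h ^^ k) ` carrier P"
    note I = H.submodule_range
    have proj: "projective R (P \<down> ?I)"
      using r(2) by (intro projective_retract[OF P(1) lin_incl[OF p.dom_mod I] r(1)]) simp
    have pk: "p ((h ^^ j) x) = p x" if "x \<in> carrier P" for j x
      using that by (induction j) (simp_all add: h(2) lin.closed[OF lin_funpow[OF hP]])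
    have "p ` ?I = carrier M"
      using P(3) pk by (simp add: image_image cong: image_cong_simp)
    then have "good (len R (P \<down> ?I))"
      unfolding good_def using proj p.restrict_domain[OF I] by (intro exI[of _ "P \<down> ?I"] exI[of _ p]) simp
    moreover have IN: "?I \<subseteq> N"
    proof -
      obtain j where j: "k = Suc j" using k by (cases k) auto
      show ?thesis unfolding j using hN lin.closed[OF lin_funpow[OF hP]] by auto
    qed
    then have "?I \<noteq> carrier P" using ne N'(1) by auto
    then have "len R (P \<down> ?I) < len R P" by (rule p.M.len_sub_less[OF I fP])
    ultimately show False using l(2) P(4) by fastforce
  qed
  moreover have "restrict p (carrier P) ` carrier P = carrier M" using P(3) by auto
  moreover have "a_kernel P M (restrict p (carrier P)) = a_kernel P M p"
    by (auto simp: a_kernel_eq_ker ker_def)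
  ultimately have "projective_cover R M P (restrict p (carrier P))"
    unfolding projective_cover_def using P p.in_rhom by simp
  then show ?thesis by blast
qed

lemma proj_cover_obtain:
  fixes M :: "('a, 'm) module"
  assumes R: "finlen_ring R" and M: "fg_mod R M"
  obtains P p where "proj_cover R M = (P, p)" "projective R P" "p \<in> rhom R P M" "lin R P M p"
    "p ` carrier P = carrier M" "syzygy R M = P \<down> ker P M p"
proof -
  obtain P p where Pp: "proj_cover R M = (P, p)" by (cases "proj_cover R M")
  have "\<exists>x. case x of (P, p) \<Rightarrow> projective_cover R M P p" using projective_cover_exists[OF R M] by auto
  from someI_ex[OF this] have "projective_cover R M P p" using Pp by (simp add: proj_cover_def)
  then have P: "projective R P" "p \<in> rhom R P M" "p ` carrier P = carrier M" by (simp_all add: projective_cover_def)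
  then show ?thesis
    using that[OF Pp] rhom_lin[OF fg_modD[OF projective_fg[OF P(1)]] fg_modD[OF M] P(2)]
    by (simp add: syzygy_def Pp a_kernel_eq_ker)
qed

section \<open>Direct summands and endomorphisms of indecomposable modules\<close>

lemma complementary_idempotent:
  assumes e: "lin R M M e" and ee: "\<And>x. x \<in> carrier M \<Longrightarrow> e (e x) = e x"
  shows "complementary R M (e ` carrier M) (ker M M e)"
proof -
  interpret e: lin R M M e by fact
  have "e ` carrier M \<inter> ker M M e = {\<zero>\<^sub>M}"
  proof
    show "{\<zero>\<^sub>M} \<subseteq> e ` carrier M \<inter> ker M M e"
      using submoduleD(2)[OF e.submodule_range] submoduleD(2)[OF e.submodule_ker] by simp
  qed (auto simp: ker_iff ee)
  moreover have "e ` carrier M <+>\<^sub>M ker M M e = carrier M"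
  proof
    show "e ` carrier M <+>\<^sub>M ker M M e \<subseteq> carrier M"
      using submoduleD(1)[OF e.M.submodule_set_add[OF e.submodule_range e.submodule_ker]] .
    show "carrier M \<subseteq> e ` carrier M <+>\<^sub>M ker M M e"
    proof
      fix x assume x: "x \<in> carrier M"
      then have "x \<ominus>\<^sub>M e x \<in> ker M M e" using ee by (simp add: ker_iff e.diff)
      then show "x \<in> e ` carrier M <+>\<^sub>M ker M M e"
        using x by (intro e.M.set_addI[of "e x" _ "x \<ominus>\<^sub>M e x"]) simp_all
    qed
  qed
  ultimately show ?thesis unfolding complementary_def using e.submodule_range e.submodule_ker by simp
qed

lemma complementary_projections:
  assumes M: "right_module R M" and c: "complementary R M N N'"
  shows "\<exists>p q. lin R M (M \<down> N) p \<and> lin R M (M \<down> N') q \<and>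
    biprod R (M \<down> N) (M \<down> N') M (\<lambda>x. x) (\<lambda>x. x) p q"
proof -
  interpret M: right_module R M by fact
  have N: "submodule N R M" "submodule N' R M" "N \<inter> N' = {\<zero>\<^sub>M}" "N <+>\<^sub>M N' = carrier M"
    using c by (simp_all add: complementary_def)
  note b = biprod_product[OF M.right_module_sub[OF N(1)] M.right_module_sub[OF N(2)]]
  let ?S = "product_module (M \<down> N) (M \<down> N')"
  let ?f = "\<lambda>x. fst x \<oplus>\<^sub>M snd x"
  have f: "lin R ?S M ?f"
    using biprod_map(1)[OF b lin_incl[OF M N(1)] lin_incl[OF M N(2)]] by simp
  interpret f: lin R ?S M ?f by (rule f)
  have s: "?f ` carrier ?S = carrier M"
  proof
    show "carrier M \<subseteq> ?f ` carrier ?S"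
    proof
      fix x assume "x \<in> carrier M"
      then obtain n n' where "n \<in> N" "n' \<in> N'" "x = n \<oplus>\<^sub>M n'" using N(4) M.set_add_iff[of x N N'] by auto
      then show "x \<in> ?f ` carrier ?S" by (intro image_eqI[of _ _ "(n, n')"]) simp_all
    qed
    show "?f ` carrier ?S \<subseteq> carrier M" unfolding image_subset_iff using f.closed by simp
  qed
  have i: "inj_on ?f (carrier ?S)"
    unfolding f.inj_iff
  proof (intro ballI impI)
    fix x assume x: "x \<in> carrier ?S" "?f x = \<zero>\<^sub>M"
    obtain n n' where n: "x = (n, n')" by (cases x)
    have nn: "n \<in> N" "n' \<in> N'" "n \<oplus>\<^sub>M n' = \<zero>\<^sub>M" using x n by auto
    note cl = submoduleD(3)[OF N(1) nn(1)] submoduleD(3)[OF N(2) nn(2)]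
    have "n = \<ominus>\<^sub>M n'" using M.M.minus_equality[OF nn(3) cl(2,1)] by simp
    then have "n \<in> N'" using submodule_minus[OF N(2) nn(2)] by simp
    then have "n = \<zero>\<^sub>M" using N(3) nn(1) by auto
    then show "x = \<zero>\<^sub>?S" using n nn(3) cl(2) by simp
  qed
  let ?g = "inv_into (carrier ?S) ?f"
  have bij: "bij_betw ?f (carrier ?S) (carrier M)" using s i by (simp add: bij_betw_def)
  have "biprod R (M \<down> N) (M \<down> N') M (\<lambda>x. ?f (x, \<zero>\<^bsub>M \<down> N'\<^esub>))
      (\<lambda>y. ?f (\<zero>\<^bsub>M \<down> N\<^esub>, y)) (\<lambda>x. fst (?g x)) (\<lambda>x. snd (?g x))"
  proof (rule biprod_copy[OF b f f.inv_into_lin[OF bij]])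
    show "?g (?f x) = x" if "x \<in> carrier ?S" for x by (rule inv_into_f_f[OF i that])
    show "?f (?g x) = x" if "x \<in> carrier M" for x by (rule f_inv_into_f) (simp only: s that)
  qed
  then obtain p q where bp: "biprod R (M \<down> N) (M \<down> N') M
      (\<lambda>x. ?f (x, \<zero>\<^bsub>M \<down> N'\<^esub>)) (\<lambda>y. ?f (\<zero>\<^bsub>M \<down> N\<^esub>, y)) p q" by blast
  note bp' = biprodD[OF bp]
  have c: "p x \<in> carrier M" "q x \<in> carrier M" if "x \<in> carrier M" for x
    using that lin.closed[OF bp'(3)] lin.closed[OF bp'(4)] submoduleD(3)[OF N(1)] submoduleD(3)[OF N(2)] by simp_all
  have b2: "biprod R (M \<down> N) (M \<down> N') M (\<lambda>x. x) (\<lambda>x. x) p q"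
    unfolding biprod_def
    using bp'(3,4) bp'(5-9) lin_incl[OF M N(1)] lin_incl[OF M N(2)]
      submoduleD(3)[OF N(1)] submoduleD(3)[OF N(2)] c by simp
  then show ?thesis using biprodD(3,4)[OF b2] by blast
qed

text \<open>The idempotent \<open>i (p x)\<close> splits \<open>M\<close> into image and kernel. As
  \<open>N\<close> is not zero, the kernel must be.\<close>

lemma indecomposable_retract:
  assumes M: "indecomposable R M" and i: "lin R N M i" and p: "lin R M N p"
    and pi: "\<And>x. x \<in> carrier N \<Longrightarrow> p (i x) = x" and nz: "carrier N \<noteq> {\<zero>\<^sub>N}" and x: "x \<in> carrier M"
  shows "i (p x) = x"
proof -
  interpret i: lin R N M i by fact
  interpret p: lin R M N p by fact
  interpret e: lin R M M "\<lambda>x. i (p x)" by (rule lin_comp[OF p i])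
  have "complementary R M ((\<lambda>x. i (p x)) ` carrier M) (ker M M (\<lambda>x. i (p x)))"
    by (rule complementary_idempotent[OF lin_comp[OF p i]]) (simp add: pi)
  then consider "(\<lambda>x. i (p x)) ` carrier M = {\<zero>\<^sub>M}" | "ker M M (\<lambda>x. i (p x)) = {\<zero>\<^sub>M}"
    using M unfolding indecomposable_def by fastforce
  then show ?thesis
  proof cases
    case 1
    have "y = \<zero>\<^sub>N" if y: "y \<in> carrier N" for y
    proof -
      have "i (p (i y)) \<in> (\<lambda>x. i (p x)) ` carrier M" using y by (intro imageI) simp
      then have "i y = \<zero>\<^sub>M" using 1 pi y by simp
      then show ?thesis using pi[OF y] p.zero by simp
    qed
    then have "carrier N = {\<zero>\<^sub>N}" by (intro equalityI subsetI) simp_all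
    then show ?thesis using nz by simp
  next
    case 2
    have "x \<ominus>\<^sub>M i (p x) \<in> ker M M (\<lambda>x. i (p x))" using x pi by (simp add: ker_iff e.diff)
    then show ?thesis using 2 x by (simp add: i.N.M.diff_eq_zero_iff)
  qed
qed

text \<open>By Fitting's lemma the image of a suitable power is a retract. If it were nonzero, the
  retraction would be the identity of \<open>M\<close>, yet it annihilates what \<open>h\<close>
  annihilates.\<close>

lemma indecomposable_endo:
  assumes M: "indecomposable R M" and f: "flen R M" and h: "lin R M M h" and ni: "\<not> inj_on h (carrier M)"
  shows "\<exists>k. \<forall>x\<in>carrier M. (h ^^ k) x = \<zero>\<^sub>M"
proof -
  interpret h: lin R M M h by fact
  obtain k r where k: "k \<ge> 1" and r: "lin R M (M \<down> (h ^^ k) ` carrier M) r"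
    "\<And>x. x \<in> (h ^^ k) ` carrier M \<Longrightarrow> r x = x" "\<And>x. x \<in> carrier M \<Longrightarrow> (h ^^ k) x = \<zero>\<^sub>M \<Longrightarrow> r x = \<zero>\<^sub>M"
    using fitting_retract[OF h f] by metis
  interpret H: lin R M M "h ^^ k" by (rule lin_funpow[OF h])
  note I = H.submodule_range
  interpret r: lin R M "M \<down> (h ^^ k) ` carrier M" r by fact
  obtain x where x: "x \<in> carrier M" "h x = \<zero>\<^sub>M" "x \<noteq> \<zero>\<^sub>M" using ni h.inj_iff by auto
  have Hx: "(h ^^ k) x = \<zero>\<^sub>M"
  proof -
    obtain j where "k = Suc j" using k by (cases k) auto
    then show ?thesis using x(2) lin.zero[OF lin_funpow[OF h]] by (simp add: funpow_swap1)
  qed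
  have z: "carrier (M \<down> (h ^^ k) ` carrier M) = {\<zero>\<^bsub>M \<down> (h ^^ k) ` carrier M\<^esub>}"
  proof (rule ccontr)
    assume "carrier (M \<down> (h ^^ k) ` carrier M) \<noteq> {\<zero>\<^bsub>M \<down> (h ^^ k) ` carrier M\<^esub>}"
    from indecomposable_retract[OF M lin_incl[OF h.dom_mod I] r(1) _ this x(1)]
    have rx: "r x = x" using r(2) by simp
    then show False using r(3)[OF x(1) Hx] x(3) by simp
  qed
  then have "(h ^^ k) x = \<zero>\<^sub>M" if "x \<in> carrier M" for x using that imageI[of x "carrier M" "h ^^ k"] by simp
  then show ?thesis by blast
qed

section \<open>Indecomposable modules and primitive idempotents\<close>

text \<open>Endomorphism rings of indecomposable modules of finite length are local. With
  \<open>u\<close> the inverse of \<open>h + g\<close>, the map \<open>u g\<close> is nilpotent if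
  \<open>g\<close> is not injective, while it is the identity on the kernel of
  \<open>h\<close>.\<close>

lemma indecomposable_local:
  assumes M: "indecomposable R M" and f: "flen R M" and h: "lin R M M h" and g: "lin R M M g"
    and inj: "inj_on (\<lambda>x. h x \<oplus>\<^sub>M g x) (carrier M)"
  shows "inj_on h (carrier M) \<or> inj_on g (carrier M)"
proof (rule disjCI)
  assume ng: "\<not> inj_on g (carrier M)"
  interpret h: lin R M M h by fact
  interpret g: lin R M M g by fact
  let ?t = "\<lambda>x. h x \<oplus>\<^sub>M g x"
  interpret t: lin R M M ?t by (rule lin_add_map[OF h g])
  have b: "bij_betw ?t (carrier M) (carrier M)" using inj t.inj_imp_surj[OF f inj] by (simp add: bij_betw_def)
  let ?u = "inv_into (carrier M) ?t"
  interpret u: lin R M M ?u by (rule t.inv_into_lin[OF b])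
  have ut: "?u (?t x) = x" if "x \<in> carrier M" for x by (rule inv_into_f_f[OF inj that])
  let ?b = "\<lambda>x. ?u (g x)"
  have lb: "lin R M M ?b" by (rule lin_comp[OF g u.lin_axioms])
  have "\<not> inj_on ?b (carrier M)" using ng inj_on_imageI2[of ?u g "carrier M"] by (auto simp: comp_def)
  then obtain k where k: "\<forall>x\<in>carrier M. (?b ^^ k) x = \<zero>\<^sub>M" using indecomposable_endo[OF M f lb] by metis
  show "inj_on h (carrier M)"
    unfolding h.inj_iff
  proof (intro ballI impI)
    fix x assume x: "x \<in> carrier M" "h x = \<zero>\<^sub>M"
    then have "?b x = x" using ut[OF x(1)] by simp
    then have "(?b ^^ j) x = x" for j by (induction j) simp_all
    then show "x = \<zero>\<^sub>M" using k x(1) by metis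
  qed
qed

lemma endo_inverse:
  assumes h: "lin R M M h" and f: "flen R M" and inj: "inj_on h (carrier M)"
  shows "\<exists>u. lin R M M u \<and> (\<forall>x\<in>carrier M. u (h x) = x) \<and> (\<forall>x\<in>carrier M. h (u x) = x)"
proof -
  interpret h: lin R M M h by fact
  have s: "h ` carrier M = carrier M" by (rule h.inj_imp_surj[OF f inj]) simp
  then have b: "bij_betw h (carrier M) (carrier M)" using inj by (simp add: bij_betw_def)
  show ?thesis
    using h.inv_into_lin[OF b] inv_into_f_f[OF inj] f_inv_into_f[of _ h "carrier M"] s by metis
qed

text \<open>Inverting the composite of \<open>a\<close> and \<open>b\<close> turns \<open>P\<close>
  into a nonzero retract of the indecomposable module \<open>Q\<close>.\<close>

lemma indecomposable_iso:
  assumes P: "indecomposable R P" and fP: "flen R P" and Q: "indecomposable R Q"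
    and a: "lin R P Q a" and b: "lin R Q P b" and inj: "inj_on (\<lambda>x. b (a x)) (carrier P)"
  shows "bij_betw a (carrier P) (carrier Q)"
proof -
  interpret a: lin R P Q a by fact
  interpret b: lin R Q P b by fact
  obtain u where u: "lin R P P u" "\<forall>x\<in>carrier P. u (b (a x)) = x"
    using endo_inverse[OF lin_comp[OF a b] fP inj] by metis
  have ub: "lin R Q P (\<lambda>x. u (b x))" by (rule lin_comp[OF b u(1)])
  have "carrier P \<noteq> {\<zero>\<^sub>P}" using P by (simp add: indecomposable_def)
  from indecomposable_retract[OF Q a ub _ this]
  have au: "a (u (b x)) = x" if "x \<in> carrier Q" for x using u(2) that by simp
  show ?thesis
    by (rule bij_betwI[of _ _ _ "\<lambda>x. u (b x)"]) (use u(2) au lin.closed[OF ub] in auto)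
qed

context ring
begin

lemma submodule_principal:
  assumes "e \<in> carrier R"
  shows "submodule {e \<otimes> x |x. x \<in> carrier R} R (regular R)"
proof -
  interpret r: right_module R "regular R" by (rule right_module_regular)
  have l: "lin R (regular R) (regular R) (\<lambda>x. e \<otimes> x)"
    using assms by (intro linI right_module_regular) (simp_all add: r_distr m_assoc)
  have "(\<lambda>x. e \<otimes> x) ` carrier R = {e \<otimes> x |x. x \<in> carrier R}" by auto
  then show ?thesis using lin.submodule_range[OF l] by simp
qed

lemma lin_left_mult: "e \<in> carrier R \<Longrightarrow> lin R (regular R) (regular R) (\<lambda>x. e \<otimes> x)"
  by (intro linI right_module_regular) (simp_all add: r_distr m_assoc)

lemma right_module_principal: "e \<in> carrier R \<Longrightarrow> right_module R (principal_right R e)"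
  unfolding principal_right_def
  using right_module.right_module_sub[OF right_module_regular submodule_principal] .

lemma carrier_principal: "carrier (principal_right R e) = {e \<otimes> x |x. x \<in> carrier R}"
  by (simp add: principal_right_def)

lemma principal_mult:
  assumes "idempotent R e"
  shows "x \<in> carrier (principal_right R e) \<longleftrightarrow> x \<in> carrier R \<and> e \<otimes> x = x"
proof
  assume "x \<in> carrier (principal_right R e)"
  then obtain y where y: "y \<in> carrier R" "x = e \<otimes> y" by (auto simp: carrier_principal)
  have e: "e \<in> carrier R" "e \<otimes> e = e" using assms by (simp_all add: idempotent_def)
  have "e \<otimes> x = e \<otimes> e \<otimes> y" unfolding y(2) by (rule m_assoc[OF e(1) e(1) y(1), symmetric])
  then have "e \<otimes> x = x" using e y by simp
  then show "x \<in> carrier R \<and> e \<otimes> x = x" using assms y by (simp add: idempotent_def)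
next
  assume "x \<in> carrier R \<and> e \<otimes> x = x"
  then show "x \<in> carrier (principal_right R e)" unfolding carrier_principal by force
qed

lemma lin_to_principal: "idempotent R e \<Longrightarrow> lin R (regular R) (principal_right R e) (\<lambda>x. e \<otimes> x)"
  unfolding principal_right_def
  by (intro lin.restrict_codomain[OF lin_left_mult submodule_principal]) (auto simp: idempotent_def)

lemma lin_principal_incl: "e \<in> carrier R \<Longrightarrow> lin R (principal_right R e) (regular R) (\<lambda>x. x)"
  unfolding principal_right_def by (intro lin_incl right_module_regular submodule_principal)

lemma principal_simps [simp]:
  "\<zero>\<^bsub>principal_right R e\<^esub> = \<zero>" "x \<oplus>\<^bsub>principal_right R e\<^esub> y = x \<oplus> y"
  "a \<odot>\<^bsub>principal_right R e\<^esub> x = x \<otimes> a"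
  by (simp_all add: principal_right_def)

text \<open>A decomposition of \<open>eA\<close> splits \<open>e\<close> into components
  \<open>p e\<close> and \<open>q e\<close>. The projections are left multiplications by these
  elements, which makes them orthogonal idempotents.\<close>

lemma principal_indecomposable:
  assumes e: "primitive_idem R e"
  shows "indecomposable R (principal_right R e)" (is "indecomposable R ?Q")
proof -
  have i: "idempotent R e" "e \<noteq> \<zero>" using e by (simp_all add: primitive_idem_def)
  have eR: "e \<in> carrier R" "e \<otimes> e = e" using i by (simp_all add: idempotent_def)
  have eQ: "e \<in> carrier ?Q" using principal_mult[OF i(1)] eR by simp
  have "N = {\<zero>} \<or> N' = {\<zero>}" if c: "complementary R ?Q N N'" for N N'
  proof -
    have N: "submodule N R ?Q" "submodule N' R ?Q" using c by (simp_all add: complementary_def)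
    obtain p q where b: "biprod R (?Q \<down> N) (?Q \<down> N') ?Q (\<lambda>x. x) (\<lambda>x. x) p q"
      using complementary_projections[OF right_module_principal[OF eR(1)] c] by metis
    note b' = biprodD[OF b]
    have Q: "z \<in> carrier R" "e \<otimes> z = z" if "z \<in> carrier ?Q" for z using that principal_mult[OF i(1), of z] by simp_all
    have pq: "p e \<in> N" "q e \<in> N'" using lin.closed[OF b'(3) eQ] lin.closed[OF b'(4) eQ] by simp_all
    note pqQ = submoduleD(3)[OF N(1) pq(1)] submoduleD(3)[OF N(2) pq(2)]
    have mult: "p z = p e \<otimes> z" "q z = q e \<otimes> z" if z: "z \<in> carrier ?Q" for z
      using lin.smult[OF b'(3) Q(1)[OF z] eQ] lin.smult[OF b'(4) Q(1)[OF z] eQ] Q(2)[OF z] by simp_all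
    have "p e \<otimes> p e = p e" "p e \<otimes> q e = \<zero>" "q e \<otimes> q e = q e" "q e \<otimes> p e = \<zero>"
      using mult(1)[OF pqQ(1)] mult(1)[OF pqQ(2)] mult(2)[OF pqQ(2)] mult(2)[OF pqQ(1)]
        b'(5)[of "p e"] b'(6)[of "p e"] b'(7)[of "q e"] b'(8)[of "q e"] pq by simp_all
    moreover have "e = p e \<oplus> q e" using b'(9)[OF eQ] by simp
    ultimately have "p e = \<zero> \<or> q e = \<zero>"
      using e Q(1)[OF pqQ(1)] Q(1)[OF pqQ(2)] unfolding primitive_idem_def idempotent_def orthogonal_in_def by metis
    then show ?thesis
    proof
      assume z: "p e = \<zero>"
      have "x = \<zero>" if x: "x \<in> N" for x
        using mult(1)[OF submoduleD(3)[OF N(1) x]] b'(5)[of x] x Q(1)[OF submoduleD(3)[OF N(1) x]] by (simp add: z)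
      moreover have "\<zero> \<in> N" using submoduleD(2)[OF N(1)] by simp
      ultimately have "N = {\<zero>}" by (rule eq_singletonI)
      then show ?thesis ..
    next
      assume z: "q e = \<zero>"
      have "x = \<zero>" if x: "x \<in> N'" for x
        using mult(2)[OF submoduleD(3)[OF N(2) x]] b'(7)[of x] x Q(1)[OF submoduleD(3)[OF N(2) x]] by (simp add: z)
      moreover have "\<zero> \<in> N'" using submoduleD(2)[OF N(2)] by simp
      ultimately have "N' = {\<zero>}" by (rule eq_singletonI)
      then show ?thesis ..
    qed
  qed
  moreover have "carrier ?Q \<noteq> {\<zero>}" using eQ i(2) by auto
  ultimately show ?thesis by (simp add: indecomposable_def)
qed

end

section \<open>Indecomposable summands of the regular module\<close>

lemma equiv_ind_summands:
  assumes M: "right_module R M"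
  shows "equiv (ind_summands R M) {(N, N'). N \<in> ind_summands R M \<and> N' \<in> ind_summands R M \<and>
    module_iso R (M \<down> N) (M \<down> N')}" (is "equiv ?I ?r")
proof (rule equivI)
  have Im: "right_module R (M \<down> N)" if "N \<in> ?I" for N
    using that right_module.right_module_sub[OF M, of N] by (auto simp: ind_summands_def complementary_def)
  show "refl_on ?I ?r" using module_iso_refl[OF Im] by (auto intro!: refl_onI)
  show "sym ?r" using module_iso_sym Im by (auto intro!: symI)
  show "trans ?r"
  proof (rule transI)
    fix x y z assume "(x, y) \<in> ?r" "(y, z) \<in> ?r"
    then show "(x, z) \<in> ?r" using module_iso_trans[OF _ _ Im Im Im, of x y z] by simp
  qed
qed auto

definition prim_decomp :: "('a, 'r) ring_scheme \<Rightarrow> 'a set \<Rightarrow> bool" where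
  "prim_decomp R E \<longleftrightarrow> finite E \<and> (\<forall>e\<in>E. primitive_idem R e) \<and> (\<Oplus>\<^bsub>R\<^esub>e\<in>E. e) = \<one>\<^sub>R"

context finlen_ring
begin

text \<open>A map through the free module of rank \<open>Suc n\<close> is the sum of one through
  rank \<open>n\<close> and one through the last coordinate; by locality one of the two stays
  injective on \<open>P\<close>.\<close>

lemma free_to_regular:
  assumes P: "indecomposable R P" and fP: "flen R P"
  shows "\<lbrakk>lin R P (free_module R n) i; lin R (free_module R n) P p; inj_on (\<lambda>x. p (i x)) (carrier P)\<rbrakk>
    \<Longrightarrow> \<exists>a b. lin R P (regular R) a \<and> lin R (regular R) P b \<and> inj_on (\<lambda>x. b (a x)) (carrier P)"
proof (induction n arbitrary: i p)
  case 0
  interpret i: lin R P "free_module R 0" i by fact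
  interpret p: lin R "free_module R 0" P p by fact
  interpret pi: lin R P P "\<lambda>x. p (i x)" by (rule lin_comp[OF 0(1,2)])
  have "i x = \<zero>\<^bsub>free_module R 0\<^esub>" if "x \<in> carrier P" for x using i.closed[OF that] by auto
  then have "x = \<zero>\<^sub>P" if "x \<in> carrier P" for x using 0(3) that p.zero unfolding pi.inj_iff by metis
  then have "carrier P = {\<zero>\<^sub>P}" by (intro equalityI subsetI) simp_all
  then show ?case using P by (simp add: indecomposable_def)
next
  case (Suc n)
  obtain k u d c where bp: "biprod R (free_module R n) (regular R) (free_module R (Suc n)) k u d c"
    using biprod_free[of n] by metis
  note b = biprodD[OF bp]
  let ?h = "\<lambda>x. p (k (d (i x)))" and ?g = "\<lambda>x. p (u (c (i x)))"
  note h = lin_comp[OF lin_comp[OF lin_comp[OF Suc(2) b(3)] b(1)] Suc(3)]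
  note g = lin_comp[OF lin_comp[OF lin_comp[OF Suc(2) b(4)] b(2)] Suc(3)]
  have "?h x \<oplus>\<^sub>P ?g x = p (i x)" if x: "x \<in> carrier P" for x
  proof -
    note cl = lin.closed[OF Suc(2) x]
    show ?thesis
      using lin.add[OF Suc(3) lin.closed[OF b(1) lin.closed[OF b(3) cl]] lin.closed[OF b(2) lin.closed[OF b(4) cl]]]
      unfolding b(9)[OF cl] by (rule sym)
  qed
  then have "inj_on (\<lambda>x. ?h x \<oplus>\<^sub>P ?g x) (carrier P)" using Suc(4) by (simp cong: inj_on_cong)
  from indecomposable_local[OF P fP h g this] show ?case
  proof
    assume "inj_on ?h (carrier P)"
    then show ?thesis by (rule Suc(1)[OF lin_comp[OF Suc(2) b(3)] lin_comp[OF b(1) Suc(3)]])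
  next
    assume "inj_on ?g (carrier P)"
    then show ?thesis
      by (intro exI[of _ "\<lambda>x. c (i x)"] exI[of _ "\<lambda>a. p (u a)"] conjI
          lin_comp[OF Suc(2) b(4)] lin_comp[OF b(2) Suc(3)])
  qed
qed

text \<open>The same use of locality, with the idempotents of \<open>F\<close> in place of the
  coordinates.\<close>

lemma regular_to_principal:
  assumes P: "indecomposable R P" and fP: "flen R P"
    and a: "lin R P (regular R) a" and b: "lin R (regular R) P b"
    and F: "finite F" "F \<subseteq> carrier R" "inj_on (\<lambda>x. b ((\<Oplus>e\<in>F. e) \<otimes> a x)) (carrier P)"
  shows "\<exists>e\<in>F. inj_on (\<lambda>x. b (e \<otimes> a x)) (carrier P)"
  using F
proof (induction F)
  interpret a: lin R P "regular R" a by fact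
  interpret b: lin R "regular R" P b by fact
  {
    case empty
    interpret z: lin R P P "\<lambda>x. b (\<zero> \<otimes> a x)" by (rule lin_comp[OF lin_comp[OF a lin_left_mult[OF zero_closed]] b])
    have "inj_on (\<lambda>x. b (\<zero> \<otimes> a x)) (carrier P)" using empty by simp
    moreover have "b (\<zero> \<otimes> a x) = \<zero>\<^sub>P" if "x \<in> carrier P" for x
      using a.closed[OF that] b.zero by simp
    ultimately have "x = \<zero>\<^sub>P" if "x \<in> carrier P" for x using that unfolding z.inj_iff by metis
    then have "carrier P = {\<zero>\<^sub>P}" by (intro equalityI subsetI) simp_all
    then show ?case using P by (simp add: indecomposable_def)
  next
    case (insert e F)
    let ?s = "\<Oplus>e\<in>F. e"
    have c: "e \<in> carrier R" "?s \<in> carrier R" using insert by (auto intro: finsum_closed)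
    have h: "lin R P P (\<lambda>x. b (e \<otimes> a x))" by (rule lin_comp[OF lin_comp[OF a lin_left_mult[OF c(1)]] b])
    have g: "lin R P P (\<lambda>x. b (?s \<otimes> a x))" by (rule lin_comp[OF lin_comp[OF a lin_left_mult[OF c(2)]] b])
    have "b ((\<Oplus>e\<in>insert e F. e) \<otimes> a x) = b (e \<otimes> a x) \<oplus>\<^sub>P b (?s \<otimes> a x)" if x: "x \<in> carrier P" for x
    proof -
      have "(\<Oplus>e\<in>insert e F. e) = e \<oplus> ?s" using insert by (intro finsum_insert) auto
      then show ?thesis using a.closed[OF x] c b.add[of "e \<otimes> a x" "?s \<otimes> a x"] by (simp add: l_distr)
    qed
    then have "inj_on (\<lambda>x. b (e \<otimes> a x) \<oplus>\<^sub>P b (?s \<otimes> a x)) (carrier P)"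
      using insert(5) by (simp cong: inj_on_cong)
    from indecomposable_local[OF P fP h g this] show ?case using insert by auto
  }
qed

text \<open>The part of the Krull-Schmidt theorem that concerns summands of free modules: the
  identity of \<open>P\<close> is cut down to a single coordinate and then to a single idempotent
  \<open>e\<close>.\<close>

lemma indecomposable_retract_free:
  assumes E: "prim_decomp R E" and P: "indecomposable R P" and fP: "flen R P"
    and i: "lin R P (free_module R n) i" and p: "lin R (free_module R n) P p"
    and pi: "\<And>x. x \<in> carrier P \<Longrightarrow> p (i x) = x"
  shows "\<exists>e\<in>E. \<exists>f. lin R P (principal_right R e) f \<and> bij_betw f (carrier P) (carrier (principal_right R e))"
proof -
  have "inj_on (\<lambda>x. p (i x)) (carrier P)" by (rule inj_onI) (use pi in simp)
  from free_to_regular[OF P fP i p this]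
  obtain a b where a: "lin R P (regular R) a" and b: "lin R (regular R) P b"
    and inj: "inj_on (\<lambda>x. b (a x)) (carrier P)" by metis
  have Ec: "E \<subseteq> carrier R" using E by (auto simp: prim_decomp_def primitive_idem_def idempotent_def)
  have "b ((\<Oplus>e\<in>E. e) \<otimes> a x) = b (a x)" if "x \<in> carrier P" for x
    using E lin.closed[OF a that] by (simp add: prim_decomp_def)
  then have "inj_on (\<lambda>x. b ((\<Oplus>e\<in>E. e) \<otimes> a x)) (carrier P)" using inj by (simp cong: inj_on_cong)
  from regular_to_principal[OF P fP a b _ Ec this] E
  obtain e where e: "e \<in> E" "inj_on (\<lambda>x. b (e \<otimes> a x)) (carrier P)" by (auto simp: prim_decomp_def)
  then have pe: "primitive_idem R e" "idempotent R e" using E by (auto simp: prim_decomp_def primitive_idem_def)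
  have ec: "e \<in> carrier R" using Ec e by auto
  have "bij_betw (\<lambda>x. e \<otimes> a x) (carrier P) (carrier (principal_right R e))"
    using lin_comp[OF lin_principal_incl[OF ec] b] e(2)
    by (intro indecomposable_iso[OF P fP principal_indecomposable[OF pe(1)] lin_comp[OF a lin_to_principal[OF pe(2)]]])
  then show ?thesis using e(1) lin_comp[OF a lin_to_principal[OF pe(2)]] by blast
qed

lemma num_summands_regular:
  assumes E: "prim_decomp R E"
    and orth: "\<And>e f. \<lbrakk>e \<in> E; f \<in> E; e \<noteq> f\<rbrakk> \<Longrightarrow> orthogonal_in R e f"
    and niso: "\<And>e f. \<lbrakk>e \<in> E; f \<in> E; e \<noteq> f\<rbrakk> \<Longrightarrow> \<not> module_iso R (principal_right R e) (principal_right R f)"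
  shows "num_summands R (regular R) = card E"
proof -
  interpret r: right_module R "regular R" by (rule right_module_regular)
  let ?I = "ind_summands R (regular R)"
  let ?r = "{(N, N'). N \<in> ?I \<and> N' \<in> ?I \<and> module_iso R ((regular R) \<down> N) ((regular R) \<down> N')}"
  define c where "c e = {e \<otimes> x |x. x \<in> carrier R}" for e
  have pr: "(regular R) \<down> c e = principal_right R e" for e by (simp add: c_def principal_right_def)
  have Iprop: "submodule N R (regular R) \<and> indecomposable R ((regular R) \<down> N)" if "N \<in> ?I" for N
    using that by (auto simp: ind_summands_def complementary_def)
  note eq = equiv_ind_summands[OF right_module_regular]
  have cI: "c e \<in> ?I" if e: "e \<in> E" for e
  proof -
    have pe: "primitive_idem R e" using E e by (simp add: prim_decomp_def)
    then have i: "e \<in> carrier R" "e \<otimes> e = e" by (simp_all add: primitive_idem_def idempotent_def)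
    have "(\<lambda>x. e \<otimes> x) ` carrier (regular R) = c e" by (auto simp: c_def)
    moreover have "complementary R (regular R) ((\<lambda>x. e \<otimes> x) ` carrier (regular R)) (ker (regular R) (regular R) (\<lambda>x. e \<otimes> x))"
      using i by (intro complementary_idempotent lin_left_mult) (simp_all flip: m_assoc)
    ultimately show ?thesis using principal_indecomposable[OF pe] unfolding ind_summands_def by (auto simp: pr)
  qed
  have "bij_betw (\<lambda>e. ?r `` {c e}) E (?I // ?r)"
    unfolding bij_betw_def
  proof
    show "inj_on (\<lambda>e. ?r `` {c e}) E"
    proof (rule inj_onI)
      fix e f assume ef: "e \<in> E" "f \<in> E" "?r `` {c e} = ?r `` {c f}"
      have "(c e, c f) \<in> ?r" using eq_equiv_class[OF ef(3) eq] cI[OF ef(2)] by auto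
      then show "e = f" using niso[OF ef(1,2)] by (auto simp: pr)
    qed
    show "(\<lambda>e. ?r `` {c e}) ` E = ?I // ?r"
    proof
      show "(\<lambda>e. ?r `` {c e}) ` E \<subseteq> ?I // ?r" using cI by (auto simp: quotient_def)
      show "?I // ?r \<subseteq> (\<lambda>e. ?r `` {c e}) ` E"
      proof
        fix C assume "C \<in> ?I // ?r"
        then obtain N where N: "N \<in> ?I" "C = ?r `` {N}" by (auto simp: quotient_def)
        then obtain N' where c': "complementary R (regular R) N N'" by (auto simp: ind_summands_def)
        obtain p where p: "lin R (regular R) ((regular R) \<down> N) p"
            "\<And>x. x \<in> N \<Longrightarrow> p x = x"
          using complementary_projections[OF right_module_regular c'] unfolding biprod_def by auto
        obtain k u d cc where "biprod R (free_module R 0) (regular R) (free_module R (Suc 0)) k u d cc"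
          using biprod_free[of 0] by metis
        note b = biprodD[OF this]
        have sN: "submodule N R (regular R)" using Iprop[OF N(1)] by simp
        have "\<exists>e\<in>E. \<exists>f. lin R ((regular R) \<down> N) (principal_right R e) f \<and>
            bij_betw f (carrier ((regular R) \<down> N)) (carrier (principal_right R e))"
          using Iprop[OF N(1)] r.flen_sub[OF sN flen_regular] submoduleD(3)[OF sN]
          by (intro indecomposable_retract_free[OF E _ _ lin_comp[OF lin_incl[OF right_module_regular sN] b(2)]
                lin_comp[OF b(4) p(1)]]) (simp_all add: p(2) b)
        then obtain e where e: "e \<in> E" "module_iso R ((regular R) \<down> N) (principal_right R e)"
          using module_isoI by metis
        then have "(N, c e) \<in> ?r" using N(1) cI by (simp add: pr)
        then have "C = ?r `` {c e}" using equiv_class_eq[OF eq] N(2) by simp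
        then show "C \<in> (\<lambda>e. ?r `` {c e}) ` E" using e(1) by (rule image_eqI)
      qed
    qed
  qed
  then show ?thesis using bij_betw_same_card unfolding num_summands_def by fastforce
qed

end

section \<open>Dimensions over the ground field\<close>

text \<open>A nonzero submodule contains a unit, so a chain has at most one strict
  inclusion.\<close>

lemma (in field) flen_regular_field: "flen R (regular R)"
proof -
  have triv: "U = {\<zero>} \<or> U = carrier R" if U: "submodule U R (regular R)" for U
  proof (rule disjCI)
    assume "U \<noteq> carrier R"
    show "U = {\<zero>}"
    proof (rule ccontr)
      assume "U \<noteq> {\<zero>}"
      then obtain x where x: "x \<in> U" "x \<noteq> \<zero>" using submoduleD(2)[OF U] by auto
      then have xc: "x \<in> carrier R" "x \<in> Units R" using submoduleD(3)[OF U x(1)] field_Units by auto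
      have "y \<in> U" if y: "y \<in> carrier R" for y
      proof -
        have "x \<otimes> (inv x \<otimes> y) \<in> U" using submoduleD(5)[OF U _ x(1), of "inv x \<otimes> y"] xc y by simp
        then show ?thesis using xc y by (simp flip: m_assoc)
      qed
      then show False using \<open>U \<noteq> carrier R\<close> submoduleD(1)[OF U] by auto
    qed
  qed
  have bound: "n \<le> (if U = {\<zero>} then 0 else 1)" if "mchain R (regular R) n U" for n U
    using that
  proof induction
    case (step n U V)
    have "\<zero> \<in> U" using submoduleD(2)[OF mchain_submodule[OF step(1)]] by simp
    moreover have "U \<noteq> carrier R" using step(3) submoduleD(1)[OF step(2)] by auto
    ultimately show ?case using step triv[OF mchain_submodule[OF step(1)]] by auto
  qed simp
  have "n \<le> 1" if "mchain R (regular R) n U" for n U using bound[OF that] by (simp split: if_splits)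
  then show ?thesis unfolding flen_def by auto
qed

text \<open>\<open>hom_group\<close> carries no scalars; the action of \<open>K\<close> is added so
  that \<open>len K\<close> measures the dimension.\<close>

definition hom_space ::
  "('k, 'a) module \<Rightarrow> ('a, 'm) module \<Rightarrow> ('a, 'n) module \<Rightarrow> ('k, 'm \<Rightarrow> 'n) module" where
  "hom_space A M N = with_smult (hom_group A M N) (\<lambda>c f. \<lambda>x\<in>carrier M. (c \<odot>\<^sub>A \<one>\<^sub>A) \<odot>\<^sub>N f x)"

lemma hom_group_simps [simp]:
  "carrier (hom_group R M N) = rhom R M N" "\<zero>\<^bsub>hom_group R M N\<^esub> = (\<lambda>x\<in>carrier M. \<zero>\<^sub>N)"
  "f \<oplus>\<^bsub>hom_group R M N\<^esub> g = (\<lambda>x\<in>carrier M. f x \<oplus>\<^sub>N g x)"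
  by (simp_all add: hom_group_def)

lemma hom_space_simps [simp]:
  "carrier (hom_space A M N) = rhom A M N" "\<zero>\<^bsub>hom_space A M N\<^esub> = (\<lambda>x\<in>carrier M. \<zero>\<^sub>N)"
  "f \<oplus>\<^bsub>hom_space A M N\<^esub> g = (\<lambda>x\<in>carrier M. f x \<oplus>\<^sub>N g x)"
  "c \<odot>\<^bsub>hom_space A M N\<^esub> f = (\<lambda>x\<in>carrier M. (c \<odot>\<^sub>A \<one>\<^sub>A) \<odot>\<^sub>N f x)"
  by (simp_all add: hom_space_def)

lemma restrict_scalars_simps [simp]:
  "carrier (restrict_scalars A M) = carrier M" "\<zero>\<^bsub>restrict_scalars A M\<^esub> = \<zero>\<^sub>M"
  "x \<oplus>\<^bsub>restrict_scalars A M\<^esub> y = x \<oplus>\<^sub>M y"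
  "c \<odot>\<^bsub>restrict_scalars A M\<^esub> x = (c \<odot>\<^sub>A \<one>\<^sub>A) \<odot>\<^sub>M x"
  by (simp_all add: restrict_scalars_def)

lemma restrict_scalars_sub: "(restrict_scalars A M) \<down> U = restrict_scalars A (M \<down> U)"
  by (simp add: restrict_scalars_def with_smult_def ring.defs module.defs)

lemma rhom_undefined: "\<lbrakk>f \<in> rhom R M N; x \<notin> carrier M\<rbrakk> \<Longrightarrow> f x = undefined"
  by (auto simp: rhom_def dest: PiE_arb)

lemma abelian_group_hom_group:
  assumes M: "right_module R M" and N: "right_module R N"
  shows "abelian_group (hom_group R M N)"
proof -
  interpret M: right_module R M by fact
  interpret N: right_module R N by fact
  have l: "lin R M N f" if "f \<in> rhom R M N" for f using rhom_lin[OF M N that] .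
  show ?thesis
  proof (rule abelian_groupI)
    fix f assume f: "f \<in> carrier (hom_group R M N)"
    then have f': "f \<in> rhom R M N" by simp
    show "\<exists>g\<in>carrier (hom_group R M N). g \<oplus>\<^bsub>hom_group R M N\<^esub> f = \<zero>\<^bsub>hom_group R M N\<^esub>"
      using lin.in_rhom[OF lin_minus_map[OF l[OF f']]] rhom_closed[OF f']
      by (intro bexI[of _ "\<lambda>x\<in>carrier M. \<ominus>\<^sub>N f x"]) (auto simp: fun_eq_iff N.M.l_neg)
  next
    fix f g assume f: "f \<in> carrier (hom_group R M N)" "g \<in> carrier (hom_group R M N)"
    then have f': "f \<in> rhom R M N" "g \<in> rhom R M N" by simp_all
    show "f \<oplus>\<^bsub>hom_group R M N\<^esub> g \<in> carrier (hom_group R M N)"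
      using lin.in_rhom[OF lin_add_map[OF l[OF f'(1)] l[OF f'(2)]]] by simp
    show "f \<oplus>\<^bsub>hom_group R M N\<^esub> g = g \<oplus>\<^bsub>hom_group R M N\<^esub> f"
      using rhom_closed[OF f'(1)] rhom_closed[OF f'(2)] by (auto simp: fun_eq_iff N.M.a_comm)
  next
    show "\<zero>\<^bsub>hom_group R M N\<^esub> \<in> carrier (hom_group R M N)" using lin.in_rhom[OF lin_zero[OF M N]] by simp
  next
    fix f g h assume f: "f \<in> carrier (hom_group R M N)" "g \<in> carrier (hom_group R M N)" "h \<in> carrier (hom_group R M N)"
    then have f': "f \<in> rhom R M N" "g \<in> rhom R M N" "h \<in> rhom R M N" by simp_all
    show "f \<oplus>\<^bsub>hom_group R M N\<^esub> g \<oplus>\<^bsub>hom_group R M N\<^esub> h = f \<oplus>\<^bsub>hom_group R M N\<^esub> (g \<oplus>\<^bsub>hom_group R M N\<^esub> h)"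
      using rhom_closed[OF f'(1)] rhom_closed[OF f'(2)] rhom_closed[OF f'(3)]
      by (auto simp: fun_eq_iff N.M.a_assoc)
  next
    fix f assume f: "f \<in> carrier (hom_group R M N)"
    then have f': "f \<in> rhom R M N" by simp
    show "\<zero>\<^bsub>hom_group R M N\<^esub> \<oplus>\<^bsub>hom_group R M N\<^esub> f = f"
      using rhom_closed[OF f'] rhom_undefined[OF f'] by (auto simp: fun_eq_iff)
  qed
qed

lemma right_module_smult_cong:
  assumes M: "right_module R (with_smult G s)" and e: "\<And>a x. \<lbrakk>a \<in> carrier R; x \<in> carrier G\<rbrakk> \<Longrightarrow> s' a x = s a x"
  shows "right_module R (with_smult G s')"
proof -
  interpret M: right_module R "with_smult G s" by (rule M)
  have "abelian_group (with_smult (with_smult G s) s')" by (rule abelian_group_with_smult[OF M.M_abelian_group])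
  then have "abelian_group (with_smult G s')" by (simp add: with_smult_def ring.defs)
  then show ?thesis
    using M.smult_closed M.smult_l_distr M.smult_r_distr M.smult_assoc M.smult_one M.R.a_closed M.R.m_closed
      M.R.one_closed M.M.a_closed
    by (intro right_module.intro right_module_axioms.intro M.R_ring) (simp_all add: e)
qed

text \<open>An action \<open>\<sigma>\<close> of \<open>S\<close> on \<open>M\<close> from the left makes \<open>Hom(M, N)\<close> a right \<open>S\<close>-module.\<close>

lemma right_module_hom_action:
  assumes M: "right_module R M" and N: "right_module R N" and S: "ring S"
    and \<sigma>: "\<And>s. s \<in> carrier S \<Longrightarrow> lin R M M (\<sigma> s)"
    and add: "\<And>s t x. \<lbrakk>s \<in> carrier S; t \<in> carrier S; x \<in> carrier M\<rbrakk> \<Longrightarrow> \<sigma> (s \<oplus>\<^sub>S t) x = \<sigma> s x \<oplus>\<^sub>M \<sigma> t x"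
    and mult: "\<And>s t x. \<lbrakk>s \<in> carrier S; t \<in> carrier S; x \<in> carrier M\<rbrakk> \<Longrightarrow> \<sigma> (s \<otimes>\<^sub>S t) x = \<sigma> s (\<sigma> t x)"
    and one: "\<And>x. x \<in> carrier M \<Longrightarrow> \<sigma> \<one>\<^sub>S x = x"
  shows "right_module S (with_smult (hom_group R M N) (\<lambda>s f. \<lambda>x\<in>carrier M. f (\<sigma> s x)))" (is "right_module S ?H")
proof (intro right_module.intro right_module_axioms.intro S)
  show "abelian_group ?H" by (rule abelian_group_with_smult[OF abelian_group_hom_group[OF M N]])
  have l: "lin R M N f" if "f \<in> carrier ?H" for f using that by (intro rhom_lin[OF M N]) simp
  show "s \<odot>\<^sub>?H f \<in> carrier ?H" if "s \<in> carrier S" "f \<in> carrier ?H" for s f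
    using lin.in_rhom[OF lin_comp[OF \<sigma>[OF that(1)] l[OF that(2)]]] by simp
  show "(s \<oplus>\<^sub>S t) \<odot>\<^sub>?H f = s \<odot>\<^sub>?H f \<oplus>\<^sub>?H t \<odot>\<^sub>?H f" if "s \<in> carrier S" "t \<in> carrier S" "f \<in> carrier ?H" for s t f
    using that lin.add[OF l[OF that(3)]] lin.closed[OF \<sigma>] by (simp add: fun_eq_iff add)
  show "s \<odot>\<^sub>?H (f \<oplus>\<^sub>?H g) = s \<odot>\<^sub>?H f \<oplus>\<^sub>?H s \<odot>\<^sub>?H g" if "s \<in> carrier S" for s f g
    using lin.closed[OF \<sigma>[OF that]] by (simp add: fun_eq_iff)
  show "(s \<otimes>\<^sub>S t) \<odot>\<^sub>?H f = t \<odot>\<^sub>?H (s \<odot>\<^sub>?H f)" if "s \<in> carrier S" "t \<in> carrier S" for s t f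
    using that lin.closed[OF \<sigma>] by (simp add: fun_eq_iff mult)
  show "\<one>\<^sub>S \<odot>\<^sub>?H f = f" if "f \<in> carrier ?H" for f
    using that rhom_undefined[of f R M N] by (simp add: fun_eq_iff one)
qed

section \<open>Restriction of scalars and dimensions of Hom spaces\<close>

context fd_algebra
begin

abbreviation Hom :: "('a, 'm) module \<Rightarrow> ('a, 'n) module \<Rightarrow> ('k, 'm \<Rightarrow> 'n) module" where "Hom \<equiv> hom_space A"

abbreviation res :: "('a, 'm) module \<Rightarrow> ('k, 'm) module" where "res \<equiv> restrict_scalars A"

lemma finlen_K: "finlen_ring K"
  using K.flen_regular_field K.ring_axioms by (simp add: finlen_ring_def finlen_ring_axioms_def)

lemma K_ring: "ring K" using K.ring_axioms .
lemma A_ring: "ring A" using A.ring_axioms .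

lemma right_module_A: "right_module K A"
proof -
  have "(a \<otimes>\<^sub>K b) \<odot>\<^sub>A x = b \<odot>\<^sub>A (a \<odot>\<^sub>A x)"
    if "a \<in> carrier K" "b \<in> carrier K" "x \<in> carrier A" for a b x
    using that smult_assoc1[of b a x] by (simp add: K.m_comm)
  then show ?thesis
    using K_ring A.is_abelian_group by (intro right_module.intro right_module_axioms.intro)
      (simp_all add: smult_l_distr smult_r_distr)
qed

lemma scalar_closed [simp]: "c \<in> carrier K \<Longrightarrow> c \<odot>\<^sub>A \<one>\<^sub>A \<in> carrier A" by simp

lemma scalar_mult_left: "\<lbrakk>c \<in> carrier K; x \<in> carrier A\<rbrakk> \<Longrightarrow> (c \<odot>\<^sub>A \<one>\<^sub>A) \<otimes>\<^sub>A x = c \<odot>\<^sub>A x"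
  using smult_mult_left[of c "\<one>\<^sub>A" x] by simp

lemma scalar_mult_right: "\<lbrakk>c \<in> carrier K; x \<in> carrier A\<rbrakk> \<Longrightarrow> x \<otimes>\<^sub>A (c \<odot>\<^sub>A \<one>\<^sub>A) = c \<odot>\<^sub>A x"
  using smult_mult_right[of c x "\<one>\<^sub>A"] by simp

lemma scalar_central:
  assumes "right_module A M" "c \<in> carrier K" "a \<in> carrier A" "x \<in> carrier M"
  shows "(c \<odot>\<^sub>A \<one>\<^sub>A) \<odot>\<^sub>M (a \<odot>\<^sub>M x) = a \<odot>\<^sub>M ((c \<odot>\<^sub>A \<one>\<^sub>A) \<odot>\<^sub>M x)"
proof -
  interpret M: right_module A M by fact
  show ?thesis
    using assms(2-4) M.smult_assoc[of a "c \<odot>\<^sub>A \<one>\<^sub>A" x] M.smult_assoc[of "c \<odot>\<^sub>A \<one>\<^sub>A" a x]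
    by (simp add: scalar_mult_left scalar_mult_right)
qed

lemma right_module_rs:
  assumes "right_module A M"
  shows "right_module K (res M)"
proof -
  interpret M: right_module A M by fact
  have m: "(c \<otimes>\<^sub>K d) \<odot>\<^sub>A \<one>\<^sub>A = (c \<odot>\<^sub>A \<one>\<^sub>A) \<otimes>\<^sub>A (d \<odot>\<^sub>A \<one>\<^sub>A)" if "c \<in> carrier K" "d \<in> carrier K" for c d
    using that by (simp add: smult_assoc1 scalar_mult_left)
  show ?thesis
  proof (intro right_module.intro right_module_axioms.intro K_ring)
    show "abelian_group (res M)"
      unfolding restrict_scalars_def by (rule abelian_group_with_smult) (rule M.M_abelian_group)
  qed (simp_all add: smult_l_distr M.smult_l_distr M.smult_r_distr m M.smult_assoc)
qed

lemma lin_rs: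
  assumes "lin A M N f"
  shows "lin K (res M) (res N) f"
proof -
  interpret f: lin A M N f by fact
  show ?thesis
    using right_module_rs[OF f.dom_mod] right_module_rs[OF f.cod_mod]
    by (intro linI) (simp_all add: f.add f.smult)
qed

lemma submodule_rs:
  assumes "right_module A M" "submodule U A M"
  shows "submodule U K (res M)"
  using submoduleD[OF assms(2)]
  by (intro right_module.submoduleI[OF right_module_rs[OF assms(1)]]) simp_all

lemma mchain_rs:
  assumes "right_module A M" "mchain A M n U"
  shows "mchain K (res M) n U"
  using assms(2) by induction (auto intro: mchain.intros submodule_rs[OF assms(1)])

lemma flen_of_rs: "\<lbrakk>right_module A M; flen K (res M)\<rbrakk> \<Longrightarrow> flen A M"
  unfolding flen_def using mchain_rs by metis

lemma flen_rs_regular: "flen K (res (regular A))"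
proof -
  have "fg_mod K A" using finite_dim right_module_A by (simp add: fg_mod_def)
  then have 1: "flen K A" by (rule finlen_ring.fg_flen[OF finlen_K])
  have "lin K A (res (regular A)) (\<lambda>x. x)"
    using right_module_A right_module_rs[OF A.right_module_regular]
    by (intro linI) (simp_all add: scalar_mult_right)
  from lin.len_bij(1)[OF this _ 1] show ?thesis by (simp add: bij_betw_def)
qed

lemma finlen_A: "finlen_ring A"
  using flen_of_rs[OF A.right_module_regular flen_rs_regular] A_ring
  by (simp add: finlen_ring_def finlen_ring_axioms_def)

lemma flen_rs_free: "flen K (res (free_module A n))"
proof (induction n)
  case 0
  have "carrier (res (free_module A 0)) = {\<zero>\<^bsub>res (free_module A 0)\<^esub>}" by auto
  then show ?case by (rule right_module.len_zero[OF right_module_rs[OF A.right_module_free]])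
next
  case (Suc n)
  have l: "lin K (res (free_module A (Suc n))) (res (regular A)) (\<lambda>r. r n)"
    by (rule lin_rs[OF A.lin_coord])
  have s: "(\<lambda>r. r n) ` carrier (res (free_module A (Suc n))) = carrier (res (regular A))"
  proof
    show "carrier (res (regular A)) \<subseteq> (\<lambda>r. r n) ` carrier (res (free_module A (Suc n)))"
    proof
      fix x assume "x \<in> carrier (res (regular A))"
      then show "x \<in> (\<lambda>r. r n) ` carrier (res (free_module A (Suc n)))"
        by (intro image_eqI[of _ "\<lambda>r. r n" "(\<lambda>_. \<zero>\<^sub>A)(n := x)"]) auto
    qed
  qed auto
  have k: "ker (res (free_module A (Suc n))) (res (regular A)) (\<lambda>r. r n) = carrier (free_module A n)"
    using A.ker_coord[of n] unfolding ker_def by simp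
  from lin.flen_ker_image[OF l s] show ?case
    using Suc flen_rs_regular by (simp only: k restrict_scalars_sub free_module_sub)
qed

sublocale AF: finlen_ring A by (rule finlen_A)

lemma flen_rs:
  assumes "fg_mod A M"
  shows "flen K (res M)"
proof -
  obtain n \<phi> where \<phi>: "lin A (free_module A n) M \<phi>" "\<phi> ` carrier (free_module A n) = carrier M"
    using fg_free_cover[OF assms] by metis
  show ?thesis using lin.flen_ker_image[OF lin_rs[OF \<phi>(1)]] \<phi>(2) flen_rs_free[of n] by simp
qed

lemma right_module_hom_space:
  assumes M: "right_module A M" and N: "right_module A N"
  shows "right_module K (Hom M N)"
  unfolding hom_space_def
proof (rule right_module_smult_cong)
  interpret M: right_module A M by (rule M)
  show "right_module K (with_smult (hom_group A M N) (\<lambda>c f. \<lambda>x\<in>carrier M. f ((c \<odot>\<^sub>A \<one>\<^sub>A) \<odot>\<^sub>M x)))"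
  proof (rule right_module_hom_action[OF M N K_ring])
    show "lin A M M (\<lambda>x. (c \<odot>\<^sub>A \<one>\<^sub>A) \<odot>\<^sub>M x)" if "c \<in> carrier K" for c
      using that by (intro linI[OF M M]) (simp_all add: M.smult_r_distr scalar_central[OF M])
    show "((c \<otimes>\<^sub>K e) \<odot>\<^sub>A \<one>\<^sub>A) \<odot>\<^sub>M x = (c \<odot>\<^sub>A \<one>\<^sub>A) \<odot>\<^sub>M ((e \<odot>\<^sub>A \<one>\<^sub>A) \<odot>\<^sub>M x)"
      if "c \<in> carrier K" "e \<in> carrier K" "x \<in> carrier M" for c e x
      using that right_module.smult_assoc[OF right_module_rs[OF M], of e c x] by (simp add: K.m_comm)
  qed (simp_all add: smult_l_distr M.smult_l_distr M.smult_one)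
  show "(\<lambda>x\<in>carrier M. (c \<odot>\<^sub>A \<one>\<^sub>A) \<odot>\<^sub>N f x) = (\<lambda>x\<in>carrier M. f ((c \<odot>\<^sub>A \<one>\<^sub>A) \<odot>\<^sub>M x))"
    if "c \<in> carrier K" "f \<in> carrier (hom_group A M N)" for c f
    using that lin.smult[OF rhom_lin[OF M N], of f "c \<odot>\<^sub>A \<one>\<^sub>A"] by (simp add: fun_eq_iff)
qed

lemma lin_precomp:
  assumes N: "right_module A N" and f: "lin A M M' f"
  shows "lin K (Hom M' N) (Hom M N) (\<lambda>g. \<lambda>x\<in>carrier M. g (f x))"
proof -
  interpret f: lin A M M' f by fact
  show ?thesis
  proof (rule linI[OF right_module_hom_space[OF f.cod_mod N] right_module_hom_space[OF f.dom_mod N]])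
    fix g assume "g \<in> carrier (Hom M' N)"
    then have "lin A M' N g" using rhom_lin[OF f.cod_mod N] by simp
    then show "(\<lambda>x\<in>carrier M. g (f x)) \<in> carrier (Hom M N)"
      using lin.in_rhom[OF lin_comp[OF f]] by simp
  qed (auto simp: fun_eq_iff)
qed

lemma lin_postcomp:
  assumes M: "right_module A M" and f: "lin A N N' f"
  shows "lin K (Hom M N) (Hom M N') (\<lambda>g. \<lambda>x\<in>carrier M. f (g x))"
proof -
  interpret f: lin A N N' f by fact
  show ?thesis
  proof (rule linI[OF right_module_hom_space[OF M f.dom_mod] right_module_hom_space[OF M f.cod_mod]])
    fix g assume "g \<in> carrier (Hom M N)"
    then have "lin A M N g" using rhom_lin[OF M f.dom_mod] by simp
    then show "(\<lambda>x\<in>carrier M. f (g x)) \<in> carrier (Hom M N')"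
      using lin.in_rhom[OF lin_comp[OF _ f]] by simp
  next
    fix g h assume "g \<in> carrier (Hom M N)" "h \<in> carrier (Hom M N)"
    then show "(\<lambda>x\<in>carrier M. f ((g \<oplus>\<^bsub>Hom M N\<^esub> h) x)) =
       (\<lambda>x\<in>carrier M. f (g x)) \<oplus>\<^bsub>Hom M N'\<^esub> (\<lambda>x\<in>carrier M. f (h x))"
      by (auto simp: fun_eq_iff rhom_closed f.add)
  next
    fix c g assume "c \<in> carrier K" "g \<in> carrier (Hom M N)"
    then show "(\<lambda>x\<in>carrier M. f ((c \<odot>\<^bsub>Hom M N\<^esub> g) x)) =
        c \<odot>\<^bsub>Hom M N'\<^esub> (\<lambda>x\<in>carrier M. f (g x))"
      by (auto simp: fun_eq_iff rhom_closed f.smult)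
  qed
qed

lemma hom_space_sub:
  "(Hom M N) \<down> (rhom A M (N \<down> U)) = Hom M (N \<down> U)"
  by (simp add: hom_space_def hom_group_def with_smult_def ring.defs module.defs)

definition hdim :: "('a, 'm) module \<Rightarrow> ('a, 'n) module \<Rightarrow> nat" where
  "hdim M N = len K (Hom M N)"

text \<open>Restriction along \<open>j\<close> maps Hom(S, L) onto Hom(N, L), and its kernel is the
  image of Hom(M, L) under composition with \<open>p\<close>.\<close>

lemma hom_space_biprod:
  assumes b: "biprod A M N S i j p q" and L: "right_module A L"
    and f: "flen K (Hom M L)" "flen K (Hom N L)"
  shows "flen K (Hom S L)" "hdim S L = hdim M L + hdim N L"
proof -
  note b' = biprodD[OF b]
  note M = lin.dom_mod[OF b'(1)] and N = lin.dom_mod[OF b'(2)] and S = lin.cod_mod[OF b'(1)]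
  let ?J = "\<lambda>g. \<lambda>x\<in>carrier N. g (j x)" and ?P = "\<lambda>g. \<lambda>x\<in>carrier S. g (p x)"
  interpret J: lin K "Hom S L" "Hom N L" ?J by (rule lin_precomp[OF L b'(2)])
  have surj: "?J ` carrier (Hom S L) = carrier (Hom N L)"
  proof
    show "carrier (Hom N L) \<subseteq> ?J ` carrier (Hom S L)"
    proof
      fix g assume g: "g \<in> carrier (Hom N L)"
      then have g': "g \<in> rhom A N L" by simp
      have "(\<lambda>x\<in>carrier S. g (q x)) \<in> carrier (Hom S L)"
        using lin.in_rhom[OF lin_comp[OF b'(4) rhom_lin[OF N L g']]] by simp
      moreover have "g = ?J (\<lambda>x\<in>carrier S. g (q x))"
        using lin.closed[OF b'(2)] rhom_undefined[OF g'] by (auto simp: fun_eq_iff b'(7))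
      ultimately show "g \<in> ?J ` carrier (Hom S L)" by (intro image_eqI[of g ?J])
    qed
  qed (use J.closed in auto)
  interpret P: lin K "Hom M L" "Hom S L" ?P by (rule lin_precomp[OF L b'(3)])
  have im: "?P ` carrier (Hom M L) = ker (Hom S L) (Hom N L) ?J"
  proof
    show "?P ` carrier (Hom M L) \<subseteq> ker (Hom S L) (Hom N L) ?J"
    proof
      fix h assume "h \<in> ?P ` carrier (Hom M L)"
      then obtain g where g: "g \<in> carrier (Hom M L)" "h = ?P g" by auto
      then have "lin A M L g" using rhom_lin[OF M L] by simp
      then have "g \<zero>\<^sub>M = \<zero>\<^sub>L" by (rule lin.zero)
      then have "?J h = \<zero>\<^bsub>Hom N L\<^esub>"
        unfolding g(2) using lin.closed[OF b'(2)] by (auto simp: fun_eq_iff b'(8))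
      then show "h \<in> ker (Hom S L) (Hom N L) ?J"
        unfolding ker_iff using P.closed[OF g(1)] g(2) by blast
    qed
    show "ker (Hom S L) (Hom N L) ?J \<subseteq> ?P ` carrier (Hom M L)"
    proof
      fix h assume "h \<in> ker (Hom S L) (Hom N L) ?J"
      then have h: "h \<in> rhom A S L" "?J h = (\<lambda>x\<in>carrier N. \<zero>\<^sub>L)" by (simp_all add: ker_iff)
      interpret h: lin A S L h by (rule rhom_lin[OF S L h(1)])
      have hj: "h (j y) = \<zero>\<^sub>L" if "y \<in> carrier N" for y using fun_cong[OF h(2), of y] that by simp
      have hp: "h (i (p s)) = h s" if s: "s \<in> carrier S" for s
      proof -
        note c = lin.closed[OF b'(3) s] lin.closed[OF b'(4) s]
        have "h (i (p s) \<oplus>\<^sub>S j (q s)) = h (i (p s))"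
          using c hj lin.closed[OF b'(1) c(1)] lin.closed[OF b'(2) c(2)] by (simp add: h.add)
        then show ?thesis using b'(9)[OF s] by simp
      qed
      have "h = ?P (\<lambda>x\<in>carrier M. h (i x))"
        using hp lin.closed[OF b'(3)] rhom_undefined[OF h(1)] by (auto simp: fun_eq_iff)
      moreover have "(\<lambda>x\<in>carrier M. h (i x)) \<in> carrier (Hom M L)"
        using lin.in_rhom[OF lin_comp[OF b'(1) h.lin_axioms]] by simp
      ultimately show "h \<in> ?P ` carrier (Hom M L)" by (rule image_eqI)
    qed
  qed
  have inj: "inj_on ?P (carrier (Hom M L))"
  proof (rule inj_onI)
    fix g h assume gh: "g \<in> carrier (Hom M L)" "h \<in> carrier (Hom M L)" "?P g = ?P h"
    have "g x = h x" if "x \<in> carrier M" for x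
      using fun_cong[OF gh(3), of "i x"] that lin.closed[OF b'(1) that] by (simp add: b'(5))
    then show "g = h" using gh(1,2) rhom_ext[of g A M L h] by simp
  qed
  interpret P': lin K "Hom M L" "(Hom S L) \<down> ker (Hom S L) (Hom N L) ?J" ?P
    by (rule P.restrict_codomain[OF J.submodule_ker]) (simp only: im)
  have bij: "bij_betw ?P (carrier (Hom M L))
      (carrier ((Hom S L) \<down> ker (Hom S L) (Hom N L) ?J))"
    unfolding bij_betw_def using inj im by simp
  note l = P'.len_bij[OF bij f(1)]
  show fS: "flen K (Hom S L)" using J.flen_ker_image[OF surj] l(1) f(2) by simp
  show "hdim S L = hdim M L + hdim N L"
    unfolding hdim_def using J.len_ker_image[OF surj fS] l(2) by simp
qed

lemma flen_hom_regular:
  assumes M: "fg_mod A M"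
  shows "flen K (Hom (regular A) M)"
proof -
  note Mr = fg_modD[OF M]
  have l: "lin K (Hom (regular A) M) (res M) (\<lambda>f. f \<one>\<^sub>A)"
    by (rule linI[OF right_module_hom_space[OF A.right_module_regular Mr] right_module_rs[OF Mr]])
      (simp_all add: rhom_closed)
  have "inj_on (\<lambda>f. f \<one>\<^sub>A) (carrier (Hom (regular A) M))"
  proof (rule inj_onI)
    fix f g assume fg: "f \<in> carrier (Hom (regular A) M)" "g \<in> carrier (Hom (regular A) M)"
      "f \<one>\<^sub>A = g \<one>\<^sub>A"
    then have fg': "f \<in> rhom A (regular A) M" "g \<in> rhom A (regular A) M" by simp_all
    note l = rhom_lin[OF A.right_module_regular Mr]
    have "f x = g x" if "x \<in> carrier A" for x
      using lin.smult[OF l[OF fg'(1)], of x "\<one>\<^sub>A"] lin.smult[OF l[OF fg'(2)], of x "\<one>\<^sub>A"] that fg(3) by simp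
    then show "f = g" using rhom_ext[OF fg'] by simp
  qed
  then show ?thesis by (rule lin.len_inj(1)[OF l _ flen_rs[OF M]])
qed

lemma hom_space_from_zero:
  assumes "right_module A N" "right_module A M" "carrier N = {\<zero>\<^sub>N}"
  shows "flen K (Hom N M)" "hdim N M = 0"
proof -
  interpret H: right_module K "Hom N M" by (rule right_module_hom_space[OF assms(1,2)])
  have "carrier (Hom N M) = {\<zero>\<^bsub>Hom N M\<^esub>}"
  proof (intro equalityI subsetI)
    fix f assume "f \<in> carrier (Hom N M)"
    then have f: "f \<in> rhom A N M" by simp
    have "f x = (\<lambda>x\<in>carrier N. \<zero>\<^sub>M) x" if "x \<in> carrier N" for x
      using lin.zero[OF rhom_lin[OF assms(1,2) f]] that assms(3) by simp
    then have "f = (\<lambda>x\<in>carrier N. \<zero>\<^sub>M)"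
      using rhom_undefined[OF f] by (auto simp: fun_eq_iff)
    then show "f \<in> {\<zero>\<^bsub>Hom N M\<^esub>}" by simp
  qed (use lin.in_rhom[OF lin_zero[OF assms(1,2)]] in simp)
  then show "flen K (Hom N M)" "hdim N M = 0"
    using H.len_zero unfolding hdim_def by simp_all
qed

lemma flen_hom_free: "fg_mod A M \<Longrightarrow> flen K (Hom (free_module A n) M)"
proof (induction n)
  case 0
  show ?case by (rule hom_space_from_zero(1)[OF A.right_module_free fg_modD[OF 0]]) auto
next
  case (Suc n)
  show ?case
    by (rule hom_space_biprod(1)[OF A.biprod_free fg_modD[OF Suc(2)] Suc(1)[OF Suc(2)] flen_hom_regular[OF Suc(2)]])
qed

lemma precomp_surj_inj:
  assumes M: "right_module A M" and a: "lin A N N' a" and s: "a ` carrier N = carrier N'"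
  shows "inj_on (\<lambda>g. \<lambda>x\<in>carrier N. g (a x)) (carrier (Hom N' M))"
proof (rule inj_onI)
  fix f g assume fg: "f \<in> carrier (Hom N' M)" "g \<in> carrier (Hom N' M)"
    "(\<lambda>x\<in>carrier N. f (a x)) = (\<lambda>x\<in>carrier N. g (a x))"
  have "f y = g y" if y: "y \<in> carrier N'" for y
  proof -
    obtain x where "x \<in> carrier N" "y = a x" using y unfolding s[symmetric] by (elim imageE)
    then show ?thesis using fun_cong[OF fg(3), of x] by simp
  qed
  then show "f = g" using fg(1,2) rhom_ext[of f A N' M g] by simp
qed

lemma flen_hom:
  assumes N: "fg_mod A N" and M: "fg_mod A M"
  shows "flen K (Hom N M)"
proof -
  obtain n \<phi> where \<phi>: "lin A (free_module A n) N \<phi>" "\<phi> ` carrier (free_module A n) = carrier N"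
    using fg_free_cover[OF N] by metis
  show ?thesis
    by (rule lin.len_inj(1)[OF lin_precomp[OF fg_modD[OF M] \<phi>(1)] precomp_surj_inj[OF fg_modD[OF M] \<phi>] flen_hom_free[OF M]])
qed

lemma hdim_le_precomp:
  assumes M: "fg_mod A M" and N: "fg_mod A N" and a: "lin A N N' a" "a ` carrier N = carrier N'"
  shows "hdim N' M \<le> hdim N M"
proof -
  note l = lin_precomp[OF fg_modD[OF M] a(1)]
  show ?thesis
    unfolding hdim_def lin.len_inj(2)[OF l precomp_surj_inj[OF fg_modD[OF M] a] flen_hom[OF N M]]
    by (rule right_module.len_sub_le[OF lin.cod_mod[OF l] lin.submodule_range[OF l] flen_hom[OF N M]])
qed

lemma hdim_iso_left:
  assumes M: "fg_mod A M" and N: "fg_mod A N" and a: "lin A N N' a" "bij_betw a (carrier N) (carrier N')"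
  shows "hdim N M = hdim N' M"
proof (rule antisym)
  have s: "a ` carrier N = carrier N'" using a(2) by (simp add: bij_betw_def)
  show "hdim N' M \<le> hdim N M" by (rule hdim_le_precomp[OF M N a(1) s])
  show "hdim N M \<le> hdim N' M"
    using bij_betw_inv_into[OF a(2)]
    by (intro hdim_le_precomp[OF M fg_image[OF a(1) s N] lin.inv_into_lin[OF a]]) (simp add: bij_betw_def)
qed

text \<open>Composition with \<open>u\<close> embeds one Hom space in the other. The third claim
  serves to tell a summand from its radical: some map does not factor through
  \<open>u\<close>.\<close>

lemma hdim_le_postcomp:
  assumes N: "fg_mod A N" and M': "fg_mod A M'" and u: "lin A M M' u"
    and inj: "\<And>f. \<lbrakk>lin A N M f; \<And>x. x \<in> carrier N \<Longrightarrow> u (f x) = \<zero>\<^sub>M'\<rbrakk> \<Longrightarrow> \<forall>x\<in>carrier N. f x = \<zero>\<^sub>M"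
  shows "flen K (Hom N M)" "hdim N M \<le> hdim N M'"
    "(\<exists>f. lin A N M' f \<and> (\<forall>g. lin A N M g \<longrightarrow> (\<exists>x\<in>carrier N. u (g x) \<noteq> f x))) \<Longrightarrow> hdim N M < hdim N M'"
proof -
  note N' = fg_modD[OF N]
  let ?U = "\<lambda>g. \<lambda>x\<in>carrier N. u (g x)"
  interpret U: lin K "Hom N M" "Hom N M'" ?U by (rule lin_postcomp[OF N' u])
  have "inj_on ?U (carrier (Hom N M))"
    unfolding U.inj_iff
  proof (intro ballI impI)
    fix f assume f: "f \<in> carrier (Hom N M)" "?U f = \<zero>\<^bsub>Hom N M'\<^esub>"
    then have f': "f \<in> rhom A N M" by simp
    have "u (f x) = \<zero>\<^sub>M'" if "x \<in> carrier N" for x using fun_cong[OF f(2), of x] that by simp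
    then have "\<forall>x\<in>carrier N. f x = \<zero>\<^sub>M" by (rule inj[OF rhom_lin[OF N' lin.dom_mod[OF u] f']])
    then show "f = \<zero>\<^bsub>Hom N M\<^esub>" using rhom_undefined[OF f'] by (auto simp: fun_eq_iff)
  qed
  note l = U.len_inj[OF this flen_hom[OF N M']]
  show "flen K (Hom N M)" by (rule l(1))
  show "hdim N M \<le> hdim N M'"
    unfolding hdim_def l(2) by (rule U.N.len_sub_le[OF U.submodule_range flen_hom[OF N M']])
  assume "\<exists>f. lin A N M' f \<and> (\<forall>g. lin A N M g \<longrightarrow> (\<exists>x\<in>carrier N. u (g x) \<noteq> f x))"
  then obtain f where f: "lin A N M' f" "\<And>g. lin A N M g \<Longrightarrow> \<exists>x\<in>carrier N. u (g x) \<noteq> f x" by metis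
  have "?U ` carrier (Hom N M) \<noteq> carrier (Hom N M')"
  proof
    assume "?U ` carrier (Hom N M) = carrier (Hom N M')"
    then have "restrict f (carrier N) \<in> ?U ` carrier (Hom N M)" using lin.in_rhom[OF f(1)] by simp
    then obtain g where g: "g \<in> rhom A N M" "restrict f (carrier N) = ?U g" by auto
    then obtain x where "x \<in> carrier N" "u (g x) \<noteq> f x" using f(2)[OF rhom_lin[OF N' lin.dom_mod[OF u] g(1)]] by metis
    then show False using fun_cong[OF g(2), of x] by simp
  qed
  then show "hdim N M < hdim N M'"
    unfolding hdim_def l(2) by (rule U.N.len_sub_less[OF U.submodule_range flen_hom[OF N M']])
qed

lemma hdim_iso_right:
  assumes N: "fg_mod A N" and M: "fg_mod A M" "fg_mod A M'" and u: "lin A M M' u"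
    and inj: "\<And>f. \<lbrakk>lin A N M f; \<And>x. x \<in> carrier N \<Longrightarrow> u (f x) = \<zero>\<^sub>M'\<rbrakk> \<Longrightarrow> \<forall>x\<in>carrier N. f x = \<zero>\<^sub>M"
    and surj: "\<And>f. lin A N M' f \<Longrightarrow> lifts_along A N M u f"
  shows "hdim N M = hdim N M'"
proof -
  note N' = fg_modD[OF N]
  let ?U = "\<lambda>g. \<lambda>x\<in>carrier N. u (g x)"
  interpret U: lin K "Hom N M" "Hom N M'" ?U by (rule lin_postcomp[OF N' u])
  have "?U ` carrier (Hom N M) = carrier (Hom N M')"
  proof
    show "carrier (Hom N M') \<subseteq> ?U ` carrier (Hom N M)"
    proof
      fix f assume "f \<in> carrier (Hom N M')"
      then have f: "f \<in> rhom A N M'" by simp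
      obtain g where g: "lin A N M g" "\<forall>x\<in>carrier N. u (g x) = f x"
        using surj[OF rhom_lin[OF N' fg_modD[OF M(2)] f]] by metis
      have "f = ?U (restrict g (carrier N))" using g(2) rhom_undefined[OF f] by (auto simp: fun_eq_iff)
      then show "f \<in> ?U ` carrier (Hom N M)"
        using lin.in_rhom[OF g(1)] by (intro image_eqI[of f ?U]) simp_all
    qed
  qed (use U.closed in auto)
  then show ?thesis
    using hdim_le_postcomp(2)[OF N M(2) u inj] U.len_ker_image[OF _ flen_hom[OF N M(1)]]
    unfolding hdim_def by simp
qed

lemma hdim_exact:
  assumes N: "fg_mod A N" and M: "fg_mod A M" and w: "lin A M M' w" "w ` carrier M = carrier M'"
    and surj: "\<And>f. lin A N M' f \<Longrightarrow> lifts_along A N M w f"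
  shows "hdim N M = hdim N (M \<down> ker M M' w) + hdim N M'"
proof -
  note N' = fg_modD[OF N]
  interpret w: lin A M M' w by (rule w(1))
  let ?U = "\<lambda>g. \<lambda>x\<in>carrier N. w (g x)"
  interpret U: lin K "Hom N M" "Hom N M'" ?U by (rule lin_postcomp[OF N' w(1)])
  have s: "?U ` carrier (Hom N M) = carrier (Hom N M')"
  proof
    show "carrier (Hom N M') \<subseteq> ?U ` carrier (Hom N M)"
    proof
      fix f assume "f \<in> carrier (Hom N M')"
      then have f: "f \<in> rhom A N M'" by simp
      obtain g where g: "lin A N M g" "\<forall>x\<in>carrier N. w (g x) = f x"
        using surj[OF rhom_lin[OF N' w.cod_mod f]] by metis
      have "f = ?U (restrict g (carrier N))" using g(2) rhom_undefined[OF f] by (auto simp: fun_eq_iff)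
      then show "f \<in> ?U ` carrier (Hom N M)"
        using lin.in_rhom[OF g(1)] by (intro image_eqI[of f ?U]) simp_all
    qed
  qed (use U.closed in auto)
  have k: "ker (Hom N M) (Hom N M') ?U = rhom A N (M \<down> ker M M' w)"
  proof (intro equalityI subsetI)
    fix f assume f: "f \<in> ker (Hom N M) (Hom N M') ?U"
    then have f': "f \<in> rhom A N M" "?U f = (\<lambda>x\<in>carrier N. \<zero>\<^sub>M')" by (simp_all add: ker_iff)
    have "w (f x) = \<zero>\<^sub>M'" if "x \<in> carrier N" for x using fun_cong[OF f'(2), of x] that by simp
    then show "f \<in> rhom A N (M \<down> ker M M' w)"
      using f'(1) by (auto simp: rhom_def ker_iff PiE_def Pi_def)
  next
    fix f assume "f \<in> rhom A N (M \<down> ker M M' w)"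
    then show "f \<in> ker (Hom N M) (Hom N M') ?U"
      by (auto simp: rhom_def ker_iff PiE_def Pi_def fun_eq_iff)
  qed
  show ?thesis
    unfolding hdim_def using U.len_ker_image[OF s flen_hom[OF N M]] k by (simp add: hom_space_sub)
qed

text \<open>The sequence 0 -> Hom(N, M) -> Hom(P0, M) -> Hom(P1, M) -> 0 is exact: its left part is
  so for any presentation, and surjectivity at the right end is the assumption
  \<open>fac\<close>.\<close>

lemma hdim_presentation:
  assumes M: "fg_mod A M" and P0: "fg_mod A P0" and d: "lin A P1 P0 d" and p: "lin A P0 N p"
    and s: "p ` carrier P0 = carrier N" and ex: "d ` carrier P1 = ker P0 N p"
    and fac: "\<And>f. lin A P1 M f \<Longrightarrow> extends_along A P1 P0 M d f"
  shows "hdim P0 M = hdim N M + hdim P1 M"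
proof -
  note M' = fg_modD[OF M]
  interpret d: lin A P1 P0 d by fact
  interpret p: lin A P0 N p by fact
  let ?D = "\<lambda>g. \<lambda>x\<in>carrier P1. g (d x)" and ?P = "\<lambda>g. \<lambda>x\<in>carrier P0. g (p x)"
  interpret D: lin K "Hom P0 M" "Hom P1 M" ?D by (rule lin_precomp[OF M' d])
  interpret P: lin K "Hom N M" "Hom P0 M" ?P by (rule lin_precomp[OF M' p])
  have surj: "?D ` carrier (Hom P0 M) = carrier (Hom P1 M)"
  proof
    show "carrier (Hom P1 M) \<subseteq> ?D ` carrier (Hom P0 M)"
    proof
      fix f assume "f \<in> carrier (Hom P1 M)"
      then have f: "f \<in> rhom A P1 M" by simp
      obtain g where g: "lin A P0 M g" "\<forall>x\<in>carrier P1. g (d x) = f x"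
        using fac[OF rhom_lin[OF d.dom_mod M' f]] by metis
      have "f = ?D (restrict g (carrier P0))" using g(2) rhom_undefined[OF f] by (auto simp: fun_eq_iff)
      then show "f \<in> ?D ` carrier (Hom P0 M)"
        using lin.in_rhom[OF g(1)] by (intro image_eqI[of f ?D]) simp_all
    qed
  qed (use D.closed in auto)
  have k: "?P ` carrier (Hom N M) = ker (Hom P0 M) (Hom P1 M) ?D"
  proof (intro equalityI subsetI)
    fix h assume "h \<in> ?P ` carrier (Hom N M)"
    then obtain g where g: "g \<in> carrier (Hom N M)" "h = ?P g" by auto
    have gl: "lin A N M g" using g(1) rhom_lin[OF p.cod_mod M'] by simp
    have "g (p (d x)) = \<zero>\<^sub>M" if "x \<in> carrier P1" for x
    proof -
      have "d x \<in> ker P0 N p" using that ex by auto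
      then show ?thesis using lin.zero[OF gl] by (simp add: ker_iff)
    qed
    then have "?D h = \<zero>\<^bsub>Hom P1 M\<^esub>" unfolding g(2) by (auto simp: fun_eq_iff)
    then show "h \<in> ker (Hom P0 M) (Hom P1 M) ?D"
      unfolding ker_iff using P.closed[OF g(1)] g(2) by metis
  next
    fix h assume h: "h \<in> ker (Hom P0 M) (Hom P1 M) ?D"
    then have h': "h \<in> rhom A P0 M" "?D h = (\<lambda>x\<in>carrier P1. \<zero>\<^sub>M)" by (simp_all add: ker_iff)
    have hd: "h (d x) = \<zero>\<^sub>M" if "x \<in> carrier P1" for x using fun_cong[OF h'(2), of x] that by simp
    have "h x = \<zero>\<^sub>M" if "x \<in> carrier P0" "p x = \<zero>\<^sub>N" for x
    proof -
      have "x \<in> d ` carrier P1" unfolding ex using that by (simp add: ker_iff)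
      then show ?thesis using hd by auto
    qed
    from p.factor_surj[OF rhom_lin[OF p.dom_mod M' h'(1)] s this]
    obtain g where g: "lin A N M g" "\<forall>x\<in>carrier P0. g (p x) = h x" by metis
    have "h = ?P (restrict g (carrier N))" using g(2) rhom_undefined[OF h'(1)] by (auto simp: fun_eq_iff)
    then show "h \<in> ?P ` carrier (Hom N M)"
      using lin.in_rhom[OF g(1)] by (intro image_eqI[of h ?P]) simp_all
  qed
  interpret P': lin K "Hom N M" "(Hom P0 M) \<down> ker (Hom P0 M) (Hom P1 M) ?D" ?P
    by (rule P.restrict_codomain[OF D.submodule_ker]) (simp only: k order_refl)
  have bij: "bij_betw ?P (carrier (Hom N M))
      (carrier ((Hom P0 M) \<down> ker (Hom P0 M) (Hom P1 M) ?D))"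
    unfolding bij_betw_def using precomp_surj_inj[OF M' p s] k by simp
  show ?thesis
    unfolding hdim_def
    using D.len_ker_image[OF surj flen_hom[OF P0 M]] P'.len_bij(2)[OF bij flen_hom[OF fg_image[OF p s P0] M]]
    by simp
qed

text \<open>The coefficients are multiplicities of the modules \<open>eA\<close> in
  \<open>P\<close>. They are found by splitting \<open>P\<close> repeatedly, with the length as
  measure, until the indecomposable pieces are recognised by
  \<open>indecomposable_retract_free\<close>.\<close>

lemma hdim_projective:
  assumes E: "prim_decomp A E"
  shows "projective A P \<Longrightarrow> \<exists>m :: 'a \<Rightarrow> nat. \<forall>M :: 'a std_module. fg_mod A M \<longrightarrow>
    hdim P M = (\<Sum>e\<in>E. m e * hdim (principal_right A e) M)"
proof (induction "len A P" arbitrary: P rule: less_induct)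
  case less
  note fgP = projective_fg[OF less(2)]
  note fP = AF.fg_flen[OF fgP]
  interpret P: right_module A P by (rule fg_modD[OF fgP])
  consider "carrier P = {\<zero>\<^sub>P}" | "indecomposable A P" |
    N N' where "complementary A P N N'" "N \<noteq> {\<zero>\<^sub>P}" "N' \<noteq> {\<zero>\<^sub>P}"
    unfolding indecomposable_def by metis
  then show ?case
  proof cases
    case 1
    then show ?thesis
      using hom_space_from_zero(2)[OF P.right_module_axioms fg_modD] by (intro exI[of _ "\<lambda>_. 0"]) auto
  next
    case 2
    obtain n i p where ip: "lin A P (free_module A n) i" "lin A (free_module A n) P p" "\<forall>x\<in>carrier P. p (i x) = x"
      using AF.projective_retract_free[OF less(2)] by metis
    obtain e f where e: "e \<in> E" "lin A P (principal_right A e) f"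
      "bij_betw f (carrier P) (carrier (principal_right A e))"
      using AF.indecomposable_retract_free[OF E 2 fP ip(1,2)] ip(3) by metis
    have "hdim P M = (\<Sum>e'\<in>E. (if e' = e then 1 else 0) * hdim (principal_right A e') M)"
      if M: "fg_mod A M" for M :: "'a std_module"
      using hdim_iso_left[OF M fgP e(2,3)] e(1) E by (simp add: prim_decomp_def if_distrib[of "\<lambda>x. x * _"] cong: if_cong)
    then show ?thesis by (intro exI[of _ "\<lambda>e'. if e' = e then 1 else 0"]) simp
  next
    case 3
    obtain p q where pq: "biprod A (P \<down> N) (P \<down> N') P (\<lambda>x. x) (\<lambda>x. x) p q"
      using complementary_projections[OF P.right_module_axioms 3(1)] by metis
    note b = biprodD[OF pq]
    have N: "submodule N A P" "submodule N' A P" "N \<inter> N' = {\<zero>\<^sub>P}" using 3(1) by (simp_all add: complementary_def)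
    have ne: "N \<noteq> carrier P" "N' \<noteq> carrier P" using N 3(2,3) submoduleD(1)[OF N(1)] submoduleD(1)[OF N(2)] by auto
    have pr: "projective A (P \<down> N)" "projective A (P \<down> N')"
      using b(5,7) by (intro projective_retract[OF less(2) b(1,3)] projective_retract[OF less(2) b(2,4)]; simp)+
    from less(1)[OF P.len_sub_less[OF N(1) fP ne(1)] pr(1)]
    obtain m where "\<forall>M :: 'a std_module. fg_mod A M \<longrightarrow>
        hdim (P \<down> N) M = (\<Sum>e\<in>E. m e * hdim (principal_right A e) M)" by (elim exE)
    note m = this[rule_format]
    from less(1)[OF P.len_sub_less[OF N(2) fP ne(2)] pr(2)]
    obtain m' where "\<forall>M :: 'a std_module. fg_mod A M \<longrightarrow>
        hdim (P \<down> N') M = (\<Sum>e\<in>E. m' e * hdim (principal_right A e) M)" by (elim exE)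
    note m' = this[rule_format]
    have "hdim P M = (\<Sum>e\<in>E. (m e + m' e) * hdim (principal_right A e) M)"
      if M: "fg_mod A M" for M :: "'a std_module"
      using hom_space_biprod(2)[OF pq fg_modD[OF M] flen_hom[OF projective_fg[OF pr(1)] M] flen_hom[OF projective_fg[OF pr(2)] M]]
      by (simp add: m[OF M] m'[OF M] sum.distrib distrib_right)
    then show ?thesis by (intro exI[of _ "\<lambda>e. m e + m' e"]) simp
  qed
qed

lemma hdim_zero_imp:
  assumes N: "fg_mod A N" and M: "fg_mod A M" and z: "hdim N M = 0" and f: "lin A N M f" and x: "x \<in> carrier N"
  shows "f x = \<zero>\<^sub>M"
proof -
  interpret H: right_module K "Hom N M" by (rule right_module_hom_space[OF fg_modD[OF N] fg_modD[OF M]])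
  have "carrier (Hom N M) = {\<zero>\<^bsub>Hom N M\<^esub>}"
    using H.len_0_iff[OF flen_hom[OF N M]] z by (simp add: hdim_def)
  then have "restrict f (carrier N) = (\<lambda>x\<in>carrier N. \<zero>\<^sub>M)" using lin.in_rhom[OF f] by simp
  from fun_cong[OF this, of x] show ?thesis using x by simp
qed

lemma hdim_zeroI:
  assumes N: "fg_mod A N" and M: "fg_mod A M" and z: "\<And>f x. \<lbrakk>lin A N M f; x \<in> carrier N\<rbrakk> \<Longrightarrow> f x = \<zero>\<^sub>M"
  shows "hdim N M = 0"
proof -
  interpret H: right_module K "Hom N M" by (rule right_module_hom_space[OF fg_modD[OF N] fg_modD[OF M]])
  have "carrier (Hom N M) = {\<zero>\<^bsub>Hom N M\<^esub>}"
  proof (intro equalityI subsetI)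
    fix f assume "f \<in> carrier (Hom N M)"
    then have f: "f \<in> rhom A N M" by simp
    have "f = (\<lambda>x\<in>carrier N. \<zero>\<^sub>M)"
      using z[OF rhom_lin[OF fg_modD[OF N] fg_modD[OF M] f]] rhom_undefined[OF f] by (auto simp: fun_eq_iff)
    then show "f \<in> {\<zero>\<^bsub>Hom N M\<^esub>}" by simp
  qed (use lin.in_rhom[OF lin_zero[OF fg_modD[OF N] fg_modD[OF M]]] in simp)
  then show ?thesis using H.len_0_iff[OF flen_hom[OF N M]] by (simp add: hdim_def)
qed

text \<open>For \<open>x\<close> in \<open>M\<close> the map a -> x a from \<open>eA\<close> sends
  \<open>e\<close> to x e, so every x e vanishes; and the idempotents of \<open>E\<close> add up to
  1.\<close>

lemma zero_of_hdim_zero: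
  assumes E: "prim_decomp A E" and M: "fg_mod A M"
    and z: "\<And>e. e \<in> E \<Longrightarrow> hdim (principal_right A e) M = 0"
  shows "carrier M = {\<zero>\<^sub>M}"
proof -
  interpret M: right_module A M by (rule fg_modD[OF M])
  have Ei: "idempotent A e" "e \<in> carrier A" if "e \<in> E" for e
    using E that by (auto simp: prim_decomp_def primitive_idem_def idempotent_def)
  have fgQ: "fg_mod A (principal_right A e)" if "e \<in> E" for e
    unfolding principal_right_def by (rule AF.fg_sub[OF AF.fg_regular A.submodule_principal[OF Ei(2)[OF that]]])
  have ez: "e \<odot>\<^sub>M x = \<zero>\<^sub>M" if "e \<in> E" "x \<in> carrier M" for e x
  proof -
    have l: "lin A (principal_right A e) M (\<lambda>a. a \<odot>\<^sub>M x)"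
      by (rule lin_comp[OF A.lin_principal_incl[OF Ei(2)[OF that(1)]] M.lin_cyclic[OF that(2)]])
    have "e \<in> carrier (principal_right A e)"
      using Ei[OF that(1)] A.principal_mult[OF Ei(1)[OF that(1)]] by (simp add: idempotent_def)
    then show ?thesis by (rule hdim_zero_imp[OF fgQ[OF that(1)] M z[OF that(1)] l])
  qed
  have "x = \<zero>\<^sub>M" if x: "x \<in> carrier M" for x
  proof -
    have "(\<Oplus>\<^bsub>A\<^esub>e\<in>F. e) \<in> carrier A \<and> (\<Oplus>\<^bsub>A\<^esub>e\<in>F. e) \<odot>\<^sub>M x = \<zero>\<^sub>M" if "finite F" "F \<subseteq> E" for F
      using that
    proof induction
      case (insert e F)
      have "(\<Oplus>\<^bsub>A\<^esub>e\<in>insert e F. e) = e \<oplus>\<^sub>A (\<Oplus>\<^bsub>A\<^esub>e\<in>F. e)"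
        using insert Ei by (intro A.finsum_insert) auto
      then show ?case using insert Ei ez x by (simp add: M.smult_l_distr)
    qed (use x in simp)
    then have "\<one>\<^sub>A \<odot>\<^sub>M x = \<zero>\<^sub>M" using E unfolding prim_decomp_def by fastforce
    then show ?thesis using x by simp
  qed
  then show ?thesis by auto
qed

end

section \<open>Linear systems over the reals\<close>

lemma homogeneous_system:
  fixes g :: "'i \<Rightarrow> 'j \<Rightarrow> real"
  assumes "finite I" "finite J" "card I < card J"
  shows "\<exists>c. (\<exists>j\<in>J. c j \<noteq> 0) \<and> (\<forall>i\<in>I. (\<Sum>j\<in>J. g i j * c j) = 0)"
  using assms
proof (induction I arbitrary: J g)
  case empty
  then obtain j where "j \<in> J" by fastforce
  then show ?case by (intro exI[of _ "\<lambda>_. 1"]) auto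
next
  case (insert a I)
  show ?case
  proof (cases "\<forall>j\<in>J. g a j = 0")
    case True
    have "card I < card J" using insert by simp
    then obtain c where "\<exists>j\<in>J. c j \<noteq> 0" "\<forall>i\<in>I. (\<Sum>j\<in>J. g i j * c j) = 0"
      using insert.IH[OF insert.prems(1), of g] by auto
    then show ?thesis using True by (intro exI[of _ c]) auto
  next
    case False
    then obtain b where b: "b \<in> J" "g a b \<noteq> 0" by auto
    let ?J = "J - {b}"
    have J: "finite ?J" "card I < card ?J" using insert b by simp_all
    \<comment> \<open>Gaussian elimination: equation \<open>a\<close> is used to remove the unknown
      \<open>b\<close> from the others, which leaves one equation and one unknown less.\<close>
    obtain c where c: "\<exists>j\<in>?J. c j \<noteq> 0" "\<forall>i\<in>I. (\<Sum>j\<in>?J. (g i j - g i b * g a j / g a b) * c j) = 0"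
      using insert.IH[OF J, of "\<lambda>i j. g i j - g i b * g a j / g a b"] by auto
    define s where "s = (\<Sum>j\<in>?J. g a j * c j)"
    \<comment> \<open>The value at \<open>b\<close> is the one that solves equation
      \<open>a\<close>.\<close>
    define c' where "c' = c(b := - s / g a b)"
    have split: "(\<Sum>j\<in>J. g i j * c' j) = g i b * (- s / g a b) + (\<Sum>j\<in>?J. g i j * c j)" for i
    proof -
      have "(\<Sum>j\<in>?J. g i j * c' j) = (\<Sum>j\<in>?J. g i j * c j)" by (intro sum.cong) (auto simp: c'_def)
      then show ?thesis using insert.prems(1) b(1) by (simp add: sum.remove[of J b] c'_def)
    qed
    have "(\<Sum>j\<in>J. g i j * c' j) = 0" if "i \<in> I" for i
    proof -
      have "0 = (\<Sum>j\<in>?J. (g i j - g i b * g a j / g a b) * c j)" using c(2) that by simp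
      also have "\<dots> = (\<Sum>j\<in>?J. g i j * c j - g i b / g a b * (g a j * c j))"
        by (intro sum.cong) (simp_all add: algebra_simps)
      also have "\<dots> = (\<Sum>j\<in>?J. g i j * c j) - g i b / g a b * s"
        unfolding sum_subtractf sum_distrib_left[symmetric] s_def by simp
      finally show ?thesis unfolding split by simp
    qed
    moreover have "(\<Sum>j\<in>J. g a j * c' j) = 0" unfolding split using b(2) by (simp add: s_def)
    moreover have "\<exists>j\<in>J. c' j \<noteq> 0" using c(1) by (auto simp: c'_def)
    ultimately show ?thesis by (intro exI[of _ c']) auto
  qed
qed

text \<open>A square matrix with independent rows has trivial kernel. Were \<open>v a\<close>
  nonzero, some nontrivial combination of the rows would vanish in every column except
  \<open>a\<close>; pairing it with \<open>v\<close> shows that it vanishes there as well.\<close>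

lemma square_system:
  fixes g :: "'i \<Rightarrow> 'k \<Rightarrow> real"
  assumes fin: "finite S" "finite E" "card S = card E"
    and indep: "\<And>c. (\<And>k. k \<in> E \<Longrightarrow> (\<Sum>i\<in>S. c i * g i k) = 0) \<Longrightarrow> \<forall>i\<in>S. c i = 0"
    and v: "\<And>i. i \<in> S \<Longrightarrow> (\<Sum>k\<in>E. g i k * v k) = 0" and a: "a \<in> E"
  shows "v a = 0"
proof (rule ccontr)
  assume va: "v a \<noteq> 0"
  have "card (E - {a}) < card S" using fin a by (metis card_Diff1_less)
  then obtain c where c: "\<exists>i\<in>S. c i \<noteq> 0" "\<forall>k\<in>E - {a}. (\<Sum>i\<in>S. g i k * c i) = 0"
    using homogeneous_system[of "E - {a}" S "\<lambda>k i. g i k"] fin by auto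
  define s where "s k = (\<Sum>i\<in>S. c i * g i k)" for k
  have s0: "s k = 0" if "k \<in> E - {a}" for k using c(2) that by (simp add: s_def mult.commute)
  have "0 = (\<Sum>i\<in>S. c i * (\<Sum>k\<in>E. g i k * v k))" using v by simp
  also have "\<dots> = (\<Sum>k\<in>E. s k * v k)"
    unfolding s_def sum_distrib_left sum_distrib_right by (subst sum.swap) (simp add: mult.assoc)
  also have "\<dots> = s a * v a" using fin a s0 by (simp add: sum.remove[of E a])
  finally have "s a = 0" using va by simp
  then have "\<forall>i\<in>S. c i = 0" using s0 by (intro indep) (metis DiffI s_def singletonD)
  then show False using c(1) by auto
qed

section \<open>Linear functionals\<close>

text \<open>Take \<open>W\<close> maximal with zero intersection with \<open>U\<close>. A vector
  outside U + W could be added to \<open>W\<close> without meeting \<open>U\<close>, since a nonzero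
  coefficient of it could be divided out.\<close>

lemma field_complement:
  assumes K: "field K" and V: "right_module K V" and f: "flen K V" and U: "submodule U K V"
  shows "\<exists>U'. complementary K V U U'"
proof -
  interpret K: field K by fact
  interpret V: right_module K V by fact
  define F where "F = {W. submodule W K V \<and> U \<inter> W = {\<zero>\<^sub>V}}"
  have "{\<zero>\<^sub>V} \<in> F" unfolding F_def using V.submodule_zero submoduleD(2)[OF U] by auto
  then have "\<exists>W\<in>F. \<forall>W'\<in>F. W \<subseteq> W' \<longrightarrow> W = W'"
    by (rule V.ex_maximal_submodule[OF f]) (simp add: F_def)
  then obtain W where W: "W \<in> F" and max: "\<And>W'. W' \<in> F \<Longrightarrow> W \<subseteq> W' \<Longrightarrow> W = W'" by auto
  then have sW: "submodule W K V" "U \<inter> W = {\<zero>\<^sub>V}" by (simp_all add: F_def)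
  note S = V.submodule_set_add[OF U sW(1)]
  have "v \<in> U <+>\<^sub>V W" if v: "v \<in> carrier V" for v
  proof (rule ccontr)
    assume nv: "v \<notin> U <+>\<^sub>V W"
    let ?C = "(\<lambda>a. a \<odot>\<^sub>V v) ` carrier K"
    note C = V.submodule_cyclic[OF v]
    have "u = \<zero>\<^sub>V" if u: "u \<in> U" "u \<in> W <+>\<^sub>V ?C" for u
    proof -
      obtain w c where wc: "w \<in> W" "c \<in> carrier K" "u = w \<oplus>\<^sub>V c \<odot>\<^sub>V v"
        using u(2) V.set_add_iff[of u W ?C] by auto
      have cl: "u \<in> carrier V" "w \<in> carrier V" using submoduleD(3)[OF U u(1)] submoduleD(3)[OF sW(1) wc(1)] .
      have "c = \<zero>\<^sub>K"
      proof (rule ccontr)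
        assume "c \<noteq> \<zero>\<^sub>K"
        then have c: "c \<in> Units K" using wc(2) K.field_Units by simp
        have "c \<odot>\<^sub>V v = u \<ominus>\<^sub>V w" using cl v wc(2) unfolding wc(3) by (simp add: V.M.a_comm[of w "c \<odot>\<^sub>V v"])
        moreover have "u \<ominus>\<^sub>V w \<in> U <+>\<^sub>V W"
          using submodule_diff[OF S] V.set_add_upper[OF U sW(1)] u(1) wc(1) by blast
        ultimately have "inv\<^bsub>K\<^esub> c \<odot>\<^sub>V (c \<odot>\<^sub>V v) \<in> U <+>\<^sub>V W" using submoduleD(5)[OF S] c by simp
        moreover have "inv\<^bsub>K\<^esub> c \<odot>\<^sub>V (c \<odot>\<^sub>V v) = v"
          using V.smult_assoc[of c "inv\<^bsub>K\<^esub> c" v] c wc(2) v by simp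
        ultimately show False using nv by simp
      qed
      then have "u = w" using wc cl v by simp
      then show ?thesis using u(1) wc(1) sW(2) by auto
    qed
    note WC = V.submodule_set_add[OF sW(1) C]
    have "U \<inter> (W <+>\<^sub>V ?C) = {\<zero>\<^sub>V}"
    proof
      show "{\<zero>\<^sub>V} \<subseteq> U \<inter> (W <+>\<^sub>V ?C)" using submoduleD(2)[OF U] submoduleD(2)[OF WC] by simp
      show "U \<inter> (W <+>\<^sub>V ?C) \<subseteq> {\<zero>\<^sub>V}" using \<open>\<And>u. \<lbrakk>u \<in> U; u \<in> W <+>\<^sub>V ?C\<rbrakk> \<Longrightarrow> u = \<zero>\<^sub>V\<close> by blast
    qed
    then have "W <+>\<^sub>V ?C \<in> F" unfolding F_def using WC by simp
    then have "W = W <+>\<^sub>V ?C" by (rule max[OF _ V.set_add_upper(1)[OF sW(1) C]])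
    then have "v \<in> W" using V.set_add_upper(2)[OF sW(1) C] V.cyclic_self[OF v] by auto
    then show False using nv V.set_add_upper(2)[OF U sW(1)] by auto
  qed
  then have "U <+>\<^sub>V W = carrier V" using submoduleD(1)[OF S] by auto
  then show ?thesis unfolding complementary_def using U sW by auto
qed

lemma functional_extension:
  assumes K: "field K" and V: "right_module K V" and f: "flen K V" and U: "submodule U K V"
    and \<mu>: "lin K (V \<down> U) W \<mu>"
  shows "\<exists>\<nu>. lin K V W \<nu> \<and> (\<forall>u\<in>U. \<nu> u = \<mu> u)"
proof -
  obtain U' where c: "complementary K V U U'" using field_complement[OF K V f U] by metis
  obtain p q where b: "biprod K (V \<down> U) (V \<down> U') V (\<lambda>x. x) (\<lambda>x. x) p q"
    using complementary_projections[OF V c] by metis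
  show ?thesis using lin_comp[OF biprodD(3)[OF b] \<mu>] biprodD(5)[OF b] by (intro exI[of _ "\<lambda>x. \<mu> (p x)"]) simp
qed

text \<open>In the quotient by \<open>U\<close> the image \<open>y\<close> of \<open>x\<close> is
  not zero, so the coordinate on the line through \<open>y\<close> exists, and it extends to a
  functional.\<close>

lemma functional_separation:
  assumes K: "field K" and V: "right_module K V" and f: "flen K V" and U: "submodule U K V"
    and x: "x \<in> carrier V" "x \<notin> U"
  shows "\<exists>\<nu>. lin K V (regular K) \<nu> \<and> (\<forall>u\<in>U. \<nu> u = \<zero>\<^sub>K) \<and> \<nu> x \<noteq> \<zero>\<^sub>K"
proof -
  interpret K: field K by fact
  interpret V: right_module K V by fact
  have "fg_mod K V" using V.right_module_axioms V.fin_gen_of_flen[OF f] by (simp add: fg_mod_def)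
  from std_quotient[OF this U] obtain Q :: "'a std_module" and q where
    q: "lin K V Q q" "q ` carrier V = carrier Q" "ker V Q q = U" by metis
  interpret q: lin K V Q q by (rule q(1))
  define y where "y = q x"
  have y: "y \<in> carrier Q" using x(1) by (simp add: y_def)
  have y0: "y \<noteq> \<zero>\<^sub>Q" using x unfolding q(3)[symmetric] by (simp add: y_def ker_iff)
  let ?C = "(\<lambda>a. a \<odot>\<^sub>Q y) ` carrier K"
  note C = q.N.submodule_cyclic[OF y]
  interpret s: lin K "regular K" "Q \<down> ?C" "\<lambda>a. a \<odot>\<^sub>Q y"
    by (rule lin.restrict_codomain[OF q.N.lin_cyclic[OF y] C]) simp
  have "inj_on (\<lambda>a. a \<odot>\<^sub>Q y) (carrier (regular K))"
    unfolding s.inj_iff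
  proof (intro ballI impI)
    fix a assume a: "a \<in> carrier (regular K)" "a \<odot>\<^sub>Q y = \<zero>\<^bsub>Q \<down> ?C\<^esub>"
    show "a = \<zero>\<^bsub>regular K\<^esub>"
    proof (rule ccontr)
      assume "a \<noteq> \<zero>\<^bsub>regular K\<^esub>"
      then have u: "a \<in> Units K" using a(1) K.field_Units by simp
      have "y = inv\<^bsub>K\<^esub> a \<odot>\<^sub>Q (a \<odot>\<^sub>Q y)"
        using q.N.smult_assoc[of a "inv\<^bsub>K\<^esub> a" y] u a(1) y by simp
      then show False using a(2) u y0 by simp
    qed
  qed
  then have inj: "inj_on (\<lambda>a. a \<odot>\<^sub>Q y) (carrier K)" by simp
  let ?c = "inv_into (carrier K) (\<lambda>a. a \<odot>\<^sub>Q y)"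
  have lc: "lin K (Q \<down> ?C) (regular K) ?c" using s.inv_into_lin inj by (simp add: bij_betw_def)
  have fQ: "flen K Q" using q.flen_ker_image[OF q(2)] f by simp
  obtain \<nu> where \<nu>: "lin K Q (regular K) \<nu>" "\<forall>u\<in>?C. \<nu> u = ?c u"
    using functional_extension[OF K q.cod_mod fQ C lc] by metis
  have "\<nu> (q u) = \<zero>\<^sub>K" if "u \<in> U" for u using that lin.zero[OF \<nu>(1)] unfolding q(3)[symmetric] by (simp add: ker_iff)
  moreover have "\<nu> (q x) = \<one>\<^sub>K"
    using bspec[OF \<nu>(2) q.N.cyclic_self[OF y]] inv_into_f_f[OF inj K.one_closed] q.N.smult_one[OF y] by (simp add: y_def)
  ultimately show ?thesis using lin_comp[OF q(1) \<nu>(1)] by (intro exI[of _ "\<lambda>v. \<nu> (q v)"]) simp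
qed

section \<open>\<open>\<tau>\<close>-rigid modules\<close>

lemma ring_dual_simps [simp]:
  "carrier (ring_dual R P) = rhom R P (regular R)" "\<zero>\<^bsub>ring_dual R P\<^esub> = (\<lambda>x\<in>carrier P. \<zero>\<^sub>R)"
  "f \<oplus>\<^bsub>ring_dual R P\<^esub> g = (\<lambda>x\<in>carrier P. f x \<oplus>\<^sub>R g x)"
  "a \<odot>\<^bsub>ring_dual R P\<^esub> f = (\<lambda>x\<in>carrier P. a \<otimes>\<^sub>R f x)"
  by (simp_all add: ring_dual_def)

lemma dual_simps [simp]:
  "carrier (dual K A M) = rhom K (restrict_scalars A M) (regular K)"
  "\<zero>\<^bsub>dual K A M\<^esub> = (\<lambda>x\<in>carrier M. \<zero>\<^sub>K)"
  "f \<oplus>\<^bsub>dual K A M\<^esub> g = (\<lambda>x\<in>carrier M. f x \<oplus>\<^sub>K g x)"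
  "a \<odot>\<^bsub>dual K A M\<^esub> f = (\<lambda>x\<in>carrier M. f (a \<odot>\<^sub>M x))"
  by (simp_all add: dual_def)

lemma quot_module_simps [simp]:
  "carrier (quot_module M N) = a_rcosets\<^bsub>M\<^esub> N" "\<zero>\<^bsub>quot_module M N\<^esub> = N"
  "C \<oplus>\<^bsub>quot_module M N\<^esub> D = C <+>\<^sub>M D"
  "a \<odot>\<^bsub>quot_module M N\<^esub> C = (\<Union>x\<in>C. N +>\<^bsub>M\<^esub> (a \<odot>\<^sub>M x))"
  by (simp_all add: quot_module_def)

context fd_algebra
begin

text \<open>
  A functional \<open>\<nu>\<close> on \<open>Hom(P1, T)\<close> that vanishes on the maps factoring through \<open>d\<close> induces the map
  \<open>T \<rightarrow> \<tau> T\<close> sending \<open>m\<close> to \<open>[\<alpha>] \<mapsto> \<nu> (x \<mapsto> m \<alpha>(x))\<close>; maps of the form \<open>x \<mapsto> m \<alpha>(x)\<close> span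
  \<open>Hom(P1, T)\<close>, because \<open>P1\<close> is projective.
\<close>

lemma tau_rigid_factor:
  fixes T :: "('a, 't) module"
  assumes T: "fg_mod A T" and rigid: "rhom A T (tau K A T) = {\<lambda>x\<in>carrier T. \<zero>\<^bsub>tau K A T\<^esub>}"
    and P0: "proj_cover A T = (P0, p0)" and P1: "proj_cover A (syzygy A T) = (P1, p1)"
    and P: "projective A P0" "projective A P1" and d: "lin A P1 P0 p1"
    and f0: "lin A P1 T f0"
  shows "extends_along A P1 P0 T p1 f0"
proof (rule ccontr)
  assume nf: "\<not> ?thesis"
  let ?H = "rhom A P1 (regular A)" and ?\<tau> = "tau K A T"
  interpret T: right_module A T by (rule fg_modD[OF T])
  interpret d: lin A P1 P0 p1 by fact
  let ?V = "Hom P1 T"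
  interpret D: lin K "Hom P0 T" ?V "\<lambda>g. \<lambda>x\<in>carrier P1. g (p1 x)"
    by (rule lin_precomp[OF T.right_module_axioms d])
  let ?U = "(\<lambda>g. \<lambda>x\<in>carrier P1. g (p1 x)) ` carrier (Hom P0 T)"
  have f0V: "restrict f0 (carrier P1) \<in> carrier ?V" using lin.in_rhom[OF f0] by simp
  \<comment> \<open>The maps that factor through \<open>p1\<close> form a subspace; a functional
    will separate \<open>f0\<close> from it.\<close>
  have "restrict f0 (carrier P1) \<notin> ?U"
  proof
    assume "restrict f0 (carrier P1) \<in> ?U"
    then obtain g where g: "g \<in> rhom A P0 T" "restrict f0 (carrier P1) = (\<lambda>x\<in>carrier P1. g (p1 x))" by auto
    have "g (p1 x) = f0 x" if "x \<in> carrier P1" for x using fun_cong[OF g(2), of x] that by simp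
    then show False using nf rhom_lin[OF d.cod_mod T.right_module_axioms g(1)] by blast
  qed
  from functional_separation[OF K.field_axioms D.cod_mod flen_hom[OF projective_fg[OF P(2)] T] D.submodule_range f0V this]
  obtain \<nu> where \<nu>: "lin K ?V (regular K) \<nu>" "\<And>u. u \<in> ?U \<Longrightarrow> \<nu> u = \<zero>\<^sub>K"
    "\<nu> (restrict f0 (carrier P1)) \<noteq> \<zero>\<^sub>K" by metis
  interpret \<nu>: lin K ?V "regular K" \<nu> by fact
  \<comment> \<open>With scalars read on the right this is x -> m \<alpha>(x), additive in
    \<open>m\<close> and in \<open>\<alpha>\<close>. Below, \<open>D1\<close> is Hom(P1, A) and its
    quotient \<open>Q\<close> is the transpose of \<open>T\<close>.\<close>
  define w where "w m \<alpha> = (\<lambda>x\<in>carrier P1. \<alpha> x \<odot>\<^sub>T m)" for m and \<alpha> :: "(nat \<Rightarrow> 'a) set \<Rightarrow> 'a"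
  have wV: "w m \<alpha> \<in> carrier ?V" if "m \<in> carrier T" "\<alpha> \<in> ?H" for m \<alpha>
    using lin.in_rhom[OF lin_comp[OF rhom_lin[OF d.dom_mod A.right_module_regular that(2)] T.lin_cyclic[OF that(1)]]]
    by (simp add: w_def)
  define D1 where "D1 = ring_dual A P1"
  define N where "N = (\<lambda>f. compose (carrier P1) f p1) ` carrier (ring_dual A P0)"
  define Q where "Q = quot_module D1 N"
  have tau_eq: "tau K A T = dual K A Q" by (simp add: tau_def transpose_module_def P0 P1 D1_def N_def Q_def)
  have D1 [simp]: "carrier D1 = ?H" "\<zero>\<^sub>D1 = (\<lambda>x\<in>carrier P1. \<zero>\<^sub>A)"
    "f \<oplus>\<^sub>D1 g = (\<lambda>x\<in>carrier P1. f x \<oplus>\<^sub>A g x)"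
    "a \<odot>\<^sub>D1 f = (\<lambda>x\<in>carrier P1. a \<otimes>\<^sub>A f x)" for f g a
    by (simp_all add: D1_def)
  have Q: "carrier Q = a_rcosets\<^bsub>D1\<^esub> N" "C \<oplus>\<^sub>Q D = C <+>\<^sub>D1 D"
    "a \<odot>\<^sub>Q C = (\<Union>x\<in>C. N +>\<^bsub>D1\<^esub> (a \<odot>\<^sub>D1 x))" for C D a
    by (simp_all add: Q_def)
  interpret DD: abelian_group D1
    unfolding D1_def ring_dual_def
    by (rule abelian_group_with_smult) (rule abelian_group_hom_group[OF d.dom_mod A.right_module_regular])
  have Npre: "N = (\<lambda>g. \<lambda>x\<in>carrier P1. g (p1 x)) ` rhom A P0 (regular A)"
    by (simp add: N_def compose_def)
  have Nmem: "\<alpha> \<in> ?H" if "\<alpha> \<in> N" for \<alpha>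
    using that lin.in_rhom[OF lin_comp[OF d rhom_lin[OF d.cod_mod A.right_module_regular]]] unfolding Npre by auto
  interpret NK: lin K "Hom P0 (regular A)" "Hom P1 (regular A)" "\<lambda>g. \<lambda>x\<in>carrier P1. g (p1 x)"
    by (rule lin_precomp[OF A.right_module_regular d])
  have NK: "submodule N K (Hom P1 (regular A))" using NK.submodule_range unfolding Npre by simp
  have Nsub: "subgroup N (add_monoid D1)"
  proof (intro subgroup.intro)
    show "N \<subseteq> carrier (add_monoid D1)" using Nmem by auto
    show "\<one>\<^bsub>add_monoid D1\<^esub> \<in> N" using submoduleD(2)[OF NK] by simp
    show "\<alpha> \<otimes>\<^bsub>add_monoid D1\<^esub> \<beta> \<in> N" if "\<alpha> \<in> N" "\<beta> \<in> N" for \<alpha> \<beta>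
      using submoduleD(4)[OF NK that] by simp
    show "inv\<^bsub>add_monoid D1\<^esub> \<alpha> \<in> N" if "\<alpha> \<in> N" for \<alpha>
    proof -
      let ?\<beta> = "\<ominus>\<^bsub>Hom P1 (regular A)\<^esub> \<alpha>"
      have \<beta>: "?\<beta> \<in> N" by (rule submodule_minus[OF NK that])
      have "?\<beta> \<oplus>\<^sub>D1 \<alpha> = \<zero>\<^sub>D1"
        using NK.N.M.l_neg[of \<alpha>] Nmem[OF that] by simp
      then have "\<ominus>\<^sub>D1 \<alpha> = ?\<beta>" using Nmem[OF \<beta>] Nmem[OF that] by (intro DD.minus_equality) simp_all
      then show ?thesis using \<beta> by (simp add: a_inv_def)
    qed
  qed
  interpret N: abelian_subgroup N D1
    by (intro abelian_subgroupI3 additive_subgroup.intro Nsub DD.abelian_group_axioms)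
  have w_add: "w m (\<alpha> \<oplus>\<^sub>D1 \<beta>) = w m \<alpha> \<oplus>\<^sub>?V w m \<beta>"
    if "m \<in> carrier T" "\<alpha> \<in> ?H" "\<beta> \<in> ?H" for m \<alpha> \<beta>
    using that rhom_closed[OF that(2)] rhom_closed[OF that(3)] by (auto simp: w_def fun_eq_iff T.smult_l_distr)
  have w_N: "\<nu> (w m \<alpha>) = \<zero>\<^sub>K" if m: "m \<in> carrier T" and \<alpha>: "\<alpha> \<in> N" for m \<alpha>
  proof (rule \<nu>(2))
    obtain \<beta> where \<beta>: "\<beta> \<in> rhom A P0 (regular A)" "\<alpha> = (\<lambda>x\<in>carrier P1. \<beta> (p1 x))" using \<alpha> unfolding Npre by auto
    have "(\<lambda>x\<in>carrier P0. \<beta> x \<odot>\<^sub>T m) \<in> carrier (Hom P0 T)"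
      using lin.in_rhom[OF lin_comp[OF rhom_lin[OF d.cod_mod A.right_module_regular \<beta>(1)] T.lin_cyclic[OF m]]] by simp
    moreover have "w m \<alpha> = (\<lambda>x\<in>carrier P1. (\<lambda>x\<in>carrier P0. \<beta> x \<odot>\<^sub>T m) (p1 x))" by (auto simp: w_def \<beta>(2) fun_eq_iff)
    ultimately show "w m \<alpha> \<in> ?U" by (intro image_eqI[of _ "\<lambda>g. \<lambda>x\<in>carrier P1. g (p1 x)"])
  qed
  \<comment> \<open>By \<open>w_N\<close> the value \<open>\<nu> (w m \<alpha>)\<close> depends only
    on the class of \<open>\<alpha>\<close> modulo \<open>N\<close>, so any representative may be
    chosen.\<close>
  define t where "t m = (\<lambda>C\<in>carrier Q. \<nu> (w m (SOME \<alpha>. \<alpha> \<in> C)))" for m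
  have CQ: "\<exists>\<alpha>. \<alpha> \<in> ?H \<and> C = N +>\<^bsub>D1\<^esub> \<alpha>" if "C \<in> carrier Q" for C
    using that unfolding Q A_RCOSETS_def' by auto
  have Qc: "N +>\<^bsub>D1\<^esub> \<alpha> \<in> carrier Q" if "\<alpha> \<in> ?H" for \<alpha>
    using that unfolding Q A_RCOSETS_def' by auto
  have t_coset: "t m (N +>\<^bsub>D1\<^esub> \<alpha>) = \<nu> (w m \<alpha>)" if m: "m \<in> carrier T" and \<alpha>: "\<alpha> \<in> ?H" for m \<alpha>
  proof -
    have "\<alpha> \<in> N +>\<^bsub>D1\<^esub> \<alpha>" using N.a_rcos_self[of \<alpha>] \<alpha> by simp
    then have "(SOME \<beta>. \<beta> \<in> N +>\<^bsub>D1\<^esub> \<alpha>) \<in> N +>\<^bsub>D1\<^esub> \<alpha>" by (rule someI[where P = "\<lambda>\<beta>. \<beta> \<in> N +>\<^bsub>D1\<^esub> \<alpha>"])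
    then obtain \<gamma> where \<gamma>: "\<gamma> \<in> N" "(SOME \<beta>. \<beta> \<in> N +>\<^bsub>D1\<^esub> \<alpha>) = \<gamma> \<oplus>\<^sub>D1 \<alpha>"
      unfolding a_r_coset_def' by auto
    have "\<nu> (w m (\<gamma> \<oplus>\<^sub>D1 \<alpha>)) = \<nu> (w m \<alpha>)"
      unfolding w_add[OF m Nmem[OF \<gamma>(1)] \<alpha>]
      using w_N[OF m \<gamma>(1)] \<nu>.add[OF wV[OF m Nmem[OF \<gamma>(1)]] wV[OF m \<alpha>]] \<nu>.closed[OF wV[OF m \<alpha>]] by simp
    then show ?thesis using Qc[OF \<alpha>] \<gamma>(2) by (simp add: t_def)
  qed
  \<comment> \<open>Scalar multiplication in \<open>quot_module\<close> is a union over the whole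
    coset. It collapses to one coset because \<open>N\<close> is closed under the left action of
    \<open>A\<close>.\<close>
  have sm: "a \<odot>\<^sub>Q (N +>\<^bsub>D1\<^esub> \<alpha>) = N +>\<^bsub>D1\<^esub> (a \<odot>\<^sub>D1 \<alpha>)" and sc: "a \<odot>\<^sub>D1 \<alpha> \<in> ?H"
    if a: "a \<in> carrier A" and \<alpha>: "\<alpha> \<in> ?H" for a \<alpha>
  proof -
    have cl: "a \<odot>\<^sub>D1 \<beta> \<in> ?H" if "\<beta> \<in> ?H" for \<beta>
      using lin.in_rhom[OF lin_comp[OF rhom_lin[OF d.dom_mod A.right_module_regular that] A.lin_left_mult[OF a]]] by simp
    show "a \<odot>\<^sub>D1 \<alpha> \<in> ?H" by (rule cl[OF \<alpha>])
    have aN: "a \<odot>\<^sub>D1 \<gamma> \<in> N" if \<gamma>: "\<gamma> \<in> N" for \<gamma>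
    proof -
      obtain \<beta> where \<beta>: "\<beta> \<in> rhom A P0 (regular A)" "\<gamma> = (\<lambda>x\<in>carrier P1. \<beta> (p1 x))" using \<gamma> unfolding Npre by auto
      have "(\<lambda>x\<in>carrier P0. a \<otimes>\<^sub>A \<beta> x) \<in> rhom A P0 (regular A)"
        using lin.in_rhom[OF lin_comp[OF rhom_lin[OF d.cod_mod A.right_module_regular \<beta>(1)] A.lin_left_mult[OF a]]] by simp
      moreover have "a \<odot>\<^sub>D1 \<gamma> = (\<lambda>x\<in>carrier P1. (\<lambda>x\<in>carrier P0. a \<otimes>\<^sub>A \<beta> x) (p1 x))"
        by (auto simp: \<beta>(2) fun_eq_iff)
      ultimately show ?thesis unfolding Npre by (intro image_eqI[of _ "\<lambda>g. \<lambda>x\<in>carrier P1. g (p1 x)"])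
    qed
    have "N +>\<^bsub>D1\<^esub> (a \<odot>\<^sub>D1 \<beta>) = N +>\<^bsub>D1\<^esub> (a \<odot>\<^sub>D1 \<alpha>)" if \<beta>: "\<beta> \<in> N +>\<^bsub>D1\<^esub> \<alpha>" for \<beta>
    proof -
      obtain \<gamma> where \<gamma>: "\<gamma> \<in> N" "\<beta> = \<gamma> \<oplus>\<^sub>D1 \<alpha>" using \<beta> unfolding a_r_coset_def' by auto
      have "a \<odot>\<^sub>D1 \<beta> = a \<odot>\<^sub>D1 \<gamma> \<oplus>\<^sub>D1 a \<odot>\<^sub>D1 \<alpha>"
        using a rhom_closed[OF Nmem[OF \<gamma>(1)]] rhom_closed[OF \<alpha>] by (auto simp: \<gamma>(2) fun_eq_iff A.r_distr)
      then have "a \<odot>\<^sub>D1 \<beta> \<in> N +>\<^bsub>D1\<^esub> (a \<odot>\<^sub>D1 \<alpha>)" using aN[OF \<gamma>(1)] unfolding a_r_coset_def' by blast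
      from DD.a_repr_independence[OF this _ Nsub] show ?thesis using cl[OF \<alpha>] by simp
    qed
    then have "(\<Union>x\<in>N +>\<^bsub>D1\<^esub> \<alpha>. N +>\<^bsub>D1\<^esub> (a \<odot>\<^sub>D1 x)) = (\<Union>x\<in>N +>\<^bsub>D1\<^esub> \<alpha>. N +>\<^bsub>D1\<^esub> (a \<odot>\<^sub>D1 \<alpha>))"
      by (rule SUP_cong[OF refl])
    also have "\<dots> = N +>\<^bsub>D1\<^esub> (a \<odot>\<^sub>D1 \<alpha>)" using N.a_rcos_self[of \<alpha>] \<alpha> by auto
    finally show "a \<odot>\<^sub>Q (N +>\<^bsub>D1\<^esub> \<alpha>) = N +>\<^bsub>D1\<^esub> (a \<odot>\<^sub>D1 \<alpha>)" unfolding Q .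
  qed
  have t_in: "t m \<in> rhom K (res Q) (regular K)" if m: "m \<in> carrier T" for m
  proof -
    have "t m (C \<oplus>\<^sub>Q C') = t m C \<oplus>\<^sub>K t m C'" if C: "C \<in> carrier Q" "C' \<in> carrier Q" for C C'
    proof -
      obtain \<alpha> \<beta> where ab: "\<alpha> \<in> ?H" "C = N +>\<^bsub>D1\<^esub> \<alpha>"
        "\<beta> \<in> ?H" "C' = N +>\<^bsub>D1\<^esub> \<beta>" using CQ C by metis
      have "C \<oplus>\<^sub>Q C' = N +>\<^bsub>D1\<^esub> (\<alpha> \<oplus>\<^sub>D1 \<beta>)"
        using N.a_rcos_sum[of \<alpha> \<beta>] ab unfolding Q by simp
      moreover have "\<alpha> \<oplus>\<^sub>D1 \<beta> \<in> ?H" using DD.a_closed[of \<alpha> \<beta>] ab by simp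
      ultimately show ?thesis
        using t_coset[OF m] ab w_add[OF m ab(1,3)] \<nu>.add[OF wV[OF m ab(1)] wV[OF m ab(3)]] by simp
    qed
    moreover have "t m ((c \<odot>\<^sub>A \<one>\<^sub>A) \<odot>\<^sub>Q C) = t m C \<otimes>\<^sub>K c" if c: "c \<in> carrier K" and C: "C \<in> carrier Q" for c C
    proof -
      obtain \<alpha> where a: "\<alpha> \<in> ?H" "C = N +>\<^bsub>D1\<^esub> \<alpha>" using CQ C by metis
      have "w m ((c \<odot>\<^sub>A \<one>\<^sub>A) \<odot>\<^sub>D1 \<alpha>) = c \<odot>\<^sub>?V w m \<alpha>"
        using rhom_closed[OF a(1)] c m
        by (auto simp: w_def fun_eq_iff scalar_mult_left T.smult_assoc[symmetric] scalar_mult_right)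
      then show ?thesis
        unfolding a(2) sm[OF scalar_closed[OF c] a(1)] t_coset[OF m sc[OF scalar_closed[OF c] a(1)]] t_coset[OF m a(1)]
        using \<nu>.smult[OF c wV[OF m a(1)]] by simp
    qed
    moreover have "t m C \<in> carrier K" if C: "C \<in> carrier Q" for C
    proof -
      obtain \<alpha> where a: "\<alpha> \<in> ?H" "C = N +>\<^bsub>D1\<^esub> \<alpha>" using CQ C by metis
      show ?thesis unfolding a(2) t_coset[OF m a(1)] using \<nu>.closed[OF wV[OF m a(1)]] by simp
    qed
    moreover have "t m \<in> extensional (carrier Q)" by (simp add: t_def)
    ultimately show ?thesis unfolding rhom_def by (simp add: PiE_def Pi_def)
  qed
  have "restrict t (carrier T) \<in> rhom A T (tau K A T)"
    unfolding rhom_def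
  proof (intro CollectI conjI ballI)
    show "restrict t (carrier T) \<in> carrier T \<rightarrow>\<^sub>E carrier ?\<tau>" unfolding tau_eq using t_in by auto
  next
    fix m m' assume m: "m \<in> carrier T" "m' \<in> carrier T"
    have "t (m \<oplus>\<^sub>T m') C = t m C \<oplus>\<^sub>K t m' C" if C: "C \<in> carrier Q" for C
    proof -
      obtain \<alpha> where a: "\<alpha> \<in> ?H" "C = N +>\<^bsub>D1\<^esub> \<alpha>" using CQ C by metis
      have "w (m \<oplus>\<^sub>T m') \<alpha> = w m \<alpha> \<oplus>\<^sub>?V w m' \<alpha>"
        using rhom_closed[OF a(1)] m by (auto simp: w_def fun_eq_iff T.smult_r_distr)
      then show ?thesis
        unfolding a(2) using t_coset[OF _ a(1)] m \<nu>.add[OF wV[OF m(1) a(1)] wV[OF m(2) a(1)]] by simp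
    qed
    then have "t (m \<oplus>\<^sub>T m') = t m \<oplus>\<^sub>?\<tau> t m'"
      unfolding tau_eq dual_simps by (auto simp: t_def fun_eq_iff)
    then show "restrict t (carrier T) (m \<oplus>\<^sub>T m') = restrict t (carrier T) m \<oplus>\<^sub>?\<tau> restrict t (carrier T) m'"
      using m by simp
  next
    fix a m assume am: "a \<in> carrier A" "m \<in> carrier T"
    have "t (a \<odot>\<^sub>T m) C = t m (a \<odot>\<^sub>Q C)" if C: "C \<in> carrier Q" for C
    proof -
      obtain \<alpha> where al: "\<alpha> \<in> ?H" "C = N +>\<^bsub>D1\<^esub> \<alpha>" using CQ C by metis
      have "w (a \<odot>\<^sub>T m) \<alpha> = w m (a \<odot>\<^sub>D1 \<alpha>)"
        using rhom_closed[OF al(1)] am by (auto simp: w_def fun_eq_iff T.smult_assoc)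
      then show ?thesis
        unfolding al(2) sm[OF am(1) al(1)] t_coset[OF am(2) sc[OF am(1) al(1)]] using t_coset[OF _ al(1)] am by simp
    qed
    then have "t (a \<odot>\<^sub>T m) = a \<odot>\<^sub>?\<tau> t m"
      unfolding tau_eq dual_simps by (auto simp: t_def fun_eq_iff)
    then show "restrict t (carrier T) (a \<odot>\<^sub>T m) = a \<odot>\<^sub>?\<tau> restrict t (carrier T) m"
      using am by simp
  qed
  \<comment> \<open>Rigidity enters here: \<open>t\<close> is a map from \<open>T\<close> to its
    Auslander-Reiten translate, so it is zero.\<close>
  then have t0: "restrict t (carrier T) = (\<lambda>x\<in>carrier T. \<zero>\<^sub>?\<tau>)" using rigid by simp
  have w0: "\<nu> (w m \<alpha>) = \<zero>\<^sub>K" if m: "m \<in> carrier T" and \<alpha>: "\<alpha> \<in> ?H" for m \<alpha>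
  proof -
    have "t m = \<zero>\<^sub>?\<tau>" using fun_cong[OF t0, of m] m by simp
    then have "t m (N +>\<^bsub>D1\<^esub> \<alpha>) = \<zero>\<^sub>K" unfolding tau_eq dual_simps using Qc[OF \<alpha>] by simp
    then show ?thesis using t_coset[OF m \<alpha>] by simp
  qed
  \<comment> \<open>Induction on \<open>n\<close>: the last coordinate contributes a map
    \<open>w m \<alpha>\<close>, on which \<open>\<nu>\<close> vanishes by \<open>w0\<close>.
    Applied to the identity of \<open>P1\<close>, factored through a free module, this makes
    \<open>\<nu>\<close> vanish at \<open>f0\<close>.\<close>
  have span: "\<nu> (\<lambda>x\<in>carrier P1. h (i x)) = \<zero>\<^sub>K" if "lin A P1 (free_module A n) i" "lin A (free_module A n) T h" for n i h
    using that
  proof (induction n arbitrary: i h)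
    case 0
    have "h (i x) = \<zero>\<^sub>T" if "x \<in> carrier P1" for x
    proof -
      have "i x = \<zero>\<^bsub>free_module A 0\<^esub>" using lin.closed[OF 0(1) that] by auto
      then show ?thesis using lin.zero[OF 0(2)] by simp
    qed
    then have "(\<lambda>x\<in>carrier P1. h (i x)) = \<zero>\<^sub>?V" by (auto simp: fun_eq_iff)
    then show ?case using \<nu>.zero by (simp only: regular_simps)
  next
    case (Suc n)
    obtain k u dr c where "biprod A (free_module A n) (regular A) (free_module A (Suc n)) k u dr c"
      using A.biprod_free[of n] by metis
    note b = biprodD[OF this]
    have l1: "lin A P1 (free_module A n) (\<lambda>x. dr (i x))" by (rule lin_comp[OF Suc(2) b(3)])
    have l2: "lin A (free_module A n) T (\<lambda>x. h (k x))" by (rule lin_comp[OF b(1) Suc(3)])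
    have l3: "lin A P1 (regular A) (\<lambda>x. c (i x))" by (rule lin_comp[OF Suc(2) b(4)])
    have l4: "lin A (regular A) T (\<lambda>x. h (u x))" by (rule lin_comp[OF b(2) Suc(3)])
    have m: "h (u \<one>\<^sub>A) \<in> carrier T" using lin.closed[OF l4, of "\<one>\<^sub>A"] by simp
    have al: "(\<lambda>x\<in>carrier P1. c (i x)) \<in> ?H" by (rule lin.in_rhom[OF l3])
    have hu: "h (u a) = a \<odot>\<^sub>T h (u \<one>\<^sub>A)" if "a \<in> carrier A" for a
      using lin.smult[OF l4, of a "\<one>\<^sub>A"] that by simp
    have "h (i x) = h (k (dr (i x))) \<oplus>\<^sub>T c (i x) \<odot>\<^sub>T h (u \<one>\<^sub>A)" if x: "x \<in> carrier P1" for x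
    proof -
      note cl = lin.closed[OF Suc(2) x]
      have "h (i x) = h (k (dr (i x)) \<oplus>\<^bsub>free_module A (Suc n)\<^esub> u (c (i x)))" unfolding b(9)[OF cl] ..
      also have "\<dots> = h (k (dr (i x))) \<oplus>\<^sub>T h (u (c (i x)))"
        by (rule lin.add[OF Suc(3) lin.closed[OF b(1) lin.closed[OF b(3) cl]] lin.closed[OF b(2) lin.closed[OF b(4) cl]]])
      also have "h (u (c (i x))) = c (i x) \<odot>\<^sub>T h (u \<one>\<^sub>A)" using lin.closed[OF l3 x] by (intro hu) simp
      finally show ?thesis .
    qed
    then have eq: "(\<lambda>x\<in>carrier P1. h (i x)) = (\<lambda>x\<in>carrier P1. h (k (dr (i x)))) \<oplus>\<^sub>?V w (h (u \<one>\<^sub>A)) (\<lambda>x\<in>carrier P1. c (i x))"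
      by (intro ext) (simp add: w_def)
    have "(\<lambda>x\<in>carrier P1. h (k (dr (i x)))) \<in> carrier ?V" using lin.in_rhom[OF lin_comp[OF l1 l2]] by simp
    from \<nu>.add[OF this wV[OF m al]] show ?case
      unfolding eq Suc(1)[OF l1 l2] w0[OF m al] by (simp only: regular_simps K.l_zero K.zero_closed)
  qed
  obtain n i p where ip: "lin A P1 (free_module A n) i" "lin A (free_module A n) P1 p" "\<forall>x\<in>carrier P1. p (i x) = x"
    using AF.projective_retract_free[OF P(2)] by metis
  have "\<nu> (\<lambda>x\<in>carrier P1. f0 (p (i x))) = \<zero>\<^sub>K" by (rule span[OF ip(1) lin_comp[OF ip(2) f0]])
  moreover have "(\<lambda>x\<in>carrier P1. f0 (p (i x))) = restrict f0 (carrier P1)" using ip(3) by (auto simp: fun_eq_iff)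
  ultimately show False using \<nu>(3) by simp
qed

end

section \<open>Modules generated by a module\<close>

text \<open>\<open>tpow\<close>: finite direct sums of copies of \<open>T\<close>; \<open>fac\<close>: the finitely generated modules generated by \<open>T\<close>.\<close>

inductive tpow :: "('a, 'r) ring_scheme \<Rightarrow> ('a, 't) module \<Rightarrow> 'a std_module \<Rightarrow> bool" for R T where
  zero: "\<lbrakk>fg_mod R S; carrier S = {\<zero>\<^sub>S}\<rbrakk> \<Longrightarrow> tpow R T S"
| step: "\<lbrakk>tpow R T S; fg_mod R S'; biprod R S T S' i j p q\<rbrakk> \<Longrightarrow> tpow R T S'"

definition fac :: "('a, 'r) ring_scheme \<Rightarrow> ('a, 't) module \<Rightarrow> ('a, 'm) module \<Rightarrow> bool" where
  "fac R T M \<longleftrightarrow> fg_mod R M \<and>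
     (\<forall>N. submodule N R M \<and> (\<forall>f. lin R T M f \<longrightarrow> f ` carrier T \<subseteq> N) \<longrightarrow> N = carrier M)"

lemma fac_fg: "fac R T M \<Longrightarrow> fg_mod R M" by (simp add: fac_def)

lemma facD:
  "\<lbrakk>fac R T M; submodule N R M; \<And>f x. \<lbrakk>lin R T M f; x \<in> carrier T\<rbrakk> \<Longrightarrow> f x \<in> N\<rbrakk> \<Longrightarrow> N = carrier M"
  unfolding fac_def by (metis image_subsetI)

lemma facI:
  assumes "fg_mod R M"
    and "\<And>N. \<lbrakk>submodule N R M; \<And>f x. \<lbrakk>lin R T M f; x \<in> carrier T\<rbrakk> \<Longrightarrow> f x \<in> N\<rbrakk> \<Longrightarrow> N = carrier M"
  shows "fac R T M"
  unfolding fac_def using assms by (simp add: image_subset_iff)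

lemma tpow_fg: "tpow R T S \<Longrightarrow> fg_mod R S"
  by (induction rule: tpow.induct) auto

text \<open>The elements where \<open>f\<close> and \<open>g\<close> agree form a submodule that
  contains the images of all maps from \<open>T\<close>.\<close>

lemma fac_eq:
  assumes M: "fac R T M" and f: "lin R M L f" and g: "lin R M L g"
    and eq: "\<And>h x. \<lbrakk>lin R T M h; x \<in> carrier T\<rbrakk> \<Longrightarrow> f (h x) = g (h x)" and x: "x \<in> carrier M"
  shows "f x = g x"
proof -
  interpret D: lin R M L "\<lambda>x. f x \<ominus>\<^sub>L g x" by (rule lin_diff_map[OF f g])
  have k: "x \<in> ker M L (\<lambda>x. f x \<ominus>\<^sub>L g x) \<longleftrightarrow> f x = g x" if "x \<in> carrier M" for x
    using that lin.closed[OF f that] lin.closed[OF g that] by (simp add: ker_iff D.N.M.diff_eq_zero_iff)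
  have "ker M L (\<lambda>x. f x \<ominus>\<^sub>L g x) = carrier M"
  proof (rule facD[OF M D.submodule_ker])
    show "h x \<in> ker M L (\<lambda>x. f x \<ominus>\<^sub>L g x)" if "lin R T M h" "x \<in> carrier T" for h x
      using k[OF lin.closed[OF that]] eq[OF that] by simp
  qed
  then show ?thesis using k[OF x] x by simp
qed

lemma fac_image:
  assumes M: "fac R T M" and w: "lin R M M' w" and s: "w ` carrier M = carrier M'"
  shows "fac R T M'"
proof (rule facI)
  interpret w: lin R M M' w by fact
  show "fg_mod R M'" by (rule fg_image[OF w s fac_fg[OF M]])
  fix N assume N: "submodule N R M'" "\<And>f x. \<lbrakk>lin R T M' f; x \<in> carrier T\<rbrakk> \<Longrightarrow> f x \<in> N"
  have "{x \<in> carrier M. w x \<in> N} = carrier M"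
    using N(2)[OF lin_comp[OF _ w]] lin.closed by (intro facD[OF M w.submodule_vimage[OF N(1)]]) fast
  then have "carrier M' \<subseteq> N" unfolding s[symmetric] by auto
  then show "N = carrier M'" using submoduleD(1)[OF N(1)] by auto
qed

lemma fac_self: "fg_mod R T \<Longrightarrow> fac R T T"
proof (rule facI)
  fix N assume T: "fg_mod R T" and N: "submodule N R T" "\<And>f x. \<lbrakk>lin R T T f; x \<in> carrier T\<rbrakk> \<Longrightarrow> f x \<in> N"
  show "N = carrier T" using N(2)[OF lin_id[OF fg_modD[OF T]]] submoduleD(1)[OF N(1)] by auto
qed

lemma fac_zero:
  assumes "fg_mod R M" "carrier M = {\<zero>\<^sub>M}"
  shows "fac R T M"
proof (rule facI[OF assms(1)])
  fix N assume "submodule N R M"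
  then show "N = carrier M" using submoduleD(1,2)[of N R M] assms(2) by auto
qed

context finlen_ring
begin

lemma fac_biprod:
  assumes M: "fac R T M" and N: "fac R T N" and b: "biprod R M N S i j p q"
  shows "fac R T S"
proof (rule facI[OF fg_biprod[OF b fac_fg[OF M] fac_fg[OF N]]])
  note b' = biprodD[OF b]
  fix U assume U: "submodule U R S" "\<And>f x. \<lbrakk>lin R T S f; x \<in> carrier T\<rbrakk> \<Longrightarrow> f x \<in> U"
  have 1: "{x \<in> carrier M. i x \<in> U} = carrier M"
    using U(2)[OF lin_comp[OF _ b'(1)]] lin.closed by (intro facD[OF M lin.submodule_vimage[OF b'(1) U(1)]]) fast
  have 2: "{x \<in> carrier N. j x \<in> U} = carrier N"
    using U(2)[OF lin_comp[OF _ b'(2)]] lin.closed by (intro facD[OF N lin.submodule_vimage[OF b'(2) U(1)]]) fast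
  have "s \<in> U" if s: "s \<in> carrier S" for s
  proof -
    have "i (p s) \<in> U" "j (q s) \<in> U" using 1 2 lin.closed[OF b'(3) s] lin.closed[OF b'(4) s] by auto
    then show ?thesis using submoduleD(4)[OF U(1)] b'(9)[OF s] by metis
  qed
  then show "U = carrier S" using submoduleD(1)[OF U(1)] by auto
qed

lemma fac_tpow:
  assumes T: "fg_mod R T" and S: "tpow R T S"
  shows "fac R T S"
  using S
proof induction
  case (zero S)
  then show ?case by (rule fac_zero)
next
  case (step S S' i j p q)
  show ?case by (rule fac_biprod[OF step(4) fac_self[OF T] step(3)])
qed

lemma tpow_zero_exists: "\<exists>S. tpow R T S"
proof -
  interpret r: right_module R "regular R" by (rule right_module_regular)
  have "fg_mod R ((regular R) \<down> {\<zero>\<^bsub>regular R\<^esub>})" by (rule fg_sub[OF fg_regular r.submodule_zero])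
  from std_copy[OF this] obtain Q :: "'a std_module" and i p where Q: "fg_mod R Q"
    "lin R Q ((regular R) \<down> {\<zero>\<^bsub>regular R\<^esub>}) i" "lin R ((regular R) \<down> {\<zero>\<^bsub>regular R\<^esub>}) Q p"
    "\<forall>y\<in>carrier Q. p (i y) = y" by metis
  interpret i: lin R Q "(regular R) \<down> {\<zero>\<^bsub>regular R\<^esub>}" i by (rule Q(2))
  interpret p: lin R "(regular R) \<down> {\<zero>\<^bsub>regular R\<^esub>}" Q p by (rule Q(3))
  have "x = \<zero>\<^sub>Q" if x: "x \<in> carrier Q" for x
    using i.closed[OF x] Q(4) x p.zero by auto
  then have "carrier Q = {\<zero>\<^sub>Q}" by (intro equalityI subsetI) simp_all
  then show ?thesis using tpow.zero[OF Q(1)] by blast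
qed

text \<open>The trace of \<open>T\<close> in \<open>M\<close>. By finite length some image of a
  finite sum of copies of \<open>T\<close> is maximal; adjoining one more copy of \<open>T\<close>,
  mapped by \<open>f\<close>, cannot enlarge it.\<close>

lemma trace_exists:
  fixes T :: "('a, 't) module" and M :: "('a, 'm) module"
  assumes T: "fg_mod R T" and M: "fg_mod R M"
  shows "\<exists>S \<pi>. tpow R T S \<and> lin R S M \<pi> \<and> (\<forall>f. lin R T M f \<longrightarrow> f ` carrier T \<subseteq> \<pi> ` carrier S)"
proof -
  interpret M: right_module R M by (rule fg_modD[OF M])
  define F where "F = {\<pi> ` carrier S |S \<pi>. tpow R T S \<and> lin R S M \<pi>}"
  obtain S0 where S0: "tpow R T S0" using tpow_zero_exists by metis
  have "(\<lambda>x. \<zero>\<^sub>M) ` carrier S0 \<in> F" unfolding F_def using S0 lin_zero[OF fg_modD[OF tpow_fg[OF S0]] M.right_module_axioms] by blast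
  then have "\<exists>U\<in>F. \<forall>V\<in>F. U \<subseteq> V \<longrightarrow> U = V"
  proof (rule M.ex_maximal_submodule[OF fg_flen[OF M]])
    fix U assume "U \<in> F"
    then obtain S :: "'a std_module" and \<pi> where "lin R S M \<pi>" "U = \<pi> ` carrier S" unfolding F_def by auto
    then show "submodule U R M" using lin.submodule_range by metis
  qed
  then obtain U where U: "U \<in> F" "\<forall>V\<in>F. U \<subseteq> V \<longrightarrow> U = V" by (elim bexE)
  then obtain S \<pi> where S: "tpow R T S" "lin R S M \<pi>" "U = \<pi> ` carrier S" unfolding F_def by auto
  have max: "\<pi> ` carrier S = V" if "V \<in> F" "\<pi> ` carrier S \<subseteq> V" for V using U(2) that S(3) by simp
  have "f ` carrier T \<subseteq> \<pi> ` carrier S" if f: "lin R T M f" for f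
  proof -
    obtain S' :: "'a std_module" and i j p q where S': "fg_mod R S'" "biprod R S T S' i j p q"
      using ex_biprod[OF tpow_fg[OF S(1)] T] by metis
    note m = biprod_map[OF S'(2) S(2) f]
    note b = biprodD[OF S'(2)]
    let ?g = "\<lambda>s. \<pi> (p s) \<oplus>\<^sub>M f (q s)"
    have "?g ` carrier S' \<in> F" unfolding F_def using tpow.step[OF S(1) S'] m(1) by blast
    moreover have "\<pi> ` carrier S \<subseteq> ?g ` carrier S'"
    proof (intro image_subsetI)
      fix x assume x: "x \<in> carrier S"
      show "\<pi> x \<in> ?g ` carrier S'" using m(2)[OF x] lin.closed[OF b(1) x] by (intro image_eqI[of _ ?g "i x"]) simp_all
    qed
    ultimately have "\<pi> ` carrier S = ?g ` carrier S'" by (rule max)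
    moreover have "f ` carrier T \<subseteq> ?g ` carrier S'"
    proof (intro image_subsetI)
      fix x assume x: "x \<in> carrier T"
      show "f x \<in> ?g ` carrier S'" using m(3)[OF x] lin.closed[OF b(2) x] by (intro image_eqI[of _ ?g "j x"]) simp_all
    qed
    ultimately show ?thesis by simp
  qed
  then show ?thesis using S(1,2) by blast
qed

lemma trace_submodule:
  assumes T: "fg_mod R T" and M: "fg_mod R M"
  shows "\<exists>U. submodule U R M \<and> fac R T (M \<down> U) \<and> (\<forall>f x. lin R T M f \<and> x \<in> carrier T \<longrightarrow> f x \<in> U)"
proof -
  obtain S \<pi> where S: "tpow R T S" "lin R S M \<pi>" "\<forall>f. lin R T M f \<longrightarrow> f ` carrier T \<subseteq> \<pi> ` carrier S"
    using trace_exists[OF T M] by metis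
  interpret \<pi>: lin R S M \<pi> by (rule S(2))
  have "fac R T (M \<down> \<pi> ` carrier S)"
    by (rule fac_image[OF fac_tpow[OF T S(1)] \<pi>.restrict_codomain[OF \<pi>.submodule_range order_refl]]) simp
  then show ?thesis using \<pi>.submodule_range S(3) by (intro exI[of _ "\<pi> ` carrier S"]) auto
qed

lemma tpow_onto:
  assumes T: "fg_mod R T" and M: "fac R T M"
  shows "\<exists>S \<pi>. tpow R T S \<and> lin R S M \<pi> \<and> \<pi> ` carrier S = carrier M"
proof -
  obtain S \<pi> where S: "tpow R T S" "lin R S M \<pi>" "\<forall>f. lin R T M f \<longrightarrow> f ` carrier T \<subseteq> \<pi> ` carrier S"
    using trace_exists[OF T fac_fg[OF M]] by metis
  have "\<pi> ` carrier S = carrier M"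
    using S(3) by (intro facD[OF M lin.submodule_range[OF S(2)]]) auto
  then show ?thesis using S by metis
qed

end

text \<open>
  \<open>factors A P1 P0 d M\<close>: every map \<open>P1 \<rightarrow> M\<close> factors through \<open>d\<close>. For a minimal projective
  presentation \<open>d\<close> of \<open>T\<close> this means \<open>Hom(M, \<tau> T) = 0\<close>.
\<close>

definition factors :: "('a, 'r) ring_scheme \<Rightarrow> ('a, 'p) module \<Rightarrow> ('a, 'q) module \<Rightarrow> ('p \<Rightarrow> 'q) \<Rightarrow> ('a, 'm) module \<Rightarrow> bool" where
  "factors R P1 P0 d M \<longleftrightarrow>
     (\<forall>f. lin R P1 M f \<longrightarrow> extends_along R P1 P0 M d f)"

lemma factors_biprod:
  assumes b: "biprod R M N S i j p q" and M: "factors R P1 P0 d M" and N: "factors R P1 P0 d N"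
    and d: "lin R P1 P0 d"
  shows "factors R P1 P0 d S"
  unfolding factors_def
proof (intro allI impI)
  fix f assume f: "lin R P1 S f"
  note b' = biprodD[OF b]
  obtain g where g: "lin R P0 M g" "\<forall>x\<in>carrier P1. g (d x) = p (f x)"
    using M lin_comp[OF f b'(3)] unfolding factors_def by metis
  obtain h where h: "lin R P0 N h" "\<forall>x\<in>carrier P1. h (d x) = q (f x)"
    using N lin_comp[OF f b'(4)] unfolding factors_def by metis
  show "extends_along R P1 P0 S d f"
    using lin_add_map[OF lin_comp[OF g(1) b'(1)] lin_comp[OF h(1) b'(2)]] g(2) h(2) b'(9) lin.closed[OF f]
    by (intro exI[of _ "\<lambda>x. i (g x) \<oplus>\<^sub>S j (h x)"]) simp
qed

lemma factors_zero:
  assumes "carrier M = {\<zero>\<^sub>M}" "right_module R M" "right_module R P0"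
  shows "factors R P1 P0 d M"
  unfolding factors_def
proof (intro allI impI)
  fix f assume f: "lin R P1 M f"
  have "f x = \<zero>\<^sub>M" if "x \<in> carrier P1" for x using lin.closed[OF f that] assms(1) by simp
  then show "extends_along R P1 P0 M d f"
    using lin_zero[OF assms(3,2)] by (intro exI[of _ "\<lambda>x. \<zero>\<^sub>M"]) simp
qed

text \<open>\<open>P1\<close> is projective, so a map to the quotient \<open>M'\<close> lifts to
  \<open>M\<close>, where it factors through \<open>d\<close>.\<close>

lemma factors_image:
  assumes P1: "projective R P1" and M: "fg_mod R M" and w: "lin R M M' w" "w ` carrier M = carrier M'"
    and c: "factors R P1 P0 d M"
  shows "factors R P1 P0 d M'"
  unfolding factors_def
proof (intro allI impI)
  fix f assume f: "lin R P1 M' f"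
  obtain f' where f': "lin R P1 M f'" "\<forall>x\<in>carrier P1. w (f' x) = f x" using projective_lift[OF P1 M w f] by metis
  obtain g where g: "lin R P0 M g" "\<forall>x\<in>carrier P1. g (d x) = f' x" using c f'(1) unfolding factors_def by metis
  show "extends_along R P1 P0 M' d f"
    using lin_comp[OF g(1) w(1)] g(2) f'(2) by (intro exI[of _ "\<lambda>x. w (g x)"]) simp
qed

lemma lin_factor_inj:
  assumes u: "lin R L M u" and inj: "inj_on u (carrier L)" and f: "lin R N M f"
    and im: "\<And>x. x \<in> carrier N \<Longrightarrow> f x \<in> u ` carrier L"
  shows "lifts_along R N L u f"
proof -
  interpret u: lin R L M u by fact
  interpret f: lin R N M f by fact
  interpret u': lin R L "M \<down> u ` carrier L" u
    by (rule u.restrict_codomain[OF u.submodule_range order_refl])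
  have b: "bij_betw u (carrier L) (carrier (M \<down> u ` carrier L))" using inj by (simp add: bij_betw_def)
  have f': "lin R N (M \<down> u ` carrier L) f"
    using im by (intro f.restrict_codomain[OF u.submodule_range]) auto
  have "u (inv_into (carrier L) u (f x)) = f x" if "x \<in> carrier N" for x
    using im[OF that] by (rule f_inv_into_f)
  then show ?thesis using lin_comp[OF f' u'.inv_into_lin[OF b]] by (intro exI[of _ "\<lambda>x. inv_into (carrier L) u (f x)"]) simp
qed

section \<open>Vanishing of extension groups\<close>

text \<open>\<open>ext0 R P \<delta> n M\<close> says that the cohomology group of \<open>Hom(P, M)\<close> in degree \<open>n + 1\<close> vanishes.\<close>

definition ext0 :: "('a, 'r) ring_scheme \<Rightarrow> (nat \<Rightarrow> ('a, 'p) module) \<Rightarrow> (nat \<Rightarrow> 'p \<Rightarrow> 'p) \<Rightarrow> nat \<Rightarrow> ('a, 'm) module \<Rightarrow> bool" where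
  "ext0 R P \<delta> n M \<longleftrightarrow> (\<forall>f. lin R (P (Suc n)) M f \<and> (\<forall>y\<in>carrier (P (Suc (Suc n))). f (\<delta> (Suc n) y) = \<zero>\<^sub>M) \<longrightarrow>
     extends_along R (P (Suc n)) (P n) M (\<delta> n) f)"

lemma ext0D:
  "\<lbrakk>ext0 R P \<delta> n M; lin R (P (Suc n)) M f; \<And>y. y \<in> carrier (P (Suc (Suc n))) \<Longrightarrow> f (\<delta> (Suc n) y) = \<zero>\<^sub>M\<rbrakk>
    \<Longrightarrow> extends_along R (P (Suc n)) (P n) M (\<delta> n) f"
  unfolding ext0_def by simp

lemma ext0I:
  "(\<And>f. \<lbrakk>lin R (P (Suc n)) M f; \<And>y. y \<in> carrier (P (Suc (Suc n))) \<Longrightarrow> f (\<delta> (Suc n) y) = \<zero>\<^sub>M\<rbrakk>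
    \<Longrightarrow> extends_along R (P (Suc n)) (P n) M (\<delta> n) f) \<Longrightarrow> ext0 R P \<delta> n M"
  unfolding ext0_def by simp

lemma ext0_biprod:
  assumes b: "biprod R M N S i j p q" and M: "ext0 R P \<delta> n M" and N: "ext0 R P \<delta> n N"
  shows "ext0 R P \<delta> n S"
proof (rule ext0I)
  fix f assume f: "lin R (P (Suc n)) S f" "\<And>y. y \<in> carrier (P (Suc (Suc n))) \<Longrightarrow> f (\<delta> (Suc n) y) = \<zero>\<^sub>S"
  note b' = biprodD[OF b]
  obtain g where g: "lin R (P n) M g" "\<forall>x\<in>carrier (P (Suc n)). g (\<delta> n x) = p (f x)"
    using ext0D[OF M lin_comp[OF f(1) b'(3)]] f(2) lin.zero[OF b'(3)] by auto
  obtain h where h: "lin R (P n) N h" "\<forall>x\<in>carrier (P (Suc n)). h (\<delta> n x) = q (f x)"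
    using ext0D[OF N lin_comp[OF f(1) b'(4)]] f(2) lin.zero[OF b'(4)] by auto
  show "extends_along R (P (Suc n)) (P n) S (\<delta> n) f"
    using lin_add_map[OF lin_comp[OF g(1) b'(1)] lin_comp[OF h(1) b'(2)]] g(2) h(2) b'(9) lin.closed[OF f(1)]
    by (intro exI[of _ "\<lambda>x. i (g x) \<oplus>\<^sub>S j (h x)"]) simp
qed

lemma ext0_retract:
  assumes M: "ext0 R P \<delta> n M" and u: "lin R N M u" and v: "lin R M N v"
    and vu: "\<And>x. x \<in> carrier N \<Longrightarrow> v (u x) = x"
  shows "ext0 R P \<delta> n N"
proof (rule ext0I)
  fix f assume f: "lin R (P (Suc n)) N f" "\<And>y. y \<in> carrier (P (Suc (Suc n))) \<Longrightarrow> f (\<delta> (Suc n) y) = \<zero>\<^sub>N"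
  obtain g where g: "lin R (P n) M g" "\<forall>x\<in>carrier (P (Suc n)). g (\<delta> n x) = u (f x)"
    using ext0D[OF M lin_comp[OF f(1) u]] f(2) lin.zero[OF u] by auto
  show "extends_along R (P (Suc n)) (P n) N (\<delta> n) f"
    using lin_comp[OF g(1) v] g(2) vu lin.closed[OF f(1)] by (intro exI[of _ "\<lambda>x. v (g x)"]) simp
qed

lemma ext0_zero:
  assumes "carrier M = {\<zero>\<^sub>M}" "right_module R M" "right_module R (P n)"
  shows "ext0 R P \<delta> n M"
proof (rule ext0I)
  fix f assume f: "lin R (P (Suc n)) M f"
  have "f x = \<zero>\<^sub>M" if "x \<in> carrier (P (Suc n))" for x using lin.closed[OF f that] assms(1) by simp
  then show "extends_along R (P (Suc n)) (P n) M (\<delta> n) f"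
    using lin_zero[OF assms(3,2)] by (intro exI[of _ "\<lambda>x. \<zero>\<^sub>M"]) simp
qed

lemma proj_resolutionD:
  assumes "proj_resolution R T P \<epsilon> \<delta>" and T: "right_module R T"
  shows "projective R (P i)" "lin R (P 0) T \<epsilon>" "lin R (P (Suc i)) (P i) (\<delta> i)"
    "\<epsilon> ` carrier (P 0) = carrier T" "ker (P 0) T \<epsilon> = \<delta> 0 ` carrier (P (Suc 0))"
    "ker (P (Suc i)) (P i) (\<delta> i) = \<delta> (Suc i) ` carrier (P (Suc (Suc i)))"
    "\<And>x. x \<in> carrier (P (Suc (Suc i))) \<Longrightarrow> \<delta> i (\<delta> (Suc i) x) = \<zero>\<^bsub>P i\<^esub>"
proof -
  have r: "\<And>i. fg_mod R (P i)" "\<epsilon> \<in> rhom R (P 0) T" "\<And>i. \<delta> i \<in> rhom R (P (Suc i)) (P i)"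
    using assms(1) by (simp_all add: proj_resolution_def resolution_def)
  show p: "projective R (P i)" using assms(1) by (simp add: proj_resolution_def)
  show "lin R (P 0) T \<epsilon>" by (rule rhom_lin[OF fg_modD[OF r(1)] T r(2)])
  show "lin R (P (Suc i)) (P i) (\<delta> i)" by (rule rhom_lin[OF fg_modD[OF r(1)] fg_modD[OF r(1)] r(3)])
  show "\<epsilon> ` carrier (P 0) = carrier T" "ker (P 0) T \<epsilon> = \<delta> 0 ` carrier (P (Suc 0))"
    using assms(1) by (simp_all add: proj_resolution_def resolution_def a_kernel_eq_ker)
  show k: "ker (P (Suc i)) (P i) (\<delta> i) = \<delta> (Suc i) ` carrier (P (Suc (Suc i)))"
    using assms(1) by (simp add: proj_resolution_def resolution_def a_kernel_eq_ker)
  fix x assume "x \<in> carrier (P (Suc (Suc i)))"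
  then have "\<delta> (Suc i) x \<in> ker (P (Suc i)) (P i) (\<delta> i)" unfolding k by simp
  then show "\<delta> i (\<delta> (Suc i) x) = \<zero>\<^bsub>P i\<^esub>" by (simp add: ker_iff)
qed

section \<open>Pieces of the long exact sequence of Ext\<close>

definition short_exact :: "('a, 'r) ring_scheme \<Rightarrow> ('a, 'l) module \<Rightarrow> ('a, 'm) module \<Rightarrow> ('a, 'n) module \<Rightarrow>
    ('l \<Rightarrow> 'm) \<Rightarrow> ('m \<Rightarrow> 'n) \<Rightarrow> bool" where
  "short_exact R L M N u w \<longleftrightarrow> lin R L M u \<and> lin R M N w \<and> inj_on u (carrier L) \<and>
     w ` carrier M = carrier N \<and> ker M N w = u ` carrier L"

lemma short_exactD:
  assumes "short_exact R L M N u w"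
  shows "lin R L M u" "lin R M N w" "inj_on u (carrier L)" "w ` carrier M = carrier N" "ker M N w = u ` carrier L"
    "\<And>x. x \<in> carrier L \<Longrightarrow> w (u x) = \<zero>\<^sub>N"
proof -
  show a: "lin R L M u" "lin R M N w" "inj_on u (carrier L)" "w ` carrier M = carrier N" "ker M N w = u ` carrier L"
    using assms by (simp_all add: short_exact_def)
  fix x assume "x \<in> carrier L"
  then have "u x \<in> ker M N w" unfolding a(5) by simp
  then show "w (u x) = \<zero>\<^sub>N" by (simp add: ker_iff)
qed

text \<open>The part Ext^(n+1)(T, M) -> Ext^(n+1)(T, N) -> Ext^(n+2)(T, L) of the long exact
  sequence, on cocycles: a lift of \<open>f\<close> to \<open>M\<close> has its coboundary in
  \<open>L\<close>, and after subtracting a map to \<open>L\<close> with the same coboundary the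
  lift is a cocycle.\<close>

lemma ext0_quotient:
  assumes res: "proj_resolution R T P \<epsilon> \<delta>" and T: "right_module R T" and se: "short_exact R L M N u w"
    and M: "fg_mod R M" and eM: "ext0 R P \<delta> n M" and eL: "ext0 R P \<delta> (Suc n) L"
  shows "ext0 R P \<delta> n N"
proof (rule ext0I)
  note r = proj_resolutionD[OF res T]
  note s = short_exactD[OF se]
  interpret u: lin R L M u by (rule s(1))
  interpret w: lin R M N w by (rule s(2))
  fix f assume f: "lin R (P (Suc n)) N f" "\<And>y. y \<in> carrier (P (Suc (Suc n))) \<Longrightarrow> f (\<delta> (Suc n) y) = \<zero>\<^sub>N"
  obtain f' where f': "lin R (P (Suc n)) M f'" "\<forall>x\<in>carrier (P (Suc n)). w (f' x) = f x"
    using projective_lift[OF r(1) M s(2,4) f(1)] by metis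
  have fd: "lin R (P (Suc (Suc n))) M (\<lambda>y. f' (\<delta> (Suc n) y))" by (rule lin_comp[OF r(3) f'(1)])
  have "f' (\<delta> (Suc n) y) \<in> u ` carrier L" if y: "y \<in> carrier (P (Suc (Suc n)))" for y
    unfolding s(5)[symmetric] using lin.closed[OF fd y] f'(2) f(2)[OF y] lin.closed[OF r(3) y] by (simp add: ker_iff)
  from lin_factor_inj[OF s(1,3) fd this] obtain k where k: "lin R (P (Suc (Suc n))) L k"
    "\<forall>y\<in>carrier (P (Suc (Suc n))). u (k y) = f' (\<delta> (Suc n) y)" by metis
  have "k (\<delta> (Suc (Suc n)) z) = \<zero>\<^sub>L" if z: "z \<in> carrier (P (Suc (Suc (Suc n))))" for z
  proof -
    note c = lin.closed[OF r(3) z]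
    have "u (k (\<delta> (Suc (Suc n)) z)) = \<zero>\<^sub>M" using k(2) c r(7)[OF z] lin.zero[OF f'(1)] by simp
    then show ?thesis using lin.closed[OF k(1) c] s(3) u.inj_iff by simp
  qed
  from ext0D[OF eL k(1) this] obtain g where g: "lin R (P (Suc n)) L g"
    "\<forall>y\<in>carrier (P (Suc (Suc n))). g (\<delta> (Suc n) y) = k y" by metis
  have l: "lin R (P (Suc n)) M (\<lambda>x. f' x \<ominus>\<^sub>M u (g x))" by (rule lin_diff_map[OF f'(1) lin_comp[OF g(1) s(1)]])
  have "f' (\<delta> (Suc n) y) \<ominus>\<^sub>M u (g (\<delta> (Suc n) y)) = \<zero>\<^sub>M" if y: "y \<in> carrier (P (Suc (Suc n)))" for y
    using g(2) k(2) y lin.closed[OF fd y] by simp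
  from ext0D[OF eM l this] obtain h where h: "lin R (P n) M h"
    "\<forall>x\<in>carrier (P (Suc n)). h (\<delta> n x) = f' x \<ominus>\<^sub>M u (g x)" by metis
  have "w (h (\<delta> n x)) = f x" if x: "x \<in> carrier (P (Suc n))" for x
    using h(2) x lin.closed[OF f'(1) x] lin.closed[OF g(1) x] f'(2) lin.closed[OF f(1) x] s(6)
    by (simp add: w.diff) (simp add: a_minus_def)
  then show "extends_along R (P (Suc n)) (P n) N (\<delta> n) f"
    using lin_comp[OF h(1) s(2)] by (intro exI[of _ "\<lambda>x. w (h x)"]) simp
qed

text \<open>The part Ext^(n+1)(T, N) -> Ext^(n+2)(T, L) -> Ext^(n+2)(T, M). In \<open>M\<close> the
  cocycle is the coboundary of some \<open>g\<close>. The image of \<open>g\<close> in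
  \<open>N\<close> is a cocycle, hence the coboundary of some \<open>h\<close>; subtracting the
  coboundary of a lift of \<open>h\<close> moves \<open>g\<close> into \<open>L\<close>.\<close>

lemma ext0_sub:
  assumes res: "proj_resolution R T P \<epsilon> \<delta>" and T: "right_module R T" and se: "short_exact R L M N u w"
    and M: "fg_mod R M" and eN: "ext0 R P \<delta> n N" and eM: "ext0 R P \<delta> (Suc n) M"
  shows "ext0 R P \<delta> (Suc n) L"
proof (rule ext0I)
  note r = proj_resolutionD[OF res T]
  note s = short_exactD[OF se]
  interpret u: lin R L M u by (rule s(1))
  interpret w: lin R M N w by (rule s(2))
  fix f assume f: "lin R (P (Suc (Suc n))) L f"
    "\<And>y. y \<in> carrier (P (Suc (Suc (Suc n)))) \<Longrightarrow> f (\<delta> (Suc (Suc n)) y) = \<zero>\<^sub>L"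
  obtain g where g: "lin R (P (Suc n)) M g" "\<forall>x\<in>carrier (P (Suc (Suc n))). g (\<delta> (Suc n) x) = u (f x)"
    using ext0D[OF eM lin_comp[OF f(1) s(1)]] f(2) by auto
  have "w (g (\<delta> (Suc n) y)) = \<zero>\<^sub>N" if y: "y \<in> carrier (P (Suc (Suc n)))" for y
    using g(2) y s(6)[OF lin.closed[OF f(1) y]] by simp
  from ext0D[OF eN lin_comp[OF g(1) s(2)] this] obtain h where h: "lin R (P n) N h"
    "\<forall>x\<in>carrier (P (Suc n)). h (\<delta> n x) = w (g x)" by metis
  obtain h' where h': "lin R (P n) M h'" "\<forall>x\<in>carrier (P n). w (h' x) = h x"
    using projective_lift[OF r(1) M s(2,4) h(1)] by metis
  have l: "lin R (P (Suc n)) M (\<lambda>x. g x \<ominus>\<^sub>M h' (\<delta> n x))" by (rule lin_diff_map[OF g(1) lin_comp[OF r(3) h'(1)]])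
  have "g x \<ominus>\<^sub>M h' (\<delta> n x) \<in> u ` carrier L" if x: "x \<in> carrier (P (Suc n))" for x
  proof -
    note c = lin.closed[OF r(3) x] lin.closed[OF g(1) x]
    have "w (g x \<ominus>\<^sub>M h' (\<delta> n x)) = \<zero>\<^sub>N"
      using c h'(2) h(2) x lin.closed[OF h'(1) c(1)] by (simp add: w.diff)
    then show ?thesis unfolding s(5)[symmetric] using lin.closed[OF l x] by (simp add: ker_iff)
  qed
  from lin_factor_inj[OF s(1,3) l this] obtain k where k: "lin R (P (Suc n)) L k"
    "\<forall>x\<in>carrier (P (Suc n)). u (k x) = g x \<ominus>\<^sub>M h' (\<delta> n x)" by metis
  have "k (\<delta> (Suc n) x) = f x" if x: "x \<in> carrier (P (Suc (Suc n)))" for x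
  proof -
    note c = lin.closed[OF r(3) x]
    have "u (k (\<delta> (Suc n) x)) = u (f x)"
      using k(2) c g(2) x r(7)[OF x] lin.zero[OF h'(1)] lin.closed[OF f(1) x] by (simp add: a_minus_def)
    then show ?thesis using s(3) lin.closed[OF k(1) c] lin.closed[OF f(1) x] by (metis inj_onD)
  qed
  then show "\<exists>g. lin R (P (Suc n)) L g \<and> (\<forall>x\<in>carrier (P (Suc (Suc n))). g (\<delta> (Suc n) x) = f x)"
    using k(1) by metis
qed

section \<open>The endomorphism algebra and the functor \<open>Hom(T, -)\<close>\<close>

definition hom_module :: "('a, 'r) ring_scheme \<Rightarrow> ('a, 't) module \<Rightarrow> ('a, 'm) module \<Rightarrow> ('t \<Rightarrow> 't, 't \<Rightarrow> 'm) module" where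
  "hom_module R T M = with_smult (hom_group R T M) (\<lambda>b f. compose (carrier T) f b)"

lemma hom_module_simps [simp]:
  "carrier (hom_module R T M) = rhom R T M" "\<zero>\<^bsub>hom_module R T M\<^esub> = (\<lambda>x\<in>carrier T. \<zero>\<^sub>M)"
  "f \<oplus>\<^bsub>hom_module R T M\<^esub> g = (\<lambda>x\<in>carrier T. f x \<oplus>\<^sub>M g x)"
  "b \<odot>\<^bsub>hom_module R T M\<^esub> f = compose (carrier T) f b"
  by (simp_all add: hom_module_def)

lemma End_algebra_simps [simp]:
  "carrier (End_algebra A T) = rhom A T T" "\<zero>\<^bsub>End_algebra A T\<^esub> = (\<lambda>x\<in>carrier T. \<zero>\<^sub>T)"
  "\<one>\<^bsub>End_algebra A T\<^esub> = (\<lambda>x\<in>carrier T. x)"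
  "f \<oplus>\<^bsub>End_algebra A T\<^esub> g = (\<lambda>x\<in>carrier T. f x \<oplus>\<^sub>T g x)"
  "f \<otimes>\<^bsub>End_algebra A T\<^esub> g = compose (carrier T) f g"
  "c \<odot>\<^bsub>End_algebra A T\<^esub> f = (\<lambda>x\<in>carrier T. (c \<odot>\<^sub>A \<one>\<^sub>A) \<odot>\<^sub>T f x)"
  by (simp_all add: End_algebra_def with_smult_def ring.defs module.defs hom_group_def)

lemma End_module_simps [simp]:
  "carrier (End_module T) = carrier T" "\<zero>\<^bsub>End_module T\<^esub> = \<zero>\<^sub>T" "x \<oplus>\<^bsub>End_module T\<^esub> y = x \<oplus>\<^sub>T y"
  "f \<odot>\<^bsub>End_module T\<^esub> x = f x"
  by (simp_all add: End_module_def)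

lemma compose_rhom:
  assumes "right_module R L" "right_module R M" "right_module R N" "f \<in> rhom R L M" "g \<in> rhom R M N"
  shows "compose (carrier L) g f \<in> rhom R L N"
  using lin.in_rhom[OF lin_comp[OF rhom_lin[OF assms(1,2,4)] rhom_lin[OF assms(2,3,5)]]] by (simp add: compose_def)

lemma ring_End_algebra:
  assumes T: "right_module A T"
  shows "ring (End_algebra A T)" (is "ring ?B")
proof (rule ringI)
  interpret T: right_module A T by fact
  note cl = compose_rhom[OF T T T]
  have id: "(\<lambda>x\<in>carrier T. x) \<in> rhom A T T" using lin.in_rhom[OF lin_id[OF T]] .
  show "abelian_group ?B"
  proof -
    interpret H: abelian_group "hom_group A T T" by (rule abelian_group_hom_group[OF T T])
    show ?thesis
    proof (rule abelian_groupI)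
      fix f assume "f \<in> carrier ?B"
      then show "\<exists>g\<in>carrier ?B. g \<oplus>\<^sub>?B f = \<zero>\<^sub>?B"
        using H.l_neg[of f] H.a_inv_closed[of f] by (intro bexI[of _ "\<ominus>\<^bsub>hom_group A T T\<^esub> f"]) simp_all
    qed (use H.a_closed H.zero_closed H.a_assoc H.a_comm H.l_zero in simp_all)
  qed
  show "monoid ?B"
  proof (rule monoidI)
    fix f assume "f \<in> carrier ?B"
    then have f: "f \<in> rhom A T T" by simp
    show "\<one>\<^sub>?B \<otimes>\<^sub>?B f = f" "f \<otimes>\<^sub>?B \<one>\<^sub>?B = f"
      using rhom_closed[OF f] rhom_undefined[OF f] by (auto simp: compose_def fun_eq_iff)
  qed (use cl id in \<open>auto simp: compose_def fun_eq_iff rhom_closed\<close>)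
next
  fix f g h assume "f \<in> carrier ?B" "g \<in> carrier ?B" "h \<in> carrier ?B"
  then have fgh: "f \<in> rhom A T T" "g \<in> rhom A T T" "h \<in> rhom A T T" by simp_all
  interpret h: lin A T T h by (rule rhom_lin[OF T T fgh(3)])
  show "(f \<oplus>\<^sub>?B g) \<otimes>\<^sub>?B h =
      f \<otimes>\<^sub>?B h \<oplus>\<^sub>?B g \<otimes>\<^sub>?B h"
    by (auto simp: compose_def fun_eq_iff)
  show "h \<otimes>\<^sub>?B (f \<oplus>\<^sub>?B g) =
      h \<otimes>\<^sub>?B f \<oplus>\<^sub>?B h \<otimes>\<^sub>?B g"
    using rhom_closed[OF fgh(1)] rhom_closed[OF fgh(2)] by (auto simp: compose_def fun_eq_iff h.add)
qed

lemma right_module_hom_module: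
  assumes T: "right_module A T" and M: "right_module A M"
  shows "right_module (End_algebra A T) (hom_module A T M)"
  unfolding hom_module_def compose_def
  by (rule right_module_hom_action[OF T M ring_End_algebra[OF T], where \<sigma> = "\<lambda>b. b"])
    (simp_all add: rhom_lin[OF T T] compose_def)

lemma lin_hom_module:
  assumes T: "right_module A T" and w: "lin A M N w"
  shows "lin (End_algebra A T) (hom_module A T M) (hom_module A T N) (compose (carrier T) w)"
    (is "lin ?B ?FM ?FN ?w")
proof -
  interpret w: lin A M N w by fact
  show ?thesis
  proof (rule linI[OF right_module_hom_module[OF T w.dom_mod] right_module_hom_module[OF T w.cod_mod]])
    fix f assume "f \<in> carrier ?FM"
    then show "?w f \<in> carrier ?FN"
      using lin.in_rhom[OF lin_comp[OF rhom_lin[OF T w.dom_mod] w.lin_axioms]] by (simp add: compose_def)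
  next
    fix f g assume "f \<in> carrier ?FM" "g \<in> carrier ?FM"
    then show "?w (f \<oplus>\<^sub>?FM g) =
        ?w f \<oplus>\<^sub>?FN ?w g"
      by (auto simp: compose_def fun_eq_iff rhom_closed w.add)
  next
    fix b f assume "b \<in> carrier ?B" "f \<in> carrier ?FM"
    then show "?w (b \<odot>\<^sub>?FM f) =
        b \<odot>\<^sub>?FN ?w f"
      by (auto simp: compose_def fun_eq_iff rhom_closed)
  qed
qed

section \<open>Finite length over the endomorphism algebra\<close>

context fd_algebra
begin

text \<open>Multiplication by a scalar is an endomorphism of \<open>T\<close>, so the submodules of
  Hom(T, M) over the endomorphism algebra are subspaces, and the dimension bounds their
  chains.\<close>

lemma mchain_hom_module:
  assumes T: "right_module A T" and M: "right_module A M" and c: "mchain (End_algebra A T) (hom_module A T M) n U"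
  shows "mchain K (Hom T M) n U"
proof -
  have sub: "submodule U K (Hom T M)" if U: "submodule U (End_algebra A T) (hom_module A T M)" for U
  proof (rule right_module.submoduleI[OF right_module_hom_space[OF T M]])
    note U' = submoduleD[OF U]
    interpret H: right_module K "Hom T T" by (rule right_module_hom_space[OF T T])
    show "U \<subseteq> carrier (Hom T M)" "\<zero>\<^bsub>Hom T M\<^esub> \<in> U"
      "\<And>x y. \<lbrakk>x \<in> U; y \<in> U\<rbrakk> \<Longrightarrow> x \<oplus>\<^bsub>Hom T M\<^esub> y \<in> U" using U'(1,2,4) by simp_all
    fix c f assume c: "c \<in> carrier K" and f: "f \<in> U"
    then have f': "f \<in> rhom A T M" using U'(1) by auto
    interpret f: lin A T M f by (rule rhom_lin[OF T M f'])
    have "(\<lambda>x\<in>carrier T. x) \<in> carrier (Hom T T)"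
      unfolding hom_space_simps by (rule lin.in_rhom[OF lin_id[OF T]])
    from H.smult_closed'[OF c this]
    have "c \<odot>\<^bsub>Hom T T\<^esub> (\<lambda>x\<in>carrier T. x) \<in> rhom A T T" by (simp only: hom_space_simps(1))
    from U'(5)[OF _ f] this
    have "(c \<odot>\<^bsub>Hom T T\<^esub> (\<lambda>x\<in>carrier T. x)) \<odot>\<^bsub>hom_module A T M\<^esub> f \<in> U" by simp
    moreover have "(c \<odot>\<^bsub>Hom T T\<^esub> (\<lambda>x\<in>carrier T. x)) \<odot>\<^bsub>hom_module A T M\<^esub> f = c \<odot>\<^bsub>Hom T M\<^esub> f"
      using c by (auto simp: compose_def fun_eq_iff f.smult)
    ultimately show "c \<odot>\<^bsub>Hom T M\<^esub> f \<in> U" by simp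
  qed
  show ?thesis using c by induction (auto intro: mchain.intros sub)
qed

lemma flen_hom_module:
  assumes T: "fg_mod A T" and M: "fg_mod A M"
  shows "flen (End_algebra A T) (hom_module A T M)"
  using flen_hom[OF T M] mchain_hom_module[OF fg_modD[OF T] fg_modD[OF M]] unfolding flen_def by metis

lemma finlen_End_algebra:
  assumes T: "fg_mod A T"
  shows "finlen_ring (End_algebra A T)"
proof -
  interpret B: ring "End_algebra A T" by (rule ring_End_algebra[OF fg_modD[OF T]])
  have "lin (End_algebra A T) (hom_module A T T) (regular (End_algebra A T)) (\<lambda>f. f)"
    using right_module_hom_module[OF fg_modD[OF T] fg_modD[OF T]] B.right_module_regular by (intro linI) simp_all
  from lin.len_bij(1)[OF this _ flen_hom_module[OF T T]]
  show ?thesis by (simp add: finlen_ring_def finlen_ring_axioms_def B.ring_axioms bij_betw_def)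
qed

end

text \<open>Rigidity is kept as \<open>factors_T\<close>, a property of a fixed projective
  presentation; neither \<open>tau\<close> nor the transpose occurs inside this locale.\<close>

locale rigid_module = fd_algebra K A for K :: "'k ring" (structure) and A :: "('k, 'a) module" (structure) +
  fixes T :: "('a, 't) module" and P0 P1 :: "'a std_module"
    and p0 :: "(nat \<Rightarrow> 'a) set \<Rightarrow> 't" and d :: "(nat \<Rightarrow> 'a) set \<Rightarrow> (nat \<Rightarrow> 'a) set"
  assumes T: "fg_mod A T" and P0: "projective A P0" and P1: "projective A P1"
    and p0: "lin A P0 T p0" and p0_surj: "p0 ` carrier P0 = carrier T"
    and d: "lin A P1 P0 d" and d_exact: "d ` carrier P1 = ker P0 T p0"
    and factors_T: "factors A P1 P0 d T"
begin

abbreviation B :: "('k, 't \<Rightarrow> 't) module" where "B \<equiv> End_algebra A T"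
abbreviation F :: "('a, 'm) module \<Rightarrow> ('t \<Rightarrow> 't, 't \<Rightarrow> 'm) module" where "F \<equiv> hom_module A T"

abbreviation Fm :: "('m \<Rightarrow> 'n) \<Rightarrow> ('t \<Rightarrow> 'm) \<Rightarrow> 't \<Rightarrow> 'n" where "Fm \<equiv> compose (carrier T)"

lemma finlen_rings: "finlen_ring A" "finlen_ring B"
  using finlen_A finlen_End_algebra[OF T] .

lemma T_mod: "right_module A T" by (rule fg_modD[OF T])

sublocale T: right_module A T by (rule T_mod)

lemma F_mod: "right_module A M \<Longrightarrow> right_module B (F M)" by (rule right_module_hom_module[OF T_mod])

lemma fg_F: "fg_mod A M \<Longrightarrow> fg_mod B (F M)"
  using finlen_ring.fg_iff_flen[OF finlen_rings(2)] flen_hom_module[OF T] F_mod[OF fg_modD] by blast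

lemma factors_fac:
  assumes M: "fac A T M"
  shows "factors A P1 P0 d M"
proof -
  have S: "factors A P1 P0 d S" if "tpow A T S" for S
    using that
  proof induction
    case (zero S)
    show ?case by (rule factors_zero[OF zero(2) fg_modD[OF zero(1)] lin.cod_mod[OF d]])
  next
    case (step S S' i j p q)
    show ?case by (rule factors_biprod[OF step(3,4) factors_T d])
  qed
  obtain S \<pi> where "tpow A T S" "lin A S M \<pi>" "\<pi> ` carrier S = carrier M" using AF.tpow_onto[OF T M] by metis
  then show ?thesis using factors_image[OF P1 tpow_fg _ _ S] by metis
qed

lemma d_zero: "x \<in> carrier P1 \<Longrightarrow> p0 (d x) = \<zero>\<^sub>T"
  using d_exact by (auto simp: ker_iff set_eq_iff)

text \<open>Lift \<open>f\<close> after \<open>p0\<close> to a map \<open>l\<close> from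
  \<open>P0\<close> to \<open>M\<close>. Then \<open>l d\<close> has values in the kernel of
  \<open>w\<close>, so it equals \<open>g d\<close> for some \<open>g\<close> from \<open>P0\<close>
  to that kernel; \<open>l - g\<close> vanishes on the image of \<open>d\<close> and descends to
  \<open>T\<close>.\<close>

lemma lift_from_T:
  assumes w: "lin A M N w" "w ` carrier M = carrier N" and M: "fg_mod A M"
    and k: "factors A P1 P0 d (M \<down> ker M N w)" and f: "lin A T N f"
  shows "lifts_along A T M w f"
proof -
  interpret w: lin A M N w by fact
  interpret d: lin A P1 P0 d by (rule d)
  interpret p0: lin A P0 T p0 by (rule p0)
  obtain l where l: "lin A P0 M l" "\<forall>x\<in>carrier P0. w (l x) = f (p0 x)"
    using projective_lift[OF P0 M w lin_comp[OF p0 f]] by metis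
  have "lin A P1 (M \<down> ker M N w) (\<lambda>x. l (d x))"
    using l(2) d_zero lin.zero[OF f] lin.closed[OF l(1)]
    by (intro lin.restrict_codomain[OF lin_comp[OF d l(1)] w.submodule_ker]) (auto simp: ker_iff)
  then obtain g where g: "lin A P0 (M \<down> ker M N w) g" "\<forall>x\<in>carrier P1. g (d x) = l (d x)"
    using k unfolding factors_def by metis
  have g': "lin A P0 M g" using lin_comp[OF g(1) lin_incl[OF w.dom_mod w.submodule_ker]] by simp
  have wg: "w (g x) = \<zero>\<^sub>N" if "x \<in> carrier P0" for x
    using lin.closed[OF g(1) that] by (simp add: ker_iff)
  have l': "lin A P0 M (\<lambda>x. l x \<ominus>\<^sub>M g x)" by (rule lin_diff_map[OF l(1) g'])
  have "l x \<ominus>\<^sub>M g x = \<zero>\<^sub>M" if x: "x \<in> carrier P0" "p0 x = \<zero>\<^sub>T" for x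
  proof -
    have "x \<in> d ` carrier P1" using x d_exact by (simp add: ker_iff)
    then obtain y where "y \<in> carrier P1" "x = d y" by auto
    then show ?thesis using g(2) lin.closed[OF l(1) x(1)] by simp
  qed
  from p0.factor_surj[OF l' p0_surj this] obtain h where h: "lin A T M h"
    "\<forall>x\<in>carrier P0. h (p0 x) = l x \<ominus>\<^sub>M g x" by metis
  have "w (h y) = f y" if "y \<in> carrier T" for y
  proof -
    have "y \<in> p0 ` carrier P0" using that p0_surj by simp
    then obtain x where x: "x \<in> carrier P0" "y = p0 x" by auto
    then show ?thesis
      using h(2) l(2) wg lin.closed[OF l(1) x(1)] lin.closed[OF g' x(1)] lin.closed[OF f that]
      by (simp add: w.diff) (simp add: a_minus_def)
  qed
  then show ?thesis using h(1) by metis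
qed

text \<open>Among the submodules of \<open>Z\<close> that are images of Hom(T, S), with
  \<open>S\<close> a finite sum of copies of \<open>T\<close>, take a maximal one. An element
  \<open>z\<close> of \<open>Z\<close> is itself a map from \<open>T\<close>; adding a copy of
  \<open>T\<close> mapped by \<open>z\<close> gives an image still inside \<open>Z\<close>, since
  \<open>Z\<close> is a \<open>B\<close>-submodule.\<close>

lemma sub_F_from_tpow:
  assumes M: "fg_mod A M" and Z: "submodule Z B (F M)"
  shows "\<exists>S \<zeta>. tpow A T S \<and> lin A S M \<zeta> \<and> Fm \<zeta> ` rhom A T S = Z"
proof -
  interpret M: right_module A M by (rule fg_modD[OF M])
  interpret FM: right_module B "F M" by (rule F_mod[OF M.right_module_axioms])
  note Z' = submoduleD[OF Z]
  define G where "G = {V. V \<subseteq> Z \<and> (\<exists>S \<zeta>. tpow A T S \<and> lin A S M \<zeta> \<and> V = Fm \<zeta> ` rhom A T S)}"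
  have Gsub: "submodule V B (F M)" if "V \<in> G" for V
  proof -
    obtain S :: "'a std_module" and \<zeta> where "lin A S M \<zeta>" "V = Fm \<zeta> ` rhom A T S" using \<open>V \<in> G\<close> unfolding G_def by auto
    then show ?thesis using lin.submodule_range[OF lin_hom_module[OF T_mod, of S M \<zeta>]] by simp
  qed
  obtain S0 where S0: "tpow A T S0" using AF.tpow_zero_exists by metis
  note S0m = fg_modD[OF tpow_fg[OF S0]]
  have "Fm (\<lambda>x. \<zero>\<^sub>M) ` rhom A T S0 \<subseteq> Z"
  proof (intro image_subsetI)
    fix g show "Fm (\<lambda>x. \<zero>\<^sub>M) g \<in> Z" using Z'(2) by (simp add: compose_def)
  qed
  then have "Fm (\<lambda>x. \<zero>\<^sub>M) ` rhom A T S0 \<in> G"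
    unfolding G_def using S0 lin_zero[OF S0m M.right_module_axioms] by blast
  then have "\<exists>U\<in>G. \<forall>V\<in>G. U \<subseteq> V \<longrightarrow> U = V"
    by (rule FM.ex_maximal_submodule[OF flen_hom_module[OF T M]]) (rule Gsub)
  then obtain U where U: "U \<in> G" "\<forall>V\<in>G. U \<subseteq> V \<longrightarrow> U = V" by (elim bexE)
  then obtain S \<zeta> where S: "tpow A T S" "lin A S M \<zeta>" "U = Fm \<zeta> ` rhom A T S" "U \<subseteq> Z"
    unfolding G_def by auto
  note Sm = fg_modD[OF tpow_fg[OF S(1)]]
  have "z \<in> U" if z: "z \<in> Z" for z
  proof -
    have z': "z \<in> rhom A T M" using Z'(3)[OF z] by simp
    note zl = rhom_lin[OF T_mod M.right_module_axioms z']
    obtain S' :: "'a std_module" and i j p q where S': "fg_mod A S'" "biprod A S T S' i j p q"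
      using AF.ex_biprod[OF tpow_fg[OF S(1)] T] by metis
    note m = biprod_map[OF S'(2) S(2) zl]
    note b = biprodD[OF S'(2)]
    let ?g = "\<lambda>s. \<zeta> (p s) \<oplus>\<^sub>M z (q s)"
    have "Fm ?g h \<in> Z" if h: "h \<in> rhom A T S'" for h
    proof -
      note hl = rhom_lin[OF T_mod fg_modD[OF S'(1)] h]
      have 1: "(\<lambda>x\<in>carrier T. p (h x)) \<in> rhom A T S" by (rule lin.in_rhom[OF lin_comp[OF hl b(3)]])
      have 2: "(\<lambda>x\<in>carrier T. q (h x)) \<in> rhom A T T" by (rule lin.in_rhom[OF lin_comp[OF hl b(4)]])
      have "Fm \<zeta> (\<lambda>x\<in>carrier T. p (h x)) \<in> Z" using 1 S(3,4) by auto
      moreover have "(\<lambda>x\<in>carrier T. q (h x)) \<odot>\<^bsub>F M\<^esub> z \<in> Z" using 2 z by (intro Z'(5)) simp_all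
      ultimately have "Fm \<zeta> (\<lambda>x\<in>carrier T. p (h x)) \<oplus>\<^bsub>F M\<^esub> (\<lambda>x\<in>carrier T. q (h x)) \<odot>\<^bsub>F M\<^esub> z \<in> Z"
        by (rule Z'(4))
      moreover have "Fm \<zeta> (\<lambda>x\<in>carrier T. p (h x)) \<oplus>\<^bsub>F M\<^esub> (\<lambda>x\<in>carrier T. q (h x)) \<odot>\<^bsub>F M\<^esub> z
          = Fm ?g h" by (auto simp: compose_def fun_eq_iff)
      ultimately show ?thesis by simp
    qed
    then have "Fm ?g ` rhom A T S' \<subseteq> Z" by auto
    then have G: "Fm ?g ` rhom A T S' \<in> G"
      unfolding G_def using tpow.step[OF S(1) S'] m(1) by blast
    have "U \<subseteq> Fm ?g ` rhom A T S'"
      unfolding S(3)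
    proof (intro image_subsetI)
      fix h assume h: "h \<in> rhom A T S"
      have m': "(\<lambda>x\<in>carrier T. i (h x)) \<in> rhom A T S'" by (rule lin.in_rhom[OF lin_comp[OF rhom_lin[OF T_mod Sm h] b(1)]])
      have e: "Fm \<zeta> h = Fm ?g (\<lambda>x\<in>carrier T. i (h x))"
        using m(2)[OF rhom_closed[OF h]] by (auto simp: compose_def fun_eq_iff)
      show "Fm \<zeta> h \<in> Fm ?g ` rhom A T S'" unfolding e by (rule imageI[OF m'])
    qed
    then have "U = Fm ?g ` rhom A T S'" using U(2) G by blast
    moreover have "z = Fm ?g (restrict j (carrier T))"
      using m(3) rhom_undefined[OF z'] by (auto simp: compose_def fun_eq_iff)
    moreover have "restrict j (carrier T) \<in> rhom A T S'" by (rule lin.in_rhom[OF b(2)])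
    ultimately show ?thesis by simp
  qed
  then have "U = Z" using S(4) by auto
  then show ?thesis using S by blast
qed

text \<open>\<open>Z\<close> comes from a map \<open>\<zeta>\<close> on \<open>S\<close>, but maps
  from \<open>T\<close> need not lift along the quotient of \<open>S\<close> by its kernel. Dividing
  by the trace \<open>U\<close> of \<open>T\<close> in the kernel keeps the lifting, as
  \<open>U\<close> is generated by \<open>T\<close>. It also makes the induced map injective on
  Hom(T, -), as every map from \<open>T\<close> into the kernel lands in \<open>U\<close>.\<close>

lemma sub_F_is_F:
  assumes M: "fg_mod A M" and Z: "submodule Z B (F M)"
  shows "\<exists>(Y :: 'a std_module) u. fac A T Y \<and> lin A Y M u \<and> inj_on (Fm u) (rhom A T Y) \<and>
    Fm u ` rhom A T Y = Z"
proof -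
  obtain S \<zeta> where S: "tpow A T S" "lin A S M \<zeta>" "Fm \<zeta> ` rhom A T S = Z"
    using sub_F_from_tpow[OF M Z] by metis
  note Sf = tpow_fg[OF S(1)]
  note Sm = fg_modD[OF Sf]
  interpret \<zeta>: lin A S M \<zeta> by (rule S(2))
  note L = \<zeta>.submodule_ker
  obtain U where U: "submodule U A (S \<down> ker S M \<zeta>)" "fac A T (S \<down> ker S M \<zeta> \<down> U)"
    "\<And>f x. \<lbrakk>lin A T (S \<down> ker S M \<zeta>) f; x \<in> carrier T\<rbrakk> \<Longrightarrow> f x \<in> U"
    using AF.trace_submodule[OF T AF.fg_sub[OF Sf L]] by metis
  have U': "submodule U A S" "U \<subseteq> ker S M \<zeta>" using U(1) \<zeta>.M.submodule_sub_iff[OF L] by simp_all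
  obtain Y :: "'a std_module" and q where Y: "fg_mod A Y" "lin A S Y q" "q ` carrier S = carrier Y" "ker S Y q = U"
    using std_quotient[OF Sf U'(1)] by metis
  interpret q: lin A S Y q by (rule Y(2))
  have fY: "fac A T Y" by (rule fac_image[OF AF.fac_tpow[OF T S(1)] Y(2,3)])
  have "\<zeta> x = \<zero>\<^sub>M" if "x \<in> carrier S" "q x = \<zero>\<^sub>Y" for x
  proof -
    have "x \<in> ker S Y q" using that by (simp add: ker_iff)
    then show ?thesis using Y(4) U'(2) by (auto simp: ker_iff)
  qed
  from q.factor_surj[OF S(2) Y(3) this] obtain u where u: "lin A Y M u" "\<forall>x\<in>carrier S. u (q x) = \<zeta> x" by metis
  have lift: "lifts_along A T S q f" if "lin A T Y f" for f
    using U(2) Y(4) by (intro lift_from_T[OF Y(2,3) Sf factors_fac that]) simp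
  have z: "f x = \<zero>\<^sub>Y" if f: "lin A T Y f" "\<And>x. x \<in> carrier T \<Longrightarrow> u (f x) = \<zero>\<^sub>M" and x: "x \<in> carrier T" for f x
  proof -
    obtain g where g: "lin A T S g" "\<forall>x\<in>carrier T. q (g x) = f x" using lift[OF f(1)] by metis
    have "\<zeta> (g y) = \<zero>\<^sub>M" if y: "y \<in> carrier T" for y
      using u(2)[rule_format, OF lin.closed[OF g(1) y]] g(2)[rule_format, OF y] f(2)[OF y] by simp
    then have "lin A T (S \<down> ker S M \<zeta>) g"
      using lin.closed[OF g(1)] by (intro lin.restrict_codomain[OF g(1) L]) (auto simp: ker_iff)
    then have "g x \<in> ker S Y q" unfolding Y(4) using x by (rule U(3))
    then show ?thesis using g(2) x by (auto simp: ker_iff)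
  qed
  interpret Fu: lin B "F Y" "F M" "Fm u" by (rule lin_hom_module[OF T_mod u(1)])
  have "inj_on (Fm u) (carrier (F Y))"
    unfolding Fu.inj_iff
  proof (intro ballI impI)
    fix f assume f: "f \<in> carrier (F Y)" "Fm u f = \<zero>\<^bsub>F M\<^esub>"
    then have f': "f \<in> rhom A T Y" by simp
    have "u (f x) = \<zero>\<^sub>M" if "x \<in> carrier T" for x using fun_cong[OF f(2), of x] that by (simp add: compose_def)
    from z[OF rhom_lin[OF T_mod q.cod_mod f'] this] show "f = \<zero>\<^bsub>F Y\<^esub>"
      using rhom_undefined[OF f'] by (auto simp: fun_eq_iff)
  qed
  moreover have "Fm u ` rhom A T Y = Z"
  proof
    show "Fm u ` rhom A T Y \<subseteq> Z"
    proof (intro image_subsetI)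
      fix f assume f: "f \<in> rhom A T Y"
      obtain g where g: "lin A T S g" "\<forall>x\<in>carrier T. q (g x) = f x"
        using lift[OF rhom_lin[OF T_mod q.cod_mod f]] by metis
      have "Fm u f = Fm \<zeta> (restrict g (carrier T))"
        using g(2)[rule_format, symmetric] u(2) lin.closed[OF g(1)] by (auto simp: compose_def fun_eq_iff)
      then show "Fm u f \<in> Z" using S(3) lin.in_rhom[OF g(1)] by auto
    qed
    show "Z \<subseteq> Fm u ` rhom A T Y"
      unfolding S(3)[symmetric]
    proof (intro image_subsetI)
      fix g assume g: "g \<in> rhom A T S"
      have m: "(\<lambda>x\<in>carrier T. q (g x)) \<in> rhom A T Y" by (rule lin.in_rhom[OF lin_comp[OF rhom_lin[OF T_mod Sm g] Y(2)]])
      have e: "Fm \<zeta> g = Fm u (\<lambda>x\<in>carrier T. q (g x))"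
        using u(2) rhom_closed[OF g] by (auto simp: compose_def fun_eq_iff)
      show "Fm \<zeta> g \<in> Fm u ` rhom A T Y" unfolding e by (rule imageI[OF m])
    qed
  qed
  ultimately show ?thesis using fY u(1) by (intro exI[of _ Y] exI[of _ u]) simp
qed

end

section \<open>Dimensions of \<open>Hom(T, -)\<close> determine dimension vectors\<close>

lemma funpow_intertwine:
  assumes "\<And>x. x \<in> U \<Longrightarrow> a x \<in> U" "\<And>x. x \<in> U \<Longrightarrow> d (a x) = b (d x)" "x \<in> U"
  shows "d ((a ^^ k) x) = (b ^^ k) (d x) \<and> (a ^^ k) x \<in> U"
  by (induction k) (simp_all add: assms)

lemma equiv_representatives:
  assumes "equiv I r"
  shows "\<exists>S. finite S \<and> card S = card (I // r) \<and> S \<subseteq> I \<and> (\<forall>x\<in>S. \<forall>y\<in>S. x \<noteq> y \<longrightarrow> (x, y) \<notin> r)"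
proof (cases "finite (I // r)")
  case False
  \<comment> \<open>An infinite quotient has cardinality 0.\<close>
  then show ?thesis by (intro exI[of _ "{}"]) simp
next
  case True
  define rep where "rep C = (SOME N. N \<in> C)" for C :: "'a set"
  have rep: "rep C \<in> C" "C \<subseteq> I" if "C \<in> I // r" for C
  proof -
    have "C \<noteq> {}" using in_quotient_imp_non_empty[OF assms that] .
    then show "rep C \<in> C" unfolding rep_def by (simp add: some_in_eq)
    show "C \<subseteq> I" using in_quotient_imp_subset[OF assms that] .
  qed
  have inj: "C = D" if "C \<in> I // r" "D \<in> I // r" "(rep C, rep D) \<in> r" for C D
    using quotient_eqI[OF assms that(1,2) rep(1)[OF that(1)] rep(1)[OF that(2)] that(3)] .
  have rr: "(rep C, rep C) \<in> r" if "C \<in> I // r" for C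
    using rep[OF that] assms by (auto simp: equiv_def refl_on_def)
  have "inj_on rep (I // r)" using inj rr by (intro inj_onI) metis
  moreover have "(rep C, rep D) \<notin> r" if "C \<in> I // r" "D \<in> I // r" "rep C \<noteq> rep D" for C D
    using inj[OF that(1,2)] that(3) by blast
  moreover have "rep C \<in> I" if "C \<in> I // r" for C using rep[OF that] by blast
  ultimately show ?thesis using True by (intro exI[of _ "rep ` (I // r)"]) (auto simp: card_image)
qed

text \<open>Every indecomposable projective module is isomorphic to some \<open>eA\<close> with
  \<open>e\<close> in \<open>E\<close>; \<open>count\<close> is the form in which |T| = |A| is
  used.\<close>

locale counted_rigid_module = rigid_module +
  fixes E :: "'b set"
  assumes E: "prim_decomp A E" and count: "num_summands A T = card E"
begin

abbreviation eA :: "'b \<Rightarrow> ('b, 'b) module" where "eA \<equiv> principal_right A"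

lemma ind_summandD:
  assumes "N \<in> ind_summands A T"
  shows "submodule N A T" "indecomposable A (T \<down> N)"
    "\<exists>r. lin A T (T \<down> N) r \<and> (\<forall>x\<in>N. r x = x)"
proof -
  obtain N' where c: "complementary A T N N'" and i: "indecomposable A (T \<down> N)"
    using assms by (auto simp: ind_summands_def)
  show "submodule N A T" using c by (simp add: complementary_def)
  show "indecomposable A (T \<down> N)" by (rule i)
  obtain p q where b: "biprod A (T \<down> N) (T \<down> N') T (\<lambda>x. x) (\<lambda>x. x) p q"
    using complementary_projections[OF T_mod c] by metis
  then show "\<exists>r. lin A T (T \<down> N) r \<and> (\<forall>x\<in>N. r x = x)"
    using biprodD(3,5)[OF b] by (intro exI[of _ p]) simp
qed

lemma summand_representatives:
  "\<exists>S. finite S \<and> card S = card E \<and> S \<subseteq> ind_summands A T \<and>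
    (\<forall>N\<in>S. \<forall>N'\<in>S. N \<noteq> N' \<longrightarrow> \<not> module_iso A (T \<down> N) (T \<down> N'))"
proof -
  let ?I = "ind_summands A T"
  let ?r = "{(N, N'). N \<in> ?I \<and> N' \<in> ?I \<and> module_iso A (T \<down> N) (T \<down> N')}"
  note eq = equiv_ind_summands[OF T_mod]
  have c: "card (?I // ?r) = card E" using count by (simp add: num_summands_def)
  from equiv_representatives[OF eq] obtain S where S: "finite S" "card S = card (?I // ?r)" "S \<subseteq> ?I"
    "\<forall>x\<in>S. \<forall>y\<in>S. x \<noteq> y \<longrightarrow> (x, y) \<notin> ?r" by (elim exE conjE)
  have "\<not> module_iso A (T \<down> N) (T \<down> N')" if "N \<in> S" "N' \<in> S" "N \<noteq> N'" for N N'
    using S(3) S(4)[rule_format, OF that] that by blast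
  then show ?thesis using S(1-3) c by (intro exI[of _ S]) simp
qed

text \<open>A presentation of the summand \<open>N\<close> is cut out of that of \<open>T\<close>:
  the projection of \<open>T\<close> to \<open>N\<close> lifts to endomorphisms \<open>a0\<close> of
  \<open>P0\<close> and \<open>a1\<close> of \<open>P1\<close>, and their Fitting summands form the
  new presentation. The factorisation property is inherited, so that
  \<open>hdim_presentation\<close> applies.\<close>

lemma summand_presentation:
  assumes N: "N \<in> ind_summands A T"
  shows "\<exists>Q0 Q1. projective A Q0 \<and> projective A Q1 \<and> (\<forall>M :: 'b std_module. fg_mod A M \<and> factors A P1 P0 d M \<longrightarrow>
    hdim Q0 M = hdim (T \<down> N) M + hdim Q1 M)"
proof -
  interpret p0: lin A P0 T p0 by (rule p0)
  interpret d: lin A P1 P0 d by (rule d)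
  note sN = ind_summandD(1)[OF N]
  obtain r where r: "lin A T (T \<down> N) r" "\<forall>x\<in>N. r x = x" using ind_summandD(3)[OF N] by metis
  have rN: "r x \<in> N" if "x \<in> carrier T" for x using lin.closed[OF r(1) that] by simp
  have rT: "lin A T T r" using lin_comp[OF r(1) lin_incl[OF T_mod sN]] by simp
  obtain a0 where a0: "lin A P0 P0 a0" "\<forall>x\<in>carrier P0. p0 (a0 x) = r (p0 x)"
    using projective_lift[OF P0 projective_fg[OF P0] p0 p0_surj lin_comp[OF p0 rT]] by metis
  note kp = p0.submodule_ker
  have dk: "lin A P1 (P0 \<down> ker P0 T p0) d" by (rule d.restrict_codomain[OF kp]) (simp add: d_exact)
  have "lin A P1 (P0 \<down> ker P0 T p0) (\<lambda>x. a0 (d x))"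
    using a0(2) d_zero lin.zero[OF rT] lin.closed[OF a0(1)]
    by (intro lin.restrict_codomain[OF lin_comp[OF d a0(1)] kp]) (auto simp: ker_iff)
  moreover have "d ` carrier P1 = carrier (P0 \<down> ker P0 T p0)" by (simp add: d_exact)
  ultimately obtain a1 where a1: "lin A P1 P1 a1" "\<forall>x\<in>carrier P1. d (a1 x) = a0 (d x)"
    using projective_lift[OF P1 projective_fg[OF P1] dk] by metis
  have f0: "flen A P0" and f1: "flen A P1" using AF.fg_flen projective_fg P0 P1 by blast+
  obtain k0 where k0: "k0 \<ge> 1" "(a0 ^^ k0) ` (a0 ^^ k0) ` carrier P0 = (a0 ^^ k0) ` carrier P0"
    "inj_on (a0 ^^ k0) ((a0 ^^ k0) ` carrier P0)" using fitting[OF a0(1) f0] by metis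
  obtain k1 where k1: "k1 \<ge> 1" "(a1 ^^ k1) ` (a1 ^^ k1) ` carrier P1 = (a1 ^^ k1) ` carrier P1"
    "inj_on (a1 ^^ k1) ((a1 ^^ k1) ` carrier P1)" using fitting[OF a1(1) f1] by metis
  \<comment> \<open>The two Fitting exponents may differ; their product serves both and keeps
    \<open>d\<close> compatible with the two powers.\<close>
  define a b where "a = a0 ^^ (k0 * k1)" and "b = a1 ^^ (k0 * k1)"
  have a': "a = (a0 ^^ k0) ^^ k1" "b = (a1 ^^ k1) ^^ k0" by (simp_all add: a_def b_def funpow_mult mult.commute)
  have la: "lin A P0 P0 a" and lb: "lin A P1 P1 b" unfolding a_def b_def using lin_funpow a0(1) a1(1) by blast+
  have sa: "a ` a ` carrier P0 = a ` carrier P0" "inj_on a (a ` carrier P0)"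
    using stable_image_power(2,3)[OF k0(2,3), of "k1 - 1"] k1(1) unfolding a' by simp_all
  have sb: "b ` b ` carrier P1 = b ` carrier P1" "inj_on b (b ` carrier P1)"
    using stable_image_power(2,3)[OF k1(2,3), of "k0 - 1"] k0(1) unfolding a' by simp_all
  have db: "d (b x) = a (d x)" if "x \<in> carrier P1" for x
    using funpow_intertwine[of "carrier P1" a1 d a0 x] a1 that lin.closed[OF a1(1)] unfolding a_def b_def by simp
  \<comment> \<open>\<open>r\<close> is idempotent, so a positive power of it is \<open>r\<close>
    again; the exponent is positive because \<open>k0\<close> and \<open>k1\<close> are at least
    1.\<close>
  have pa: "p0 (a x) = r (p0 x)" if x: "x \<in> carrier P0" for x
  proof -
    have 1: "p0 ((a0 ^^ j) x) = (r ^^ j) (p0 x)" for j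
      using funpow_intertwine[of "carrier P0" a0 p0 r x] a0 x lin.closed[OF a0(1)] by simp
    have 2: "(r ^^ Suc j) y = r y" if "y \<in> carrier T" for j y
      using that rN r(2) by (induction j) simp_all
    obtain j where "k0 * k1 = Suc j" using k0(1) k1(1) by (cases "k0 * k1") auto
    then show ?thesis unfolding a_def using 1[of "Suc j"] 2[OF p0.closed[OF x], of j] by (simp only:)
  qed
  interpret a: lin A P0 P0 a by (rule la)
  interpret b: lin A P1 P1 b by (rule lb)
  let ?I = "a ` carrier P0" and ?J = "b ` carrier P1"
  note I = a.submodule_range and J = b.submodule_range
  let ?Q0 = "P0 \<down> ?I" and ?Q1 = "P1 \<down> ?J" and ?N = "T \<down> N"
  have pQ0: "projective A ?Q0"
  proof -
    obtain r' where "lin A P0 ?Q0 r'" "\<And>x. x \<in> ?I \<Longrightarrow> r' x = x" using stable_image_retract[OF la sa] by metis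
    then show ?thesis by (intro projective_retract[OF P0 lin_incl[OF a.dom_mod I], of r']) simp_all
  qed
  have pQ1: "projective A ?Q1"
  proof -
    obtain r' where "lin A P1 ?Q1 r'" "\<And>x. x \<in> ?J \<Longrightarrow> r' x = x" using stable_image_retract[OF lb sb] by metis
    then show ?thesis by (intro projective_retract[OF P1 lin_incl[OF b.dom_mod J], of r']) simp_all
  qed
  have Ic: "x \<in> carrier P0" if "x \<in> ?I" for x using submoduleD(3)[OF I that] .
  have Jc: "x \<in> carrier P1" if "x \<in> ?J" for x using submoduleD(3)[OF J that] .
  have pI: "p0 x \<in> N" if "x \<in> ?I" for x using that pa rN by auto
  have dJ: "d x \<in> ?I" if "x \<in> ?J" for x using that db by auto
  have dQ: "lin A ?Q1 ?Q0 d"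
    using dJ by (intro lin.restrict_codomain[OF lin.restrict_domain[OF d J] I]) auto
  have pQ: "lin A ?Q0 ?N p0"
    using pI by (intro lin.restrict_codomain[OF lin.restrict_domain[OF p0 I] sN]) auto
  have s: "p0 ` carrier ?Q0 = carrier ?N"
  proof
    show "carrier ?N \<subseteq> p0 ` carrier ?Q0"
    proof
      fix y assume "y \<in> carrier ?N"
      then have y: "y \<in> N" by simp
      then have "y \<in> p0 ` carrier P0" using submoduleD(3)[OF sN y] p0_surj by simp
      then obtain x where x: "x \<in> carrier P0" "y = p0 x" by auto
      then have "p0 (a x) = y" using pa[OF x(1)] r(2) y by simp
      then show "y \<in> p0 ` carrier ?Q0" using x(1) by auto
    qed
  qed (use pI in auto)
  have ex: "d ` carrier ?Q1 = ker ?Q0 ?N p0"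
  proof
    show "d ` carrier ?Q1 \<subseteq> ker ?Q0 ?N p0" using dJ d_zero Jc by (auto simp: ker_iff)
    show "ker ?Q0 ?N p0 \<subseteq> d ` carrier ?Q1"
    proof
      fix z assume "z \<in> ker ?Q0 ?N p0"
      then have z: "z \<in> ?I" "p0 z = \<zero>\<^sub>T" by (simp_all add: ker_iff)
      \<comment> \<open>Writing z as a z' with z' in the stable image puts z' into the kernel of
        \<open>p0\<close>. For x with d x = z' the element b x lies in the stable image of
        \<open>b\<close> and is mapped to z.\<close>
      have "z \<in> a ` ?I" using z(1) sa(1) by simp
      then obtain z' where z': "z' \<in> ?I" "z = a z'" using imageE[of z a ?I thesis] by metis
      have "p0 z' \<in> N" by (rule pI[OF z'(1)])
      then have "p0 z' = \<zero>\<^sub>T" using pa[OF Ic[OF z'(1)]] z(2) z'(2) r(2) by simp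
      then have "z' \<in> d ` carrier P1" unfolding d_exact using Ic[OF z'(1)] by (simp add: ker_iff)
      then obtain x where x: "x \<in> carrier P1" "z' = d x" by (elim imageE)
      then have "z = d (b x)" using db z'(2) by simp
      then show "z \<in> d ` carrier ?Q1" using x(1) by simp
    qed
  qed
  have fac: "extends_along A ?Q1 ?Q0 M d f"
    if M: "factors A P1 P0 d M" and f: "lin A ?Q1 M f" for M :: "'b std_module" and f
  proof -
    have "lin A P1 ?Q1 b" by (rule b.restrict_codomain[OF J order_refl])
    then obtain g where g: "lin A P0 M g" "\<forall>x\<in>carrier P1. g (d x) = f (b x)"
      using M lin_comp[OF _ f] unfolding factors_def by metis
    \<comment> \<open>The factorisation obtained on \<open>P0\<close> is that of \<open>f\<close>
      after \<open>b\<close>; inverting \<open>a\<close> on its stable image removes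
      \<open>b\<close>.\<close>
    have "bij_betw a (carrier ?Q0) (carrier ?Q0)" using sa by (simp add: bij_betw_def)
    moreover have la': "lin A ?Q0 ?Q0 a" using sa(1)
      by (intro lin.restrict_codomain[OF a.restrict_domain[OF I] I]) simp
    ultimately have li: "lin A ?Q0 ?Q0 (inv_into ?I a)" using lin.inv_into_lin[OF la'] by simp
    have lg: "lin A ?Q0 M g" by (rule lin.restrict_domain[OF g(1) I])
    have "g (inv_into ?I a (d y)) = f y" if "y \<in> carrier ?Q1" for y
    proof -
      have "y \<in> b ` ?J" using that sb(1) by simp
      then obtain y' where y': "y' \<in> ?J" "y = b y'" using imageE[of y b ?J thesis] by metis
      then have "d y = a (d y')" using db Jc by simp
      then have "inv_into ?I a (d y) = d y'" using inv_into_f_f[OF sa(2) dJ[OF y'(1)]] by simp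
      then show ?thesis using g(2) Jc[OF y'(1)] y'(2) by simp
    qed
    then show ?thesis using lin_comp[OF li lg] by (intro exI[of _ "\<lambda>x. g (inv_into ?I a x)"]) simp
  qed
  show ?thesis
    using pQ0 pQ1 hdim_presentation[OF _ projective_fg[OF pQ0] dQ pQ s ex fac]
    by (intro exI[of _ ?Q0] exI[of _ ?Q1]) simp
qed

text \<open>The coefficients are the multiplicities of \<open>eA\<close> in \<open>Q0\<close> minus
  those in \<open>Q1\<close>, a g-vector of the summand; they may be negative and do not depend on
  \<open>M\<close>.\<close>

lemma summand_dims:
  assumes N: "N \<in> ind_summands A T"
  shows "\<exists>g :: 'b \<Rightarrow> real. \<forall>M :: 'b std_module. fg_mod A M \<and> factors A P1 P0 d M \<longrightarrow>
    real (hdim (T \<down> N) M) = (\<Sum>e\<in>E. g e * real (hdim (eA e) M))"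
proof -
  obtain Q0 Q1 where Q: "projective A Q0" "projective A Q1"
    "\<And>M :: 'b std_module. fg_mod A M \<Longrightarrow> factors A P1 P0 d M \<Longrightarrow> hdim Q0 M = hdim (T \<down> N) M + hdim Q1 M"
    using summand_presentation[OF N] by auto
  obtain m0 :: "'b \<Rightarrow> nat" where m0: "\<forall>M :: 'b std_module. fg_mod A M \<longrightarrow> hdim Q0 M = (\<Sum>e\<in>E. m0 e * hdim (eA e) M)"
    using hdim_projective[OF E Q(1)] by (elim exE)
  obtain m1 :: "'b \<Rightarrow> nat" where m1: "\<forall>M :: 'b std_module. fg_mod A M \<longrightarrow> hdim Q1 M = (\<Sum>e\<in>E. m1 e * hdim (eA e) M)"
    using hdim_projective[OF E Q(2)] by (elim exE)
  have "real (hdim (T \<down> N) M) = (\<Sum>e\<in>E. (real (m0 e) - real (m1 e)) * real (hdim (eA e) M))"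
    if M: "fg_mod A M" "factors A P1 P0 d M" for M :: "'b std_module"
  proof -
    have "real (hdim (T \<down> N) M) = real (hdim Q0 M) - real (hdim Q1 M)" using Q(3)[OF M] by simp
    then show ?thesis using m0 m1 M(1) by (simp add: sum_subtractf left_diff_distrib)
  qed
  then show ?thesis by (intro exI[of _ "\<lambda>e. real (m0 e) - real (m1 e)"]) simp
qed

text \<open>
  The non-split maps to a summand \<open>N0\<close> form a submodule of \<open>Hom(T, N0)\<close>, which is of the form
  \<open>Hom(T, Y)\<close>. Passing from \<open>N0\<close> to \<open>Y\<close> changes only the dimension of \<open>Hom(N0, -)\<close>.
\<close>

lemma summand_radical:
  assumes S: "S \<subseteq> ind_summands A T"
    "\<And>N N'. \<lbrakk>N \<in> S; N' \<in> S; N \<noteq> N'\<rbrakk> \<Longrightarrow> \<not> module_iso A (T \<down> N) (T \<down> N')"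
    and N0: "N0 \<in> S"
  shows "\<exists>(M :: 'b std_module) (Y :: 'b std_module). fac A T M \<and> fac A T Y \<and>
    (\<forall>N\<in>S - {N0}. hdim (T \<down> N) Y = hdim (T \<down> N) M) \<and>
    hdim (T \<down> N0) Y < hdim (T \<down> N0) M"
proof -
  have SI: "N \<in> ind_summands A T" if "N \<in> S" for N using S(1) that by auto
  note sN0 = ind_summandD(1)[OF SI[OF N0]] and iN0 = ind_summandD(2)[OF SI[OF N0]]
  obtain r0 where r0: "lin A T (T \<down> N0) r0" "\<forall>x\<in>N0. r0 x = x" using ind_summandD(3)[OF SI[OF N0]] by metis
  have fgN: "fg_mod A (T \<down> N)" if "N \<in> S" for N
    by (rule AF.fg_sub[OF T ind_summandD(1)[OF SI[OF that]]])
  obtain M :: "'b std_module" and i p where M: "fg_mod A M" "lin A M (T \<down> N0) i" "lin A (T \<down> N0) M p"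
    "\<forall>x\<in>carrier (T \<down> N0). i (p x) = x" "\<forall>y\<in>carrier M. p (i y) = y"
    using std_copy[OF fgN[OF N0]] by metis
  interpret M: right_module A M by (rule fg_modD[OF M(1)])
  have iN: "i x \<in> N0" if "x \<in> carrier M" for x using lin.closed[OF M(2) that] by simp
  have iT: "lin A M T i" using lin_comp[OF M(2) lin_incl[OF T_mod sN0]] by simp
  have pr: "lin A T M (\<lambda>x. p (r0 x))" by (rule lin_comp[OF r0(1) M(3)])
  have pri: "p (r0 (i x)) = x" if "x \<in> carrier M" for x using r0(2) iN[OF that] M(5) that by simp
  have Mnz: "carrier M \<noteq> {\<zero>\<^sub>M}"
  proof
    assume z: "carrier M = {\<zero>\<^sub>M}"
    have "x = \<zero>\<^sub>T" if x: "x \<in> N0" for x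
    proof -
      have "p x \<in> carrier M" using lin.closed[OF M(3), of x] x by simp
      then have "p x = \<zero>\<^sub>M" using z by simp
      moreover have "i (p x) = x" using M(4) x by simp
      ultimately show ?thesis using lin.zero[OF iT] by simp
    qed
    then have "N0 = {\<zero>\<^sub>T}" by (rule eq_singletonI[OF _ submoduleD(2)[OF sN0]])
    then show False using iN0 by (simp add: indecomposable_def)
  qed
  have facM: "fac A T M"
  proof (rule fac_image[OF fac_self[OF T] pr])
    show "(\<lambda>x. p (r0 x)) ` carrier T = carrier M"
    proof
      show "carrier M \<subseteq> (\<lambda>x. p (r0 x)) ` carrier T"
        using pri lin.closed[OF iT] by (intro subsetI) (metis (no_types, lifting) imageI)
    qed (use lin.closed[OF pr] in auto)
  qed
  \<comment> \<open>Split epimorphisms onto \<open>M\<close>, the copy of \<open>N0\<close>; the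
    remaining maps form the radical part \<open>Z\<close> of Hom(T, M).\<close>
  define split where "split f \<longleftrightarrow> (\<exists>s. lin A M T s \<and> (\<forall>x\<in>carrier M. f (s x) = x))" for f
  have indM: "indecomposable A M"
    unfolding indecomposable_def
  proof (intro conjI allI impI)
    show "carrier M \<noteq> {\<zero>\<^sub>M}" by (rule Mnz)
    fix V W assume c: "complementary A M V W"
    then have VW: "submodule V A M" "submodule W A M" by (simp_all add: complementary_def)
    obtain q q' where b: "biprod A (M \<down> V) (M \<down> W) M (\<lambda>x. x) (\<lambda>x. x) q q'"
      using complementary_projections[OF M.right_module_axioms c] by metis
    note b' = biprodD[OF b]
    show "V = {\<zero>\<^sub>M} \<or> W = {\<zero>\<^sub>M}"
    proof (rule disjCI)
      assume "W \<noteq> {\<zero>\<^sub>M}"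
      have "i (q' (p x)) = x" if "x \<in> carrier (T \<down> N0)" for x
        using \<open>W \<noteq> {\<zero>\<^sub>M}\<close> M(5) b'(7) submoduleD(3)[OF VW(2)] that
        by (intro indecomposable_retract[OF iN0 lin_comp[OF b'(2) M(2)] lin_comp[OF M(3) b'(4)]]) simp_all
      note iq = this
      have q': "q' x = x" if x: "x \<in> carrier M" for x
      proof -
        have "i (q' (p (i x))) = i x" by (rule iq[OF lin.closed[OF M(2) x]])
        then have "i (q' x) = i x" using M(5) x by simp
        then have "p (i (q' x)) = p (i x)" by simp
        moreover have "q' x \<in> carrier M" using submoduleD(3)[OF VW(2)] lin.closed[OF b'(4) x] by simp
        ultimately show ?thesis using M(5) x by simp
      qed
      have "x = \<zero>\<^sub>M" if "x \<in> V" for x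
      proof -
        have "q' x = \<zero>\<^bsub>M \<down> W\<^esub>" by (rule b'(6)) (simp add: that)
        then show ?thesis using q'[OF submoduleD(3)[OF VW(1) that]] by simp
      qed
      then show "V = {\<zero>\<^sub>M}" by (rule eq_singletonI[OF _ submoduleD(2)[OF VW(1)]])
    qed
  qed
  have fM: "flen A M" by (rule AF.fg_flen[OF M(1)])
  define Z where "Z = {f \<in> rhom A T M. \<not> split f}"
  interpret FM: right_module B "F M" by (rule F_mod[OF M.right_module_axioms])
  have split_inj: "split f" if f: "lin A T M f" "lin A M T s" "inj_on (\<lambda>x. f (s x)) (carrier M)" for f s
  proof -
    obtain v where v: "lin A M M v" "\<forall>x\<in>carrier M. f (s (v x)) = x"
      using endo_inverse[OF lin_comp[OF f(2,1)] fM f(3)] by metis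
    then show ?thesis unfolding split_def using lin_comp[OF v(1) f(2)] by (intro exI[of _ "\<lambda>x. s (v x)"]) simp
  qed
  have Z: "submodule Z B (F M)"
  proof (rule FM.submoduleI)
    show "Z \<subseteq> carrier (F M)" by (auto simp: Z_def)
    have "\<not> split (\<lambda>x\<in>carrier T. \<zero>\<^sub>M)"
    proof
      assume "split (\<lambda>x\<in>carrier T. \<zero>\<^sub>M)"
      then obtain s where "lin A M T s" "\<forall>x\<in>carrier M. (\<lambda>x\<in>carrier T. \<zero>\<^sub>M) (s x) = x" unfolding split_def by metis
      note s = this
      have "x = \<zero>\<^sub>M" if "x \<in> carrier M" for x
        using s(2)[rule_format, OF that] lin.closed[OF s(1) that] by simp
      then have "carrier M = {\<zero>\<^sub>M}" by (intro equalityI subsetI) simp_all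
      then show False using Mnz by simp
    qed
    then show "\<zero>\<^bsub>F M\<^esub> \<in> Z" using lin.in_rhom[OF lin_zero[OF T_mod M.right_module_axioms]] by (simp add: Z_def)
  next
    fix f g assume fg: "f \<in> Z" "g \<in> Z"
    then have fg': "f \<in> rhom A T M" "g \<in> rhom A T M" "\<not> split f" "\<not> split g" by (simp_all add: Z_def)
    note l = rhom_lin[OF T_mod M.right_module_axioms fg'(1)] rhom_lin[OF T_mod M.right_module_axioms fg'(2)]
    \<comment> \<open>\<open>M\<close> is indecomposable, so its endomorphism ring is local: a
      section \<open>s\<close> of the sum makes \<open>f s\<close> or \<open>g s\<close>
      invertible.\<close>
    have "\<not> split (f \<oplus>\<^bsub>F M\<^esub> g)"
    proof
      assume "split (f \<oplus>\<^bsub>F M\<^esub> g)"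
      then obtain s where s: "lin A M T s" "\<forall>x\<in>carrier M. (f \<oplus>\<^bsub>F M\<^esub> g) (s x) = x" unfolding split_def by metis
      have "f (s x) \<oplus>\<^sub>M g (s x) = x" if "x \<in> carrier M" for x
        using s(2)[rule_format, OF that] lin.closed[OF s(1) that] by simp
      then have "inj_on (\<lambda>x. f (s x) \<oplus>\<^sub>M g (s x)) (carrier M)" by (intro inj_onI) simp
      from indecomposable_local[OF indM fM lin_comp[OF s(1) l(1)] lin_comp[OF s(1) l(2)] this]
      show False using split_inj[OF l(1) s(1)] split_inj[OF l(2) s(1)] fg' by auto
    qed
    moreover have "f \<oplus>\<^bsub>F M\<^esub> g \<in> rhom A T M" using FM.M.a_closed[of f g] fg' by simp
    ultimately show "f \<oplus>\<^bsub>F M\<^esub> g \<in> Z" by (simp add: Z_def)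
  next
    fix b f assume b: "b \<in> carrier B" and f: "f \<in> Z"
    then have f': "f \<in> rhom A T M" "\<not> split f" and b': "b \<in> rhom A T T" by (simp_all add: Z_def)
    have "\<not> split (b \<odot>\<^bsub>F M\<^esub> f)"
    proof
      assume "split (b \<odot>\<^bsub>F M\<^esub> f)"
      then obtain s where s: "lin A M T s" "\<forall>x\<in>carrier M. (b \<odot>\<^bsub>F M\<^esub> f) (s x) = x" unfolding split_def by metis
      have "f (b (s x)) = x" if "x \<in> carrier M" for x
        using s(2)[rule_format, OF that] lin.closed[OF s(1) that] by (simp add: compose_def)
      then have "split f" unfolding split_def
        using lin_comp[OF s(1) rhom_lin[OF T_mod T_mod b']] by (intro exI[of _ "\<lambda>x. b (s x)"]) simp
      then show False using f' by simp
    qed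
    moreover have "b \<odot>\<^bsub>F M\<^esub> f \<in> rhom A T M" using FM.smult_closed'[OF b, of f] f' by simp
    ultimately show "b \<odot>\<^bsub>F M\<^esub> f \<in> Z" by (simp add: Z_def)
  qed
  obtain Y :: "'b std_module" and u where Y: "fac A T Y" "lin A Y M u" "inj_on (Fm u) (rhom A T Y)"
    "Fm u ` rhom A T Y = Z" using sub_F_is_F[OF M(1) Z] by metis
  interpret u: lin A Y M u by (rule Y(2))
  have inj: "\<forall>x\<in>N. f x = \<zero>\<^sub>Y"
    if N: "N \<in> S" and f: "lin A (T \<down> N) Y f" "\<And>x. x \<in> N \<Longrightarrow> u (f x) = \<zero>\<^sub>M" for N f
  proof
    fix x assume x: "x \<in> N"
    obtain r where r: "lin A T (T \<down> N) r" "\<forall>x\<in>N. r x = x" using ind_summandD(3)[OF SI[OF N]] by metis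
    have rN: "r x \<in> N" if "x \<in> carrier T" for x using lin.closed[OF r(1) that] by simp
    let ?f = "\<lambda>x\<in>carrier T. f (r x)" and ?z = "\<lambda>x\<in>carrier T. \<zero>\<^sub>Y"
    have 1: "?f \<in> rhom A T Y" by (rule lin.in_rhom[OF lin_comp[OF r(1) f(1)]])
    have 2: "?z \<in> rhom A T Y" by (rule lin.in_rhom[OF lin_zero[OF T_mod u.dom_mod]])
    have "Fm u ?f = Fm u ?z"
      using f(2) rN by (auto simp: compose_def fun_eq_iff)
    then have e: "?f = ?z" using inj_onD[OF Y(3) _ 1 2] by simp
    have xT: "x \<in> carrier T" by (rule submoduleD(3)[OF ind_summandD(1)[OF SI[OF N]] x])
    show "f x = \<zero>\<^sub>Y" using fun_cong[OF e, of x] x xT r(2) by simp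
  qed
  have surj: "lifts_along A (T \<down> N) Y u f"
    if N: "N \<in> S" "N \<noteq> N0" and f: "lin A (T \<down> N) M f" for N f
  proof -
    obtain r where r: "lin A T (T \<down> N) r" "\<forall>x\<in>N. r x = x" using ind_summandD(3)[OF SI[OF N(1)]] by metis
    have rN: "r x \<in> N" if "x \<in> carrier T" for x using lin.closed[OF r(1) that] by simp
    note sN = ind_summandD(1)[OF SI[OF N(1)]] and iN = ind_summandD(2)[OF SI[OF N(1)]]
    let ?f = "\<lambda>x\<in>carrier T. f (r x)"
    \<comment> \<open>A section would make \<open>N\<close> isomorphic to \<open>N0\<close>.\<close>
    have "\<not> split ?f"
    proof
      assume "split ?f"
      then obtain s where s: "lin A M T s" "\<forall>x\<in>carrier M. ?f (s x) = x" unfolding split_def by metis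
      have lrs: "lin A M (T \<down> N) (\<lambda>x. r (s x))" by (rule lin_comp[OF s(1) r(1)])
      have frs: "f (r (s x)) = x" if "x \<in> carrier M" for x
        using s(2)[rule_format, OF that] lin.closed[OF s(1) that] by simp
      have rsf: "r (s (f x)) = x" if "x \<in> carrier (T \<down> N)" for x
        using frs by (rule indecomposable_retract[OF iN lrs f _ Mnz that])
      have b1: "bij_betw f (carrier (T \<down> N)) (carrier M)"
        by (rule bij_betwI[of _ _ _ "\<lambda>x. r (s x)"]) (use rsf frs lin.closed[OF f] lin.closed[OF lrs] in auto)
      have b2: "bij_betw i (carrier M) (carrier (T \<down> N0))"
        by (rule bij_betwI[of _ _ _ p]) (use M(4,5) lin.closed[OF M(2)] lin.closed[OF M(3)] in auto)
      have "module_iso A (T \<down> N) (T \<down> N0)"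
        using bij_betw_trans[OF b1 b2] by (intro module_isoI[OF lin_comp[OF f M(2)]]) (simp add: comp_def)
      then show False using S(2)[OF N(1) N0 N(2)] by simp
    qed
    then have "?f \<in> Z" unfolding Z_def using lin.in_rhom[OF lin_comp[OF r(1) f]] by simp
    then obtain h where h: "h \<in> rhom A T Y" "?f = Fm u h" using Y(4) by auto
    have "lin A (T \<down> N) Y h" by (rule lin.restrict_domain[OF rhom_lin[OF T_mod u.dom_mod h(1)] sN])
    moreover have "u (h x) = f x" if x: "x \<in> N" for x
      using fun_cong[OF h(2), of x] x submoduleD(3)[OF sN x] r(2) by (simp add: compose_def)
    ultimately show ?thesis by (intro exI[of _ h]) simp
  qed
  have 1: "hdim (T \<down> N) Y = hdim (T \<down> N) M" if "N \<in> S - {N0}" for N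
    using that inj surj by (intro hdim_iso_right[OF fgN fac_fg[OF Y(1)] M(1) Y(2)]) auto
  have 2: "hdim (T \<down> N0) Y < hdim (T \<down> N0) M"
  proof (rule hdim_le_postcomp(3)[OF fgN[OF N0] M(1) Y(2)])
    show "\<forall>x\<in>carrier (T \<down> N0). f x = \<zero>\<^sub>Y"
      if "lin A (T \<down> N0) Y f" "\<And>x. x \<in> carrier (T \<down> N0) \<Longrightarrow> u (f x) = \<zero>\<^sub>M" for f
      using inj[OF N0 that(1)] that(2) by simp
    \<comment> \<open>The isomorphism \<open>p\<close> from \<open>N0\<close> to \<open>M\<close>
      does not factor through \<open>u\<close>: otherwise its composite with \<open>r0\<close>,
      which is split by \<open>i\<close>, would lie in \<open>Z\<close>.\<close>
    have "\<exists>x\<in>N0. u (g x) \<noteq> p x" if g: "lin A (T \<down> N0) Y g" for g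
    proof (rule ccontr)
      assume "\<not> ?thesis"
      then have ug: "u (g x) = p x" if "x \<in> N0" for x using that by auto
      have rN: "r0 x \<in> N0" if "x \<in> carrier T" for x using lin.closed[OF r0(1) that] by simp
      have "(\<lambda>x\<in>carrier T. g (r0 x)) \<in> rhom A T Y" by (rule lin.in_rhom[OF lin_comp[OF r0(1) g]])
      then have "Fm u (\<lambda>x\<in>carrier T. g (r0 x)) \<in> Z" using Y(4) by auto
      then have "\<not> split (Fm u (\<lambda>x\<in>carrier T. g (r0 x)))" by (simp add: Z_def)
      moreover have "split (Fm u (\<lambda>x\<in>carrier T. g (r0 x)))"
        unfolding split_def using iT ug rN pri lin.closed[OF iT] by (intro exI[of _ i]) (simp add: compose_def)
      ultimately show False by simp
    qed
    then show "\<exists>f. lin A (T \<down> N0) M f \<and>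
        (\<forall>g. lin A (T \<down> N0) Y g \<longrightarrow> (\<exists>x\<in>carrier (T \<down> N0). u (g x) \<noteq> f x))"
      using M(3) by (intro exI[of _ p]) simp
  qed
  show ?thesis by (intro exI[of _ M] exI[of _ Y] conjI ballI facM Y(1) 1 2)
qed

text \<open>The relation for \<open>M\<close> and the relation for its radical counterpart
  \<open>Y\<close> differ only in the term of \<open>N0\<close>, where the dimensions are
  different.\<close>

lemma coefficients_vanish:
  fixes c :: "'c set \<Rightarrow> real"
  assumes S: "finite S" "S \<subseteq> ind_summands A T"
    "\<And>N N'. \<lbrakk>N \<in> S; N' \<in> S; N \<noteq> N'\<rbrakk> \<Longrightarrow> \<not> module_iso A (T \<down> N) (T \<down> N')"
    and c: "\<And>M :: 'b std_module. fac A T M \<Longrightarrow> (\<Sum>N\<in>S. c N * real (hdim (T \<down> N) M)) = 0"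
    and N0: "N0 \<in> S"
  shows "c N0 = 0"
proof -
  obtain M :: "'b std_module" and Y :: "'b std_module" where MY: "fac A T M" "fac A T Y"
    "\<forall>N\<in>S - {N0}. hdim (T \<down> N) Y = hdim (T \<down> N) M"
    "hdim (T \<down> N0) Y < hdim (T \<down> N0) M" using summand_radical[OF S(2) _ N0] S(3) by metis
  have "(\<Sum>N\<in>S - {N0}. c N * real (hdim (T \<down> N) Y)) = (\<Sum>N\<in>S - {N0}. c N * real (hdim (T \<down> N) M))"
    using MY(3) by (intro sum.cong) auto
  then have "c N0 * real (hdim (T \<down> N0) Y) = c N0 * real (hdim (T \<down> N0) M)"
    using c[OF MY(1)] c[OF MY(2)] unfolding sum.remove[OF S(1) N0] by linarith
  then show ?thesis using MY(4) by simp
qed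

lemma prim_idem: "e \<in> E \<Longrightarrow> idempotent A e" "e \<in> E \<Longrightarrow> e \<in> carrier A"
  using E by (auto simp: prim_decomp_def primitive_idem_def idempotent_def)

lemma fg_principal: "e \<in> E \<Longrightarrow> fg_mod A (eA e)"
proof -
  assume "e \<in> E"
  then show ?thesis
    unfolding principal_right_def by (rule AF.fg_sub[OF AF.fg_regular A.submodule_principal[OF prim_idem(2)]])
qed

lemma lifts_principal: "e \<in> E \<Longrightarrow> lifts A (eA e)"
  using A.principal_mult[OF prim_idem(1)]
  by (intro lifts_retract[OF A.lifts_regular A.lin_principal_incl[OF prim_idem(2)] A.lin_to_principal[OF prim_idem(1)]]) auto

text \<open>Maps from \<open>eA\<close> lift to finite sums of copies of \<open>T\<close>, where
  every component is a map to \<open>T\<close>.\<close>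

lemma principal_to_fac_zero:
  assumes e: "e \<in> E" and z: "hdim (eA e) T = 0" and M: "fac A T M"
  shows "hdim (eA e) M = 0"
proof (rule hdim_zeroI[OF fg_principal[OF e] fac_fg[OF M]])
  have zS: "f x = \<zero>\<^sub>S" if "tpow A T S" "lin A (eA e) S f" "x \<in> carrier (eA e)" for S f x
    using that
  proof (induction arbitrary: f)
    case (zero S)
    then show ?case using lin.closed[OF zero(3,4)] by simp
  next
    case (step S S' i j p q)
    note b = biprodD[OF step(3)]
    interpret S': right_module A S' by (rule lin.cod_mod[OF b(1)])
    have "p (f x) = \<zero>\<^sub>S" using step(4)[OF lin_comp[OF step(5) b(3)] step(6)] .
    moreover have "q (f x) = \<zero>\<^sub>T" by (rule hdim_zero_imp[OF fg_principal[OF e] T z lin_comp[OF step(5) b(4)] step(6)])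
    ultimately have "f x = \<zero>\<^sub>S' \<oplus>\<^sub>S' \<zero>\<^sub>S'"
      using b(9)[OF lin.closed[OF step(5,6)]] lin.zero[OF b(1)] lin.zero[OF b(2)] by metis
    then show ?case by simp
  qed
  fix f x assume f: "lin A (eA e) M f" and x: "x \<in> carrier (eA e)"
  obtain S \<pi> where S: "tpow A T S" "lin A S M \<pi>" "\<pi> ` carrier S = carrier M" using AF.tpow_onto[OF T M] by metis
  obtain h where h: "lin A (eA e) S h" "\<forall>x\<in>carrier (eA e). \<pi> (h x) = f x"
    using lifts_gen[OF lifts_principal[OF e] tpow_fg[OF S(1)] S(2,3) f] by metis
  show "f x = \<zero>\<^sub>M" using h(2) x zS[OF S(1) h(1) x] lin.zero[OF S(2)] by auto
qed

lemma summand_matrix: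
  "\<exists>S (g :: 'c set \<Rightarrow> 'b \<Rightarrow> real). finite S \<and> card S = card E \<and> S \<subseteq> ind_summands A T \<and>
    (\<forall>N\<in>S. \<forall>M :: 'b std_module. fg_mod A M \<and> factors A P1 P0 d M \<longrightarrow>
      real (hdim (T \<down> N) M) = (\<Sum>e\<in>E. g N e * real (hdim (eA e) M))) \<and>
    (\<forall>c. (\<forall>M :: 'b std_module. fac A T M \<longrightarrow> (\<Sum>N\<in>S. c N * real (hdim (T \<down> N) M)) = 0) \<longrightarrow> (\<forall>N\<in>S. c N = 0))"
proof -
  obtain S where S: "finite S" "card S = card E" "S \<subseteq> ind_summands A T"
    "\<forall>N\<in>S. \<forall>N'\<in>S. N \<noteq> N' \<longrightarrow> \<not> module_iso A (T \<down> N) (T \<down> N')"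
    using summand_representatives by metis
  have "\<forall>N\<in>S. \<exists>g :: 'b \<Rightarrow> real. \<forall>M :: 'b std_module. fg_mod A M \<and> factors A P1 P0 d M \<longrightarrow>
    real (hdim (T \<down> N) M) = (\<Sum>e\<in>E. g e * real (hdim (eA e) M))"
    using summand_dims S(3) by blast
  then obtain g :: "'c set \<Rightarrow> 'b \<Rightarrow> real" where g: "\<forall>N\<in>S. \<forall>M :: 'b std_module. fg_mod A M \<and> factors A P1 P0 d M \<longrightarrow>
    real (hdim (T \<down> N) M) = (\<Sum>e\<in>E. g N e * real (hdim (eA e) M))"
    by (elim bchoice[THEN exE])
  have "c N0 = 0" if c: "\<forall>M :: 'b std_module. fac A T M \<longrightarrow> (\<Sum>N\<in>S. c N * real (hdim (T \<down> N) M)) = 0"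
    and "N0 \<in> S" for c N0
  proof (rule coefficients_vanish[OF S(1,3) _ _ \<open>N0 \<in> S\<close>])
    show "\<not> module_iso A (T \<down> N) (T \<down> N')" if "N \<in> S" "N' \<in> S" "N \<noteq> N'" for N N'
      using S(4) that by metis
    show "(\<Sum>N\<in>S. c N * real (hdim (T \<down> N) M)) = 0" if "fac A T M" for M :: "'b std_module"
      by (rule c[rule_format, OF that])
  qed
  note vanish = this
  have indep: "\<forall>c. (\<forall>M :: 'b std_module. fac A T M \<longrightarrow> (\<Sum>N\<in>S. c N * real (hdim (T \<down> N) M)) = 0) \<longrightarrow> (\<forall>N\<in>S. c N = 0)"
  proof (intro allI impI ballI)
    show "c N = 0" if "\<forall>M :: 'b std_module. fac A T M \<longrightarrow> (\<Sum>N\<in>S. c N * real (hdim (T \<down> N) M)) = 0" "N \<in> S" for c N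
      by (rule vanish[OF that])
  qed
  show ?thesis by (rule exI[of _ S], rule exI[of _ g]) (intro conjI S(1-3) g indep)
qed

text \<open>If Hom(eA, T) = 0, then Hom(eA, -) vanishes on all modules generated by
  \<open>T\<close>. The column of \<open>e\<close> drops out of the matrix, and the rows, now more
  numerous than the columns, are dependent, against \<open>summand_matrix\<close>.\<close>

lemma sincere:
  assumes e: "e \<in> E"
  shows "hdim (eA e) T \<noteq> 0"
proof
  assume z: "hdim (eA e) T = 0"
  obtain S and g :: "'c set \<Rightarrow> 'b \<Rightarrow> real" where S: "finite S" "card S = card E"
    and g: "\<forall>N\<in>S. \<forall>M :: 'b std_module. fg_mod A M \<and> factors A P1 P0 d M \<longrightarrow>
      real (hdim (T \<down> N) M) = (\<Sum>e\<in>E. g N e * real (hdim (eA e) M))"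
    and indep: "\<forall>c. (\<forall>M :: 'b std_module. fac A T M \<longrightarrow> (\<Sum>N\<in>S. c N * real (hdim (T \<down> N) M)) = 0) \<longrightarrow> (\<forall>N\<in>S. c N = 0)"
    using summand_matrix by (elim exE conjE)
  have fE: "finite E" using E by (simp add: prim_decomp_def)
  have "card (E - {e}) < card S" using S fE e by (metis card_Diff1_less)
  then obtain c where c: "\<exists>N\<in>S. c N \<noteq> 0" "\<forall>k\<in>E - {e}. (\<Sum>N\<in>S. g N k * c N) = 0"
    using homogeneous_system[of "E - {e}" S "\<lambda>k N. g N k"] fE S(1) by auto
  have "(\<Sum>N\<in>S. c N * real (hdim (T \<down> N) M)) = 0" if M: "fac A T M" for M :: "'b std_module"
  proof -
    have "(\<Sum>N\<in>S. c N * real (hdim (T \<down> N) M))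
        = (\<Sum>N\<in>S. \<Sum>k\<in>E. c N * (g N k * real (hdim (eA k) M)))"
      using g fac_fg[OF M] factors_fac[OF M] by (intro sum.cong) (simp_all add: sum_distrib_left)
    also have "\<dots> = (\<Sum>k\<in>E. (\<Sum>N\<in>S. g N k * c N) * real (hdim (eA k) M))"
      by (subst sum.swap) (simp add: sum_distrib_right mult.assoc mult.left_commute)
    also have "\<dots> = 0"
      using c(2) principal_to_fac_zero[OF e z M] by (intro sum.neutral) (metis DiffI mult_eq_0_iff of_nat_0 singletonD)
    finally show ?thesis .
  qed
  then show False using indep c(1) by blast
qed

text \<open>\<open>square_system\<close>, applied to the difference of the two dimension
  vectors.\<close>

lemma dimension_vector:
  fixes M M' :: "'b std_module"
  assumes M: "fg_mod A M" "factors A P1 P0 d M" and M': "fg_mod A M'" "factors A P1 P0 d M'"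
    and eq: "\<And>N. N \<in> ind_summands A T \<Longrightarrow> hdim (T \<down> N) M = hdim (T \<down> N) M'"
    and e: "e \<in> E"
  shows "hdim (eA e) M = hdim (eA e) M'"
proof -
  obtain S and g :: "'c set \<Rightarrow> 'b \<Rightarrow> real" where S: "finite S" "card S = card E" "S \<subseteq> ind_summands A T"
    and g: "\<forall>N\<in>S. \<forall>M :: 'b std_module. fg_mod A M \<and> factors A P1 P0 d M \<longrightarrow>
      real (hdim (T \<down> N) M) = (\<Sum>e\<in>E. g N e * real (hdim (eA e) M))"
    and indep: "\<forall>c. (\<forall>M :: 'b std_module. fac A T M \<longrightarrow> (\<Sum>N\<in>S. c N * real (hdim (T \<down> N) M)) = 0) \<longrightarrow> (\<forall>N\<in>S. c N = 0)"
    using summand_matrix by (elim exE conjE)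
  have fE: "finite E" using E by (simp add: prim_decomp_def)
  have "real (hdim (eA e) M) - real (hdim (eA e) M') = 0"
  proof (rule square_system[OF S(1) fE S(2), of g "\<lambda>e. real (hdim (eA e) M) - real (hdim (eA e) M')"])
    fix c assume c: "\<And>k. k \<in> E \<Longrightarrow> (\<Sum>N\<in>S. c N * g N k) = 0"
    have "(\<Sum>N\<in>S. c N * real (hdim (T \<down> N) L)) = 0" if L: "fac A T L" for L :: "'b std_module"
    proof -
      have "(\<Sum>N\<in>S. c N * real (hdim (T \<down> N) L))
          = (\<Sum>N\<in>S. \<Sum>k\<in>E. c N * (g N k * real (hdim (eA k) L)))"
        using g fac_fg[OF L] factors_fac[OF L] by (intro sum.cong) (simp_all add: sum_distrib_left)
      also have "\<dots> = (\<Sum>k\<in>E. (\<Sum>N\<in>S. c N * g N k) * real (hdim (eA k) L))"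
        by (subst sum.swap) (simp add: sum_distrib_right mult.assoc)
      finally show ?thesis using c by simp
    qed
    then show "\<forall>N\<in>S. c N = 0" using indep by blast
  next
    fix N assume N: "N \<in> S"
    have "(\<Sum>e\<in>E. g N e * real (hdim (eA e) M)) = (\<Sum>e\<in>E. g N e * real (hdim (eA e) M'))"
      using g[rule_format, OF N conjI[OF M]] g[rule_format, OF N conjI[OF M']] eq[of N] N S(3) by auto
    then show "(\<Sum>e\<in>E. g N e * (real (hdim (eA e) M) - real (hdim (eA e) M'))) = 0"
      by (simp add: right_diff_distrib sum_subtractf)
  qed (rule e)
  then show ?thesis by simp
qed

text \<open>Such a \<open>w\<close> preserves the dimensions of Hom(N, -) for the summands
  \<open>N\<close> of \<open>T\<close>, hence the dimension vector; a surjection with this property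
  has zero kernel.\<close>

lemma F_bij_imp_inj:
  fixes M M' :: "'b std_module"
  assumes M: "fac A T M" and M': "fac A T M'" and w: "lin A M M' w" "w ` carrier M = carrier M'"
    and inj: "\<And>f x. \<lbrakk>lin A T M f; \<And>x. x \<in> carrier T \<Longrightarrow> w (f x) = \<zero>\<^sub>M'; x \<in> carrier T\<rbrakk> \<Longrightarrow> f x = \<zero>\<^sub>M"
    and surj: "\<And>f. lin A T M' f \<Longrightarrow> lifts_along A T M w f"
  shows "inj_on w (carrier M)"
proof -
  interpret w: lin A M M' w by (rule w(1))
  have eq: "hdim (T \<down> N) M = hdim (T \<down> N) M'" if N: "N \<in> ind_summands A T" for N
  proof (rule hdim_iso_right[OF AF.fg_sub[OF T ind_summandD(1)[OF N]] fac_fg[OF M] fac_fg[OF M'] w(1)])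
    note sN = ind_summandD(1)[OF N]
    obtain r where r: "lin A T (T \<down> N) r" "\<forall>x\<in>N. r x = x" using ind_summandD(3)[OF N] by metis
    have rN: "r x \<in> N" if "x \<in> carrier T" for x using lin.closed[OF r(1) that] by simp
    fix f
    {
      assume f: "lin A (T \<down> N) M f" "\<And>x. x \<in> carrier (T \<down> N) \<Longrightarrow> w (f x) = \<zero>\<^sub>M'"
      have "f (r x) = \<zero>\<^sub>M" if "x \<in> carrier T" for x
        using f(2) rN by (intro inj[OF lin_comp[OF r(1) f(1)] _ that]) simp
      note this[OF submoduleD(3)[OF sN]]
      then show "\<forall>x\<in>carrier (T \<down> N). f x = \<zero>\<^sub>M" using r(2) by simp
    }
    {
      assume f: "lin A (T \<down> N) M' f"
      obtain g where g: "lin A T M g" "\<forall>x\<in>carrier T. w (g x) = f (r x)" using surj[OF lin_comp[OF r(1) f]] by metis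
      then show "lifts_along A (T \<down> N) M w f"
        using lin.restrict_domain[OF g(1) sN] r(2) submoduleD(3)[OF sN] by (intro exI[of _ g]) simp
    }
  qed
  have "hdim (eA e) (M \<down> ker M M' w) = 0" if e: "e \<in> E" for e
  proof -
    have "hdim (eA e) M = hdim (eA e) M'"
      by (rule dimension_vector[OF fac_fg[OF M] factors_fac[OF M] fac_fg[OF M'] factors_fac[OF M'] eq e])
    then show ?thesis
      using hdim_exact[OF fg_principal[OF e] fac_fg[OF M] w lifts_gen[OF lifts_principal[OF e] fac_fg[OF M] w]] by simp
  qed
  from zero_of_hdim_zero[OF E AF.fg_sub[OF fac_fg[OF M] w.submodule_ker] this]
  show ?thesis by (simp add: w.inj_iff_ker)
qed

text \<open>\<open>U\<close> is the trace of \<open>T\<close> in the kernel of \<open>w\<close>. The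
  induced map from \<open>M\<close> modulo \<open>U\<close> to \<open>M'\<close> satisfies the
  conditions of \<open>F_bij_imp_inj\<close>, so \<open>U\<close> is the whole kernel.\<close>

lemma F_surj_imp_kernel_fac:
  fixes M M' :: "'b std_module"
  assumes M: "fac A T M" and M': "fac A T M'" and w: "lin A M M' w" "w ` carrier M = carrier M'"
    and surj: "\<And>f. lin A T M' f \<Longrightarrow> lifts_along A T M w f"
    and U: "submodule U A M" "U \<subseteq> ker M M' w" "fac A T (M \<down> U)"
    and tr: "\<And>f x. \<lbrakk>lin A T M f; \<And>x. x \<in> carrier T \<Longrightarrow> w (f x) = \<zero>\<^sub>M'; x \<in> carrier T\<rbrakk> \<Longrightarrow> f x \<in> U"
  shows "U = ker M M' w"
proof -
  interpret w: lin A M M' w by (rule w(1))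
  obtain Q :: "'b std_module" and q where Q: "fg_mod A Q" "lin A M Q q" "q ` carrier M = carrier Q" "ker M Q q = U"
    using std_quotient[OF fac_fg[OF M] U(1)] by metis
  interpret q: lin A M Q q by (rule Q(2))
  have "w x = \<zero>\<^sub>M'" if "x \<in> carrier M" "q x = \<zero>\<^sub>Q" for x
  proof -
    have "x \<in> ker M Q q" using that by (simp add: ker_iff)
    then show ?thesis using Q(4) U(2) by (auto simp: ker_iff)
  qed
  from q.factor_surj[OF w(1) Q(3) this] obtain v where v: "lin A Q M' v" "\<forall>x\<in>carrier M. v (q x) = w x" by metis
  interpret v: lin A Q M' v by (rule v(1))
  have vs: "v ` carrier Q = carrier M'" using v(2) w(2) unfolding Q(3)[symmetric] by (simp add: image_image)
  have "inj_on v (carrier Q)"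
  proof (rule F_bij_imp_inj[OF fac_image[OF M Q(2,3)] M' v(1) vs])
    fix f x assume f: "lin A T Q f" "\<And>x. x \<in> carrier T \<Longrightarrow> v (f x) = \<zero>\<^sub>M'" and x: "x \<in> carrier T"
    have "factors A P1 P0 d (M \<down> ker M Q q)" unfolding Q(4) by (rule factors_fac[OF U(3)])
    from lift_from_T[OF Q(2,3) fac_fg[OF M] this f(1)] obtain g where g: "lin A T M g" "\<forall>x\<in>carrier T. q (g x) = f x" by metis
    have "w (g y) = \<zero>\<^sub>M'" if y: "y \<in> carrier T" for y
      using v(2)[rule_format, OF lin.closed[OF g(1) y]] g(2)[rule_format, OF y] f(2)[OF y] by simp
    from tr[OF g(1) this x] have "g x \<in> ker M Q q" unfolding Q(4) by simp
    then show "f x = \<zero>\<^sub>Q" using g(2) x by (auto simp: ker_iff)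
  next
    fix f assume "lin A T M' f"
    from surj[OF this] obtain g where g: "lin A T M g" "\<forall>x\<in>carrier T. w (g x) = f x" by metis
    then show "lifts_along A T Q v f"
      using lin_comp[OF g(1) Q(2)] v(2) lin.closed[OF g(1)] by (intro exI[of _ "\<lambda>x. q (g x)"]) simp
  qed
  then have "ker M M' w \<subseteq> ker M Q q"
    using v(2) unfolding v.inj_iff by (auto simp: ker_iff)
  then show ?thesis using Q(4) U(2) by auto
qed

end

section \<open>Modules over the endomorphism algebra\<close>

context counted_rigid_module
begin

lemma F_closed: "\<lbrakk>lin A M N w; f \<in> rhom A T M\<rbrakk> \<Longrightarrow> Fm w f \<in> rhom A T N"
  using lin.closed[OF lin_hom_module[OF T_mod, of M N w], of f] by simp

text \<open>F(T) is the regular module of \<open>B\<close>, so a \<open>B\<close>-map on it is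
  determined by the image of the identity; \<open>j1\<close> is that identity, seen in the last
  summand of \<open>S'\<close>.\<close>

lemma tpow_full:
  assumes Y: "right_module A Y"
  shows "tpow A T S \<Longrightarrow> lin B (F S) (F Y) \<chi> \<Longrightarrow>
    \<exists>u. lin A S Y u \<and> (\<forall>h\<in>rhom A T S. \<chi> h = Fm u h)"
proof (induction arbitrary: \<chi> rule: tpow.induct)
  case (zero S)
  note mS = fg_modD[OF zero(1)]
  have z: "x = \<zero>\<^sub>S" if "x \<in> carrier S" for x using that zero(2) by simp
  have "\<chi> h = Fm (\<lambda>x. \<zero>\<^sub>Y) h" if h: "h \<in> rhom A T S" for h
  proof -
    have "h = (\<lambda>x\<in>carrier T. \<zero>\<^sub>S)"
      using z[OF rhom_closed[OF h]] by (intro rhom_ext[OF h lin.in_rhom[OF lin_zero[OF T_mod mS]]]) simp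
    then have "h = \<zero>\<^bsub>F S\<^esub>" by simp
    then have "\<chi> h = \<zero>\<^bsub>F Y\<^esub>" using lin.zero[OF zero(3)] by metis
    then show ?thesis by (simp add: compose_def)
  qed
  then show ?case using lin_zero[OF mS Y] by (intro exI[of _ "\<lambda>x. \<zero>\<^sub>Y"]) simp
next
  case (step S S' i j p q)
  note b = biprodD[OF step(3)]
  interpret S': right_module A S' by (rule lin.cod_mod[OF b(1)])
  interpret \<chi>: lin B "F S'" "F Y" \<chi> by (rule step(5))
  have "lin B (F S) (F Y) (\<lambda>h. \<chi> (Fm i h))"
    by (rule lin_comp[OF lin_hom_module[OF T_mod b(1)] step(5)])
  from step(4)[OF this] obtain u1 where u1: "lin A S Y u1"
    "\<forall>h\<in>rhom A T S. \<chi> (Fm i h) = Fm u1 h" by (elim exE conjE)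
  define j1 where "j1 = Fm j (\<lambda>x\<in>carrier T. x)"
  have j1: "j1 \<in> rhom A T S'" unfolding j1_def by (rule F_closed[OF b(2) lin.in_rhom[OF lin_id[OF T_mod]]])
  then have u2': "\<chi> j1 \<in> rhom A T Y" using \<chi>.closed[of j1] by simp
  note u2 = rhom_lin[OF T_mod Y u2']
  have "\<chi> h = Fm (\<lambda>s. u1 (p s) \<oplus>\<^sub>Y \<chi> j1 (q s)) h" if h: "h \<in> rhom A T S'" for h
  proof -
    let ?p = "Fm p h" and ?q = "Fm q h"
    have hp: "?p \<in> rhom A T S" and hq: "?q \<in> rhom A T T" using F_closed b(3,4) h by auto
    have c1: "Fm i ?p \<in> carrier (F S')" using F_closed[OF b(1) hp] by simp
    have e2: "Fm j ?q = ?q \<odot>\<^bsub>F S'\<^esub> j1"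
      using rhom_closed[OF hq] by (simp add: j1_def compose_def fun_eq_iff)
    have c2: "Fm j ?q \<in> carrier (F S')" using F_closed[OF b(2) hq] by simp
    have "h = Fm i ?p \<oplus>\<^bsub>F S'\<^esub> Fm j ?q"
    proof (rule rhom_ext[OF h])
      show "Fm i ?p \<oplus>\<^bsub>F S'\<^esub> Fm j ?q \<in> rhom A T S'"
        using \<chi>.M.a_closed[OF c1 c2] by simp
    qed (simp add: compose_def b(9)[OF rhom_closed[OF h]])
    then have "\<chi> h = \<chi> (Fm i ?p) \<oplus>\<^bsub>F Y\<^esub> \<chi> (?q \<odot>\<^bsub>F S'\<^esub> j1)"
      using \<chi>.add[OF c1 c2] e2 by simp
    also have "\<dots> = Fm u1 ?p \<oplus>\<^bsub>F Y\<^esub> Fm (\<chi> j1) ?q"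
      using \<chi>.smult[of ?q j1] hp hq j1 u1(2) by simp
    finally show ?thesis by (simp add: compose_def fun_eq_iff)
  qed
  then show ?case using biprod_map(1)[OF step(3) u1(1) u2] by (intro exI[of _ "\<lambda>s. u1 (p s) \<oplus>\<^sub>Y \<chi> j1 (q s)"]) simp
qed

lemma kernel_fac:
  fixes M M' :: "'b std_module"
  assumes M: "fac A T M" and M': "fac A T M'" and w: "lin A M M' w" "w ` carrier M = carrier M'"
    and surj: "\<And>f. lin A T M' f \<Longrightarrow> lifts_along A T M w f"
  shows "fac A T (M \<down> ker M M' w)"
proof -
  interpret w: lin A M M' w by (rule w(1))
  let ?K = "M \<down> ker M M' w"
  obtain U where U: "submodule U A ?K" "fac A T (?K \<down> U)"
    "\<forall>f x. lin A T ?K f \<and> x \<in> carrier T \<longrightarrow> f x \<in> U"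
    using AF.trace_submodule[OF T AF.fg_sub[OF fac_fg[OF M] w.submodule_ker]] by metis
  have U': "submodule U A M" "U \<subseteq> ker M M' w" using U(1) by (simp_all add: w.M.submodule_sub_iff[OF w.submodule_ker])
  have "U = ker M M' w"
  proof (rule F_surj_imp_kernel_fac[OF M M' w surj U'])
    show "fac A T (M \<down> U)" using U(2) by simp
    fix f x assume f: "lin A T M f" "\<And>x. x \<in> carrier T \<Longrightarrow> w (f x) = \<zero>\<^sub>M'" and x: "x \<in> carrier T"
    have "lin A T ?K f"
      by (rule lin.restrict_codomain[OF f(1) w.submodule_ker]) (use f lin.closed[OF f(1)] in \<open>auto simp: ker_iff\<close>)
    then show "f x \<in> U" using U(3) x by simp
  qed
  then show ?thesis using U(2) by simp
qed

lemma F_onto_imp_onto: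
  assumes Y: "fac A T Y" and w: "lin A S Y w" and s: "Fm w ` rhom A T S = rhom A T Y"
  shows "w ` carrier S = carrier Y" "\<And>f. lin A T Y f \<Longrightarrow> lifts_along A T S w f"
proof -
  interpret w: lin A S Y w by (rule w)
  show l: "lifts_along A T S w f" if f: "lin A T Y f" for f
  proof -
    have "restrict f (carrier T) \<in> Fm w ` rhom A T S" unfolding s by (rule lin.in_rhom[OF f])
    then obtain g where g: "g \<in> rhom A T S" "restrict f (carrier T) = Fm w g" by (elim imageE)
    have "w (g x) = f x" if "x \<in> carrier T" for x using fun_cong[OF g(2), of x] that by (simp add: compose_def)
    then show ?thesis using rhom_lin[OF T_mod w.dom_mod g(1)] by (intro exI[of _ g]) simp
  qed
  show "w ` carrier S = carrier Y"
  proof (rule facD[OF Y w.submodule_range])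
    fix f x assume f: "lin A T Y f" and x: "x \<in> carrier T"
    obtain g where g: "lin A T S g" "\<forall>x\<in>carrier T. w (g x) = f x" using l[OF f] by metis
    then show "f x \<in> w ` carrier S" using x lin.closed[OF g(1) x] by (intro image_eqI[of _ w "g x"]) simp_all
  qed
qed

text \<open>Cover \<open>Y\<close> by a finite sum \<open>S\<close> of copies of \<open>T\<close>
  such that F(S) -> F(Y) is onto. The composite F(S) -> F(Y') comes from some \<open>\<psi>\<close>,
  which vanishes on the kernel of \<open>\<zeta>\<close>: this kernel is generated by
  \<open>T\<close>, and on maps from \<open>T\<close> the vanishing can be read off after applying
  \<open>F\<close>.\<close>

lemma F_full:
  fixes Y Y' :: "'b std_module"
  assumes Y: "fac A T Y" and Y': "fac A T Y'" and \<phi>: "lin B (F Y) (F Y') \<phi>"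
  shows "\<exists>u. lin A Y Y' u \<and> (\<forall>f\<in>rhom A T Y. \<phi> f = Fm u f)"
proof -
  interpret \<phi>: lin B "F Y" "F Y'" \<phi> by (rule \<phi>)
  note mY = fg_modD[OF fac_fg[OF Y]] and mY' = fg_modD[OF fac_fg[OF Y']]
  obtain S \<zeta> where S: "tpow A T S" "lin A S Y \<zeta>" "Fm \<zeta> ` rhom A T S = carrier (F Y)"
    using sub_F_from_tpow[OF fac_fg[OF Y] \<phi>.M.submodule_carrier] by metis
  have s: "Fm \<zeta> ` rhom A T S = rhom A T Y" using S(3) by simp
  note onto = F_onto_imp_onto[OF Y S(2) s]
  interpret \<zeta>: lin A S Y \<zeta> by (rule S(2))
  obtain \<psi> where \<psi>: "lin A S Y' \<psi>" "\<forall>h\<in>rhom A T S. \<phi> (Fm \<zeta> h) = Fm \<psi> h"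
    using tpow_full[OF mY' S(1) lin_comp[OF lin_hom_module[OF T_mod S(2)] \<phi>]] by metis
  note kf = kernel_fac[OF AF.fac_tpow[OF T S(1)] Y S(2) onto]
  let ?L = "S \<down> ker S Y \<zeta>"
  have lL: "lin A ?L Y' \<psi>" by (rule lin.restrict_domain[OF \<psi>(1) \<zeta>.submodule_ker])
  have k: "\<psi> x = \<zero>\<^sub>Y'" if "x \<in> carrier S" "\<zeta> x = \<zero>\<^sub>Y" for x
  proof (rule fac_eq[OF kf lL lin_zero[OF lin.dom_mod[OF lL] mY']])
    show "x \<in> carrier ?L" using that by (simp add: ker_iff)
    fix h y assume h: "lin A T ?L h" and y: "y \<in> carrier T"
    have hk: "h z \<in> carrier S" "\<zeta> (h z) = \<zero>\<^sub>Y" if "z \<in> carrier T" for z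
      using lin.closed[OF h that] by (simp_all add: ker_iff)
    let ?h = "restrict h (carrier T)"
    have rh: "?h \<in> rhom A T S"
      by (rule lin.in_rhom) (use lin_comp[OF h lin_incl[OF \<zeta>.dom_mod \<zeta>.submodule_ker]] in simp)
    have "Fm \<zeta> ?h = \<zero>\<^bsub>F Y\<^esub>" using hk by (simp add: compose_def fun_eq_iff)
    then have "Fm \<psi> ?h = \<zero>\<^bsub>F Y'\<^esub>" using \<psi>(2) rh \<phi>.zero by metis
    from fun_cong[OF this, of y] show "\<psi> (h y) = \<zero>\<^sub>Y'" using y by (simp add: compose_def)
  qed
  obtain u where u: "lin A Y Y' u" "\<forall>x\<in>carrier S. u (\<zeta> x) = \<psi> x" using \<zeta>.factor_surj[OF \<psi>(1) onto(1) k] by metis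
  have "\<phi> f = Fm u f" if f: "f \<in> rhom A T Y" for f
  proof -
    obtain h where h: "h \<in> rhom A T S" "f = Fm \<zeta> h" using f unfolding s[symmetric] by (elim imageE)
    then have "\<phi> f = Fm \<psi> h" using \<psi>(2) by simp
    then show ?thesis unfolding h(2) using u(2) rhom_closed[OF h(1)] by (simp add: compose_def fun_eq_iff)
  qed
  then show ?thesis using u(1) by blast
qed

text \<open>Fullness realises both maps. Injectivity of F(u) says only that \<open>u\<close> kills
  no nonzero map from \<open>T\<close>; injectivity of \<open>u\<close> and exactness in the middle
  come from the comparison of dimension vectors.\<close>

lemma F_exact:
  fixes Y' Y Y'' :: "'b std_module"
  assumes Y': "fac A T Y'" and Y: "fac A T Y" and Y'': "fac A T Y''"
    and se: "short_exact B (F Y') (F Y) (F Y'') \<phi> \<psi>"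
  shows "\<exists>u w. short_exact A Y' Y Y'' u w"
proof -
  note se' = short_exactD[OF se]
  obtain u where u: "lin A Y' Y u" "\<forall>f\<in>rhom A T Y'. \<phi> f = Fm u f" using F_full[OF Y' Y se'(1)] by metis
  obtain w where w: "lin A Y Y'' w" "\<forall>f\<in>rhom A T Y. \<psi> f = Fm w f" using F_full[OF Y Y'' se'(2)] by metis
  interpret u: lin A Y' Y u by (rule u(1))
  interpret w: lin A Y Y'' w by (rule w(1))
  have "Fm w ` rhom A T Y = \<psi> ` rhom A T Y" using w(2) by (intro image_cong) simp_all
  then have s: "Fm w ` rhom A T Y = rhom A T Y''" using se'(4) by simp
  note onto = F_onto_imp_onto[OF Y'' w(1) s]
  have wu: "w (u x) = \<zero>\<^sub>Y''" if x: "x \<in> carrier Y'" for x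
  proof (rule fac_eq[OF Y' lin_comp[OF u(1) w(1)] lin_zero[OF u.dom_mod w.cod_mod] _ x])
    fix h y assume h: "lin A T Y' h" and y: "y \<in> carrier T"
    have rh: "restrict h (carrier T) \<in> rhom A T Y'" by (rule lin.in_rhom[OF h])
    have c: "Fm u (restrict h (carrier T)) \<in> rhom A T Y" by (rule F_closed[OF u(1) rh])
    have "\<psi> (\<phi> (restrict h (carrier T))) = \<zero>\<^bsub>F Y''\<^esub>" using se'(6) rh by simp
    then have "Fm w (Fm u (restrict h (carrier T))) = \<zero>\<^bsub>F Y''\<^esub>"
      using u(2) w(2) rh c by simp
    from fun_cong[OF this, of y] show "w (u (h y)) = \<zero>\<^sub>Y''" using y by (simp add: compose_def)
  qed
  have ex: "lifts_along A T Y' u f"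
    if f: "lin A T Y f" "\<And>x. x \<in> carrier T \<Longrightarrow> w (f x) = \<zero>\<^sub>Y''" for f
  proof -
    have rf: "restrict f (carrier T) \<in> rhom A T Y" by (rule lin.in_rhom[OF f(1)])
    have "\<psi> (restrict f (carrier T)) = \<zero>\<^bsub>F Y''\<^esub>"
      using w(2)[rule_format, OF rf] f(2) by (simp add: compose_def fun_eq_iff)
    then have "restrict f (carrier T) \<in> \<phi> ` carrier (F Y')" unfolding se'(5)[symmetric] using rf by (simp add: ker_iff)
    then obtain g where g: "g \<in> rhom A T Y'" "restrict f (carrier T) = \<phi> g" by (elim imageE) simp
    then have e: "restrict f (carrier T) = Fm u g" using u(2) by simp
    have "u (g x) = f x" if "x \<in> carrier T" for x using fun_cong[OF e, of x] that by (simp add: compose_def)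
    then show ?thesis using rhom_lin[OF T_mod u.dom_mod g(1)] by (intro exI[of _ g]) simp
  qed
  let ?U = "Y \<down> u ` carrier Y'"
  have lU: "lin A Y' ?U u" by (rule u.restrict_codomain[OF u.submodule_range]) simp
  have sU: "u ` carrier Y' = carrier ?U" by simp
  have fU: "fac A T ?U" by (rule fac_image[OF Y' lU sU])
  have iU: "lin A ?U Y (\<lambda>x. x)" by (rule lin_incl[OF u.cod_mod u.submodule_range])
  have "inj_on u (carrier Y')"
  proof (rule F_bij_imp_inj[OF Y' fU lU sU])
    fix f x assume f: "lin A T Y' f" "\<And>x. x \<in> carrier T \<Longrightarrow> u (f x) = \<zero>\<^sub>?U" and x: "x \<in> carrier T"
    have rf: "restrict f (carrier T) \<in> carrier (F Y')" using lin.in_rhom[OF f(1)] by simp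
    have "\<phi> (restrict f (carrier T)) = Fm u (restrict f (carrier T))" using u(2) rf by simp
    also have "\<dots> = \<zero>\<^bsub>F Y\<^esub>" using f(2) by (simp add: compose_def fun_eq_iff)
    finally have "restrict f (carrier T) = \<zero>\<^bsub>F Y'\<^esub>" using se'(3) rf unfolding lin.inj_iff[OF se'(1)] by blast
    from fun_cong[OF this, of x] show "f x = \<zero>\<^sub>Y'" using x by simp
  next
    fix f assume f: "lin A T ?U f"
    have "w (f x) = \<zero>\<^sub>Y''" if "x \<in> carrier T" for x using lin.closed[OF f that] wu by auto
    then show "lifts_along A T Y' u f" using ex[OF lin_comp[OF f iU]] by simp
  qed
  moreover have "u ` carrier Y' = ker Y Y'' w"
  proof (rule F_surj_imp_kernel_fac[OF Y Y'' w(1) onto u.submodule_range _ fU])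
    show "u ` carrier Y' \<subseteq> ker Y Y'' w" using wu by (auto simp: ker_iff)
    fix f x assume f: "lin A T Y f" "\<And>x. x \<in> carrier T \<Longrightarrow> w (f x) = \<zero>\<^sub>Y''" and x: "x \<in> carrier T"
    obtain g where g: "lin A T Y' g" "\<forall>x\<in>carrier T. u (g x) = f x" using ex[OF f] by metis
    then show "f x \<in> u ` carrier Y'" using x lin.closed[OF g(1) x] by (intro image_eqI[of _ u "g x"]) simp_all
  qed
  ultimately show ?thesis using u(1) w(1) onto(1) unfolding short_exact_def by metis
qed

end

section \<open>Explicit isomorphisms and short exact sequences\<close>

definition isos :: "('a, 'r) ring_scheme \<Rightarrow> ('a, 'm) module \<Rightarrow> ('a, 'n) module \<Rightarrow> ('m \<Rightarrow> 'n) \<Rightarrow> ('n \<Rightarrow> 'm) \<Rightarrow> bool" where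
  "isos R M N f g \<longleftrightarrow> lin R M N f \<and> lin R N M g \<and>
     (\<forall>x\<in>carrier M. g (f x) = x) \<and> (\<forall>y\<in>carrier N. f (g y) = y)"

lemma isosD:
  assumes "isos R M N f g"
  shows "lin R M N f" "lin R N M g" "\<And>x. x \<in> carrier M \<Longrightarrow> g (f x) = x" "\<And>y. y \<in> carrier N \<Longrightarrow> f (g y) = y"
  using assms by (auto simp: isos_def)

lemma isos_refl: "right_module R M \<Longrightarrow> isos R M M (\<lambda>x. x) (\<lambda>x. x)"
  using lin_id by (auto simp: isos_def)

lemma isos_same_image:
  assumes f: "lin R L N f" and g: "lin R M N g" and inj: "inj_on f (carrier L)" "inj_on g (carrier M)"
    and im: "f ` carrier L = g ` carrier M"
  shows "\<exists>a b. isos R L M a b"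
proof -
  have "f x \<in> g ` carrier M" if "x \<in> carrier L" for x unfolding im[symmetric] by (rule imageI[OF that])
  from lin_factor_inj[OF g inj(2) f this] obtain a where a: "lin R L M a" "\<forall>x\<in>carrier L. g (a x) = f x" by metis
  have "g x \<in> f ` carrier L" if "x \<in> carrier M" for x unfolding im by (rule imageI[OF that])
  from lin_factor_inj[OF f inj(1) g this] obtain b where b: "lin R M L b" "\<forall>x\<in>carrier M. f (b x) = g x" by metis
  have "b (a x) = x" if "x \<in> carrier L" for x
    using inj_onD[OF inj(1), of "b (a x)" x] a b that lin.closed[OF a(1) that] lin.closed[OF b(1)] by simp
  moreover have "a (b x) = x" if "x \<in> carrier M" for x
    using inj_onD[OF inj(2), of "a (b x)" x] a b that lin.closed[OF b(1) that] lin.closed[OF a(1)] by simp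
  ultimately show ?thesis using a(1) b(1) unfolding isos_def by blast
qed

lemma short_exact_ker:
  assumes "lin R M N w" "w ` carrier M = carrier N"
  shows "short_exact R (M \<down> ker M N w) M N (\<lambda>x. x) w"
  using assms lin_incl[OF lin.dom_mod[OF assms(1)] lin.submodule_ker[OF assms(1)]] by (simp add: short_exact_def)

lemma short_exact_isos:
  assumes se: "short_exact R L M N u w"
    and L: "isos R L L' a a'" and M: "isos R M M' b b'" and N: "isos R N N' c c'"
  shows "short_exact R L' M' N' (\<lambda>x. b (u (a' x))) (\<lambda>x. c (w (b' x)))"
proof -
  note se' = short_exactD[OF se] and L' = isosD[OF L] and M' = isosD[OF M] and N' = isosD[OF N]
  have lu: "lin R L' M' (\<lambda>x. b (u (a' x)))" by (rule lin_comp[OF lin_comp[OF L'(2) se'(1)] M'(1)])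
  have lw: "lin R M' N' (\<lambda>x. c (w (b' x)))" by (rule lin_comp[OF lin_comp[OF M'(2) se'(2)] N'(1)])
  note cl = lin.closed[OF L'(1)] lin.closed[OF L'(2)] lin.closed[OF M'(1)] lin.closed[OF M'(2)]
    lin.closed[OF N'(1)] lin.closed[OF N'(2)] lin.closed[OF se'(1)] lin.closed[OF se'(2)]
  have "inj_on (\<lambda>x. b (u (a' x))) (carrier L')"
  proof (rule inj_onI)
    fix x y assume x: "x \<in> carrier L'" and y: "y \<in> carrier L'" and e: "b (u (a' x)) = b (u (a' y))"
    have "b' (b (u (a' x))) = b' (b (u (a' y)))" using e by simp
    then have "u (a' x) = u (a' y)" using M'(3) cl(7) cl(2) x y by simp
    then have "a' x = a' y" using inj_onD[OF se'(3)] cl(2) x y by simp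
    then show "x = y" using L'(4) x y by metis
  qed
  moreover have "(\<lambda>x. c (w (b' x))) ` carrier M' = carrier N'"
  proof
    show "carrier N' \<subseteq> (\<lambda>x. c (w (b' x))) ` carrier M'"
    proof
      fix y assume y: "y \<in> carrier N'"
      have "c' y \<in> w ` carrier M" unfolding se'(4) by (rule cl(6)[OF y])
      then obtain x where x: "x \<in> carrier M" "c' y = w x" by (elim imageE)
      then have "y = c (w (b' (b x)))" using N'(4)[OF y] M'(3) by simp
      then show "y \<in> (\<lambda>x. c (w (b' x))) ` carrier M'" using cl(3)[OF x(1)] by (intro image_eqI) auto
    qed
  qed (use lin.closed[OF lw] in auto)
  moreover have "ker M' N' (\<lambda>x. c (w (b' x))) = (\<lambda>x. b (u (a' x))) ` carrier L'"
  proof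
    show "(\<lambda>x. b (u (a' x))) ` carrier L' \<subseteq> ker M' N' (\<lambda>x. c (w (b' x)))"
      using se'(6) M'(3) cl lin.zero[OF N'(1)] by (auto simp: ker_iff)
    show "ker M' N' (\<lambda>x. c (w (b' x))) \<subseteq> (\<lambda>x. b (u (a' x))) ` carrier L'"
    proof
      fix y assume "y \<in> ker M' N' (\<lambda>x. c (w (b' x)))"
      then have y: "y \<in> carrier M'" "c (w (b' y)) = \<zero>\<^sub>N'" by (simp_all add: ker_iff)
      have "w (b' y) = \<zero>\<^sub>N" using N'(3)[of "w (b' y)"] cl(8) cl(4) y lin.zero[OF N'(2)] by metis
      then have "b' y \<in> ker M N w" using cl(4)[OF y(1)] by (simp add: ker_iff)
      then obtain x where x: "x \<in> carrier L" "b' y = u x" unfolding se'(5) by (elim imageE)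
      then have "y = b (u (a' (a x)))" using M'(4)[OF y(1)] L'(3) by simp
      then show "y \<in> (\<lambda>x. b (u (a' x))) ` carrier L'" using cl(1)[OF x(1)] by (intro image_eqI) auto
    qed
  qed
  ultimately show ?thesis using lu lw by (simp add: short_exact_def)
qed

context counted_rigid_module
begin

text \<open>By maximality, as in \<open>trace_exists\<close>: an element \<open>x\<close> of
  \<open>M\<close> is the image of the identity under the map b -> x b from F(T) = B, and this map
  is adjoined as one more summand.\<close>

lemma F_cover:
  assumes M: "fg_mod B M"
  shows "\<exists>S \<chi>. tpow A T S \<and> lin B (F S) M \<chi> \<and> \<chi> ` rhom A T S = carrier M"
proof -
  interpret BF: finlen_ring B by (rule finlen_rings(2))
  interpret M: right_module B M by (rule fg_modD[OF M])
  let ?C = "{\<chi> ` rhom A T S |S \<chi>. tpow A T S \<and> lin B (F S) M \<chi>}"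
  have sub: "submodule U B M" if "U \<in> ?C" for U using that lin.submodule_range by fastforce
  obtain S0 where S0: "tpow A T S0" using AF.tpow_zero_exists by metis
  have "(\<lambda>x. \<zero>\<^sub>M) ` rhom A T S0 \<in> ?C"
    using S0 lin_zero[OF F_mod[OF fg_modD[OF tpow_fg[OF S0]]] M.right_module_axioms] by blast
  then have "\<exists>U\<in>?C. \<forall>V\<in>?C. U \<subseteq> V \<longrightarrow> U = V"
    using sub by (rule M.ex_maximal_submodule[OF BF.fg_flen[OF M]])
  then obtain U where U: "U \<in> ?C" and max: "\<forall>V\<in>?C. U \<subseteq> V \<longrightarrow> U = V" by (elim bexE)
  obtain S \<chi> where S: "tpow A T S" "lin B (F S) M \<chi>" "U = \<chi> ` rhom A T S" using U by auto
  have "x \<in> U" if x: "x \<in> carrier M" for x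
  proof -
    obtain S' :: "'b std_module" and i j p q where S': "fg_mod A S'" "biprod A S T S' i j p q" using AF.ex_biprod[OF tpow_fg[OF S(1)] T] by metis
    note b = biprodD[OF S'(2)]
    have lx: "lin B (F T) M (\<lambda>b. b \<odot>\<^sub>M x)"
    proof (rule linI[OF F_mod[OF T_mod] M.right_module_axioms])
      show "a \<odot>\<^sub>M x \<in> carrier M" if "a \<in> carrier (F T)" for a using M.smult_closed[of a x] that x by simp
      show "(a \<oplus>\<^bsub>F T\<^esub> b) \<odot>\<^sub>M x = a \<odot>\<^sub>M x \<oplus>\<^sub>M b \<odot>\<^sub>M x" if "a \<in> carrier (F T)" "b \<in> carrier (F T)" for a b
        using M.smult_l_distr[of a b x] that x by simp
      show "(a \<odot>\<^bsub>F T\<^esub> b) \<odot>\<^sub>M x = a \<odot>\<^sub>M (b \<odot>\<^sub>M x)" if "a \<in> carrier B" "b \<in> carrier (F T)" for a b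
        using M.smult_assoc[of b a x] that x by simp
    qed
    have l: "lin B (F S') M (\<lambda>h. \<chi> (Fm p h) \<oplus>\<^sub>M Fm q h \<odot>\<^sub>M x)" (is "lin B _ M ?\<chi>")
      by (rule lin_add_map[OF lin_comp[OF lin_hom_module[OF T_mod b(3)] S(2)] lin_comp[OF lin_hom_module[OF T_mod b(4)] lx]])
    interpret \<chi>: lin B "F S" M \<chi> by (rule S(2))
    have 1: "?\<chi> (Fm i h) = \<chi> h" if h: "h \<in> rhom A T S" for h
    proof -
      have "Fm p (Fm i h) = h"
        by (rule rhom_ext[OF F_closed[OF b(3) F_closed[OF b(1) h]] h]) (simp add: compose_def b(5)[OF rhom_closed[OF h]])
      moreover have "Fm q (Fm i h) = \<zero>\<^sub>B"
        using b(6)[OF rhom_closed[OF h]] by (simp add: compose_def fun_eq_iff)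
      ultimately show ?thesis using M.smult_l_null[OF x] \<chi>.closed[of h] h by (simp del: End_algebra_simps)
    qed
    let ?j = "Fm j (\<lambda>x\<in>carrier T. x)"
    have idT: "(\<lambda>x\<in>carrier T. x) \<in> rhom A T T" by (rule lin.in_rhom[OF lin_id[OF T_mod]])
    have 2: "?\<chi> ?j = x"
    proof -
      have "Fm p ?j = \<zero>\<^bsub>F S\<^esub>" using b(8) by (simp add: compose_def fun_eq_iff)
      moreover have "Fm q ?j = \<one>\<^sub>B" using b(7) by (simp add: compose_def fun_eq_iff)
      ultimately show ?thesis using M.smult_one[OF x] x by (simp del: End_algebra_simps hom_module_simps)
    qed
    have "U \<subseteq> ?\<chi> ` rhom A T S'"
    proof
      fix y assume "y \<in> U"
      then obtain h where "h \<in> rhom A T S" "y = \<chi> h" unfolding S(3) by (elim imageE)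
      then show "y \<in> ?\<chi> ` rhom A T S'" using 1 F_closed[OF b(1)] by (intro image_eqI[of _ ?\<chi> "Fm i h"]) simp_all
    qed
    moreover have "?\<chi> ` rhom A T S' \<in> ?C" using tpow.step[OF S(1) S'] l by blast
    ultimately have "U = ?\<chi> ` rhom A T S'" using max by simp
    moreover have "x \<in> ?\<chi> ` rhom A T S'" by (rule image_eqI[of x ?\<chi> ?j, OF 2[symmetric] F_closed[OF b(2) idT]])
    ultimately show ?thesis by simp
  qed
  moreover have "U \<subseteq> carrier M" using sub[OF U] submoduleD(1) by metis
  ultimately show ?thesis using S by blast
qed

end

text \<open>\<open>Ext\<close> is computed from a resolution chosen by \<open>SOME\<close>,
  unrelated to the presentation by \<open>P1\<close> and \<open>P0\<close>. The two are compared by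
  lifting the identity of \<open>T\<close>, in \<open>ext0_fac\<close> and in
  \<open>relation_maps_vanish\<close>.\<close>

locale resolved_rigid_module = counted_rigid_module +
  fixes Pr \<epsilon> \<delta>
  assumes res: "proj_resolution A T Pr \<epsilon> \<delta>"
begin

text \<open>Lifts \<open>l\<close> and \<open>l'\<close> of the identity of \<open>T\<close> compare
  the presentation with \<open>Pr\<close>. A cocycle in degree 1 is a map \<open>f'\<close> on the
  kernel of \<open>\<epsilon>\<close>. Since \<open>f' l d\<close> factors through \<open>d\<close>,
  the map \<open>f'\<close> can be extended to \<open>Pr 0\<close>, which is Ext^1(T, M) =
  0.\<close>

lemma ext0_fac:
  assumes M: "fac A T M"
  shows "ext0 A Pr \<delta> 0 M"
proof (rule ext0I)
  note r = proj_resolutionD[OF res T_mod]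
  interpret \<delta>: lin A "Pr (Suc 0)" "Pr 0" "\<delta> 0" by (rule r(3))
  interpret \<epsilon>: lin A "Pr 0" T \<epsilon> by (rule r(2))
  fix f assume f: "lin A (Pr (Suc 0)) M f" "\<And>y. y \<in> carrier (Pr (Suc (Suc 0))) \<Longrightarrow> f (\<delta> (Suc 0) y) = \<zero>\<^sub>M"
  let ?K = "(Pr 0) \<down> ker (Pr 0) T \<epsilon>"
  have dK: "lin A (Pr (Suc 0)) ?K (\<delta> 0)" by (rule \<delta>.restrict_codomain[OF \<epsilon>.submodule_ker]) (simp add: r(5))
  have dKs: "\<delta> 0 ` carrier (Pr (Suc 0)) = carrier ?K" by (simp add: r(5))
  have "f x = \<zero>\<^sub>M" if "x \<in> carrier (Pr (Suc 0))" "\<delta> 0 x = \<zero>\<^sub>?K" for x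
  proof -
    have "x \<in> ker (Pr (Suc 0)) (Pr 0) (\<delta> 0)" using that by (simp add: ker_iff)
    then show ?thesis unfolding r(6) using f(2) by auto
  qed
  from lin.factor_surj[OF dK f(1) dKs this] obtain f' where f': "lin A ?K M f'" "\<forall>x\<in>carrier (Pr (Suc 0)). f' (\<delta> 0 x) = f x" by metis
  obtain l where l: "lin A P0 (Pr 0) l" "\<forall>x\<in>carrier P0. \<epsilon> (l x) = p0 x"
    using projective_lift[OF P0 projective_fg[OF r(1)] r(2,4) p0] by metis
  obtain l' where l': "lin A (Pr 0) P0 l'" "\<forall>x\<in>carrier (Pr 0). p0 (l' x) = \<epsilon> x"
    using projective_lift[OF r(1) projective_fg[OF P0] p0 p0_surj r(2)] by metis
  have ldK: "lin A P1 ?K (\<lambda>x. l (d x))"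
    by (rule lin.restrict_codomain[OF lin_comp[OF d l(1)] \<epsilon>.submodule_ker])
      (use l d_zero lin.closed[OF l(1)] lin.closed[OF d] in \<open>auto simp: ker_iff\<close>)
  obtain g where g: "lin A P0 M g" "\<forall>x\<in>carrier P1. g (d x) = f' (l (d x))"
    using factors_fac[OF M] lin_comp[OF ldK f'(1)] unfolding factors_def by metis
  have l1: "lin A (Pr 0) ?K (\<lambda>z. z \<ominus>\<^bsub>Pr 0\<^esub> l (l' z))"
    by (rule lin.restrict_codomain[OF lin_diff_map[OF lin_id[OF \<delta>.cod_mod] lin_comp[OF l'(1) l(1)]] \<epsilon>.submodule_ker])
      (use l l' lin.closed[OF l(1)] lin.closed[OF l'(1)] in \<open>auto simp: ker_iff \<epsilon>.diff\<close>)
  \<comment> \<open>For z in the kernel of \<open>\<epsilon>\<close> the element l' z is in the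
    image of \<open>d\<close>, where \<open>g\<close> agrees with \<open>f'\<close> after
    \<open>l\<close>; the two terms then add up to f' z.\<close>
  have l2: "lin A (Pr 0) M (\<lambda>z. f' (z \<ominus>\<^bsub>Pr 0\<^esub> l (l' z)) \<oplus>\<^sub>M g (l' z))"
    by (rule lin_add_map[OF lin_comp[OF l1 f'(1)] lin_comp[OF l'(1) g(1)]])
  have e: "f' (z \<ominus>\<^bsub>Pr 0\<^esub> l (l' z)) \<oplus>\<^sub>M g (l' z) = f' z" if z: "z \<in> ker (Pr 0) T \<epsilon>" for z
  proof -
    interpret f': lin A ?K M f' by (rule f'(1))
    have zc: "z \<in> carrier (Pr 0)" "\<epsilon> z = \<zero>\<^sub>T" using z by (simp_all add: ker_iff)
    have "l' z \<in> ker P0 T p0" using l' zc lin.closed[OF l'(1)] by (simp add: ker_iff)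
    then obtain y where y: "y \<in> carrier P1" "l' z = d y" unfolding d_exact[symmetric] by (elim imageE)
    have ll: "l (l' z) \<in> ker (Pr 0) T \<epsilon>" using lin.closed[OF ldK y(1)] y(2) by simp
    have "f' (z \<ominus>\<^bsub>Pr 0\<^esub> l (l' z)) = f' z \<ominus>\<^sub>M f' (l (l' z))"
      using f'.diff[of z "l (l' z)"] z ll \<delta>.N.a_minus_sub[OF \<epsilon>.submodule_ker ll] by simp
    moreover have "g (l' z) = f' (l (l' z))" using g(2) y by simp
    ultimately show ?thesis using f'.closed[of z] f'.closed[of "l (l' z)"] z ll by simp
  qed
  have "\<delta> 0 x \<in> ker (Pr 0) T \<epsilon>" if "x \<in> carrier (Pr (Suc 0))" for x unfolding r(5) by (rule imageI[OF that])
  then show "extends_along A (Pr (Suc 0)) (Pr 0) M (\<delta> 0) f"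
    using l2 f'(2) e by (intro exI[of _ "\<lambda>z. f' (z \<ominus>\<^bsub>Pr 0\<^esub> l (l' z)) \<oplus>\<^sub>M g (l' z)"]) simp
qed

text \<open>\<open>FE n Y\<close>: up to isomorphism, \<open>Y = F V\<close> for a module \<open>V\<close> generated by \<open>T\<close> with \<open>Ext\<^sup>n\<^sup>+\<^sup>1(T, V) = 0\<close>.\<close>

definition FE :: "nat \<Rightarrow> ('c \<Rightarrow> 'c, 'm) module \<Rightarrow> bool" where
  "FE n Y \<longleftrightarrow> (\<exists>(V :: 'b std_module) \<phi> \<psi>. fac A T V \<and> ext0 A Pr \<delta> n V \<and> isos B Y (F V) \<phi> \<psi>)"

text \<open>\<open>F\<close> is full and faithful on modules generated by \<open>T\<close>, so a
  retraction between F(V) and F(V') comes from one between \<open>V\<close> and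
  \<open>V'\<close>.\<close>

lemma ext0_F_retract:
  fixes V V' :: "'b std_module"
  assumes V: "fac A T V" and V': "fac A T V'" and a: "lin B (F V) (F V') a" and b: "lin B (F V') (F V) b"
    and ba: "\<And>f. f \<in> rhom A T V \<Longrightarrow> b (a f) = f" and e: "ext0 A Pr \<delta> n V'"
  shows "ext0 A Pr \<delta> n V"
proof -
  obtain u where u: "lin A V V' u" "\<forall>f\<in>rhom A T V. a f = Fm u f" using F_full[OF V V' a] by metis
  obtain v where v: "lin A V' V v" "\<forall>f\<in>rhom A T V'. b f = Fm v f" using F_full[OF V' V b] by metis
  have "v (u x) = x" if x: "x \<in> carrier V" for x
  proof (rule fac_eq[OF V lin_comp[OF u(1) v(1)] lin_id[OF lin.dom_mod[OF u(1)]] _ x])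
    fix h y assume h: "lin A T V h" and y: "y \<in> carrier T"
    have rh: "restrict h (carrier T) \<in> rhom A T V" by (rule lin.in_rhom[OF h])
    have "Fm v (Fm u (restrict h (carrier T))) = restrict h (carrier T)"
      using u(2) v(2) ba[OF rh] rh F_closed[OF u(1) rh] by simp
    from fun_cong[OF this, of y] show "v (u (h y)) = h y" using y by (simp add: compose_def)
  qed
  then show ?thesis by (rule ext0_retract[OF e u(1) v(1)])
qed

text \<open>Two modules that represent the same \<open>Y\<close> are retracts of each other, so the
  choice made in \<open>FE\<close> is immaterial.\<close>

lemma FE_ext0:
  fixes V :: "'b std_module"
  assumes Y: "FE n Y" and V: "fac A T V" and i: "isos B Y (F V) \<phi> \<psi>"
  shows "ext0 A Pr \<delta> n V"
proof -
  obtain V' :: "'b std_module" and \<phi>' \<psi>' where V': "fac A T V'" "ext0 A Pr \<delta> n V'" "isos B Y (F V') \<phi>' \<psi>'"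
    using Y by (auto simp: FE_def)
  note i = isosD[OF i] and i' = isosD[OF V'(3)]
  show ?thesis
    using i(4) i'(3) lin.closed[OF i(2)]
    by (intro ext0_F_retract[OF V V'(1) lin_comp[OF i(2) i'(1)] lin_comp[OF i'(2) i(1)] _ V'(2)]) simp
qed

lemma FE_F:
  fixes V :: "'b std_module"
  assumes "fac A T V" "ext0 A Pr \<delta> n V"
  shows "FE n (F V)"
  unfolding FE_def using assms isos_refl[OF F_mod[OF fg_modD[OF fac_fg[OF assms(1)]]]] by blast

text \<open>In degree 0 the Ext condition of \<open>FE\<close> is automatic by
  \<open>ext0_fac\<close>. Thus \<open>FE 0\<close> only expresses that \<open>Y\<close> lies in the
  image of \<open>F\<close>, and this passes to submodules by \<open>sub_F_is_F\<close>.\<close>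

lemma FE_sub_F:
  assumes M: "fg_mod A M" and f: "lin B Y (F M) f" "inj_on f (carrier Y)"
  shows "FE 0 Y"
proof -
  obtain V :: "'b std_module" and u where V: "fac A T V" "lin A V M u" "inj_on (Fm u) (rhom A T V)"
    "Fm u ` rhom A T V = f ` carrier Y"
    using sub_F_is_F[OF M lin.submodule_range[OF f(1)]] by metis
  have "\<exists>a b. isos B Y (F V) a b"
    using V(3,4) by (intro isos_same_image[OF f(1) lin_hom_module[OF T_mod V(2)] f(2)]) simp_all
  then show ?thesis unfolding FE_def using V(1) ext0_fac[OF V(1)] by blast
qed

text \<open>The identity of \<open>Y\<close> factors through the sum of \<open>Y1\<close> and
  \<open>Y2\<close>; this form covers retracts, biproducts and stable retracts at once.
  \<open>Y\<close> embeds in F(V), with \<open>V\<close> the sum of \<open>V1\<close> and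
  \<open>V2\<close>, hence is some F(W), and \<open>W\<close> is a retract of
  \<open>V\<close>.\<close>

lemma FE_retract_sum:
  assumes Y1: "FE n Y1" and Y2: "FE n Y2"
    and a1: "lin B Y Y1 a1" and b1: "lin B Y1 Y b1" and a2: "lin B Y Y2 a2" and b2: "lin B Y2 Y b2"
    and id: "\<And>y. y \<in> carrier Y \<Longrightarrow> b1 (a1 y) \<oplus>\<^sub>Y b2 (a2 y) = y"
  shows "FE n Y"
proof -
  obtain V1 :: "'b std_module" and \<phi>1 \<psi>1 where V1: "fac A T V1" "ext0 A Pr \<delta> n V1" "isos B Y1 (F V1) \<phi>1 \<psi>1"
    using Y1 by (auto simp: FE_def)
  obtain V2 :: "'b std_module" and \<phi>2 \<psi>2 where V2: "fac A T V2" "ext0 A Pr \<delta> n V2" "isos B Y2 (F V2) \<phi>2 \<psi>2"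
    using Y2 by (auto simp: FE_def)
  note i1 = isosD[OF V1(3)] and i2 = isosD[OF V2(3)]
  obtain V :: "'b std_module" and i j p q where V: "fg_mod A V" "biprod A V1 V2 V i j p q"
    using AF.ex_biprod[OF fac_fg[OF V1(1)] fac_fg[OF V2(1)]] by metis
  note b = biprodD[OF V(2)]
  interpret V: right_module A V by (rule fg_modD[OF V(1)])
  have fV: "fac A T V" by (rule AF.fac_biprod[OF V1(1) V2(1) V(2)])
  have eV: "ext0 A Pr \<delta> n V" by (rule ext0_biprod[OF V(2) V1(2) V2(2)])
  define \<alpha> where "\<alpha> y = Fm i (\<phi>1 (a1 y)) \<oplus>\<^bsub>F V\<^esub> Fm j (\<phi>2 (a2 y))" for y
  define \<beta> where "\<beta> f = b1 (\<psi>1 (Fm p f)) \<oplus>\<^sub>Y b2 (\<psi>2 (Fm q f))" for f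
  have \<alpha>: "lin B Y (F V) \<alpha>" unfolding \<alpha>_def
    by (rule lin_add_map[OF lin_comp[OF lin_comp[OF a1 i1(1)] lin_hom_module[OF T_mod b(1)]]
      lin_comp[OF lin_comp[OF a2 i2(1)] lin_hom_module[OF T_mod b(2)]]])
  have \<beta>: "lin B (F V) Y \<beta>" unfolding \<beta>_def
    by (rule lin_add_map[OF lin_comp[OF lin_hom_module[OF T_mod b(3)] lin_comp[OF i1(2) b1]]
      lin_comp[OF lin_hom_module[OF T_mod b(4)] lin_comp[OF i2(2) b2]]])
  have \<beta>\<alpha>: "\<beta> (\<alpha> y) = y" if y: "y \<in> carrier Y" for y
  proof -
    have f: "\<phi>1 (a1 y) \<in> rhom A T V1" "\<phi>2 (a2 y) \<in> rhom A T V2"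
      using lin.closed[OF i1(1) lin.closed[OF a1 y]] lin.closed[OF i2(1) lin.closed[OF a2 y]] by simp_all
    note cl = rhom_closed[OF f(1)] rhom_closed[OF f(2)]
    have \<alpha>y: "\<alpha> y \<in> rhom A T V" using lin.closed[OF \<alpha> y] by simp
    have v: "p (i v1 \<oplus>\<^sub>V j v2) = v1" "q (i v1 \<oplus>\<^sub>V j v2) = v2" if "v1 \<in> carrier V1" "v2 \<in> carrier V2" for v1 v2
    proof -
      interpret p: lin A V V1 p by (rule b(3))
      interpret q: lin A V V2 q by (rule b(4))
      have c: "i v1 \<in> carrier V" "j v2 \<in> carrier V" using lin.closed[OF b(1)] lin.closed[OF b(2)] that by simp_all
      show "p (i v1 \<oplus>\<^sub>V j v2) = v1" using p.add[OF c] b(5,8) that by simp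
      show "q (i v1 \<oplus>\<^sub>V j v2) = v2" using q.add[OF c] b(6,7) that by simp
    qed
    have "Fm p (\<alpha> y) = \<phi>1 (a1 y)"
      by (rule rhom_ext[OF F_closed[OF b(3) \<alpha>y] f(1)]) (simp add: \<alpha>_def compose_def v cl)
    moreover have "Fm q (\<alpha> y) = \<phi>2 (a2 y)"
      by (rule rhom_ext[OF F_closed[OF b(4) \<alpha>y] f(2)]) (simp add: \<alpha>_def compose_def v cl)
    ultimately show ?thesis
      unfolding \<beta>_def using i1(3)[OF lin.closed[OF a1 y]] i2(3)[OF lin.closed[OF a2 y]] id[OF y] by simp
  qed
  have "inj_on \<alpha> (carrier Y)" using \<beta>\<alpha> by (metis inj_onI)
  from FE_sub_F[OF V(1) \<alpha> this] obtain W :: "'b std_module" and \<phi> \<psi> where W: "fac A T W" "isos B Y (F W) \<phi> \<psi>"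
    by (auto simp: FE_def)
  note i = isosD[OF W(2)]
  have "ext0 A Pr \<delta> n W"
    using \<beta>\<alpha> i(4) lin.closed[OF i(2)]
    by (intro ext0_F_retract[OF W(1) fV lin_comp[OF i(2) \<alpha>] lin_comp[OF \<beta> i(1)] _ eV]) simp
  then show ?thesis unfolding FE_def using W by blast
qed

lemma FE_retract:
  assumes Y': "FE n Y'" and a: "lin B Y Y' a" and b: "lin B Y' Y b" and id: "\<And>y. y \<in> carrier Y \<Longrightarrow> b (a y) = y"
  shows "FE n Y"
proof -
  interpret Y: right_module B Y by (rule lin.dom_mod[OF a])
  have "b (a y) \<oplus>\<^sub>Y \<zero>\<^sub>Y = y" if "y \<in> carrier Y" for y using id[OF that] that Y.r_zero[of y] by simp
  then show ?thesis
    by (rule FE_retract_sum[OF Y' Y' a b lin_zero[OF lin.dom_mod[OF a] lin.cod_mod[OF a]] lin_zero[OF lin.cod_mod[OF a] lin.dom_mod[OF a]]])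
qed

lemma FE_biprod:
  assumes "biprod B Y1 Y2 Y i j p q" "FE n Y1" "FE n Y2"
  shows "FE n Y"
  using biprodD[OF assms(1)] by (intro FE_retract_sum[OF assms(2,3), of Y p i q j]) simp_all

text \<open>By \<open>F_cover\<close> a projective module is a retract of F(S) for a finite sum
  \<open>S\<close> of copies of \<open>T\<close>.\<close>

lemma FE_projective:
  assumes P: "projective B P" and e: "ext0 A Pr \<delta> n T"
  shows "FE n P"
proof -
  note r = proj_resolutionD[OF res T_mod]
  have eS: "ext0 A Pr \<delta> n S" if "tpow A T S" for S
    using that
  proof induction
    case (zero S)
    then show ?case using ext0_zero[OF _ fg_modD[OF zero(1)] fg_modD[OF projective_fg[OF r(1)]]] by simp
  next
    case (step S S' i j p q)
    show ?case by (rule ext0_biprod[OF step(3,4) e])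
  qed
  obtain S \<chi> where S: "tpow A T S" "lin B (F S) P \<chi>" "\<chi> ` rhom A T S = carrier P" using F_cover[OF projective_fg[OF P]] by metis
  have s: "\<chi> ` carrier (F S) = carrier P" using S(3) by simp
  obtain \<sigma> where \<sigma>: "lin B P (F S) \<sigma>" "\<forall>x\<in>carrier P. \<chi> (\<sigma> x) = x"
    using projective_lift[OF P fg_F[OF tpow_fg[OF S(1)]] S(2) s lin_id[OF lin.cod_mod[OF S(2)]]] by metis
  show ?thesis using \<sigma>(2) by (intro FE_retract[OF FE_F[OF AF.fac_tpow[OF T S(1)] eS[OF S(1)]] \<sigma>(1) S(2)]) simp
qed

lemma FE_quotient:
  assumes se: "short_exact B Y' Y Y'' u w" and z: "FE 0 Y''" and Y: "FE n Y" and Y': "FE (Suc n) Y'"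
  shows "FE n Y''"
proof -
  obtain V'' :: "'b std_module" and \<phi>'' \<psi>'' where V'': "fac A T V''" "isos B Y'' (F V'') \<phi>'' \<psi>''" using z by (auto simp: FE_def)
  obtain V :: "'b std_module" and \<phi> \<psi> where V: "fac A T V" "ext0 A Pr \<delta> n V" "isos B Y (F V) \<phi> \<psi>" using Y by (auto simp: FE_def)
  obtain V' :: "'b std_module" and \<phi>' \<psi>' where V': "fac A T V'" "ext0 A Pr \<delta> (Suc n) V'" "isos B Y' (F V') \<phi>' \<psi>'" using Y' by (auto simp: FE_def)
  obtain a b where "short_exact A V' V V'' a b"
    using F_exact[OF V'(1) V(1) V''(1) short_exact_isos[OF se V'(3) V(3) V''(2)]] by metis
  from ext0_quotient[OF res T_mod this fac_fg[OF V(1)] V(2) V'(2)]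
  show ?thesis unfolding FE_def using V'' by blast
qed

lemma FE_sub:
  assumes se: "short_exact B Y' Y Y'' u w" and z: "FE 0 Y'" and Y'': "FE n Y''" and Y: "FE (Suc n) Y"
  shows "FE (Suc n) Y'"
proof -
  obtain V'' :: "'b std_module" and \<phi>'' \<psi>'' where V'': "fac A T V''" "ext0 A Pr \<delta> n V''" "isos B Y'' (F V'') \<phi>'' \<psi>''" using Y'' by (auto simp: FE_def)
  obtain V :: "'b std_module" and \<phi> \<psi> where V: "fac A T V" "ext0 A Pr \<delta> (Suc n) V" "isos B Y (F V) \<phi> \<psi>" using Y by (auto simp: FE_def)
  obtain V' :: "'b std_module" and \<phi>' \<psi>' where V': "fac A T V'" "isos B Y' (F V') \<phi>' \<psi>'" using z by (auto simp: FE_def)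
  obtain a b where "short_exact A V' V V'' a b"
    using F_exact[OF V'(1) V(1) V''(1) short_exact_isos[OF se V'(2) V(3) V''(3)]] by metis
  from ext0_sub[OF res T_mod this fac_fg[OF V(1)] V''(2) V(2)]
  show ?thesis unfolding FE_def using V' by blast
qed

end

section \<open>Delooping levels\<close>

lemma Inf_enat_leD:
  assumes "Inf {enat n |n. Q n} \<le> enat k"
  shows "\<exists>n\<le>k. Q n"
proof (rule ccontr)
  assume "\<not> ?thesis"
  then have "enat (Suc k) \<le> Inf {enat n |n. Q n}" by (intro Inf_greatest) (auto simp: not_le Suc_le_eq)
  then have "enat (Suc k) \<le> enat k" using assms by (rule order_trans)
  then show False by simp
qed

context finlen_ring
begin

lemma syzygy_exact:
  fixes M :: "('a, 'm) module"
  assumes M: "fg_mod R M"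
  shows "\<exists>P p. projective R P \<and> lin R P M p \<and> p ` carrier P = carrier M \<and> syzygy R M = P \<down> ker P M p"
  using proj_cover_obtain[OF finlen_ring_axioms M] by metis

lemma fg_syzygy:
  assumes M: "fg_mod R M"
  shows "fg_mod R (syzygy R M)"
proof -
  obtain P p where P: "projective R P" "lin R P M p" "syzygy R M = P \<down> ker P M p"
    using syzygy_exact[OF M] by metis
  show ?thesis unfolding P(3) by (rule fg_sub[OF projective_fg[OF P(1)] lin.submodule_ker[OF P(2)]])
qed

lemma fg_syzygy_pow:
  fixes M :: "'a std_module"
  shows "fg_mod R M \<Longrightarrow> fg_mod R ((syzygy R ^^ n) M)"
  by (induction n) (simp_all add: fg_syzygy)

end

section \<open>Vanishing of extensions along syzygies\<close>

context resolved_rigid_module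
begin

lemma FE_submodule:
  assumes Y: "FE n Y" and f: "lin B Z Y f" "inj_on f (carrier Z)"
  shows "FE 0 Z"
proof -
  obtain V :: "'b std_module" and \<phi> \<psi> where V: "fac A T V" "isos B Y (F V) \<phi> \<psi>" using Y by (auto simp: FE_def)
  note i = isosD[OF V(2)]
  have "inj_on (\<lambda>x. \<phi> (f x)) (carrier Z)"
    using i(3) lin.closed[OF f(1)] inj_onD[OF f(2)] by (intro inj_onI) metis
  then show ?thesis by (rule FE_sub_F[OF fac_fg[OF V(1)] lin_comp[OF f(1) i(1)]])
qed

lemma FE_sub_projective:
  assumes P: "projective B P" and N: "submodule N B P"
  shows "FE 0 (P \<down> N)"
  using lin_incl[OF fg_modD[OF projective_fg[OF P]] N]
  by (rule FE_submodule[OF FE_projective[OF P ext0_fac[OF fac_self[OF T]]]]) simp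

lemma FE_syzygy_0:
  assumes M: "fg_mod B M"
  shows "FE 0 (syzygy B M)"
proof -
  interpret BF: finlen_ring B by (rule finlen_rings(2))
  obtain P p where P: "projective B P" "lin B P M p" "syzygy B M = P \<down> ker P M p"
    using BF.syzygy_exact[OF M] by metis
  show ?thesis unfolding P(3) by (rule FE_sub_projective[OF P(1) lin.submodule_ker[OF P(2)]])
qed

lemma syzygy_short_exact:
  assumes M: "fg_mod B M"
  shows "\<exists>P u w. projective B P \<and> short_exact B (syzygy B M) P M u w"
proof -
  interpret BF: finlen_ring B by (rule finlen_rings(2))
  obtain P p where P: "projective B P" "lin B P M p" "p ` carrier P = carrier M" "syzygy B M = P \<down> ker P M p"
    using BF.syzygy_exact[OF M] by metis
  show ?thesis using short_exact_ker[OF P(2,3)] P(1) unfolding P(4) by blast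
qed

lemma FE_syzygy_Suc:
  assumes M: "fg_mod B M" and e: "ext0 A Pr \<delta> (Suc n) T" and Mn: "FE n M"
  shows "FE (Suc n) (syzygy B M)"
proof -
  obtain P u w where P: "projective B P" "short_exact B (syzygy B M) P M u w" using syzygy_short_exact[OF M] by metis
  show ?thesis by (rule FE_sub[OF P(2) FE_syzygy_0[OF M] Mn FE_projective[OF P(1) e]])
qed

lemma FE_of_syzygy:
  assumes M: "fg_mod B M" and e: "ext0 A Pr \<delta> n T" and M0: "FE 0 M" and s: "FE (Suc n) (syzygy B M)"
  shows "FE n M"
proof -
  obtain P u w where P: "projective B P" "short_exact B (syzygy B M) P M u w" using syzygy_short_exact[OF M] by metis
  show ?thesis by (rule FE_quotient[OF P(2) M0 FE_projective[OF P(1) e] s])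
qed

text \<open>A stable retraction means v u - 1 = t s for maps \<open>s\<close> and \<open>t\<close>
  through a projective \<open>P\<close>; so 1 = v u - t s factors through the sum of
  \<open>N\<close> and \<open>P\<close>.\<close>

lemma FE_stable_retract:
  assumes M: "right_module B M" and N: "right_module B N" and sr: "stable_retract B M N"
    and eN: "FE n N" and e: "ext0 A Pr \<delta> n T"
  shows "FE n M"
proof -
  interpret M: right_module B M by (rule M)
  obtain u v P s t where u: "u \<in> rhom B M N" and v: "v \<in> rhom B N M" and P: "projective B P"
    and s: "s \<in> rhom B M P" and t: "t \<in> rhom B P M"
    and eq: "\<forall>x\<in>carrier M. compose (carrier M) v u x \<ominus>\<^sub>M (\<lambda>x\<in>carrier M. x) x = t (s x)"
    using sr unfolding stable_retract_def stably_equal_def by metis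
  note mP = fg_modD[OF projective_fg[OF P]]
  note lu = rhom_lin[OF M N u] and lv = rhom_lin[OF N M v] and ls = rhom_lin[OF M mP s] and lt = rhom_lin[OF mP M t]
  show ?thesis
  proof (rule FE_retract_sum[OF eN FE_projective[OF P e] lu lv ls lin_minus_map[OF lt]])
    fix y assume y: "y \<in> carrier M"
    have c: "v (u y) \<in> carrier M" using lin.closed[OF lin_comp[OF lu lv] y] .
    have "t (s y) = v (u y) \<ominus>\<^sub>M y" using eq y by (simp add: compose_def)
    then have "v (u y) \<oplus>\<^sub>M \<ominus>\<^sub>M t (s y) = v (u y) \<ominus>\<^sub>M (v (u y) \<ominus>\<^sub>M y)" by (simp add: a_minus_def)
    also have "\<dots> = y" using c y by (simp add: a_minus_def M.minus_add M.r_neg M.r_neg1 M.r_neg2 flip: M.a_assoc)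
    finally show "v (u y) \<oplus>\<^sub>M \<ominus>\<^sub>M t (s y) = y" .
  qed
qed

text \<open>Dimension shift: a first syzygy has \<open>FE 0\<close>, and each further syzygy raises
  the degree by one as long as the corresponding Ext(T, T) vanishes.\<close>

lemma FE_syzygy_pow:
  fixes Y :: "('c \<Rightarrow> 'c) std_module"
  assumes Y: "fg_mod B Y" and e: "\<And>n. n \<le> k \<Longrightarrow> ext0 A Pr \<delta> n T"
  shows "n < r \<Longrightarrow> n \<le> k \<Longrightarrow> FE n ((syzygy B ^^ r) Y)"
proof (induction r arbitrary: n)
  case (Suc r)
  interpret BF: finlen_ring B by (rule finlen_rings(2))
  note fg = BF.fg_syzygy_pow[OF Y, of r]
  show ?case
  proof (cases n)
    case 0
    then show ?thesis using FE_syzygy_0[OF fg] by simp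
  next
    case (Suc n')
    then show ?thesis using FE_syzygy_Suc[OF fg, of n'] e[of n] Suc.IH[of n'] Suc.prems by simp
  qed
qed simp

text \<open>For some r \<le> m - i the r-th syzygy of \<open>C\<close> is a stable retract of one of
  order r + i + 2, which gives \<open>FE n\<close> for n \<le> r + i + 1. Each step back towards
  \<open>C\<close> lowers this bound by one; it stops at the first syzygy, since \<open>C\<close>
  itself need not come from \<open>F\<close>.\<close>

lemma dell_FE:
  assumes C: "fg_mod B C" and i: "i \<le> m" and l: "dell B (i + 2) C \<le> enat (m - i)"
    and e: "\<And>n. n \<le> m + 2 \<Longrightarrow> ext0 A Pr \<delta> n T" and n: "n \<le> i + 2"
  shows "FE n (syzygy B C)"
proof -
  interpret BF: finlen_ring B by (rule finlen_rings(2))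
  obtain r and Y :: "('c \<Rightarrow> 'c) std_module" where r: "r \<le> m - i" and Y: "fg_mod B Y"
    and sr: "stable_retract B ((syzygy B ^^ r) C) ((syzygy B ^^ (r + (i + 2))) Y)"
    using Inf_enat_leD[OF l[unfolded dell_def]] by metis
  have er: "FE n ((syzygy B ^^ r) C)" if "n \<le> r + i + 1" for n
  proof (rule FE_stable_retract[OF fg_modD[OF BF.fg_syzygy_pow[OF C]] fg_modD[OF BF.fg_syzygy_pow[OF Y]] sr])
    show "FE n ((syzygy B ^^ (r + (i + 2))) Y)"
      using that r i e by (intro FE_syzygy_pow[OF Y, of "m + 2"]) simp_all
    show "ext0 A Pr \<delta> n T" using that r i by (intro e) simp
  qed
  show ?thesis
  proof (cases r)
    case 0
    show ?thesis
    proof (cases n)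
      case 0
      then show ?thesis using FE_syzygy_0[OF C] by simp
    next
      \<comment> \<open>With r = 0 the retract is \<open>C\<close> itself, and its first syzygy
        gains a degree; for n = i + 2 this uses Ext^(i+3)(T, T) = 0.\<close>
      case (Suc n')
      then show ?thesis using FE_syzygy_Suc[OF C, of n'] e[of n] er[of n'] \<open>r = 0\<close> n i by simp
    qed
  next
    case (Suc r')
    then have "1 \<le> r" by simp
    \<comment> \<open>The induction claim for q = 1, left unsimplified so that it matches the
      pattern of \<open>inc_induct\<close>; the bound is i + 2.\<close>
    then have "\<forall>n\<le>1 + i + 1. FE n ((syzygy B ^^ 1) C)"
    proof (induction rule: inc_induct[where P = "\<lambda>q. \<forall>n\<le>q + i + 1. FE n ((syzygy B ^^ q) C)"])
      case base
      then show ?case using er by simp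
    next
      case (step q)
      show ?case
      proof (intro allI impI)
        fix n assume n: "n \<le> q + i + 1"
        obtain q' where q': "q = Suc q'" using step(1) by (cases q) simp_all
        have z: "FE 0 ((syzygy B ^^ q) C)" unfolding q' using FE_syzygy_0[OF BF.fg_syzygy_pow[OF C]] by simp
        have "ext0 A Pr \<delta> n T" using n step(2) r i by (intro e) simp
        moreover have "FE (Suc n) (syzygy B ((syzygy B ^^ q) C))" using step(3) n by simp
        ultimately show "FE n ((syzygy B ^^ q) C)" using FE_of_syzygy[OF BF.fg_syzygy_pow[OF C] _ z] by simp
      qed
    qed
    then show ?thesis using n by simp
  qed
qed

text \<open>\<open>SE n Y\<close>: some syzygy of \<open>Y\<close>, not necessarily the minimal one, satisfies \<open>FE n\<close>.\<close>

definition SE :: "nat \<Rightarrow> ('c \<Rightarrow> 'c, 'm) module \<Rightarrow> bool" where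
  "SE n Y \<longleftrightarrow> (\<exists>P p. projective B P \<and> lin B P Y p \<and> p ` carrier P = carrier Y \<and> FE n (P \<down> ker P Y p))"

text \<open>The syzygy \<open>?M\<close> of \<open>Y''\<close> formed with \<open>P\<close> contains
  the syzygy \<open>?N\<close> of \<open>Y\<close>, with quotient \<open>Y'\<close>. Lifting the
  projective \<open>Q\<close> over \<open>Y'\<close> to \<open>?M\<close> gives an exact sequence 0
  -> \<open>?N'\<close> -> \<open>?N\<close> + Q -> \<open>?M\<close> -> 0, where \<open>?N'\<close>
  is the syzygy of \<open>Y'\<close>, and \<open>FE_quotient\<close> applies to it.\<close>

lemma SE_quotient:
  assumes se: "short_exact B Y' Y Y'' u w" and Y': "SE (Suc n) Y'" and Y: "SE n Y" and e: "ext0 A Pr \<delta> n T"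
  shows "SE n Y''"
proof -
  interpret BF: finlen_ring B by (rule finlen_rings(2))
  note se' = short_exactD[OF se]
  obtain P p where P: "projective B P" "lin B P Y p" "p ` carrier P = carrier Y" "FE n (P \<down> ker P Y p)"
    using Y by (auto simp: SE_def)
  obtain Q q where Q: "projective B Q" "lin B Q Y' q" "q ` carrier Q = carrier Y'" "FE (Suc n) (Q \<down> ker Q Y' q)"
    using Y' by (auto simp: SE_def)
  interpret p: lin B P Y p by (rule P(2))
  interpret q: lin B Q Y' q by (rule Q(2))
  have wp: "lin B P Y'' (\<lambda>x. w (p x))" by (rule lin_comp[OF P(2) se'(2)])
  have wps: "(\<lambda>x. w (p x)) ` carrier P = carrier Y''" using P(3) se'(4) by (simp flip: image_image)
  let ?M = "P \<down> ker P Y'' (\<lambda>x. w (p x))" and ?N = "P \<down> ker P Y p"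
  let ?N' = "Q \<down> ker Q Y' q"
  note sM = lin.submodule_ker[OF wp]
  have fM: "fg_mod B ?M" by (rule BF.fg_sub[OF projective_fg[OF P(1)] sM])
  have pM: "lin B ?M Y p" by (rule lin.restrict_domain[OF P(2) sM])
  have "p x \<in> u ` carrier Y'" if "x \<in> carrier ?M" for x
    unfolding se'(5)[symmetric] using that by (simp add: ker_iff)
  from lin_factor_inj[OF se'(1,3) pM this] obtain \<pi> where \<pi>: "lin B ?M Y' \<pi>" "\<forall>x\<in>carrier ?M. u (\<pi> x) = p x" by metis
  interpret M: right_module B ?M by (rule fg_modD[OF fM])
  interpret \<pi>: lin B ?M Y' \<pi> by (rule \<pi>(1))
  have \<pi>s: "\<pi> ` carrier ?M = carrier Y'"
  proof
    show "carrier Y' \<subseteq> \<pi> ` carrier ?M"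
    proof
      fix y assume y: "y \<in> carrier Y'"
      have "u y \<in> p ` carrier P" unfolding P(3) by (rule lin.closed[OF se'(1) y])
      then obtain x where x: "x \<in> carrier P" "u y = p x" by (elim imageE)
      have xM: "x \<in> carrier ?M" using x se'(6)[OF y] by (simp add: ker_iff)
      then have "u (\<pi> x) = u y" using \<pi>(2) x(2) by simp
      then have "\<pi> x = y" using inj_onD[OF se'(3)] \<pi>.closed[OF xM] y by metis
      then show "y \<in> \<pi> ` carrier ?M" using xM by (intro image_eqI[of y \<pi> x]) simp_all
    qed
  qed (use \<pi>.closed in auto)
  obtain l where l: "lin B Q ?M l" "\<forall>z\<in>carrier Q. \<pi> (l z) = q z"
    using projective_lift[OF Q(1) fM \<pi>(1) \<pi>s Q(2)] by metis
  have NM: "x \<in> carrier ?M" if "x \<in> carrier ?N" for x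
    using that lin.zero[OF se'(2)] by (simp add: ker_iff)
  have \<pi>0: "\<pi> x = \<zero>\<^sub>Y' \<longleftrightarrow> p x = \<zero>\<^sub>Y" if x: "x \<in> carrier ?M" for x
    using \<pi>(2) x \<pi>.closed[OF x] se'(3) lin.zero[OF se'(1)] unfolding lin.inj_iff[OF se'(1)] by metis
  have iN: "lin B ?N ?M (\<lambda>x. x)"
    by (rule lin.restrict_codomain[OF lin_incl[OF p.dom_mod p.submodule_ker] sM]) (use NM in auto)
  let ?S = "product_module ?N Q"
  note bp = biprod_product[OF lin.dom_mod[OF iN] q.dom_mod]
  let ?c = "\<lambda>s. fst s \<oplus>\<^sub>?M l (snd s)"
  have c: "lin B ?S ?M ?c" by (rule biprod_map(1)[OF bp iN l(1)])
  have cs: "?c ` carrier ?S = carrier ?M"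
  proof
    show "carrier ?M \<subseteq> ?c ` carrier ?S"
    proof
      fix y assume y: "y \<in> carrier ?M"
      have "\<pi> y \<in> q ` carrier Q" unfolding Q(3) by (rule \<pi>.closed[OF y])
      then obtain z where z: "z \<in> carrier Q" "\<pi> y = q z" by (elim imageE)
      note lz = lin.closed[OF l(1) z(1)]
      have d: "y \<ominus>\<^sub>?M l z \<in> carrier ?M" using y lz by (rule M.minus_closed)
      have "\<pi> (y \<ominus>\<^sub>?M l z) = \<zero>\<^sub>Y'" using \<pi>.diff[OF y lz] l(2) z \<pi>.closed[OF y] by simp
      then have "y \<ominus>\<^sub>?M l z \<in> carrier ?N" using d \<pi>0[OF d] by (simp add: ker_iff)
      then show "y \<in> ?c ` carrier ?S"
        using z(1) M.diff_add_cancel[OF y lz] by (intro image_eqI[of y ?c "(y \<ominus>\<^sub>?M l z, z)"]) simp_all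
    qed
  qed (use lin.closed[OF c] in auto)
  have N'Q: "z \<in> carrier Q" "q z = \<zero>\<^sub>Y'" if "z \<in> carrier ?N'" for z using that by (simp_all add: ker_iff)
  note iN' = lin_incl[OF q.dom_mod q.submodule_ker]
  have lN: "lin B ?N' ?N (\<lambda>z. \<ominus>\<^sub>P l z)"
  proof (rule lin.restrict_codomain[OF lin_minus_map[OF lin_comp[OF lin_comp[OF iN' l(1)] lin_incl[OF p.dom_mod sM]]] p.submodule_ker])
    have "\<ominus>\<^sub>P l z \<in> ker P Y p" if z: "z \<in> carrier ?N'" for z
    proof -
      note lz = lin.closed[OF l(1) N'Q(1)[OF z]]
      have "p (l z) = \<zero>\<^sub>Y" using \<pi>0[OF lz] l(2) N'Q[OF z] by simp
      then have "l z \<in> ker P Y p" using lz by (simp add: ker_iff)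
      then show ?thesis by (rule submodule_minus[OF p.submodule_ker])
    qed
    then show "(\<lambda>z. \<ominus>\<^sub>P l z) ` carrier ?N' \<subseteq> ker P Y p" by (intro image_subsetI)
  qed
  \<comment> \<open>For z in \<open>?N'\<close> the lift l z lies in \<open>?N\<close>, so the two
    components cancel under \<open>?c\<close>.\<close>
  let ?j = "\<lambda>z. (\<ominus>\<^sub>P l z, z)"
  have j: "lin B ?N' ?S ?j"
  proof (rule linI[OF lin.dom_mod[OF lN] lin.cod_mod[OF biprodD(1)[OF bp]]])
    show "?j z \<in> carrier ?S" if "z \<in> carrier ?N'" for z using lin.closed[OF lN that] N'Q[OF that] by simp
    show "?j (x \<oplus>\<^sub>?N' y) = ?j x \<oplus>\<^sub>?S ?j y" if "x \<in> carrier ?N'" "y \<in> carrier ?N'" for x y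
      using lin.add[OF lN that] by simp
    show "?j (a \<odot>\<^sub>?N' x) = a \<odot>\<^sub>?S ?j x" if "a \<in> carrier B" "x \<in> carrier ?N'" for a x
      using lin.smult[OF lN that] by simp
  qed
  have lP: "l z \<in> carrier P" if "z \<in> carrier Q" for z using lin.closed[OF l(1) that] by (simp add: ker_iff)
  have "short_exact B ?N' ?S ?M ?j ?c"
    unfolding short_exact_def
  proof (intro conjI)
    show "inj_on ?j (carrier ?N')" by (rule inj_onI) simp
    show "ker ?S ?M ?c = ?j ` carrier ?N'"
    proof
      show "?j ` carrier ?N' \<subseteq> ker ?S ?M ?c"
        using lin.closed[OF j] lP N'Q(1) by (intro image_subsetI) (simp add: ker_iff p.M.l_neg)
      show "ker ?S ?M ?c \<subseteq> ?j ` carrier ?N'"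
      proof
        fix s assume "s \<in> ker ?S ?M ?c"
        then obtain x z where s: "s = (x, z)" and x: "x \<in> carrier ?N" and z: "z \<in> carrier Q" and 0: "x \<oplus>\<^sub>P l z = \<zero>\<^sub>P"
          by (cases s) (simp add: ker_iff)
        have xP: "x \<in> carrier P" using x by (simp add: ker_iff)
        have x': "x = \<ominus>\<^sub>P l z" using p.M.minus_equality[OF 0 lP[OF z] xP] by simp
        have "\<pi> (x \<oplus>\<^sub>?M l z) = \<zero>\<^sub>Y'" using 0 \<pi>.zero by simp
        then have "\<pi> x \<oplus>\<^sub>Y' q z = \<zero>\<^sub>Y'" using \<pi>.add[OF NM[OF x] lin.closed[OF l(1) z]] l(2) z by simp
        moreover have "\<pi> x = \<zero>\<^sub>Y'" using \<pi>0[OF NM[OF x]] x by (simp add: ker_iff)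
        ultimately have "q z = \<zero>\<^sub>Y'" using q.closed[OF z] by simp
        then show "s \<in> ?j ` carrier ?N'" unfolding s x' using z by (intro image_eqI[of _ ?j z]) (simp_all add: ker_iff)
      qed
    qed
  qed (rule j c cs)+
  from FE_quotient[OF this FE_sub_projective[OF P(1) sM] FE_biprod[OF bp P(4) FE_projective[OF Q(1) e]] Q(4)]
  show ?thesis unfolding SE_def using P(1) wp wps by (intro exI[of _ P] exI[of _ "\<lambda>x. w (p x)"] conjI)
qed

text \<open>A zero module over \<open>A\<close> is obtained as \<open>T\<close> modulo
  itself.\<close>

lemma FE_zero_module:
  assumes Z: "right_module B Z" "carrier Z = {\<zero>\<^sub>Z}"
  shows "FE n Z"
proof -
  obtain Q :: "'b std_module" and q where Q: "fg_mod A Q" "lin A T Q q" "q ` carrier T = carrier Q" "ker T Q q = carrier T"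
    using std_quotient[OF T T.submodule_carrier] by metis
  have Q0: "y = \<zero>\<^sub>Q" if "y \<in> carrier Q" for y
  proof -
    have "y \<in> q ` carrier T" unfolding Q(3) by (rule that)
    then obtain x where "x \<in> carrier T" "y = q x" by (elim imageE)
    then show ?thesis using Q(4) by (auto simp: ker_def)
  qed
  interpret Q: right_module A Q by (rule fg_modD[OF Q(1)])
  have z: "carrier Q = {\<zero>\<^sub>Q}" by (rule eq_singletonI[OF Q0 Q.zero_closed])
  have fQ: "fac A T Q" by (rule fac_zero[OF Q(1) z])
  have "ext0 A Pr \<delta> n Q"
    by (rule ext0_zero[OF z fg_modD[OF Q(1)] fg_modD[OF projective_fg[OF proj_resolutionD(1)[OF res T_mod]]]])
  note FQ = FE_F[OF fQ this] and mF = F_mod[OF fg_modD[OF Q(1)]]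
  show ?thesis by (rule FE_retract[OF FQ lin_zero[OF Z(1) mF] lin_zero[OF mF Z(1)]]) (use Z(2) in simp)
qed

text \<open>Let \<open>L i\<close> be the image of \<open>\<theta> i\<close>. The property
  \<open>SE (i + 3)\<close> of \<open>L i\<close> is carried down from i = t, where
  \<open>L t\<close> is zero, by means of \<open>SE (i + 2)\<close> for \<open>C i\<close>. At the
  end \<open>D\<close> has \<open>SE 2\<close>; as \<open>D\<close> is known to be some F(X), this
  passes to \<open>FE 1\<close>, that is, Ext^2(T, X) = 0.\<close>

lemma ddell_FE:
  assumes d: "ddell B 2 D \<le> enat m" and D: "right_module B D" "FE 0 D"
    and e: "\<And>n. n \<le> m + 2 \<Longrightarrow> ext0 A Pr \<delta> n T"
  shows "FE 1 D"
proof -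
  interpret BF: finlen_ring B by (rule finlen_rings(2))
  obtain m' t C \<eta> \<theta> where m': "m' \<le> m" and t: "t \<le> m'" and r: "resolution B D C \<eta> \<theta>" "vanishes_above t C"
    "\<forall>i\<le>t. dell B (i + 2) (C i) \<le> enat (m' - i)"
    using Inf_enat_leD[OF d[unfolded ddell_def]] by metis
  have e': "ext0 A Pr \<delta> n T" if "n \<le> m' + 2" for n using that m' by (intro e) simp
  have C: "fg_mod B (C i)" for i using r(1) by (simp add: resolution_def)
  have \<eta>: "lin B (C 0) D \<eta>" using r(1) by (intro rhom_lin[OF fg_modD[OF C] D(1)]) (simp add: resolution_def)
  have \<theta>: "lin B (C (Suc i)) (C i) (\<theta> i)" for i
    using r(1) by (intro rhom_lin[OF fg_modD[OF C] fg_modD[OF C]]) (simp add: resolution_def)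
  have ex: "\<eta> ` carrier (C 0) = carrier D" "ker (C 0) D \<eta> = \<theta> 0 ` carrier (C (Suc 0))"
    "ker (C (Suc i)) (C i) (\<theta> i) = \<theta> (Suc i) ` carrier (C (Suc (Suc i)))" for i
    using r(1) by (simp_all add: resolution_def a_kernel_eq_ker)
  define L where "L i = (C i) \<down> \<theta> i ` carrier (C (Suc i))" for i
  have \<theta>L: "lin B (C (Suc i)) (L i) (\<theta> i)" "\<theta> i ` carrier (C (Suc i)) = carrier (L i)" for i
    unfolding L_def using lin.restrict_codomain[OF \<theta> lin.submodule_range[OF \<theta>]] by simp_all
  have seL: "short_exact B (L (Suc i)) (C (Suc i)) (L i) (\<lambda>x. x) (\<theta> i)" for i
  proof -
    have "ker (C (Suc i)) (L i) (\<theta> i) = \<theta> (Suc i) ` carrier (C (Suc (Suc i)))"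
      unfolding ex(3)[symmetric] by (simp add: ker_def L_def)
    then have "L (Suc i) = (C (Suc i)) \<down> ker (C (Suc i)) (L i) (\<theta> i)" by (simp add: L_def)
    then show ?thesis using short_exact_ker[OF \<theta>L] by simp
  qed
  have SC: "SE (i + 2) (C i)" if i: "i \<le> t" for i
  proof -
    obtain P p where P: "projective B P" "lin B P (C i) p" "p ` carrier P = carrier (C i)"
      "syzygy B (C i) = P \<down> ker P (C i) p" using BF.syzygy_exact[OF C] by metis
    have "FE (i + 2) (syzygy B (C i))"
      using i t r(3) by (intro dell_FE[OF C, of i m']) (simp_all add: e')
    then show ?thesis unfolding SE_def P(4) using P(1-3) by blast
  qed
  \<comment> \<open>\<open>C (Suc t)\<close> is zero by the padding convention; it is projective and
    maps onto \<open>L t\<close>, and its zero submodule has \<open>FE\<close> in every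
    degree.\<close>
  have SL: "SE (t + 3) (L t)"
  proof -
    have z: "carrier (C (Suc t)) = {\<zero>\<^bsub>C (Suc t)\<^esub>}" using r(2) by (simp add: vanishes_above_def)
    note mC = fg_modD[OF C]
    have P: "projective B (C (Suc t))" unfolding projective_iff using C lifts_zero[OF z mC] by simp
    let ?Z = "(C (Suc t)) \<down> ker (C (Suc t)) (L t) (\<theta> t)"
    have "carrier ?Z = {\<zero>\<^sub>?Z}" using z lin.zero[OF \<theta>L(1), of t] by (auto simp: ker_def)
    then have "FE (t + 3) ?Z" by (rule FE_zero_module[OF right_module.right_module_sub[OF mC lin.submodule_ker[OF \<theta>L(1)]]])
    then show ?thesis unfolding SE_def using P \<theta>L by blast
  qed
  have "SE (0 + 3) (L 0)"
    using le0[of t]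
  proof (induction rule: inc_induct)
    case base
    then show ?case by (rule SL)
  next
    case (step i)
    have 1: "SE (Suc (i + 3)) (L (Suc i))" using step(3) by simp
    \<comment> \<open>The index i + 1 supplies the degree (i + 1) + 2 = i + 3 needed for the middle
      term.\<close>
    have 2: "SE (i + 3) (C (Suc i))" using SC[of "Suc i"] step(2) by (simp add: eval_nat_numeral)
    show ?case using step(2) t by (intro SE_quotient[OF seL 1 2] e') simp
  qed
  then have L0: "SE (Suc 2) (L 0)" by (simp add: eval_nat_numeral)
  have C0: "SE 2 (C 0)" using SC[OF le0] by (simp only: add_0)
  have "L 0 = (C 0) \<down> ker (C 0) D \<eta>" by (simp add: L_def ex(2))
  then have se: "short_exact B (L 0) (C 0) D (\<lambda>x. x) \<eta>" using short_exact_ker[OF \<eta> ex(1)] by simp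
  have "SE 2 D" by (rule SE_quotient[OF se L0 C0 e']) simp
  then obtain P p where P: "projective B P" "lin B P D p" "p ` carrier P = carrier D" "FE 2 (P \<down> ker P D p)"
    by (auto simp: SE_def)
  have "FE (Suc 1) (P \<down> ker P D p)" using P(4) by (simp add: eval_nat_numeral)
  then show ?thesis using e' by (intro FE_quotient[OF short_exact_ker[OF P(2,3)] D(2) FE_projective[OF P(1)]]) simp
qed

end

section \<open>Extension groups and projective resolutions\<close>

lemma (in abelian_subgroup) trivial_quotient_iff: "trivial_group (G A_Mod H) \<longleftrightarrow> H = carrier G"
proof
  assume "trivial_group (G A_Mod H)"
  then have t: "a_rcosets\<^bsub>G\<^esub> H = {H}" by (simp add: trivial_group_def A_FactGroup_def')
  have "x \<in> H" if x: "x \<in> carrier G" for x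
  proof -
    have "H +>\<^bsub>G\<^esub> x \<in> a_rcosets\<^bsub>G\<^esub> H" by (rule a_rcosetsI[OF a_subset x])
    then show ?thesis using a_rcos_self[OF x] t by simp
  qed
  then show "H = carrier G" by (intro subset_antisym[OF a_subset] subsetI)
next
  assume H: "H = carrier G"
  have 1: "H +>\<^bsub>G\<^esub> x = H" if "x \<in> H" for x by (rule a_coset_join2[OF a_Hcarr[OF that] a_subgroup that])
  have "H \<noteq> {}" by (rule ex_in_conv[THEN iffD1, OF exI, OF subgroup.one_closed[OF a_subgroup]])
  then have "(\<Union>a\<in>H. {H +>\<^bsub>G\<^esub> a}) = {H}" using 1 by (simp add: UN_constant)
  then have "a_rcosets\<^bsub>G\<^esub> H = {H}" unfolding A_RCOSETS_def' H[symmetric] .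
  then show "trivial_group (G A_Mod H)"
    using a_factorgroup_is_group by (simp add: trivial_group_def A_FactGroup_def')
qed

text \<open>The resolution handed on is the one that \<open>SOME\<close> selects in the definition
  of \<open>Ext\<close>; it does not depend on the degree, so a single resolution serves all
  \<open>n\<close>.\<close>

lemma (in fd_algebra) trivial_Ext_iff:
  fixes T :: "('a, 't) module" and N :: "('a, 'n) module"
  assumes T: "right_module A T" and N: "right_module A N" and ex: "\<exists>P \<epsilon> \<delta>. proj_resolution A T P \<epsilon> \<delta>"
  shows "\<exists>P \<epsilon> \<delta>. proj_resolution A T P \<epsilon> \<delta> \<and> (\<forall>n. trivial_group (Ext A (Suc n) T N) \<longleftrightarrow> ext0 A P \<delta> n N)"
proof -
  obtain P \<epsilon> \<delta> where c: "(SOME (P, \<epsilon>, \<delta>). proj_resolution A T P \<epsilon> \<delta>) = (P, \<epsilon>, \<delta>)" by (metis prod_cases3)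
  have "\<exists>r. case r of (P, \<epsilon>, \<delta>) \<Rightarrow> proj_resolution A T P \<epsilon> \<delta>" using ex by simp
  from someI_ex[OF this] have res: "proj_resolution A T P \<epsilon> \<delta>" unfolding c by simp
  note r = proj_resolutionD[OF res T]
  note mP = fg_modD[OF projective_fg[OF r(1)]]
  have "trivial_group (Ext A (Suc n) T N) \<longleftrightarrow> ext0 A P \<delta> n N" for n
  proof -
    let ?H = "\<lambda>j. Hom (P j) N"
    let ?pull = "\<lambda>j g. \<lambda>x\<in>carrier (P (Suc j)). g (\<delta> j x)"
    have pull: "lin K (?H j) (?H (Suc j)) (?pull j)" for j by (rule lin_precomp[OF N r(3)])
    interpret p: lin K "?H n" "?H (Suc n)" "?pull n" by (rule pull)
    interpret q: lin K "?H (Suc n)" "?H (Suc (Suc n))" "?pull (Suc n)" by (rule pull)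
    let ?Z = "ker (?H (Suc n)) (?H (Suc (Suc n))) (?pull (Suc n))"
    let ?G = "(?H (Suc n)) \<down> ?Z" and ?B = "?pull n ` rhom A (P n) N"
    have BZ: "?B \<subseteq> ?Z"
    proof (rule image_subsetI)
      fix g assume g: "g \<in> rhom A (P n) N"
      have "?pull n g \<in> rhom A (P (Suc n)) N" using p.closed[of g] g by simp
      moreover have "?pull (Suc n) (?pull n g) = \<zero>\<^bsub>?H (Suc (Suc n))\<^esub>"
        using r(7) lin.closed[OF r(3)] lin.zero[OF rhom_lin[OF mP N g]] by (simp add: fun_eq_iff)
      ultimately show "?pull n g \<in> ?Z" by (simp add: ker_iff)
    qed
    have "submodule ?B K ?G" using p.submodule_range BZ by (simp add: p.N.submodule_sub_iff[OF q.submodule_ker])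
    then have "additive_subgroup ?B ?G" by (simp add: submodule_def additive_subgroup_def)
    then interpret B: abelian_subgroup ?B ?G
      by (rule abelian_subgroupI3) (rule right_module.M_abelian_group[OF p.N.right_module_sub[OF q.submodule_ker]])
    have "Ext A (Suc n) T N = ?G A_Mod ?B"
      by (simp add: Ext_def c A_FactGroup_def FactGroup_def RCOSETS_def r_coset_def set_mult_def[abs_def]
        Let_def a_kernel_def' ker_def compose_def hom_space_def)
    then have "trivial_group (Ext A (Suc n) T N) \<longleftrightarrow> ?B = ?Z" using B.trivial_quotient_iff by simp
    also have "\<dots> \<longleftrightarrow> ext0 A P \<delta> n N"
    proof
      assume e: "?B = ?Z"
      show "ext0 A P \<delta> n N"
      proof (rule ext0I)
        fix f assume f: "lin A (P (Suc n)) N f" "\<And>y. y \<in> carrier (P (Suc (Suc n))) \<Longrightarrow> f (\<delta> (Suc n) y) = \<zero>\<^sub>N"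
        have "restrict f (carrier (P (Suc n))) \<in> ?Z"
          using lin.in_rhom[OF f(1)] f(2) lin.closed[OF r(3)] by (simp add: ker_iff fun_eq_iff)
        then have "restrict f (carrier (P (Suc n))) \<in> ?B" unfolding e .
        then obtain g where g: "g \<in> rhom A (P n) N" "restrict f (carrier (P (Suc n))) = ?pull n g" by (elim imageE)
        have "g (\<delta> n x) = f x" if "x \<in> carrier (P (Suc n))" for x using fun_cong[OF g(2), of x] that by simp
        then show "extends_along A (P (Suc n)) (P n) N (\<delta> n) f"
          using rhom_lin[OF mP N g(1)] by blast
      qed
    next
      assume e: "ext0 A P \<delta> n N"
      have "f \<in> ?B" if "f \<in> ?Z" for f
      proof -
        have f: "f \<in> rhom A (P (Suc n)) N" and z: "?pull (Suc n) f = \<zero>\<^bsub>?H (Suc (Suc n))\<^esub>" using that by (simp_all add: ker_iff)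
        have "f (\<delta> (Suc n) y) = \<zero>\<^sub>N" if "y \<in> carrier (P (Suc (Suc n)))" for y using fun_cong[OF z, of y] that by simp
        from ext0D[OF e rhom_lin[OF mP N f] this]
        obtain g where g: "lin A (P n) N g" "\<forall>x\<in>carrier (P (Suc n)). g (\<delta> n x) = f x" by metis
        have "f = ?pull n (restrict g (carrier (P n)))"
          using g(2) lin.closed[OF r(3)] rhom_undefined[OF f] by (simp add: fun_eq_iff)
        then show ?thesis using lin.in_rhom[OF g(1)] by (rule image_eqI)
      qed
      then show "?B = ?Z" using BZ by blast
    qed
    finally show ?thesis .
  qed
  then show ?thesis using res by blast
qed

lemma (in finlen_ring) proj_resolution_exists:
  fixes T :: "('a, 't) module"
  assumes T: "fg_mod R T"
  shows "\<exists>P \<epsilon> \<delta>. proj_resolution R T P \<epsilon> \<delta>"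
proof -
  obtain P0 \<epsilon> where P0: "projective R P0" "\<epsilon> \<in> rhom R P0 T" "\<epsilon> ` carrier P0 = carrier T"
    "syzygy R T = P0 \<down> ker P0 T \<epsilon>" using proj_cover_obtain[OF finlen_ring_axioms T] by metis
  define L where "L n = (syzygy R ^^ n) (syzygy R T)" for n
  have L: "fg_mod R (L n)" for n unfolding L_def by (rule fg_syzygy_pow[OF fg_syzygy[OF T]])
  have "\<forall>n. \<exists>P p. projective R P \<and> p \<in> rhom R P (L n) \<and> p ` carrier P = carrier (L n) \<and> L (Suc n) = P \<down> ker P (L n) p"
  proof
    fix n
    have s: "L (Suc n) = syzygy R (L n)" by (simp add: L_def)
    show "\<exists>P p. projective R P \<and> p \<in> rhom R P (L n) \<and> p ` carrier P = carrier (L n) \<and> L (Suc n) = P \<down> ker P (L n) p"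
      unfolding s using proj_cover_obtain[OF finlen_ring_axioms L[of n]] by metis
  qed
  then obtain Q q where Q: "projective R (Q n)" "q n \<in> rhom R (Q n) (L n)" "q n ` carrier (Q n) = carrier (L n)"
    "L (Suc n) = (Q n) \<down> ker (Q n) (L n) (q n)" for n by metis
  define P where "P = case_nat P0 Q"
  have P: "P 0 = P0" "P (Suc n) = Q n" for n by (simp_all add: P_def)
  have PL: "L n = (P n) \<down> carrier (L n)" "carrier (L n) \<subseteq> carrier (P n)" for n
  proof -
    have 0: "L 0 = P0 \<down> ker P0 T \<epsilon>" by (simp add: L_def P0(4))
    have "L n = (P n) \<down> carrier (L n) \<and> carrier (L n) \<subseteq> carrier (P n)"
    proof (cases n)
      case n: 0
      show ?thesis unfolding n P(1) 0 by (simp add: ker_def)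
    next
      case (Suc m)
      show ?thesis unfolding Suc P(2) Q(4) by (simp add: ker_def)
    qed
    then show "L n = (P n) \<down> carrier (L n)" "carrier (L n) \<subseteq> carrier (P n)" by simp_all
  qed
  \<comment> \<open>Syzygies are literally restrictions of the carrier of \<open>P n\<close>, so a
    map to \<open>L n\<close> can be read as a map to \<open>P n\<close>.\<close>
  have ops: "\<zero>\<^bsub>L n\<^esub> = \<zero>\<^bsub>P n\<^esub>" "ring.add (L n) = ring.add (P n)" "smult (L n) = smult (P n)" for n
    by (subst PL(1), simp)+
  have q: "q n \<in> rhom R (P (Suc n)) (P n)" for n
    using Q(2)[of n] PL(2)[of n] unfolding rhom_def P(2) ops by auto
  have kq: "ker (P (Suc n)) (P n) (q n) = carrier (L (Suc n))" for n
    unfolding Q(4) by (simp add: P(2) ker_def ops)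
  have proj: "projective R (P n)" for n using P0(1) Q(1) by (cases n) (simp_all add: P)
  have "proj_resolution R T P \<epsilon> q"
    unfolding proj_resolution_def resolution_def a_kernel_eq_ker
    using proj projective_fg[OF proj] P0(2,3) q kq Q(3) by (simp add: P(1)) (simp add: P L_def P0(4))
  then show ?thesis by blast
qed

text \<open>An injective \<open>d\<close> makes P1 -> P0 a projective resolution, which is padded
  with a zero module.\<close>

lemma (in finlen_ring) proj_dim_le_1:
  fixes T :: "('a, 't) module"
  assumes T: "right_module R T" and P0: "projective R P0" and P1: "projective R P1"
    and p: "p \<in> rhom R P0 T" "p ` carrier P0 = carrier T" and d: "lin R P1 P0 d" "d ` carrier P1 = ker P0 T p"
    and inj: "inj_on d (carrier P1)"
  shows "proj_dim R T \<le> 1"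
proof -
  interpret T: right_module R T by (rule T)
  interpret d: lin R P1 P0 d by (rule d(1))
  obtain Z :: "'a std_module" and q where Z: "fg_mod R Z" "lin R P1 Z q" "q ` carrier P1 = carrier Z" "ker P1 Z q = carrier P1"
    using std_quotient[OF projective_fg[OF P1] d.M.submodule_carrier] by metis
  interpret Z: right_module R Z by (rule fg_modD[OF Z(1)])
  have Z0: "y = \<zero>\<^sub>Z" if "y \<in> carrier Z" for y
  proof -
    have "y \<in> q ` carrier P1" unfolding Z(3) by (rule that)
    then obtain x where "x \<in> carrier P1" "y = q x" by (elim imageE)
    then show ?thesis using Z(4) by (auto simp: ker_def)
  qed
  have z: "carrier Z = {\<zero>\<^sub>Z}" by (rule eq_singletonI[OF Z0 Z.zero_closed])
  have pZ: "projective R Z" unfolding projective_iff using Z(1) lifts_zero[OF z Z.right_module_axioms] by simp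
  define C where "C n = (if n = 0 then P0 else if n = 1 then P1 else Z)" for n :: nat
  define \<delta> where "\<delta> n = (if n = 0 then restrict d (carrier P1) else (\<lambda>x\<in>carrier Z. \<zero>\<^bsub>C n\<^esub>))" for n :: nat
  have C: "C 0 = P0" "C (Suc 0) = P1" "C (Suc (Suc n)) = Z" for n by (simp_all add: C_def)
  have proj: "projective R (C n)" for n using P0 P1 pZ by (simp add: C_def)
  have \<delta>: "\<delta> n \<in> rhom R (C (Suc n)) (C n)" for n
  proof (cases n)
    case 0
    then show ?thesis using d.in_rhom by (simp add: C \<delta>_def)
  next
    case (Suc m)
    then show ?thesis
      using lin.in_rhom[OF lin_zero[OF Z.right_module_axioms fg_modD[OF projective_fg[OF proj[of n]]]]]
      by (simp add: C \<delta>_def)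
  qed
  have "ker (C (Suc n)) (C n) (\<delta> n) = \<delta> (Suc n) ` carrier (C (Suc (Suc n)))" for n
  proof (cases n)
    case 0
    have "ker P1 P0 (restrict d (carrier P1)) = ker P1 P0 d" by (auto simp: ker_def)
    then show ?thesis using inj z unfolding d.inj_iff_ker by (simp add: 0 C \<delta>_def)
  next
    case (Suc m)
    then show ?thesis using z by (auto simp: C \<delta>_def ker_def)
  qed
  moreover have "ker P0 T p = \<delta> 0 ` carrier (C 1)" using d(2) by (simp add: C \<delta>_def)
  ultimately have "proj_resolution R T C p \<delta>"
    unfolding proj_resolution_def resolution_def a_kernel_eq_ker
    using proj projective_fg[OF proj] p \<delta> by (simp add: C(1))
  moreover have "vanishes_above 1 C" unfolding vanishes_above_def using z by (simp add: C_def)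
  ultimately have "proj_dim R T \<le> enat 1" unfolding proj_dim_def by (intro Inf_lower) blast
  then show ?thesis by (simp add: one_enat_def)
qed

section \<open>The dual of the faithful quotient\<close>

context fd_algebra
begin

text \<open>The injective cogenerator D(A), of which \<open>faithful_dual\<close> is a
  submodule.\<close>

definition coregular :: "('a, 'a \<Rightarrow> 'k) module" where
  "coregular = with_smult (hom_group K A (regular K)) (\<lambda>a \<phi>. \<lambda>x\<in>carrier A. \<phi> (a \<otimes>\<^sub>A x))"

lemma coregular_simps [simp]:
  "carrier coregular = rhom K A (regular K)" "\<zero>\<^sub>coregular = (\<lambda>x\<in>carrier A. \<zero>\<^sub>K)"
  "\<phi> \<oplus>\<^sub>coregular \<psi> = (\<lambda>x\<in>carrier A. \<phi> x \<oplus>\<^sub>K \<psi> x)"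
  "a \<odot>\<^sub>coregular \<phi> = (\<lambda>x\<in>carrier A. \<phi> (a \<otimes>\<^sub>A x))"
  by (simp_all add: coregular_def)

lemma right_module_K: "right_module K (regular K)"
  by (rule K.right_module_regular)

lemma functional_lin: "\<phi> \<in> rhom K A (regular K) \<Longrightarrow> lin K A (regular K) \<phi>"
  by (rule rhom_lin[OF right_module_A right_module_K])

lemma functional_closed: "\<lbrakk>\<phi> \<in> rhom K A (regular K); x \<in> carrier A\<rbrakk> \<Longrightarrow> \<phi> x \<in> carrier K"
  using rhom_closed[of \<phi> K A "regular K" x] by simp

lemma right_module_coregular: "right_module A coregular"
  unfolding coregular_def
proof (rule right_module_hom_action[OF right_module_A right_module_K A_ring])
  show "lin K A A (\<lambda>x. a \<otimes>\<^sub>A x)" if "a \<in> carrier A" for a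
    using that by (intro linI[OF right_module_A right_module_A]) (simp_all add: A.r_distr smult_mult_right)
qed (simp_all add: A.l_distr A.m_assoc)

text \<open>Values on a finite spanning set of \<open>A\<close> over \<open>K\<close> determine a
  functional, which embeds D(A) in a free \<open>K\<close>-module of finite rank.\<close>

lemma fg_coregular: "fg_mod A coregular"
proof -
  interpret KF: finlen_ring K by (rule finlen_K)
  obtain S where S: "finite S" "S \<subseteq> carrier A" "\<And>N. submodule N K A \<Longrightarrow> S \<subseteq> N \<Longrightarrow> N = carrier A"
    using finite_dim unfolding fin_gen_def by metis
  obtain n :: nat and x where x: "S = x ` {..<n}"
    using S(1) by (metis finite_imp_nat_seg_image_inj_on lessThan_def)
  have xA: "x i \<in> carrier A" if "i < n" for i using that S(2) unfolding x by auto
  let ?V = "res coregular"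
  let ?E = "\<lambda>\<phi> i. if i < n then \<phi> (x i) else \<zero>\<^sub>K"
  have E: "lin K ?V (free_module K n) ?E"
  proof (rule linI[OF right_module_rs[OF right_module_coregular] K.right_module_free])
    show "?E \<phi> \<in> carrier (free_module K n)" if "\<phi> \<in> carrier ?V" for \<phi>
      using that functional_closed xA by simp
    show "?E (\<phi> \<oplus>\<^sub>?V \<psi>) = ?E \<phi> \<oplus>\<^bsub>free_module K n\<^esub> ?E \<psi>" for \<phi> \<psi>
      using xA by (simp add: fun_eq_iff)
    show "?E (c \<odot>\<^sub>?V \<phi>) = c \<odot>\<^bsub>free_module K n\<^esub> ?E \<phi>" if "c \<in> carrier K" "\<phi> \<in> carrier ?V" for c \<phi>
      using that xA lin.smult[OF functional_lin, of \<phi> c] by (simp add: fun_eq_iff scalar_mult_left)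
  qed
  interpret E: lin K ?V "free_module K n" ?E by (rule E)
  have "inj_on ?E (carrier ?V)"
    unfolding E.inj_iff
  proof (intro ballI impI)
    fix \<phi> assume "\<phi> \<in> carrier ?V" and z: "?E \<phi> = \<zero>\<^bsub>free_module K n\<^esub>"
    then have \<phi>: "\<phi> \<in> rhom K A (regular K)" by simp
    have "\<phi> (x i) = \<zero>\<^sub>K" if "i < n" for i using fun_cong[OF z, of i] that by simp
    then have "S \<subseteq> ker A (regular K) \<phi>" unfolding x using xA by (auto simp: ker_iff)
    from S(3)[OF lin.submodule_ker[OF functional_lin[OF \<phi>]] this]
    have "\<phi> y = \<zero>\<^sub>K" if "y \<in> carrier A" for y using that by (auto simp: ker_def)
    then show "\<phi> = \<zero>\<^sub>?V" using rhom_undefined[OF \<phi>] by (simp add: fun_eq_iff)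
  qed
  then have "flen K ?V" by (rule E.len_inj(1)[OF _ K.flen_free[OF KF.flen_regular]])
  then show ?thesis unfolding AF.fg_iff_flen using right_module_coregular flen_of_rs by blast
qed

definition ann :: "('a, 't) module \<Rightarrow> 'a set" where
  "ann T = {a \<in> carrier A. \<forall>t\<in>carrier T. a \<odot>\<^sub>T t = \<zero>\<^sub>T}"

lemma ann_mult:
  assumes T: "right_module A T" and a: "a \<in> ann T" and c: "c \<in> carrier A"
  shows "a \<otimes>\<^sub>A c \<in> ann T" "c \<otimes>\<^sub>A a \<in> ann T"
proof -
  interpret T: right_module A T by (rule T)
  show "a \<otimes>\<^sub>A c \<in> ann T" "c \<otimes>\<^sub>A a \<in> ann T"
    using a c by (auto simp: ann_def T.smult_assoc)
qed

text \<open>The dual of \<open>A / ann T\<close>, as the functionals on \<open>A\<close> that vanish on \<open>ann T\<close>.\<close>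

definition faithful_dual :: "('a, 't) module \<Rightarrow> ('a, 'a \<Rightarrow> 'k) module" where
  "faithful_dual T = coregular \<down> {\<phi> \<in> rhom K A (regular K). \<forall>a\<in>ann T. \<phi> a = \<zero>\<^sub>K}"

lemma faithful_dual_simps [simp]:
  "\<phi> \<in> carrier (faithful_dual T) \<longleftrightarrow> \<phi> \<in> rhom K A (regular K) \<and> (\<forall>a\<in>ann T. \<phi> a = \<zero>\<^sub>K)"
  "\<zero>\<^bsub>faithful_dual T\<^esub> = (\<lambda>x\<in>carrier A. \<zero>\<^sub>K)"
  "\<phi> \<oplus>\<^bsub>faithful_dual T\<^esub> \<psi> = (\<lambda>x\<in>carrier A. \<phi> x \<oplus>\<^sub>K \<psi> x)"
  "a \<odot>\<^bsub>faithful_dual T\<^esub> \<phi> = (\<lambda>x\<in>carrier A. \<phi> (a \<otimes>\<^sub>A x))"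
  by (simp_all add: faithful_dual_def)

lemma fg_faithful_dual:
  assumes T: "right_module A T"
  shows "fg_mod A (faithful_dual T)"
proof -
  interpret C: right_module A coregular by (rule right_module_coregular)
  have aA: "a \<in> carrier A" if "a \<in> ann T" for a using that by (simp add: ann_def)
  let ?D = "{\<phi> \<in> rhom K A (regular K). \<forall>a\<in>ann T. \<phi> a = \<zero>\<^sub>K}"
  have "submodule ?D A coregular"
  proof (rule C.submoduleI)
    show "\<zero>\<^sub>coregular \<in> ?D"
      using C.M.zero_closed aA by simp
    show "\<phi> \<oplus>\<^sub>coregular \<psi> \<in> ?D"
      if "\<phi> \<in> ?D" "\<psi> \<in> ?D" for \<phi> \<psi>
      using C.M.a_closed[of \<phi> \<psi>] that aA by simp
    show "c \<odot>\<^sub>coregular \<phi> \<in> ?D"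
      if "c \<in> carrier A" "\<phi> \<in> ?D" for c \<phi>
      using C.smult_closed[of c \<phi>] that aA ann_mult(2)[OF T] by simp
  qed auto
  then show ?thesis unfolding faithful_dual_def by (rule AF.fg_sub[OF fg_coregular])
qed

lemma ann_faithful_dual:
  assumes T: "right_module A T" and a: "a \<in> ann T" and \<phi>: "\<phi> \<in> carrier (faithful_dual T)"
  shows "a \<odot>\<^bsub>faithful_dual T\<^esub> \<phi> = \<zero>\<^bsub>faithful_dual T\<^esub>"
  using \<phi> ann_mult(1)[OF T a] by (simp add: fun_eq_iff)

text \<open>Maps from \<open>M\<close> to D(A / I), with I the annihilator of \<open>T\<close>,
  correspond to functionals on \<open>M\<close> that vanish on M I; evaluation at 1, in
  \<open>faithful_dual_eval\<close>, is the opposite direction.\<close>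

lemma faithful_dual_map:
  assumes T: "right_module A T" and M: "right_module A M" and \<nu>: "lin K (res M) (regular K) \<nu>"
    and z: "\<And>a x. \<lbrakk>a \<in> ann T; x \<in> carrier M\<rbrakk> \<Longrightarrow> \<nu> (a \<odot>\<^sub>M x) = \<zero>\<^sub>K"
  shows "lin A M (faithful_dual T) (\<lambda>x. \<lambda>a\<in>carrier A. \<nu> (a \<odot>\<^sub>M x))"
proof (rule linI[OF M fg_modD[OF fg_faithful_dual[OF T]]])
  interpret M: right_module A M by (rule M)
  interpret \<nu>: lin K "res M" "regular K" \<nu> by (rule \<nu>)
  have \<nu>c: "\<nu> x \<in> carrier K" if "x \<in> carrier M" for x using \<nu>.closed[of x] that by simp
  show "(\<lambda>a\<in>carrier A. \<nu> (a \<odot>\<^sub>M x)) \<in> carrier (faithful_dual T)" if x: "x \<in> carrier M" for x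
  proof -
    have "(\<lambda>a\<in>carrier A. \<nu> (a \<odot>\<^sub>M x)) \<in> rhom K A (regular K)"
    proof (rule lin.in_rhom, rule linI[OF right_module_A right_module_K])
      show "\<nu> (a \<odot>\<^sub>M x) \<in> carrier (regular K)" if "a \<in> carrier A" for a using \<nu>c that x by simp
      show "\<nu> ((a \<oplus>\<^sub>A b) \<odot>\<^sub>M x) = \<nu> (a \<odot>\<^sub>M x) \<oplus>\<^bsub>regular K\<^esub> \<nu> (b \<odot>\<^sub>M x)"
        if "a \<in> carrier A" "b \<in> carrier A" for a b
        using that x \<nu>.add[of "a \<odot>\<^sub>M x" "b \<odot>\<^sub>M x"] by (simp add: M.smult_l_distr)
      show "\<nu> ((c \<odot>\<^sub>A a) \<odot>\<^sub>M x) = c \<odot>\<^bsub>regular K\<^esub> \<nu> (a \<odot>\<^sub>M x)" if "c \<in> carrier K" "a \<in> carrier A" for c a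
        using that x \<nu>.smult[of c "a \<odot>\<^sub>M x"] M.smult_assoc[of a "c \<odot>\<^sub>A \<one>\<^sub>A" x]
        by (simp add: scalar_mult_right)
    qed
    moreover have "a \<in> carrier A" if "a \<in> ann T" for a using that by (simp add: ann_def)
    ultimately show ?thesis using z x by simp
  qed
  show "(\<lambda>a\<in>carrier A. \<nu> (a \<odot>\<^sub>M (x \<oplus>\<^sub>M y))) =
      (\<lambda>a\<in>carrier A. \<nu> (a \<odot>\<^sub>M x)) \<oplus>\<^bsub>faithful_dual T\<^esub> (\<lambda>a\<in>carrier A. \<nu> (a \<odot>\<^sub>M y))"
    if "x \<in> carrier M" "y \<in> carrier M" for x y
    using that \<nu>.add by (simp add: fun_eq_iff M.smult_r_distr)
  show "(\<lambda>a\<in>carrier A. \<nu> (a \<odot>\<^sub>M (b \<odot>\<^sub>M x))) = b \<odot>\<^bsub>faithful_dual T\<^esub> (\<lambda>a\<in>carrier A. \<nu> (a \<odot>\<^sub>M x))"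
    if "b \<in> carrier A" "x \<in> carrier M" for b x
    using that by (simp add: fun_eq_iff M.smult_assoc)
qed

lemma faithful_dual_eval:
  assumes h: "lin A M (faithful_dual T) h"
  shows "lin K (res M) (regular K) (\<lambda>x. h x \<one>\<^sub>A)"
    "\<And>a x. \<lbrakk>a \<in> carrier A; x \<in> carrier M\<rbrakk> \<Longrightarrow> h x a = h (a \<odot>\<^sub>M x) \<one>\<^sub>A"
proof -
  interpret h: lin A M "faithful_dual T" h by (rule h)
  have hr: "h x \<in> rhom K A (regular K)" if "x \<in> carrier M" for x using h.closed[OF that] by simp
  show e: "h x a = h (a \<odot>\<^sub>M x) \<one>\<^sub>A" if "a \<in> carrier A" "x \<in> carrier M" for a x
    using h.smult[OF that] that by simp
  show "lin K (res M) (regular K) (\<lambda>x. h x \<one>\<^sub>A)"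
  proof (rule linI[OF right_module_rs[OF h.dom_mod] right_module_K])
    show "h x \<one>\<^sub>A \<in> carrier (regular K)" if "x \<in> carrier (res M)" for x
      using functional_closed[OF hr] that by simp
    show "h (x \<oplus>\<^bsub>res M\<^esub> y) \<one>\<^sub>A = h x \<one>\<^sub>A \<oplus>\<^bsub>regular K\<^esub> h y \<one>\<^sub>A"
      if "x \<in> carrier (res M)" "y \<in> carrier (res M)" for x y
      using that h.add[of x y] by simp
    show "h (c \<odot>\<^bsub>res M\<^esub> x) \<one>\<^sub>A = c \<odot>\<^bsub>regular K\<^esub> h x \<one>\<^sub>A"
      if "c \<in> carrier K" "x \<in> carrier (res M)" for c x
      using that e[of "c \<odot>\<^sub>A \<one>\<^sub>A" x] lin.smult[OF functional_lin[OF hr[of x]], of c "\<one>\<^sub>A"] by simp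
  qed
qed

text \<open>The image of \<open>r\<close> is a sum of products y a with \<open>y\<close> in
  \<open>M\<close> and a coordinate \<open>a\<close> of \<open>r\<close>, which is in
  \<open>I\<close>.\<close>

lemma ann_free_zero:
  assumes g: "lin A (free_module A n) M g" and r: "r \<in> carrier (free_module A n)" and rI: "\<And>k. r k \<in> I"
    and I: "\<And>a y. \<lbrakk>a \<in> I; y \<in> carrier M\<rbrakk> \<Longrightarrow> a \<odot>\<^sub>M y = \<zero>\<^sub>M" and 0: "\<zero>\<^sub>A \<in> I"
  shows "g r = \<zero>\<^sub>M"
  using g r rI
proof (induction n arbitrary: g r)
  case 0
  then have "r = \<zero>\<^bsub>free_module A 0\<^esub>" by (simp add: fun_eq_iff)
  then show ?case using lin.zero[OF 0(1)] by simp
next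
  case (Suc n)
  interpret g: lin A "free_module A (Suc n)" M g by (rule Suc.prems(1))
  note b = biprodD[OF A.biprod_free[of n]]
  have rn: "r n \<in> carrier A" using Suc.prems(2) by simp
  have 1: "g (r(n := \<zero>\<^sub>A)) = \<zero>\<^sub>M"
    by (rule Suc.IH[OF lin_comp[OF b(1) Suc.prems(1)] lin.closed[OF b(3) Suc.prems(2)]]) (use Suc.prems(3) 0 in simp)
  have "g ((\<lambda>_. \<zero>\<^sub>A)(n := r n)) = r n \<odot>\<^sub>M g ((\<lambda>_. \<zero>\<^sub>A)(n := \<one>\<^sub>A))"
    using lin.smult[OF lin_comp[OF b(2) Suc.prems(1)], of "r n" "\<one>\<^sub>A"] rn by (simp add: fun_upd_def)
  moreover have "g ((\<lambda>_. \<zero>\<^sub>A)(n := \<one>\<^sub>A)) \<in> carrier M"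
    using lin.closed[OF lin_comp[OF b(2) Suc.prems(1)], of "\<one>\<^sub>A"] by simp
  ultimately have 2: "g ((\<lambda>_. \<zero>\<^sub>A)(n := r n)) = \<zero>\<^sub>M" using I Suc.prems(3) by simp
  have "g r = g (r(n := \<zero>\<^sub>A) \<oplus>\<^bsub>free_module A (Suc n)\<^esub> (\<lambda>_. \<zero>\<^sub>A)(n := r n))"
    using b(9)[OF Suc.prems(2)] by simp
  also have "\<dots> = g (r(n := \<zero>\<^sub>A)) \<oplus>\<^sub>M g ((\<lambda>_. \<zero>\<^sub>A)(n := r n))"
    using lin.closed[OF b(1) lin.closed[OF b(3) Suc.prems(2)]] lin.closed[OF b(2), of "r n"] rn by (intro g.add) simp_all
  finally show ?case using 1 2 by simp
qed

end

section \<open>The dual of \<open>A / ann T\<close> is generated by \<open>T\<close>\<close>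

context counted_rigid_module
begin

text \<open>\<open>M\<close> and the trace \<open>U\<close> of \<open>T\<close> in it have the same
  maps from every summand of \<open>T\<close>. Both have the factorisation property, so
  \<open>dimension_vector\<close> applies and forces U = M.\<close>

lemma factors_imp_fac:
  fixes M :: "'b std_module"
  assumes M: "fg_mod A M" and f: "factors A P1 P0 d M"
  shows "fac A T M"
proof -
  interpret M: right_module A M by (rule fg_modD[OF M])
  obtain U where U: "submodule U A M" "fac A T (M \<down> U)" "\<forall>f x. lin A T M f \<and> x \<in> carrier T \<longrightarrow> f x \<in> U"
    using AF.trace_submodule[OF T M] by metis
  let ?U = "M \<down> U"
  have eq: "hdim (T \<down> N) ?U = hdim (T \<down> N) M" if N: "N \<in> ind_summands A T" for N
  proof (rule hdim_iso_right[OF AF.fg_sub[OF T ind_summandD(1)[OF N]] fac_fg[OF U(2)] M lin_incl[OF M.right_module_axioms U(1)]])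
    note sN = ind_summandD(1)[OF N]
    obtain r where r: "lin A T (T \<down> N) r" "\<forall>x\<in>N. r x = x" using ind_summandD(3)[OF N] by metis
    fix f assume f: "lin A (T \<down> N) M f"
    have "f x \<in> U" if x: "x \<in> N" for x
    proof -
      have "f (r x) \<in> U" using U(3) lin_comp[OF r(1) f] submoduleD(3)[OF sN x] by blast
      then show ?thesis using r(2) x by simp
    qed
    then have "lin A (T \<down> N) ?U f" by (intro lin.restrict_codomain[OF f U(1)]) auto
    then show "\<exists>g. lin A (T \<down> N) ?U g \<and> (\<forall>x\<in>carrier (T \<down> N). g x = f x)" by blast
  qed simp
  obtain Q :: "'b std_module" and q where Q: "fg_mod A Q" "lin A M Q q" "q ` carrier M = carrier Q" "ker M Q q = U"
    using std_quotient[OF M U(1)] by metis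
  have "hdim (eA e) Q = 0" if e: "e \<in> E" for e
  proof -
    have "hdim (eA e) ?U = hdim (eA e) M"
      by (rule dimension_vector[OF fac_fg[OF U(2)] factors_fac[OF U(2)] M f eq e])
    then show ?thesis
      using hdim_exact[OF fg_principal[OF e] M Q(2,3) lifts_gen[OF lifts_principal[OF e] M Q(2,3)]] Q(4) by simp
  qed
  from zero_of_hdim_zero[OF E Q(1) this] have z: "carrier Q = {\<zero>\<^sub>Q}" .
  have "x \<in> U" if "x \<in> carrier M" for x
    using lin.closed[OF Q(2) that] z that unfolding Q(4)[symmetric] by (simp add: ker_iff)
  then have "U = carrier M" by (intro subset_antisym subsetI submoduleD(3)[OF U(1)])
  then show ?thesis using U(2) by simp
qed

text \<open>The reject of \<open>T\<close> in \<open>M\<close>, dual to the trace.\<close>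

definition T_radical :: "('b, 'm) module \<Rightarrow> 'm set" where
  "T_radical M = {x \<in> carrier M. \<forall>f. lin A M T f \<longrightarrow> f x = \<zero>\<^sub>T}"

lemma T_radicalI: "\<lbrakk>x \<in> carrier M; \<And>f. lin A M T f \<Longrightarrow> f x = \<zero>\<^sub>T\<rbrakk> \<Longrightarrow> x \<in> T_radical M"
  by (simp add: T_radical_def)

lemma T_radicalD:
  assumes "x \<in> T_radical M"
  shows "x \<in> carrier M" "\<And>f. lin A M T f \<Longrightarrow> f x = \<zero>\<^sub>T"
  using assms by (simp_all add: T_radical_def)

lemma submodule_T_radical:
  assumes M: "right_module A M"
  shows "submodule (T_radical M) A M"
proof -
  interpret M: right_module A M by (rule M)
  show ?thesis
  proof (rule M.submoduleI)
    show "\<zero>\<^sub>M \<in> T_radical M" by (rule T_radicalI[OF M.M.zero_closed]) (rule lin.zero)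
    show "x \<oplus>\<^sub>M y \<in> T_radical M" if x: "x \<in> T_radical M" and y: "y \<in> T_radical M" for x y
    proof (rule T_radicalI)
      show "x \<oplus>\<^sub>M y \<in> carrier M" by (rule M.M.a_closed[OF T_radicalD(1)[OF x] T_radicalD(1)[OF y]])
      show "f (x \<oplus>\<^sub>M y) = \<zero>\<^sub>T" if f: "lin A M T f" for f
        using lin.add[OF f T_radicalD(1)[OF x] T_radicalD(1)[OF y]] T_radicalD(2)[OF x f] T_radicalD(2)[OF y f] by simp
    qed
    show "a \<odot>\<^sub>M x \<in> T_radical M" if a: "a \<in> carrier A" and x: "x \<in> T_radical M" for a x
    proof (rule T_radicalI)
      show "a \<odot>\<^sub>M x \<in> carrier M" by (rule M.smult_closed'[OF a T_radicalD(1)[OF x]])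
      show "f (a \<odot>\<^sub>M x) = \<zero>\<^sub>T" if f: "lin A M T f" for f
        using lin.smult[OF f a T_radicalD(1)[OF x]] T_radicalD(2)[OF x f] a by simp
    qed
  qed (auto simp: T_radical_def)
qed

text \<open>Embed \<open>P\<close> in a free module. Each coordinate, multiplied into an element of
  \<open>T\<close>, is a map from \<open>P\<close> to \<open>T\<close>, so the coordinates of
  \<open>x\<close> lie in \<open>ann T\<close>, which acts as zero on the target of
  \<open>f\<close>.\<close>

lemma projective_T_radical:
  assumes P: "projective A P" and x: "x \<in> T_radical P" and f: "lin A P (faithful_dual T) f"
  shows "f x = \<zero>\<^bsub>faithful_dual T\<^esub>"
proof -
  have xP: "x \<in> carrier P" using x by (simp add: T_radical_def)
  obtain n i p where ip: "lin A P (free_module A n) i" "lin A (free_module A n) P p" "\<forall>x\<in>carrier P. p (i x) = x"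
    using AF.projective_retract_free[OF P] by metis
  have "i x k \<in> ann T" for k
  proof -
    have "i x k \<odot>\<^sub>T t = \<zero>\<^sub>T" if t: "t \<in> carrier T" for t
      by (rule T_radicalD(2)[OF x lin_comp[OF lin_comp[OF ip(1) A.lin_coord] T.lin_cyclic[OF t]]])
    then show ?thesis using lin.closed[OF ip(1) xP] by (simp add: ann_def)
  qed
  moreover have "\<zero>\<^sub>A \<in> ann T" by (simp add: ann_def)
  ultimately have "f (p (i x)) = \<zero>\<^bsub>faithful_dual T\<^esub>"
    by (intro ann_free_zero[OF lin_comp[OF ip(2) f] lin.closed[OF ip(1) xP], of "ann T"] ann_faithful_dual[OF T_mod])
  then show ?thesis using ip(3) xP by simp
qed

text \<open>A map to D(A / I) amounts to a functional on \<open>P1\<close>. If d x is in the reject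
  of \<open>T\<close> in \<open>P0\<close>, then \<open>x\<close> is in that of \<open>P1\<close>,
  because maps from \<open>P1\<close> to \<open>T\<close> factor through \<open>d\<close>. Hence the
  functional is well defined on the image of \<open>P1\<close> in \<open>P0\<close> modulo its
  reject. It extends to this quotient, and the extension, pulled back to \<open>P0\<close>, vanishes
  on P0 I.\<close>

lemma factors_faithful_dual: "factors A P1 P0 d (faithful_dual T)"
  unfolding factors_def
proof (intro allI impI)
  interpret d: lin A P1 P0 d by (rule d)
  fix f assume f: "lin A P1 (faithful_dual T) f"
  note ev = faithful_dual_eval[OF f]
  obtain Q :: "'b std_module" and q where Q: "fg_mod A Q" "lin A P0 Q q" "q ` carrier P0 = carrier Q" "ker P0 Q q = T_radical P0"
    using std_quotient[OF projective_fg[OF P0] submodule_T_radical[OF d.cod_mod]] by metis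
  have q0: "q x = \<zero>\<^sub>Q \<longleftrightarrow> x \<in> T_radical P0" if "x \<in> carrier P0" for x
    unfolding Q(4)[symmetric] using that by (simp add: ker_iff)
  note qd = lin_rs[OF lin_comp[OF d Q(2)]]
  interpret qd: lin K "res P1" "res Q" "\<lambda>x. q (d x)" by (rule qd)
  let ?W = "(res Q) \<down> (\<lambda>x. q (d x)) ` carrier (res P1)"
  have qW: "lin K (res P1) ?W (\<lambda>x. q (d x))" by (rule qd.restrict_codomain[OF qd.submodule_range order_refl])
  have k: "f x \<one>\<^sub>A = \<zero>\<^bsub>regular K\<^esub>" if x: "x \<in> carrier (res P1)" and z: "q (d x) = \<zero>\<^sub>?W" for x
  proof -
    have xP: "x \<in> carrier P1" using x by simp
    have dx: "d x \<in> T_radical P0" using q0[OF d.closed[OF xP]] z by simp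
    have "x \<in> T_radical P1"
      unfolding T_radical_def
    proof (intro CollectI conjI allI impI xP)
      fix h assume "lin A P1 T h"
      then obtain g where "lin A P0 T g" "\<forall>x\<in>carrier P1. g (d x) = h x" using factors_T unfolding factors_def by metis
      then show "h x = \<zero>\<^sub>T" using dx xP by (auto simp: T_radical_def)
    qed
    then show ?thesis using projective_T_radical[OF P1 _ f] by simp
  qed
  have Ws: "(\<lambda>x. q (d x)) ` carrier (res P1) = carrier ?W" by simp
  obtain \<mu> where \<mu>: "lin K ?W (regular K) \<mu>" "\<forall>x\<in>carrier (res P1). \<mu> (q (d x)) = f x \<one>\<^sub>A"
    using lin.factor_surj[OF qW ev(1) Ws k] by metis
  obtain \<nu> where \<nu>: "lin K (res Q) (regular K) \<nu>"
    "\<forall>u\<in>(\<lambda>x. q (d x)) ` carrier (res P1). \<nu> u = \<mu> u"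
    using functional_extension[OF K.field_axioms qd.cod_mod flen_rs[OF Q(1)] qd.submodule_range \<mu>(1)] by metis
  have \<nu>d: "\<nu> (q (d x)) = f x \<one>\<^sub>A" if "x \<in> carrier P1" for x using \<nu>(2) \<mu>(2) that by simp
  have "\<nu> (q (a \<odot>\<^sub>P0 x)) = \<zero>\<^sub>K" if a: "a \<in> ann T" and x: "x \<in> carrier P0" for a x
  proof -
    have aA: "a \<in> carrier A" using a by (simp add: ann_def)
    have "a \<odot>\<^sub>P0 x \<in> T_radical P0"
    proof (rule T_radicalI[OF d.N.smult_closed'[OF aA x]])
      show "h (a \<odot>\<^sub>P0 x) = \<zero>\<^sub>T" if h: "lin A P0 T h" for h
        using a lin.smult[OF h aA x] lin.closed[OF h x] by (simp add: ann_def)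
    qed
    then show ?thesis using q0[OF d.N.smult_closed'[OF aA x]] lin.zero[OF \<nu>(1)] by simp
  qed
  from faithful_dual_map[OF T_mod d.cod_mod lin_comp[OF lin_rs[OF Q(2)] \<nu>(1)] this]
  have g: "lin A P0 (faithful_dual T) (\<lambda>x. \<lambda>a\<in>carrier A. \<nu> (q (a \<odot>\<^sub>P0 x)))" .
  have "(\<lambda>a\<in>carrier A. \<nu> (q (a \<odot>\<^sub>P0 d x))) = f x" if x: "x \<in> carrier P1" for x
  proof -
    have fr: "f x \<in> rhom K A (regular K)" using lin.closed[OF f x] by simp
    have "\<nu> (q (a \<odot>\<^sub>P0 d x)) = f x a" if a: "a \<in> carrier A" for a
      using \<nu>d[OF d.M.smult_closed'[OF a x]] d.smult[OF a x] ev(2)[OF a x] by simp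
    then show ?thesis using rhom_undefined[OF fr] by (simp add: fun_eq_iff)
  qed
  then show "extends_along A P1 P0 (faithful_dual T) d f"
    using g by blast
qed

end

section \<open>The projective dimension of \<open>T\<close>\<close>

context counted_rigid_module
begin

lemma finsum_smult_in:
  assumes L: "right_module A L" and W: "submodule W A L" and y: "y \<in> carrier L" and a: "a \<in> carrier A"
    and G: "finite G" "G \<subseteq> carrier A" "\<And>e. e \<in> G \<Longrightarrow> (e \<otimes>\<^sub>A a) \<odot>\<^sub>L y \<in> W"
  shows "((\<Oplus>\<^bsub>A\<^esub>e\<in>G. e) \<otimes>\<^sub>A a) \<odot>\<^sub>L y \<in> W"
  using G
proof (induction G)
  case empty
  interpret L: right_module A L by (rule L)
  show ?case using a y submoduleD(2)[OF W] by simp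
next
  case (insert e G)
  interpret L: right_module A L by (rule L)
  have s: "(\<Oplus>\<^bsub>A\<^esub>e\<in>G. e) \<in> carrier A" using insert.prems(1) by (intro A.finsum_closed) auto
  have e: "e \<in> carrier A" using insert.prems(1) by simp
  have "(\<Oplus>\<^bsub>A\<^esub>e\<in>insert e G. e) = e \<oplus>\<^sub>A (\<Oplus>\<^bsub>A\<^esub>e\<in>G. e)"
    using insert.hyps insert.prems(1) by (intro A.finsum_insert) auto
  then have "((\<Oplus>\<^bsub>A\<^esub>e\<in>insert e G. e) \<otimes>\<^sub>A a) \<odot>\<^sub>L y = (e \<otimes>\<^sub>A a) \<odot>\<^sub>L y \<oplus>\<^sub>L ((\<Oplus>\<^bsub>A\<^esub>e\<in>G. e) \<otimes>\<^sub>A a) \<odot>\<^sub>L y"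
    using s e a y by (simp add: A.l_distr L.smult_l_distr)
  then show ?case using insert by (simp add: submoduleD(4)[OF W])
qed

text \<open>Otherwise Hom(eA, T) would vanish, against sincerity.\<close>

lemma idempotent_not_in_ann:
  assumes e: "e \<in> E"
  shows "e \<notin> ann T"
proof
  assume a: "e \<in> ann T"
  note eA = prim_idem(2)[OF e] and ee = prim_idem(1)[OF e]
  have e1: "e \<in> carrier (eA e)" using eA ee A.principal_mult[OF ee, of e] by (simp add: idempotent_def)
  have "hdim (eA e) T = 0"
  proof (rule hdim_zeroI[OF fg_principal[OF e] T])
    fix f x assume f: "lin A (eA e) T f" and x: "x \<in> carrier (eA e)"
    have x': "x \<in> carrier A" "e \<otimes>\<^sub>A x = x" using x A.principal_mult[OF ee, of x] by simp_all
    have "f e = e \<odot>\<^sub>T f e" using lin.smult[OF f eA e1] ee by (simp add: idempotent_def)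
    also have "\<dots> = \<zero>\<^sub>T" using a lin.closed[OF f e1] by (simp add: ann_def)
    finally show "f x = \<zero>\<^sub>T" using lin.smult[OF f x'(1) e1] x' by simp
  qed
  then show False using sincere[OF e] by simp
qed

text \<open>By hypothesis L I lies in no proper submodule, where I = \<open>ann T\<close>. If
  \<open>L\<close> is not zero, a maximal submodule \<open>W\<close> and some \<open>e\<close> in
  \<open>E\<close> yield \<open>x\<close> outside \<open>W\<close> and \<open>b\<close> in e I e
  with x congruent to x b modulo \<open>W\<close>. In the local ring e A e either \<open>b\<close>
  is invertible, which puts \<open>e\<close> into I, or it is nilpotent, which puts \<open>x\<close>
  into \<open>W\<close>.\<close>

lemma zero_of_faithful_dual:
  assumes L: "fg_mod A L" and z: "\<And>f x. \<lbrakk>lin A L (faithful_dual T) f; x \<in> carrier L\<rbrakk> \<Longrightarrow> f x = \<zero>\<^bsub>faithful_dual T\<^esub>"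
  shows "carrier L = {\<zero>\<^sub>L}"
proof (rule ccontr)
  assume nz: "carrier L \<noteq> {\<zero>\<^sub>L}"
  interpret L: right_module A L by (rule fg_modD[OF L])
  let ?C = "{U. submodule U A L \<and> U \<noteq> carrier L}"
  have "{\<zero>\<^sub>L} \<in> ?C" using L.submodule_zero nz by simp
  then have "\<exists>W\<in>?C. \<forall>V\<in>?C. W \<subseteq> V \<longrightarrow> W = V"
    by (rule L.ex_maximal_submodule[OF AF.fg_flen[OF L]]) (elim CollectE, elim conjunct1)
  then obtain W where W: "submodule W A L" "W \<noteq> carrier L" and max: "\<forall>V\<in>?C. W \<subseteq> V \<longrightarrow> W = V" by auto
  have "\<not> carrier L \<subseteq> W" using W(2) submoduleD(1)[OF W(1)] by (metis subset_antisym)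
  then obtain x0 where x0: "x0 \<in> carrier L" "x0 \<notin> W" unfolding subset_iff by metis
  \<comment> \<open>If L I were inside \<open>W\<close>, a functional that vanishes on
    \<open>W\<close> but not at \<open>x0\<close> would give a nonzero map to D(A / I).\<close>
  have "\<exists>a\<in>ann T. \<exists>y\<in>carrier L. a \<odot>\<^sub>L y \<notin> W"
  proof (rule ccontr)
    assume n: "\<not> ?thesis"
    obtain \<nu> where \<nu>: "lin K (res L) (regular K) \<nu>" "\<forall>u\<in>W. \<nu> u = \<zero>\<^sub>K" "\<nu> x0 \<noteq> \<zero>\<^sub>K"
      using functional_separation[OF K.field_axioms right_module_rs[OF L.right_module_axioms] flen_rs[OF L]
        submodule_rs[OF L.right_module_axioms W(1)], of x0] x0 by auto
    have "\<nu> (a \<odot>\<^sub>L x) = \<zero>\<^sub>K" if "a \<in> ann T" "x \<in> carrier L" for a x using \<nu>(2) n that by metis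
    from z[OF faithful_dual_map[OF T_mod L.right_module_axioms \<nu>(1) this] x0(1)]
    have "(\<lambda>a\<in>carrier A. \<nu> (a \<odot>\<^sub>L x0)) = \<zero>\<^bsub>faithful_dual T\<^esub>" .
    from fun_cong[OF this, of "\<one>\<^sub>A"] show False using \<nu>(3) L.smult_one[OF x0(1)] by simp
  qed
  then obtain a y where a: "a \<in> ann T" and y: "y \<in> carrier L" and ay: "a \<odot>\<^sub>L y \<notin> W" by metis
  have aA: "a \<in> carrier A" using a by (simp add: ann_def)
  have E': "finite E" "E \<subseteq> carrier A" "(\<Oplus>\<^bsub>A\<^esub>e\<in>E. e) = \<one>\<^sub>A"
    using E prim_idem(2) by (auto simp: prim_decomp_def)
  have "\<exists>e\<in>E. (e \<otimes>\<^sub>A a) \<odot>\<^sub>L y \<notin> W"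
  proof (rule ccontr)
    assume "\<not> ?thesis"
    then have "((\<Oplus>\<^bsub>A\<^esub>e\<in>E. e) \<otimes>\<^sub>A a) \<odot>\<^sub>L y \<in> W"
      by (intro finsum_smult_in[OF L.right_module_axioms W(1) y aA E'(1,2)]) metis
    then show False using ay aA E'(3) by simp
  qed
  then obtain e where e: "e \<in> E" and ea: "(e \<otimes>\<^sub>A a) \<odot>\<^sub>L y \<notin> W" by metis
  note eA = prim_idem(2)[OF e] and ee = prim_idem(1)[OF e]
  have eee: "e \<otimes>\<^sub>A e = e" using ee by (simp add: idempotent_def)
  define x where "x = e \<odot>\<^sub>L y"
  have x: "x \<in> carrier L" "e \<odot>\<^sub>L x = x" using eA y L.smult_assoc[OF eA eA y] eee by (simp_all add: x_def)
  have ax: "a \<odot>\<^sub>L x \<notin> W" "a \<odot>\<^sub>L x \<in> carrier L" using ea L.smult_assoc[OF eA aA y] aA x(1) by (simp_all add: x_def)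
  have xW: "x \<notin> W" using ax(1) submoduleD(5)[OF W(1) aA] by metis
  let ?Z = "(\<lambda>c. c \<odot>\<^sub>L (a \<odot>\<^sub>L x)) ` carrier A"
  note sZ = L.submodule_cyclic[OF ax(2)]
  \<comment> \<open>\<open>?Z\<close> is generated by \<open>a \<odot>\<^sub>L x\<close>, that is, x
    a, which lies outside the maximal submodule \<open>W\<close>.\<close>
  have "W <+>\<^sub>L ?Z = carrier L"
  proof (rule ccontr)
    assume "W <+>\<^sub>L ?Z \<noteq> carrier L"
    then have "W <+>\<^sub>L ?Z \<in> ?C" using L.submodule_set_add[OF W(1) sZ] by simp
    then have "W = W <+>\<^sub>L ?Z" by (rule max[rule_format, OF _ L.set_add_upper(1)[OF W(1) sZ]])
    then show False using L.set_add_upper(2)[OF W(1) sZ] L.cyclic_self[OF ax(2)] ax(1) by (metis subsetD)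
  qed
  then have "x \<in> W <+>\<^sub>L ?Z" using x(1) by simp
  then obtain m z where m: "m \<in> W" and z: "z \<in> ?Z" and xz: "x = m \<oplus>\<^sub>L z" unfolding L.set_add_iff by (elim bexE)
  obtain c where c: "c \<in> carrier A" and zc: "z = c \<odot>\<^sub>L (a \<odot>\<^sub>L x)" using z by (elim imageE)
  \<comment> \<open>Multiplying x = m + x a c by \<open>e\<close> on the right gives x = m e + x b,
    since x e = x.\<close>
  define b where "b = e \<otimes>\<^sub>A (a \<otimes>\<^sub>A (c \<otimes>\<^sub>A e))"
  have bA: "b \<in> carrier A" using eA aA c by (simp add: b_def)
  have bI: "b \<in> ann T" unfolding b_def using ann_mult[OF T_mod] a eA c A.m_closed by metis
  have eb: "e \<otimes>\<^sub>A b = b" using eA aA c eee by (simp add: b_def flip: A.m_assoc)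
  have mL: "m \<in> carrier L" by (rule submoduleD(3)[OF W(1) m])
  have bx: "b \<odot>\<^sub>L x = e \<odot>\<^sub>L (c \<odot>\<^sub>L (a \<odot>\<^sub>L x))" using eA aA c x by (simp add: b_def L.smult_assoc)
  have zL: "z \<in> carrier L" unfolding zc by (rule L.smult_closed'[OF c ax(2)])
  have "e \<odot>\<^sub>L x = e \<odot>\<^sub>L m \<oplus>\<^sub>L e \<odot>\<^sub>L z"
    unfolding xz by (rule L.smult_r_distr[OF eA mL zL])
  then have xb: "x = e \<odot>\<^sub>L m \<oplus>\<^sub>L b \<odot>\<^sub>L x" unfolding x(2) bx zc .
  have em: "e \<odot>\<^sub>L m \<in> W" by (rule submoduleD(5)[OF W(1) eA m])
  let ?P = "eA e"
  have mP: "right_module A ?P" by (rule A.right_module_principal[OF eA])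
  have h: "lin A ?P ?P (\<lambda>z. b \<otimes>\<^sub>A z)"
  proof (rule linI[OF mP mP])
    show "b \<otimes>\<^sub>A z \<in> carrier ?P" if "z \<in> carrier ?P" for z
      using that bA eA eb unfolding A.principal_mult[OF ee] by (simp flip: A.m_assoc)
    show "b \<otimes>\<^sub>A (z \<oplus>\<^sub>?P w) = b \<otimes>\<^sub>A z \<oplus>\<^sub>?P b \<otimes>\<^sub>A w" if "z \<in> carrier ?P" "w \<in> carrier ?P" for z w
      using that bA unfolding A.principal_mult[OF ee] by (simp add: A.r_distr)
    show "b \<otimes>\<^sub>A (r \<odot>\<^sub>?P z) = r \<odot>\<^sub>?P (b \<otimes>\<^sub>A z)" if "r \<in> carrier A" "z \<in> carrier ?P" for r z
      using that bA unfolding A.principal_mult[OF ee] by (simp add: A.m_assoc)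
  qed
  have eP: "e \<in> carrier ?P" using eA eee unfolding A.principal_mult[OF ee] by simp
  have ind: "indecomposable A ?P" using E e by (intro A.principal_indecomposable) (simp add: prim_decomp_def)
  note fP = AF.fg_flen[OF fg_principal[OF e]]
  show False
  proof (cases "inj_on (\<lambda>z. b \<otimes>\<^sub>A z) (carrier ?P)")
    case True
    obtain u where u: "lin A ?P ?P u" "\<forall>z\<in>carrier ?P. b \<otimes>\<^sub>A u z = z" using endo_inverse[OF h fP True] by metis
    have "u e \<in> carrier A" using lin.closed[OF u(1) eP] unfolding A.principal_mult[OF ee] by simp
    then have "b \<otimes>\<^sub>A u e \<in> ann T" by (rule ann_mult(1)[OF T_mod bI])
    then show False using u(2) eP idempotent_not_in_ann[OF e] by simp
  next
    case False
    obtain k where k: "\<forall>z\<in>carrier ?P. ((\<lambda>z. b \<otimes>\<^sub>A z) ^^ k) z = \<zero>\<^sub>?P" using indecomposable_endo[OF ind fP h False] by metis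
    \<comment> \<open>Iterating x = m e + x b with m e in \<open>W\<close>: no x b^j e lies in
      \<open>W\<close>, and for j = k this contradicts nilpotence.\<close>
    have "((\<lambda>z. b \<otimes>\<^sub>A z) ^^ j) e \<in> carrier A \<and> ((\<lambda>z. b \<otimes>\<^sub>A z) ^^ j) e \<odot>\<^sub>L x \<notin> W" for j
    proof (induction j)
      case 0
      show ?case using eA x(2) xW by simp
    next
      case (Suc j)
      let ?z = "((\<lambda>z. b \<otimes>\<^sub>A z) ^^ j) e"
      have z: "?z \<in> carrier A" "?z \<odot>\<^sub>L x \<notin> W" using Suc by simp_all
      have "?z \<odot>\<^sub>L (e \<odot>\<^sub>L m \<oplus>\<^sub>L b \<odot>\<^sub>L x) \<notin> W" unfolding xb[symmetric] by (rule z(2))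
      moreover have "?z \<odot>\<^sub>L (e \<odot>\<^sub>L m \<oplus>\<^sub>L b \<odot>\<^sub>L x) = ?z \<odot>\<^sub>L (e \<odot>\<^sub>L m) \<oplus>\<^sub>L (b \<otimes>\<^sub>A ?z) \<odot>\<^sub>L x"
        using z(1) eA mL bA x(1) by (simp add: L.smult_r_distr L.smult_assoc)
      ultimately have "(b \<otimes>\<^sub>A ?z) \<odot>\<^sub>L x \<notin> W"
        using submoduleD(4)[OF W(1) submoduleD(5)[OF W(1) z(1) em]] by metis
      then show ?case using z(1) bA by simp
    qed
    from this[of k] show False using k[rule_format, OF eP] submoduleD(2)[OF W(1)] x(1) by simp
  qed
qed

end

section \<open>Vanishing of the kernel of the presentation\<close>

context resolved_rigid_module
begin

text \<open>For the resolution \<open>Pr\<close>, Ext^2(T, M) = 0 lets maps from the second syzygy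
  to \<open>M\<close> extend to \<open>Pr 1\<close>. Comparison maps in both directions and a
  homotopy \<open>h\<close> transfer this to the presentation, so \<open>\<mu>\<close> extends to
  \<open>P1\<close>. The extension factors through \<open>d\<close>, hence is zero on the kernel of
  \<open>d\<close>.\<close>

lemma relation_maps_vanish:
  assumes e: "ext0 A Pr \<delta> 1 M" and M: "factors A P1 P0 d M"
    and \<mu>: "lin A (P1 \<down> ker P1 P0 d) M \<mu>" and x: "x \<in> ker P1 P0 d"
  shows "\<mu> x = \<zero>\<^sub>M"
proof -
  note r = proj_resolutionD[OF res T_mod]
  interpret d: lin A P1 P0 d by (rule d)
  interpret p0: lin A P0 T p0 by (rule p0)
  interpret \<mu>: lin A "P1 \<down> ker P1 P0 d" M \<mu> by (rule \<mu>)
  note fgP = projective_fg[OF P0] projective_fg[OF P1] projective_fg[OF r(1)]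
  let ?L = "P1 \<down> ker P1 P0 d" and ?K = "P0 \<down> ker P0 T p0"
  let ?K' = "(Pr 0) \<down> ker (Pr 0) T \<epsilon>"
  note kp = p0.submodule_ker and ke = lin.submodule_ker[OF r(2)]
  have dK: "lin A P1 ?K d" "d ` carrier P1 = carrier ?K" using d.restrict_codomain[OF kp] d_exact by simp_all
  have \<delta>K: "lin A (Pr (Suc 0)) ?K' (\<delta> 0)" "\<delta> 0 ` carrier (Pr (Suc 0)) = carrier ?K'"
    using lin.restrict_codomain[OF r(3) ke] r(5) by simp_all
  have \<delta>0: "\<epsilon> (\<delta> 0 z) = \<zero>\<^sub>T" if "z \<in> carrier (Pr (Suc 0))" for z
    using lin.closed[OF \<delta>K(1) that] by (simp add: ker_iff)
  obtain a0 where a0: "lin A (Pr 0) P0 a0" "\<forall>z\<in>carrier (Pr 0). p0 (a0 z) = \<epsilon> z"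
    using projective_lift[OF r(1) fgP(1) p0 p0_surj r(2)] by metis
  obtain b0 where b0: "lin A P0 (Pr 0) b0" "\<forall>z\<in>carrier P0. \<epsilon> (b0 z) = p0 z"
    using projective_lift[OF P0 fgP(3) r(2,4) p0] by metis
  have "lin A (Pr (Suc 0)) ?K (\<lambda>z. a0 (\<delta> 0 z))"
    by (rule lin.restrict_codomain[OF lin_comp[OF r(3) a0(1)] kp])
      (use a0 \<delta>0 lin.closed[OF a0(1)] lin.closed[OF r(3)] in \<open>auto simp: ker_iff\<close>)
  from projective_lift[OF r(1) fgP(2) dK this]
  obtain a1 where a1: "lin A (Pr (Suc 0)) P1 a1" "\<forall>z\<in>carrier (Pr (Suc 0)). d (a1 z) = a0 (\<delta> 0 z)" by metis
  have "lin A P1 ?K' (\<lambda>z. b0 (d z))"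
    by (rule lin.restrict_codomain[OF lin_comp[OF d b0(1)] ke])
      (use b0 d_zero lin.closed[OF b0(1)] lin.closed[OF d] in \<open>auto simp: ker_iff\<close>)
  from projective_lift[OF P1 fgP(3) \<delta>K this]
  obtain b1 where b1: "lin A P1 (Pr (Suc 0)) b1" "\<forall>z\<in>carrier P1. \<delta> 0 (b1 z) = b0 (d z)" by metis
  have "lin A P0 ?K (\<lambda>z. a0 (b0 z) \<ominus>\<^sub>P0 z)"
    by (rule lin.restrict_codomain[OF lin_diff_map[OF lin_comp[OF b0(1) a0(1)] lin_id[OF d.cod_mod]] kp])
      (use a0 b0 lin.closed[OF a0(1)] lin.closed[OF b0(1)] in \<open>auto simp: ker_iff p0.diff\<close>)
  from projective_lift[OF P0 fgP(2) dK this]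
  obtain h where h: "lin A P0 P1 h" "\<forall>z\<in>carrier P0. d (h z) = a0 (b0 z) \<ominus>\<^sub>P0 z" by metis
  \<comment> \<open>The comparison of \<open>a1\<close> after \<open>b1\<close> with the identity,
    corrected by the homotopy. Since d h = a0 b0 - 1, the composite of \<open>d\<close> and
    \<open>\<kappa>\<close> is zero, so \<open>\<mu>\<close> may be applied to its values.\<close>
  define \<kappa> where "\<kappa> z = (a1 (b1 z) \<ominus>\<^sub>P1 z) \<ominus>\<^sub>P1 h (d z)" for z
  have c1: "a1 (b1 z) \<in> carrier P1" "h (d z) \<in> carrier P1" if "z \<in> carrier P1" for z
    using that lin.closed[OF b1(1)] lin.closed[OF a1(1)] lin.closed[OF h(1)] by simp_all
  have dab: "d (a1 (b1 z)) = a0 (b0 (d z))" if "z \<in> carrier P1" for z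
    using a1(2) b1(2) lin.closed[OF b1(1) that] that by simp
  have \<kappa>: "lin A P1 ?L \<kappa>"
    unfolding \<kappa>_def
  proof (rule lin.restrict_codomain[OF lin_diff_map[OF lin_diff_map[OF lin_comp[OF b1(1) a1(1)] lin_id[OF d.dom_mod]] lin_comp[OF d h(1)]] d.submodule_ker], rule image_subsetI)
    fix z assume z: "z \<in> carrier P1"
    have "d ((a1 (b1 z) \<ominus>\<^sub>P1 z) \<ominus>\<^sub>P1 h (d z)) = (d (a1 (b1 z)) \<ominus>\<^sub>P0 d z) \<ominus>\<^sub>P0 d (h (d z))"
      using c1[OF z] z by (simp add: d.diff)
    also have "\<dots> = \<zero>\<^sub>P0"
      using dab[OF z] h(2) z lin.closed[OF lin_comp[OF b0(1) a0(1)]] by simp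
    finally show "(a1 (b1 z) \<ominus>\<^sub>P1 z) \<ominus>\<^sub>P1 h (d z) \<in> ker P1 P0 d" using c1[OF z] z by (simp add: ker_iff)
  qed
  have l: "lin A (Pr (Suc (Suc 0))) ?L (\<lambda>z. a1 (\<delta> (Suc 0) z))"
  proof (rule lin.restrict_codomain[OF lin_comp[OF r(3) a1(1)] d.submodule_ker], rule image_subsetI)
    fix z assume z: "z \<in> carrier (Pr (Suc (Suc 0)))"
    show "a1 (\<delta> (Suc 0) z) \<in> ker P1 P0 d"
      using a1 lin.closed[OF a1(1)] lin.closed[OF r(3) z] r(7)[OF z] lin.zero[OF a0(1)] by (simp add: ker_iff)
  qed
  have "\<mu> (a1 (\<delta> (Suc 0) (\<delta> (Suc (Suc 0)) y))) = \<zero>\<^sub>M" if "y \<in> carrier (Pr (Suc (Suc (Suc 0))))" for y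
    using r(7)[OF that] lin.zero[OF a1(1)] \<mu>.zero by simp
  from ext0D[OF e, unfolded One_nat_def, OF lin_comp[OF l \<mu>] this]
  obtain g where g: "lin A (Pr (Suc 0)) M g" "\<forall>z\<in>carrier (Pr (Suc (Suc 0))). g (\<delta> (Suc 0) z) = \<mu> (a1 (\<delta> (Suc 0) z))" by metis
  \<comment> \<open>On the kernel of \<open>d\<close> the homotopy term vanishes, so \<kappa> z = a1
    (b1 z) - z, while g (b1 z) = \<mu> (a1 (b1 z)); the difference is \<mu> z.\<close>
  have ext: "g (b1 z) \<ominus>\<^sub>M \<mu> (\<kappa> z) = \<mu> z" if z: "z \<in> ker P1 P0 d" for z
  proof -
    have zP: "z \<in> carrier P1" "d z = \<zero>\<^sub>P0" using z by (simp_all add: ker_iff)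
    have "b1 z \<in> ker (Pr (Suc 0)) (Pr 0) (\<delta> 0)"
      using b1(2) zP lin.closed[OF b1(1)] lin.zero[OF b0(1)] by (simp add: ker_iff)
    then obtain y where y: "y \<in> carrier (Pr (Suc (Suc 0)))" "b1 z = \<delta> (Suc 0) y" unfolding r(6) by (elim imageE)
    have gb: "g (b1 z) = \<mu> (a1 (b1 z))" using g(2) y by simp
    have aL: "a1 (b1 z) \<in> carrier ?L" using lin.closed[OF l y(1)] y(2) by simp
    have "\<kappa> z = a1 (b1 z) \<ominus>\<^sub>P1 z"
      unfolding \<kappa>_def using zP lin.zero[OF h(1)] c1[OF zP(1)] by (simp add: a_minus_def)
    also have "\<dots> = a1 (b1 z) \<ominus>\<^sub>?L z" by (rule d.M.a_minus_sub[OF d.submodule_ker z, symmetric])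
    finally have "\<mu> (\<kappa> z) = \<mu> (a1 (b1 z)) \<ominus>\<^sub>M \<mu> z" using \<mu>.diff[OF aL, of z] z by simp
    then have e1: "\<mu> (\<kappa> z) \<oplus>\<^sub>M \<mu> z = g (b1 z)" using \<mu>.closed[OF aL] \<mu>.closed[of z] z gb by simp
    have c: "\<mu> (\<kappa> z) \<in> carrier M" "\<mu> z \<in> carrier M" using \<mu>.closed[OF lin.closed[OF \<kappa> zP(1)]] \<mu>.closed[of z] z by simp_all
    show ?thesis using c unfolding e1[symmetric] by (simp add: \<mu>.N.a_comm)
  qed
  obtain k where k: "lin A P0 M k" "\<forall>z\<in>carrier P1. k (d z) = g (b1 z) \<ominus>\<^sub>M \<mu> (\<kappa> z)"
    using M[unfolded factors_def, rule_format, OF lin_diff_map[OF lin_comp[OF b1(1) g(1)] lin_comp[OF \<kappa> \<mu>]]] by (elim exE conjE)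
  have xP: "x \<in> carrier P1" "d x = \<zero>\<^sub>P0" using x by (simp_all add: ker_iff)
  have "\<mu> x = k (d x)"
    by (rule trans[OF ext[OF x, symmetric] k(2)[rule_format, OF xP(1), symmetric]])
  then show ?thesis unfolding xP(2) using lin.zero[OF k(1)] by simp
qed

abbreviation DT :: "('c \<Rightarrow> 'c, 'c \<Rightarrow> 'a) module" where "DT \<equiv> dual K B (End_module T)"

lemma DT_eq: "DT = with_smult (hom_group K (res T) (regular K)) (\<lambda>b \<phi>. \<lambda>x\<in>carrier T. \<phi> (b x))"
proof -
  have "rhom K (restrict_scalars B (End_module T)) (regular K) = rhom K (res T) (regular K)"
    unfolding rhom_def by simp
  then show ?thesis by (simp add: dual_def hom_group_def)
qed

lemma DT_simps:
  "carrier DT = rhom K (res T) (regular K)"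
  "\<zero>\<^sub>DT = (\<lambda>x\<in>carrier T. \<zero>\<^sub>K)"
  "\<phi> \<oplus>\<^sub>DT \<psi> = (\<lambda>x\<in>carrier T. \<phi> x \<oplus>\<^sub>K \<psi> x)"
  "b \<odot>\<^sub>DT \<phi> = (\<lambda>x\<in>carrier T. \<phi> (b x))"
  unfolding DT_eq by simp_all

lemma DT_lin: "\<phi> \<in> carrier DT \<Longrightarrow> lin K (res T) (regular K) \<phi>"
  unfolding DT_simps by (rule rhom_lin[OF right_module_rs[OF T_mod] right_module_K])

lemma DT_in: "lin K (res T) (regular K) \<phi> \<Longrightarrow> (\<lambda>x\<in>carrier T. \<phi> x) \<in> carrier DT"
  unfolding DT_simps using lin.in_rhom[of K "res T" "regular K" \<phi>] by simp

lemma right_module_DT: "right_module B DT"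
  unfolding DT_eq
  using right_module_hom_action[OF right_module_rs[OF T_mod] right_module_K ring_End_algebra[OF T_mod], where \<sigma> = "\<lambda>b. b"]
    lin_rs[OF rhom_lin[OF T_mod T_mod]] by (simp add: compose_def)

text \<open>By adjunction, \<open>Hom\<^sub>A(T, D(A / ann T)) = DT\<close>.\<close>

lemma DT_isos: "\<exists>\<phi> \<psi>. isos B DT (F (faithful_dual T)) \<phi> \<psi>"
proof -
  let ?C = "faithful_dual T"
  have mC: "right_module A ?C" by (rule fg_modD[OF fg_faithful_dual[OF T_mod]])
  note mF = F_mod[OF mC]
  let ?\<phi> = "\<lambda>\<phi>. \<lambda>t\<in>carrier T. \<lambda>a\<in>carrier A. \<phi> (a \<odot>\<^sub>T t)"
  let ?\<psi> = "\<lambda>h. \<lambda>t\<in>carrier T. h t \<one>\<^sub>A"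
  have hl: "lin A T ?C h" if "h \<in> carrier (F ?C)" for h using that by (intro rhom_lin[OF T_mod mC]) simp
  have hc: "h t \<in> rhom K A (regular K)" if "h \<in> carrier (F ?C)" "t \<in> carrier T" for h t
    using lin.closed[OF hl[OF that(1)] that(2)] by simp
  have \<phi>: "lin B DT (F ?C) ?\<phi>"
  proof (rule linI[OF right_module_DT mF])
    show "?\<phi> \<phi> \<in> carrier (F ?C)" if \<phi>: "\<phi> \<in> carrier DT" for \<phi>
    proof -
      have "\<phi> (a \<odot>\<^sub>T t) = \<zero>\<^sub>K" if "a \<in> ann T" "t \<in> carrier T" for a t
        using lin.zero[OF DT_lin[OF \<phi>]] that by (simp add: ann_def)
      from lin.in_rhom[OF faithful_dual_map[OF T_mod T_mod DT_lin[OF \<phi>] this]] show ?thesis by simp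
    qed
    show "?\<phi> (\<phi> \<oplus>\<^sub>DT \<psi>) = ?\<phi> \<phi> \<oplus>\<^bsub>F ?C\<^esub> ?\<phi> \<psi>" for \<phi> \<psi>
      by (simp add: DT_simps fun_eq_iff)
    show "?\<phi> (b \<odot>\<^sub>DT \<phi>) = b \<odot>\<^bsub>F ?C\<^esub> ?\<phi> \<phi>" if "b \<in> carrier B" "\<phi> \<in> carrier DT" for b \<phi>
    proof -
      have "lin A T T b" using that(1) by (intro rhom_lin[OF T_mod T_mod]) simp
      then show ?thesis using lin.smult lin.closed by (fastforce simp: DT_simps fun_eq_iff compose_def)
    qed
  qed
  have \<psi>: "lin B (F ?C) DT ?\<psi>"
  proof (rule linI[OF mF right_module_DT])
    show "?\<psi> h \<in> carrier DT" if "h \<in> carrier (F ?C)" for h by (rule DT_in[OF faithful_dual_eval(1)[OF hl[OF that]]])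
    show "?\<psi> (h \<oplus>\<^bsub>F ?C\<^esub> g) = ?\<psi> h \<oplus>\<^sub>DT ?\<psi> g" for h g by (simp add: DT_simps fun_eq_iff)
    show "?\<psi> (b \<odot>\<^bsub>F ?C\<^esub> h) = b \<odot>\<^sub>DT ?\<psi> h" if "b \<in> carrier B" for b h
      using that rhom_closed[of b A T T] by (simp add: DT_simps fun_eq_iff compose_def)
  qed
  have "?\<psi> (?\<phi> \<phi>) = \<phi>" if "\<phi> \<in> carrier DT" for \<phi>
  proof -
    have "\<phi> \<in> rhom K (res T) (regular K)" using that unfolding DT_simps .
    note u = rhom_undefined[OF this]
    show ?thesis using u T.smult_one by (auto simp: fun_eq_iff)
  qed
  moreover have "?\<phi> (?\<psi> h) = h" if h: "h \<in> carrier (F ?C)" for h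
  proof
    fix t
    show "?\<phi> (?\<psi> h) t = h t"
    proof (cases "t \<in> carrier T")
      case True
      have "(\<lambda>a\<in>carrier A. ?\<psi> h (a \<odot>\<^sub>T t)) a = h t a" for a
        using faithful_dual_eval(2)[OF hl[OF h], of a t] rhom_undefined[OF hc[OF h True], of a] True by simp
      then show ?thesis using True by (simp add: fun_eq_iff)
    next
      case False
      then show ?thesis using h rhom_undefined[of h A T ?C] by simp
    qed
  qed
  ultimately show ?thesis using \<phi> \<psi> unfolding isos_def by blast
qed

text \<open>\<open>FE\<close> speaks of standard modules, so D(A / I) is replaced by a standard copy
  \<open>Q\<close>. F(Q) is isomorphic to \<open>DT\<close>, and \<open>ddell_FE\<close> gives
  Ext^2(T, Q) = 0; then all maps from the kernel of \<open>d\<close> to D(A / I) vanish, which makes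
  the kernel zero.\<close>

lemma presentation_injective:
  assumes l: "ddell B 2 DT \<le> enat m" and e: "\<And>n. n \<le> m + 2 \<Longrightarrow> ext0 A Pr \<delta> n T"
  shows "inj_on d (carrier P1)"
proof -
  interpret d: lin A P1 P0 d by (rule d)
  let ?C = "faithful_dual T"
  note fC = fg_faithful_dual[OF T_mod]
  obtain Q :: "'b std_module" and i p where Q: "fg_mod A Q" "lin A Q ?C i" "lin A ?C Q p"
    "\<forall>x\<in>carrier ?C. i (p x) = x" "\<forall>y\<in>carrier Q. p (i y) = y" using std_copy[OF fC] by metis
  have ps: "p ` carrier ?C = carrier Q"
  proof
    show "carrier Q \<subseteq> p ` carrier ?C"
    proof
      fix y assume y: "y \<in> carrier Q"
      show "y \<in> p ` carrier ?C" using Q(5) y lin.closed[OF Q(2) y] by (intro image_eqI[of y p "i y"]) simp_all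
    qed
  qed (use lin.closed[OF Q(3)] in blast)
  have fQ: "factors A P1 P0 d Q" by (rule factors_image[OF P1 fC Q(3) ps factors_faithful_dual])
  have facQ: "fac A T Q" by (rule factors_imp_fac[OF Q(1) fQ])
  obtain \<phi> \<psi> where iso: "isos B DT (F ?C) \<phi> \<psi>" using DT_isos by metis
  have FQ: "isos B (F ?C) (F Q) (Fm p) (Fm i)"
    unfolding isos_def
  proof (intro conjI ballI lin_hom_module[OF T_mod] Q(2,3))
    fix f assume f: "f \<in> carrier (F ?C)"
    then have fr: "f \<in> rhom A T ?C" by simp
    show "Fm i (Fm p f) = f"
      by (rule rhom_ext[OF F_closed[OF Q(2) F_closed[OF Q(3) fr]] fr])
        (simp add: compose_def Q(4)[rule_format, OF rhom_closed[OF fr]])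
  next
    fix f assume f: "f \<in> carrier (F Q)"
    then have fr: "f \<in> rhom A T Q" by simp
    show "Fm p (Fm i f) = f"
      by (rule rhom_ext[OF F_closed[OF Q(3) F_closed[OF Q(2) fr]] fr])
        (simp add: compose_def Q(5)[rule_format, OF rhom_closed[OF fr]])
  qed
  note i1 = isosD[OF iso] and i2 = isosD[OF FQ]
  have iso': "isos B DT (F Q) (\<lambda>x. Fm p (\<phi> x)) (\<lambda>y. \<psi> (Fm i y))"
    unfolding isos_def
  proof (intro conjI ballI)
    show "lin B DT (F Q) (\<lambda>x. Fm p (\<phi> x))" by (rule lin_comp[OF i1(1) i2(1)])
    show "lin B (F Q) DT (\<lambda>y. \<psi> (Fm i y))" by (rule lin_comp[OF i2(2) i1(2)])
    show "\<psi> (Fm i (Fm p (\<phi> x))) = x" if x: "x \<in> carrier DT" for x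
      using i2(3)[OF lin.closed[OF i1(1) x]] i1(3)[OF x] by simp
    show "Fm p (\<phi> (\<psi> (Fm i y))) = y" if y: "y \<in> carrier (F Q)" for y
      using i1(4)[OF lin.closed[OF i2(2) y]] i2(4)[OF y] by simp
  qed
  have D0: "FE 0 DT" unfolding FE_def using facQ ext0_fac[OF facQ] iso' by blast
  have "FE 1 DT" by (rule ddell_FE[OF l right_module_DT D0 e])
  from FE_ext0[OF this facQ iso'] have eQ: "ext0 A Pr \<delta> 1 Q" .
  let ?L = "P1 \<down> ker P1 P0 d"
  have "carrier ?L = {\<zero>\<^sub>?L}"
  proof (rule zero_of_faithful_dual[OF AF.fg_sub[OF projective_fg[OF P1] d.submodule_ker]])
    fix f x assume f: "lin A ?L ?C f" and x: "x \<in> carrier ?L"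
    have "p (f x) = \<zero>\<^sub>Q" using relation_maps_vanish[OF eQ fQ lin_comp[OF f Q(3)]] x by simp
    then have "i (p (f x)) = \<zero>\<^sub>?C" using lin.zero[OF Q(2)] by metis
    then show "f x = \<zero>\<^sub>?C" using Q(4) lin.closed[OF f x] by metis
  qed
  then show ?thesis unfolding d.inj_iff_ker by simp
qed

end

theorem theoremB:
  fixes K :: "'k ring" and A :: "('k, 'a) module" and T :: "('a, 't) module"
    and B :: "('k, 't \<Rightarrow> 't) module" and DT :: "('t \<Rightarrow> 't, 't \<Rightarrow> 'k) module" and d :: enat
  assumes "algebraically_closed K" and "fd_algebra K A" and "basic A"
    and "tau_tilting K A T"
    and "B = End_algebra A T"
    and "DT = dual K B (End_module T)"
    and "d = ddell B 2 DT"
  shows "(d < \<infinity> \<and> (\<forall>j::nat. 2 \<le> j \<and> enat j \<le> d + 3 \<longrightarrow> trivial_group (Ext A j T T))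
            \<longrightarrow> one_tilting A T)
       \<and> (self_orthogonal A T \<and> d < \<infinity> \<longrightarrow> one_tilting A T)"
proof -
  have main: "one_tilting A T"
    if fin: "d < \<infinity>" and tr: "\<And>j. \<lbrakk>2 \<le> j; enat j \<le> d + 3\<rbrakk> \<Longrightarrow> trivial_group (Ext A j T T)"
  proof -
    interpret fd_algebra K A by (rule assms(2))
    interpret AF: finlen_ring A by (rule finlen_A)
    obtain m where m: "d = enat m" using fin by (cases d) simp_all
    obtain E where E: "finite E" "\<forall>e\<in>E. primitive_idem A e"
      "\<forall>e\<in>E. \<forall>f\<in>E. e \<noteq> f \<longrightarrow> orthogonal_in A e f" "(\<Oplus>\<^bsub>A\<^esub>e\<in>E. e) = \<one>\<^bsub>A\<^esub>"
      "\<forall>e\<in>E. \<forall>f\<in>E. e \<noteq> f \<longrightarrow> \<not> module_iso A (principal_right A e) (principal_right A f)"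
      using assms(3) unfolding basic_def by metis
    have E': "prim_decomp A E" using E(1,2,4) by (simp add: prim_decomp_def)
    have T: "fg_mod A T" and rigid: "rhom A T (tau K A T) = {\<lambda>x\<in>carrier T. \<zero>\<^bsub>tau K A T\<^esub>}"
      and num: "num_summands A T = num_summands A (regular A)"
      using assms(4) by (simp_all add: tau_tilting_def)
    note mT = fg_modD[OF T]
    have count: "num_summands A T = card E"
      unfolding num by (rule AF.num_summands_regular[OF E']) (use E(3,5) in metis)+
    obtain P0 p0 where cover0: "proj_cover A T = (P0, p0)" "projective A P0" "p0 \<in> rhom A P0 T" "lin A P0 T p0"
      "p0 ` carrier P0 = carrier T" "syzygy A T = P0\<lparr>carrier := ker P0 T p0\<rparr>"
      using proj_cover_obtain[OF finlen_A T] by metis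
    have sk: "submodule (ker P0 T p0) A P0" by (rule lin.submodule_ker[OF cover0(4)])
    obtain P1 p1 where cover1: "proj_cover A (syzygy A T) = (P1, p1)" "projective A P1" "lin A P1 (syzygy A T) p1"
      "p1 ` carrier P1 = carrier (syzygy A T)"
      using proj_cover_obtain[OF finlen_A AF.fg_syzygy[OF T]] by metis
    have p1: "lin A P1 P0 p1"
      by (rule lin_comp[OF cover1(3)[unfolded cover0(6)] lin_incl[OF lin.dom_mod[OF cover0(4)] sk]])
    have ex: "p1 ` carrier P1 = ker P0 T p0" using cover1(4) unfolding cover0(6) by simp
    have fT: "factors A P1 P0 p1 T"
      unfolding factors_def using tau_rigid_factor[OF T rigid cover0(1) cover1(1) cover0(2) cover1(2) p1] by blast
    obtain Pr \<epsilon> \<delta> where Pr: "proj_resolution A T Pr \<epsilon> \<delta>"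
      "\<forall>n. trivial_group (Ext A (Suc n) T T) \<longleftrightarrow> ext0 A Pr \<delta> n T"
      using trivial_Ext_iff[OF mT mT AF.proj_resolution_exists[OF T]] by metis
    have "resolved_rigid_module K A T P0 P1 p0 p1 E Pr \<epsilon> \<delta>"
      by (intro resolved_rigid_module.intro counted_rigid_module.intro rigid_module.intro fd_algebra_axioms
        resolved_rigid_module_axioms.intro counted_rigid_module_axioms.intro rigid_module_axioms.intro
        T cover0(2) cover1(2) cover0(4,5) p1 ex fT E' count Pr(1))
    then interpret resolved_rigid_module K A T P0 P1 p0 p1 E Pr \<epsilon> \<delta> .
    \<comment> \<open>The range 2 \<le> j leaves out Ext^1(T, T); it vanishes by rigidity.\<close>
    have e0: "ext0 A Pr \<delta> 0 T" by (rule ext0_fac[OF fac_self[OF T]])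
    have ext: "ext0 A Pr \<delta> n T" if "n \<le> m + 2" for n
    proof (cases n)
      case 0
      then show ?thesis using e0 by simp
    next
      case (Suc k)
      \<comment> \<open>\<open>ext0\<close> with index n concerns Ext^(n+1), so n \<le> m + 2
        reaches the degrees up to d + 3.\<close>
      have "enat (Suc n) \<le> d + 3" using that unfolding m by (simp add: numeral_eq_enat)
      then show ?thesis using tr[of "Suc n"] Pr(2) Suc by simp
    qed
    have "ddell (End_algebra A T) 2 (dual K (End_algebra A T) (End_module T)) \<le> enat m" using assms(5-7) m by simp
    then have inj: "inj_on p1 (carrier P1)" by (rule presentation_injective[OF _ ext])
    have "proj_dim A T \<le> 1" by (rule AF.proj_dim_le_1[OF mT cover0(2) cover1(2) cover0(3,5) p1 ex inj])
    moreover have "trivial_group (Ext A 1 T T)" using e0 Pr(2) by simp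
    ultimately show ?thesis using T num by (simp add: one_tilting_def)
  qed
  then show ?thesis unfolding self_orthogonal_def by auto
qed

end
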